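(* Let $X$ be a compact connected metric space, let $T:X\to X$ be a strictly ergodic homeomorphism, let $v\in C^{0}(X,\mathbb{R})$ and let $g>0$. Assume further that the Lyapunov exponent $E\mapsto L(E)$ is continuous. Then $$\operatorname{supp}\mathrm{d}\mathcal{N}^{g}=\Sigma(g),$$ where $\mathrm{d}\mathcal{N}^{g}$ is the density of states measure of the Hatano-Nelson model with periodic boundary conditions and $\Sigma(g)$ is the spectrum of $\mathcal{H}(g,x)$ on $\ell^2(\mathbb{Z})$.
   Context: $(X,T)$ is strictly ergodic if it is both minimal and uniquely ergodic; $\mu$ denotes the unique $T$-invariant Borel probability measure. For $x\in X$, the Hatano-Nelson operator $\mathcal{H}(g,x):\ell^2(\mathbb{Z})\to\ell^2(\mathbb{Z})$ is $$[\mathcal{H}(g,x)u]_n=-\mathrm{e}^{g}u_{n+1}-\mathrm{e}^{-g}u_{n-1}+v(T^nx)u_n,\quad n\in\mathbb{Z}.$$ Since $T$ is minimal, its spectrum is the same set for all $x\in X$, denoted $\Sigma(g)\subseteq\mathbb{C}$. Lyapunov exponent: for $E\in\mathbb{C}$ let $$S_E(x)=\begin{pmatrix} v(x)-E&-1\\1&0\end{pmatrix},\qquad A_n(x)=S_E(T^{n-1}x)\cdots S_E(Tx)S_E(x)\quad (n\ge 1),$$ and $L(E)=\lim_{n\to\infty}\int_X\frac1n\log\|A_n(x)\|\,\mathrm{d}\mu(x)$. Continuity of $L$ means continuity as a function on $\mathbb{C}$. Density of states: let $\mathcal{H}_n(g,x)$ ($n\ge3$) be the truncation to $\{0,\dots,n-1\}$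 with periodic boundary conditions, i.e. the $n\times n$ matrix with diagonal entries $v(T^0x),v(T^1x),\dots,v(T^{n-1}x)$, all superdiagonal entries equal to $-\mathrm{e}^{g}$, all subdiagonal entries equal to $-\mathrm{e}^{-g}$, upper-right corner entry $-\mathrm{e}^{-g}$, lower-left corner entry $-\mathrm{e}^{g}$, and all other entries $0$. Let $E_1(g,x),\dots,E_n(g,x)$ be its eigenvalues with multiplicity and let $\mathrm{d}\mathcal{N}_n^{g,x}=\frac1n\sum_{j=1}^n\delta_{E_j(g,x)}$. It is known (Goldsheid-Khoruzhenko) that for $\mu$-a.e. $x\in X$ the measures $\mathrm{d}\mathcal{N}_n^{g,x}$ converge weakly as $n\to\infty$ to the non-random measure $\mathrm{d}\mathcal{N}^{g}=\frac{1}{2\pi}\Delta\max\{L(E),g\}\,\mathrm{d}m$ (distributional Laplacian, $m$ being Lebesgue measure on $\mathbb{C}$); this measure $\mathrm{d}\mathcal{N}^g$ is called the density of states. *)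

theory Defs
  imports "HOL-Probability.Probability" "Jordan_Normal_Form.Char_Poly"
begin

section \<open>Strictly ergodic homeomorphisms\<close>

text \<open>The phase space is the whole type; compactness and connectedness are hypotheses on
  its universe in the theorem. For a homeomorphism \<^term>\<open>T\<close> the integer power \<open>T^n\<close>
  with \<open>n < 0\<close> is a power of the inverse function.\<close>

definition int_iter :: "('a \<Rightarrow> 'a) \<Rightarrow> int \<Rightarrow> 'a \<Rightarrow> 'a" where
  "int_iter T n = (if 0 \<le> n then T ^^ nat n else inv_into UNIV T ^^ nat (- n))"

definition minimal_system :: "('a::topological_space \<Rightarrow> 'a) \<Rightarrow> bool" where
  "minimal_system T \<longleftrightarrow> (\<forall>x. closure (range (\<lambda>n. int_iter T n x)) = UNIV)"

definition invariant_prob :: "('a::topological_space \<Rightarrow> 'a) \<Rightarrow> 'a measure \<Rightarrow> bool" where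
  "invariant_prob T \<mu> \<longleftrightarrow> sets \<mu> = sets borel \<and> prob_space \<mu> \<and> distr \<mu> borel T = \<mu>"

definition uniquely_ergodic :: "('a::topological_space \<Rightarrow> 'a) \<Rightarrow> bool" where
  "uniquely_ergodic T \<longleftrightarrow> (\<exists>!\<mu>. invariant_prob T \<mu>)"

definition strictly_ergodic :: "('a::topological_space \<Rightarrow> 'a) \<Rightarrow> bool" where
  "strictly_ergodic T \<longleftrightarrow> minimal_system T \<and> uniquely_ergodic T"


section \<open>Operators on \<open>\<ell>\<^sup>2(\<int>)\<close> and their spectrum\<close>

definition ell2 :: "(int \<Rightarrow> complex) set" where
  "ell2 = {u. (\<lambda>n. (cmod (u n))\<^sup>2) summable_on UNIV}"

definition ell2_norm :: "(int \<Rightarrow> complex) \<Rightarrow> real" where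
  "ell2_norm u = sqrt (\<Sum>\<^sub>\<infinity>n. (cmod (u n))\<^sup>2)"

text \<open>Operators are functions on all sequences; only their values on \<^const>\<open>ell2\<close> matter.\<close>

definition bounded_operator_ell2 :: "((int \<Rightarrow> complex) \<Rightarrow> int \<Rightarrow> complex) \<Rightarrow> bool" where
  "bounded_operator_ell2 A \<longleftrightarrow>
     (\<forall>u\<in>ell2. A u \<in> ell2) \<and>
     (\<forall>u\<in>ell2. \<forall>w\<in>ell2. A (\<lambda>n. u n + w n) = (\<lambda>n. A u n + A w n)) \<and>
     (\<forall>c. \<forall>u\<in>ell2. A (\<lambda>n. c * u n) = (\<lambda>n. c * A u n)) \<and>
     (\<exists>C. \<forall>u\<in>ell2. ell2_norm (A u) \<le> C * ell2_norm u)"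

definition resolvent_set_ell2 :: "((int \<Rightarrow> complex) \<Rightarrow> int \<Rightarrow> complex) \<Rightarrow> complex set" where
  "resolvent_set_ell2 A = {z. \<exists>R. bounded_operator_ell2 R \<and>
     (\<forall>u\<in>ell2. R (\<lambda>n. A u n - z * u n) = u \<and> (\<lambda>n. A (R u) n - z * R u n) = u)}"

definition spectrum_ell2 :: "((int \<Rightarrow> complex) \<Rightarrow> int \<Rightarrow> complex) \<Rightarrow> complex set" where
  "spectrum_ell2 A = - resolvent_set_ell2 A"


section \<open>The Hatano-Nelson operator\<close>

definition hatano_nelson ::
  "('a \<Rightarrow> 'a) \<Rightarrow> ('a \<Rightarrow> real) \<Rightarrow> real \<Rightarrow> 'a \<Rightarrow> (int \<Rightarrow> complex) \<Rightarrow> int \<Rightarrow> complex" where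
  "hatano_nelson T v g x u n =
     - of_real (exp g) * u (n + 1) - of_real (exp (- g)) * u (n - 1)
     + of_real (v (int_iter T n x)) * u n"


section \<open>The Lyapunov exponent\<close>

definition schrodinger_matrix :: "('a \<Rightarrow> real) \<Rightarrow> complex \<Rightarrow> 'a \<Rightarrow> complex ^ 2 ^ 2" where
  "schrodinger_matrix v E x = vector [vector [of_real (v x) - E, - 1], vector [1, 0]]"

fun transfer_matrix ::
  "('a \<Rightarrow> 'a) \<Rightarrow> ('a \<Rightarrow> real) \<Rightarrow> complex \<Rightarrow> nat \<Rightarrow> 'a \<Rightarrow> complex ^ 2 ^ 2" where
  "transfer_matrix T v E 0 x = Finite_Cartesian_Product.mat 1"
| "transfer_matrix T v E (Suc n) x =
     schrodinger_matrix v E ((T ^^ n) x) ** transfer_matrix T v E n x"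

definition lyapunov_exponent ::
  "'a measure \<Rightarrow> ('a \<Rightarrow> 'a) \<Rightarrow> ('a \<Rightarrow> real) \<Rightarrow> complex \<Rightarrow> real" where
  "lyapunov_exponent \<mu> T v E =
     lim (\<lambda>n. \<integral>x. 1 / real n * ln (onorm ((*v) (transfer_matrix T v E n x))) \<partial>\<mu>)"


section \<open>The density of states\<close>

text \<open>Indices run over \<open>0, \<dots>, n - 1\<close>. The entries are the intended ones for \<open>n \<ge> 3\<close>,
  where the corners do not meet the off-diagonals; smaller \<open>n\<close> are irrelevant for the limit.\<close>

definition periodic_hn_matrix ::
  "('a \<Rightarrow> 'a) \<Rightarrow> ('a \<Rightarrow> real) \<Rightarrow> real \<Rightarrow> 'a \<Rightarrow> nat \<Rightarrow> complex Matrix.mat" where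
  "periodic_hn_matrix T v g x n = Matrix.mat n n (\<lambda>(i, j).
     if i = j then of_real (v ((T ^^ i) x))
     else if j = i + 1 \<or> (i = n - 1 \<and> j = 0) then - of_real (exp g)
     else if i = j + 1 \<or> (i = 0 \<and> j = n - 1) then - of_real (exp (- g))
     else 0)"

text \<open>\<^const>\<open>proots\<close> of the characteristic polynomial is the multiset of eigenvalues with
  algebraic multiplicity, so this is the average of the Dirac measures at the eigenvalues.\<close>

definition eigenvalue_counting_measure :: "complex Matrix.mat \<Rightarrow> complex measure" where
  "eigenvalue_counting_measure A =
     distr (measure_pmf (pmf_of_multiset (proots (char_poly A)))) borel (\<lambda>z. z)"

definition converges_weakly ::
  "(nat \<Rightarrow> 'b::topological_space measure) \<Rightarrow> 'b measure \<Rightarrow> bool" where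
  "converges_weakly M N \<longleftrightarrow>
     (\<forall>f :: 'b \<Rightarrow> real. continuous_on UNIV f \<longrightarrow> bounded (range f) \<longrightarrow>
        (\<lambda>n. \<integral>z. f z \<partial>M n) \<longlonglongrightarrow> (\<integral>z. f z \<partial>N))"

text \<open>The non-random weak limit of the eigenvalue distributions of the periodic truncations.
  By Goldsheid and Khoruzhenko it exists and equals \<open>(2\<pi>)\<^sup>-\<^sup>1 \<Delta> max {L, g} dm\<close>; neither fact
  is built into the definition.\<close>

definition density_of_states ::
  "'a measure \<Rightarrow> ('a \<Rightarrow> 'a) \<Rightarrow> ('a \<Rightarrow> real) \<Rightarrow> real \<Rightarrow> complex measure \<Rightarrow> bool" where
  "density_of_states \<mu> T v g N \<longleftrightarrow>
     sets N = sets borel \<and> finite_measure N \<and>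
     (AE x in \<mu>. converges_weakly
        (\<lambda>n. eigenvalue_counting_measure (periodic_hn_matrix T v g x n)) N)"

definition measure_support :: "'b::topological_space measure \<Rightarrow> 'b set" where
  "measure_support N = {z. \<forall>U. open U \<longrightarrow> z \<in> U \<longrightarrow> emeasure N U > 0}"

end

theory Submission
  imports Defs "HOL-Complex_Analysis.Complex_Analysis"
begin

text \<open>
  Both sides are compared through their complements. Write \<open>H\<close> for the Hatano-Nelson operator,
  \<open>D(a, n)\<close> for the determinant (a continuant) of the Jacobi matrix with potential \<open>v(T^k x) - E\<close> on
  \<open>a \<le> k < a + n\<close>, and \<open>growth E\<close> for the exponential rate of \<open>|D(a, n)|\<close> at a nonreal energy.

  \<^bold>\<open>Resolvent set inside the complement of the support.\<close> If \<open>E0\<close> is in the resolvent set, then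
  \<open>H - E0\<close> is bounded below on finitely supported sequences, and minimality carries the bound from one
  orbit to every orbit. Let \<open>n\<close> be a time at which the orbit returns so close to its starting
  point that the potential nearly repeats on a long window. An eigenvector of the periodic
  truncation of size \<open>n\<close> with eigenvalue near \<open>E0\<close>, continued periodically, is then nearly
  annihilated by \<open>H - E0\<close> on one period and that window; cutting it off to windows and averaging over
  all positions of the window contradicts the lower bound. So infinitely many truncations have no
  eigenvalue in a fixed disc about \<open>E0\<close>, and the weak limit gives that disc no mass
  (\<open>periodic_spectrum_avoids_resolvent_set\<close>).

  \<^bold>\<open>Complement of the support inside the resolvent set.\<close> Off the real axis the ratios of successive
  continuants stay in a half plane, so \<open>ln |D|\<close> is an almost additive cocycle, and unique ergodicity
  makes its growth rate exist uniformly in the point. The characteristic polynomial of a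
  truncation is, up to sign, \<open>D(0, n) - D(1, n - 2) - 2 cosh (g n)\<close>. On a disc without mass, the logarithmic
  potential \<open>U\<close> of the limit measure is harmonic, and comparing sizes in this formula shows
  \<open>U \<le> max growth g\<close>, \<open>growth \<le> U\<close> where \<open>growth > g\<close>, and \<open>U \<ge> g\<close> everywhere. Two cases remain for the
  centre \<open>E0\<close>.

  If somewhere on the vertical ray from \<open>E0\<close> away from the real axis the growth is at most \<open>g\<close>, then, growth
  being strictly increasing along the ray, \<open>|D(a, n)|\<close> at \<open>E0\<close> itself is at most a constant times
  \<open>exp ((g - \<delta>) n)\<close>. The one-sided fundamental solution, conjugated by \<open>exp (g k)\<close>, is then a decaying kernel
  that inverts \<open>H - E0\<close> (\<open>resolvent_if_growth_small\<close>).

  Otherwise the minimum principle gives \<open>U(E0) > g\<close>, hence \<open>growth = U > g + \<delta>\<close> at all nonreal energies near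
  \<open>E0\<close>. For nonreal \<open>E0\<close> the Green kernel of the operator with \<open>g = 0\<close> decays faster than \<open>exp (- g |i - j|)\<close> and
  survives the conjugation. For real \<open>E0\<close> the smoothness of \<open>U\<close> across the axis leaves only \<open>o(n)\<close> eigenvalues
  of the Jacobi matrices of size \<open>n\<close> near \<open>E0\<close>; by recurrence a single approximate eigenfunction
  would force a positive fraction of \<open>n\<close>, so the operator with \<open>g = 0\<close> is bounded below near \<open>E0\<close>
  (\<open>lower_bound_of_sparse_spectrum\<close>). The Green kernel therefore continues analytically across the axis, and a
  maximum principle transports its decay to \<open>E0\<close> (\<open>green_kernel_at_real_energy\<close>).
\<close>

section \<open>Averages along orbits of a uniquely ergodic map\<close>

lemma ternary_expansion_separation:
  fixes \<delta> :: "nat \<Rightarrow> real"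
  assumes "\<And>j. \<bar>\<delta> j\<bar> \<le> 1" "\<And>j. j < k \<Longrightarrow> \<delta> j = 0" "\<bar>\<delta> k\<bar> = 1"
  shows "\<bar>\<Sum>j. \<delta> j * (1/3) ^ j\<bar> \<ge> (1/3) ^ k / 2"
proof -
  let ?f = "\<lambda>j. \<delta> j * (1/3) ^ j"
  have le: "\<bar>?f j\<bar> \<le> (1/3) ^ j" for j
    using assms(1)[of j] by (simp add: abs_mult mult_left_le_one_le)
  have sm: "summable ?f"
    by (rule summable_comparison_test'[of "\<lambda>j. (1/3) ^ j" 0]) (use le in \<open>auto intro!: summable_geometric\<close>)
  have tail: "\<bar>\<Sum>j. ?f (j + Suc k)\<bar> \<le> (1/3) ^ k / 2"
  proof -
    have g: "(\<lambda>j. (1/3) ^ Suc k * (1/3 :: real) ^ j) sums ((1/3) ^ Suc k * (1 / (1 - 1/3)))"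
      by (intro sums_mult geometric_sums) auto
    have "norm (\<Sum>j. ?f (j + Suc k)) \<le> (\<Sum>j. (1/3) ^ Suc k * (1/3) ^ j)"
    proof (rule norm_suminf_le)
      show "norm (?f (j + Suc k)) \<le> (1/3) ^ Suc k * (1/3) ^ j" for j
        using le[of "j + Suc k"] by (simp only: real_norm_def power_add mult.commute)
    qed (use g sums_summable in blast)
    also have "\<dots> = (1/3) ^ k / 2" using sums_unique[OF g] by simp
    finally show ?thesis by simp
  qed
  have "(\<Sum>j. ?f j) = (\<Sum>j. ?f (j + Suc k)) + (\<Sum>j<Suc k. ?f j)"
    by (rule suminf_split_initial_segment[OF sm])
  also have "(\<Sum>j<Suc k. ?f j) = ?f k" using assms(2) by simp
  finally have "\<bar>\<Sum>j. ?f j\<bar> \<ge> \<bar>?f k\<bar> - \<bar>\<Sum>j. ?f (j + Suc k)\<bar>" by linarith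
  moreover have "\<bar>?f k\<bar> = (1/3) ^ k" using assms(3) by (simp add: abs_mult)
  ultimately show ?thesis using tail by linarith
qed

text \<open>List the balls of radius \<open>1 / m\<close> about finite \<open>1 / m\<close>-nets and record membership in the \<open>j\<close>-th ball as the
  \<open>j\<close>-th ternary digit. The first digit in which two codes differ dominates the tail, so close codes agree
  on many digits and hence share a small ball. Measures on the space thereby become measures
  on a bounded interval, where tightness yields convergent subsequences.\<close>

lemma compact_metric_real_coding:
  assumes "compact (UNIV :: 'a::metric_space set)"
  obtains \<kappa> :: "'a::metric_space \<Rightarrow> real" where "\<And>x. \<kappa> x \<in> {0..2}"
    "\<And>e. e > 0 \<Longrightarrow> \<exists>d>0. \<forall>x y. \<bar>\<kappa> x - \<kappa> y\<bar> < d \<longrightarrow> dist x y < e"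
proof -
  have "\<exists>F. finite F \<and> (UNIV :: 'a set) \<subseteq> (\<Union>c\<in>F. ball c (1 / real (Suc m)))" for m
    using assms compact_eq_totally_bounded[of "UNIV :: 'a set"] by (metis of_nat_0_less_iff zero_less_Suc zero_less_divide_1_iff)
  then obtain F :: "nat \<Rightarrow> 'a set" where
    F: "\<And>m. finite (F m)" "\<And>m. (UNIV :: 'a set) \<subseteq> (\<Union>c\<in>F m. ball c (1 / real (Suc m)))" by metis
  define B where "B = (SIGMA m:UNIV. F m)"
  have cB: "countable B" unfolding B_def using F(1) by (intro countable_SIGMA) (auto intro: countable_finite)
  have "B \<noteq> {}" using F(2)[of 0] unfolding B_def by blast
  define b where "b = from_nat_into B"
  have bB: "b j \<in> B" for j unfolding b_def using from_nat_into[OF \<open>B \<noteq> {}\<close>] by blast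
  define bit :: "nat \<Rightarrow> 'a \<Rightarrow> real" where
    "bit j x = of_bool (x \<in> ball (snd (b j)) (1 / real (Suc (fst (b j)))))" for j x
  define \<kappa> where "\<kappa> x = (\<Sum>j. bit j x * (1/3) ^ j)" for x
  have bit01: "bit j x \<ge> 0" "bit j x \<le> 1" for j x unfolding bit_def by auto
  have g: "(\<lambda>j. (1/3 :: real) ^ j) sums (1 / (1 - 1/3))" by (intro geometric_sums) auto
  have sm: "summable (\<lambda>j. bit j x * (1/3) ^ j)" for x
    by (rule summable_comparison_test'[of "\<lambda>j. (1/3) ^ j" 0])
       (use bit01 in \<open>auto intro!: summable_geometric mult_left_le_one_le simp: abs_mult\<close>)
  show ?thesis
  proof (rule that)
    fix x
    have "\<kappa> x \<ge> 0" unfolding \<kappa>_def using bit01 by (intro suminf_nonneg sm) auto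
    moreover have "\<kappa> x \<le> (\<Sum>j. (1/3) ^ j)" unfolding \<kappa>_def
      using bit01 sums_summable[OF g] by (intro suminf_le sm) (auto intro!: mult_left_le_one_le)
    ultimately show "\<kappa> x \<in> {0..2}" using sums_unique[OF g] by simp
  next
    fix e :: real assume e: "e > 0"
    obtain m where m: "2 * (1 / real (Suc m)) < e"
      using e reals_Archimedean[of "e / 2"] by (auto simp: field_simps inverse_eq_divide)
    have "\<exists>j. b j = (m, c)" if "c \<in> F m" for c
      using from_nat_into_surj[OF cB, of "(m, c)"] that unfolding b_def B_def by auto
    then obtain J where J: "\<And>c. c \<in> F m \<Longrightarrow> b (J c) = (m, c)" by metis
    define K where "K = Suc (Max (insert 0 (J ` F m)))"
    have K: "J c < K" if "c \<in> F m" for c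
      unfolding K_def using that F(1)[of m] by (auto simp: less_Suc_eq_le intro!: Max_ge)
    show "\<exists>d>0. \<forall>x y. \<bar>\<kappa> x - \<kappa> y\<bar> < d \<longrightarrow> dist x y < e"
    proof (intro exI[of _ "(1/3) ^ K / 2"] conjI allI impI)
      fix x y assume close: "\<bar>\<kappa> x - \<kappa> y\<bar> < (1/3) ^ K / 2"
      (* two codes this close agree in the first K digits, which include all balls of radius 1 / (m + 1) *)
      have agree: "bit j x = bit j y" if "j < K" for j
      proof (rule ccontr)
        assume ne: "bit j x \<noteq> bit j y"
        define k where "k = (LEAST j. bit j x \<noteq> bit j y)"
        have k: "bit k x \<noteq> bit k y" unfolding k_def by (rule LeastI[of _ j]) (rule ne)
        have k': "bit i x = bit i y" if "i < k" for i using not_less_Least that unfolding k_def by blast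
        have "k \<le> j" unfolding k_def by (rule Least_le) (rule ne)
        have "\<kappa> x - \<kappa> y = (\<Sum>j. (bit j x - bit j y) * (1/3) ^ j)"
          unfolding \<kappa>_def by (subst suminf_diff[OF sm sm]) (simp add: left_diff_distrib)
        moreover have "\<bar>\<Sum>j. (bit j x - bit j y) * (1/3) ^ j\<bar> \<ge> (1/3) ^ k / 2"
        proof (rule ternary_expansion_separation)
          show "\<bar>bit k x - bit k y\<bar> = 1" using k unfolding bit_def by (auto split: if_splits)
        qed (use k' bit01 in \<open>auto simp: bit_def\<close>)
        moreover have "(1/3 :: real) ^ k \<ge> (1/3) ^ K"
          using \<open>k \<le> j\<close> \<open>j < K\<close> by (intro power_decreasing) auto
        ultimately show False using close by linarith
      qed
      obtain c where c: "c \<in> F m" "x \<in> ball c (1 / real (Suc m))" using F(2)[of m] by blast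
      have "bit (J c) x = 1" using c J[OF c(1)] unfolding bit_def by simp
      then have "bit (J c) y = 1" using agree[OF K[OF c(1)]] by simp
      then have "y \<in> ball c (1 / real (Suc m))" using J[OF c(1)] unfolding bit_def by (simp split: if_splits)
      then show "dist x y < e"
        using c(2) m dist_triangle3[of x y c] unfolding mem_ball by linarith
    qed auto
  qed
qed

text \<open>The inverse of the coding is uniformly continuous on the set of codes, so it extends to the
  closure. The closure matters because a weak limit of measures on codes need only live there.\<close>

lemma compact_metric_continuous_decoding:
  fixes \<kappa> :: "'a::metric_space \<Rightarrow> real"
  assumes "compact (UNIV :: 'a set)"
    and sep: "\<And>e. e > 0 \<Longrightarrow> \<exists>d>0. \<forall>x y. \<bar>\<kappa> x - \<kappa> y\<bar> < d \<longrightarrow> dist x y < e"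
  obtains c where "continuous_on (closure (range \<kappa>)) c" "\<And>x. c (\<kappa> x) = x"
proof -
  let ?K = "closure (range \<kappa>)"
  have "\<exists>z. \<forall>e>0. \<exists>d>0. \<forall>x. \<bar>\<kappa> x - t\<bar> < d \<longrightarrow> dist x z < e" if t: "t \<in> ?K" for t
  proof -
    obtain Y where Y: "\<And>n. Y n \<in> range \<kappa>" "Y \<longlonglongrightarrow> t"
      using t unfolding closure_sequential by blast
    define X where "X n = (SOME x. Y n = \<kappa> x)" for n
    have X: "Y n = \<kappa> (X n)" for n
      unfolding X_def using Y(1)[of n] by (intro someI_ex[of "\<lambda>x. Y n = \<kappa> x"]) blast
    have X2: "(\<lambda>n. \<kappa> (X n)) \<longlonglongrightarrow> t"
    proof -
      have "Y = (\<lambda>n. \<kappa> (X n))" using X by (rule ext)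
      then show ?thesis using Y(2) by simp
    qed
    obtain z and r :: "nat \<Rightarrow> nat" where r: "strict_mono r" and z: "(X \<circ> r) \<longlonglongrightarrow> z"
      using assms(1) unfolding compact_def by blast
    have kr: "(\<lambda>n. \<kappa> (X (r n))) \<longlonglongrightarrow> t" using LIMSEQ_subseq_LIMSEQ[OF X2 r] by (simp add: o_def)
    show ?thesis
    proof (intro exI[of _ z] allI impI)
      fix e :: real assume "e > 0"
      then obtain d where d: "d > 0" "\<And>x y. \<bar>\<kappa> x - \<kappa> y\<bar> < d \<Longrightarrow> dist x y < e / 2"
        using sep[of "e / 2"] by auto
      have "\<forall>\<^sub>F n in sequentially. dist (\<kappa> (X (r n))) t < d / 2 \<and> dist ((X \<circ> r) n) z < e / 2"
        using tendstoD[OF kr, of "d / 2"] tendstoD[OF z, of "e / 2"] d(1) \<open>e > 0\<close>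
        by (simp add: eventually_conj)
      then obtain n where n: "dist (\<kappa> (X (r n))) t < d / 2" "dist ((X \<circ> r) n) z < e / 2"
        using eventually_happens by fastforce
      show "\<exists>d>0. \<forall>x. \<bar>\<kappa> x - t\<bar> < d \<longrightarrow> dist x z < e"
      proof (intro exI[of _ "d / 2"] conjI allI impI)
        fix x assume "\<bar>\<kappa> x - t\<bar> < d / 2"
        then have "dist x (X (r n)) < e / 2" using n(1) by (intro d(2)) (simp add: dist_real_def abs_if split: if_splits)
        then show "dist x z < e" using n(2) dist_triangle[of x z "X (r n)"] unfolding o_def by linarith
      qed (use d in auto)
    qed
  qed
  then obtain c where c: "\<And>t e. t \<in> ?K \<Longrightarrow> e > 0 \<Longrightarrow> \<exists>d>0. \<forall>x. \<bar>\<kappa> x - t\<bar> < d \<longrightarrow> dist x (c t) < e" by metis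
  show ?thesis
  proof (rule that)
    fix x
    show "c (\<kappa> x) = x"
    proof (rule ccontr)
      assume "c (\<kappa> x) \<noteq> x"
      then have "dist x (c (\<kappa> x)) > 0" by simp
      from c[OF _ this, of "\<kappa> x"] closure_subset[of "range \<kappa>"] obtain d where "d > 0" "\<forall>x'. \<bar>\<kappa> x' - \<kappa> x\<bar> < d \<longrightarrow> dist x' (c (\<kappa> x)) < dist x (c (\<kappa> x))"
        by blast
      then show False by (auto dest: spec[of _ x])
    qed
  next
    show "continuous_on ?K c" unfolding continuous_on_iff
    proof (intro ballI allI impI)
      fix t and e :: real assume t: "t \<in> ?K" and e: "e > 0"
      from e obtain d where d: "d > 0" "\<And>x. \<bar>\<kappa> x - t\<bar> < d \<Longrightarrow> dist x (c t) < e / 2"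
        using c[OF t, of "e / 2"] half_gt_zero by blast
      show "\<exists>d>0. \<forall>t'\<in>?K. dist t' t < d \<longrightarrow> dist (c t') (c t) < e"
      proof (intro exI[of _ "d / 2"] conjI ballI impI)
        fix t' assume t': "t' \<in> ?K" "dist t' t < d / 2"
        then obtain d' where d': "d' > 0" "\<And>x. \<bar>\<kappa> x - t'\<bar> < d' \<Longrightarrow> dist x (c t') < e / 2"
          using c[OF t'(1), of "e / 2"] half_gt_zero[OF e] by blast
        obtain x where x: "dist (\<kappa> x) t' < min d' (d / 2)"
          using t'(1) d d' unfolding closure_approachable by (metis min_less_iff_conj half_gt_zero rangeE)
        have "dist x (c t') < e / 2" using x by (intro d') (unfold dist_real_def min_less_iff_conj, linarith)
        moreover have "dist x (c t) < e / 2" using x t'(2) by (intro d) (unfold dist_real_def min_less_iff_conj, linarith)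
        ultimately show "dist (c t') (c t) < e" using dist_triangle_half_r by blast
      qed (use d in auto)
    qed
  qed
qed

text \<open>Indicators of open sets are limits of the bounded continuous functions \<open>min 1 (n * infdist x (- U))\<close>, and the
  open sets form an intersection-stable generator.\<close>

lemma finite_measure_eqI_continuous:
  fixes M N :: "'a::metric_space measure"
  assumes sets: "sets M = sets borel" "sets N = sets borel" and fin: "finite_measure M" "finite_measure N"
    and eq: "\<And>f :: 'a \<Rightarrow> real. continuous_on UNIV f \<Longrightarrow> bounded (range f) \<Longrightarrow> (\<integral>x. f x \<partial>M) = (\<integral>x. f x \<partial>N)"
  shows "M = N"
proof -
  interpret M: finite_measure M by fact
  interpret N: finite_measure N by fact
  have sp: "space M = UNIV" "space N = UNIV"
    using sets_eq_imp_space_eq[OF sets(1)] sets_eq_imp_space_eq[OF sets(2)] by simp_all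
  have lim: "(\<lambda>n. \<integral>x. min 1 (real n * infdist x (- U)) \<partial>P) \<longlonglongrightarrow> measure P U"
    if P: "finite_measure P" "sets P = sets borel" and U: "open U" "U \<noteq> UNIV" for P and U :: "'a set"
  proof -
    interpret P: finite_measure P by fact
    have spP: "space P = UNIV" using sets_eq_imp_space_eq[OF P(2)] by simp
    have [measurable_cong]: "sets P = sets borel" by fact
    have "(\<lambda>n. \<integral>x. min 1 (real n * infdist x (- U)) \<partial>P) \<longlonglongrightarrow> (\<integral>x. indicator U x \<partial>P)"
    proof (rule integral_dominated_convergence[where w = "\<lambda>_. 1"])
      show "indicator U \<in> borel_measurable P"
        unfolding measurable_cong_sets[OF P(2) refl] using U(1) by (intro borel_measurable_indicator) auto
      show "(\<lambda>x. min 1 (real n * infdist x (- U))) \<in> borel_measurable P" for n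
        unfolding measurable_cong_sets[OF P(2) refl]
        by (intro borel_measurable_continuous_onI continuous_intros)
      show "AE x in P. (\<lambda>n. min 1 (real n * infdist x (- U))) \<longlonglongrightarrow> indicator U x"
      proof (intro AE_I2)
        fix x
        show "(\<lambda>n. min 1 (real n * infdist x (- U))) \<longlonglongrightarrow> indicator U x"
        proof (cases "x \<in> U")
          case True
          have "infdist x (- U) \<noteq> 0"
            using True U in_closed_iff_infdist_zero[of "- U" x] by auto
          then have pos: "infdist x (- U) > 0" using infdist_nonneg[of x "- U"] by linarith
          obtain n0 where n0: "1 / infdist x (- U) < real n0" using reals_Archimedean2 by blast
          have "\<forall>\<^sub>F n in sequentially. min 1 (real n * infdist x (- U)) = indicator U x"
            using eventually_ge_at_top[of n0]
          proof eventually_elim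
            case (elim n)
            then have "1 / infdist x (- U) \<le> real n" using n0 by linarith
            then show ?case using pos True by (simp add: field_simps min_def)
          qed
          then show ?thesis by (rule tendsto_eventually)
        next
          case False
          then have "infdist x (- U) = 0" by (simp add: infdist_zero)
          then show ?thesis using False by simp
        qed
      qed
      show "AE x in P. norm (min 1 (real n * infdist x (- U))) \<le> 1" for n
        by (intro AE_I2) (simp add: infdist_nonneg)
    qed auto
    then show ?thesis using U spP P by simp
  qed
  have open_eq: "measure M U = measure N U" if U: "open U" for U :: "'a set"
  proof (cases "U = UNIV")
    case True
    have "(\<integral>x. (1::real) \<partial>M) = (\<integral>x. 1 \<partial>N)" by (intro eq) auto
    then show ?thesis using True sp by simp
  next
    case False
    have "(\<integral>x. min 1 (real n * infdist x (- U)) \<partial>M) = (\<integral>x. min 1 (real n * infdist x (- U)) \<partial>N)" for n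
      by (intro eq continuous_intros) (auto intro!: boundedI[of _ 1] simp: infdist_nonneg)
    then show ?thesis
      using lim[OF fin(1) sets(1) U False] lim[OF fin(2) sets(2) U False] LIMSEQ_unique by simp
  qed
  show ?thesis
  proof (rule measure_eqI_generator_eq[where E = "Collect open" and \<Omega> = UNIV and A = "\<lambda>_. UNIV"])
    show "Int_stable (Collect open :: 'a set set)" by (auto simp: Int_stable_def)
    show "sets M = sigma_sets UNIV (Collect open)" "sets N = sigma_sets UNIV (Collect open)"
      unfolding sets borel_def by (auto simp: sets_measure_of)
    show "emeasure M X = emeasure N X" if "X \<in> Collect open" for X
      using open_eq that by (simp add: M.emeasure_eq_measure N.emeasure_eq_measure)
    show "emeasure M UNIV \<noteq> \<infinity>" by simp
  qed auto
qed

text \<open>The argument of Krylov and Bogolyubov, with starting points allowed to vary with the length of the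
  orbit segment: averaging \<open>h \<circ> T - h\<close> telescopes to a boundary term of order \<open>1 / n\<close>.\<close>

lemma empirical_measures_cluster_at_invariant:
  fixes T :: "'a::metric_space \<Rightarrow> 'a" and y :: "nat \<Rightarrow> 'a"
  assumes comp: "compact (UNIV :: 'a set)" and T: "continuous_on UNIV T" and s: "strict_mono (s :: nat \<Rightarrow> nat)"
  shows "\<exists>(r :: nat \<Rightarrow> nat) \<nu>. strict_mono r \<and> invariant_prob T \<nu> \<and>
    (\<forall>h :: 'a \<Rightarrow> real. continuous_on UNIV h \<longrightarrow>
       (\<lambda>k. (\<Sum>j<Suc (s (r k)). h ((T ^^ j) (y (s (r k))))) / Suc (s (r k))) \<longlonglongrightarrow> (\<integral>x. h x \<partial>\<nu>))"
proof -
  have "\<exists>\<kappa> :: 'a \<Rightarrow> real. (\<forall>x. \<kappa> x \<in> {0..2}) \<and>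
      (\<forall>e>0. \<exists>d>0. \<forall>x y. \<bar>\<kappa> x - \<kappa> y\<bar> < d \<longrightarrow> dist x y < e)"
    by (rule compact_metric_real_coding[OF comp]) blast
  then obtain \<kappa> :: "'a \<Rightarrow> real" where \<kappa>: "\<And>x. \<kappa> x \<in> {0..2}"
    "\<And>e. e > 0 \<Longrightarrow> \<exists>d>0. \<forall>x y. \<bar>\<kappa> x - \<kappa> y\<bar> < d \<longrightarrow> dist x y < e" by metis
  have "\<exists>c. continuous_on (closure (range \<kappa>)) c \<and> (\<forall>x. c (\<kappa> x) = x)"
    by (rule compact_metric_continuous_decoding[OF comp \<kappa>(2)]) blast+
  then obtain c where c: "continuous_on (closure (range \<kappa>)) c" "\<And>x. c (\<kappa> x) = x" by blast
  define K where "K = closure (range \<kappa>)"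
  have K: "closed K" "\<And>x. \<kappa> x \<in> K" "K \<noteq> {}"
    unfolding K_def using closure_subset[of "range \<kappa>"] by (auto simp: closure_eq_empty)
  define P where "P n = pmf_of_set {..<Suc n}" for n
  have Pint: "(\<integral>j. f j \<partial>measure_pmf (P n)) = (\<Sum>j<Suc n. f j) / Suc n" for f :: "nat \<Rightarrow> real" and n
    unfolding P_def by (subst integral_pmf_of_set) (auto simp: lessThan_empty_iff)
  define E where "E n = distr (measure_pmf (P n)) borel (\<lambda>j. \<kappa> ((T ^^ j) (y n)))" for n
  have E: "real_distribution (E n)" for n unfolding E_def by (rule prob_space.real_distribution_distr[OF prob_space_measure_pmf]) simp
  have Eint: "(\<integral>t. f t \<partial>E n) = (\<Sum>j<Suc n. f (\<kappa> ((T ^^ j) (y n)))) / Suc n"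
    if "continuous_on UNIV f" for f :: "real \<Rightarrow> real" and n
    unfolding E_def
    by (subst integral_distr) (simp_all only: Pint borel_measurable_continuous_onI[OF that] measurable_pmf_measure1 UNIV_I Pi_UNIV space_borel)
  have tight: "tight E" unfolding tight_def
  proof (intro conjI allI impI E)
    fix \<epsilon> :: real assume "\<epsilon> > 0"
    have "measure (E n) {-1<..2} = 1" for n
    proof -
      have "measure (E n) {-1<..2} = measure (measure_pmf (P n)) ((\<lambda>j. \<kappa> ((T ^^ j) (y n))) -` {-1<..2})"
        unfolding E_def by (subst measure_distr) auto
      also have "(\<lambda>j. \<kappa> ((T ^^ j) (y n))) -` {-1<..2} = UNIV"
      proof -
        have "-1 < \<kappa> x \<and> \<kappa> x \<le> 2" for x using \<kappa>(1)[of x] by auto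
        then show ?thesis by auto
      qed
      finally show ?thesis by simp
    qed
    then show "\<exists>a b. a < b \<and> (\<forall>n. 1 - \<epsilon> < measure (E n) {a<..b})"
      using \<open>\<epsilon> > 0\<close> by (intro exI[of _ "-1"] exI[of _ 2]) auto
  qed
  obtain r M where r: "strict_mono (r :: nat \<Rightarrow> nat)" and M: "real_distribution M"
    and wc: "weak_conv_m (E \<circ> s \<circ> r) M"
    using tight_imp_convergent_subsubsequence[OF tight s] by blast
  interpret M: real_distribution M by fact
  have conv: "(\<lambda>k. \<integral>t. f t \<partial>E (s (r k))) \<longlonglongrightarrow> (\<integral>t. f t \<partial>M)"
    if f: "continuous_on UNIV f" "\<And>t. norm (f t) \<le> B" for f :: "real \<Rightarrow> real" and B
    using weak_conv_imp_integral_bdd_continuous_conv[of "E \<circ> s \<circ> r" M f B] E M wc f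
    by (simp add: o_def continuous_on_eq_continuous_at)
  have AEK: "AE t in M. t \<in> K"
  proof -
    let ?\<phi> = "\<lambda>t. min 1 (infdist t K)"
    have cont: "continuous_on UNIV ?\<phi>" by (intro continuous_intros)
    have 0: "(\<integral>t. ?\<phi> t \<partial>E n) = 0" for n
      unfolding Eint[OF cont] using K(2) by simp
    have "(\<lambda>k. \<integral>t. ?\<phi> t \<partial>E (s (r k))) \<longlonglongrightarrow> (\<integral>t. ?\<phi> t \<partial>M)"
      by (rule conv[OF cont, of 1]) (simp add: infdist_nonneg)
    then have "(\<integral>t. ?\<phi> t \<partial>M) = 0" unfolding 0 by (rule LIMSEQ_unique) (rule tendsto_const)
    moreover have int: "integrable M ?\<phi>"
    proof (rule M.integrable_const_bound[of _ 1])
      show "?\<phi> \<in> borel_measurable M"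
        unfolding measurable_cong_sets[OF M.events_eq_borel refl]
        by (rule borel_measurable_continuous_onI[OF cont])
    qed (simp add: infdist_nonneg)
    ultimately have "AE t in M. ?\<phi> t = 0"
      using integral_nonneg_eq_0_iff_AE[OF int] by (simp add: infdist_nonneg)
    then show ?thesis
    proof eventually_elim
      case (elim t)
      then have "infdist t K = 0" by (simp add: min_def split: if_splits)
      then show ?case using K in_closed_iff_infdist_zero by blast
    qed
  qed
  (* off the set K of codes, which carries the limit measure, any fixed value keeps c' measurable *)
  define c' where "c' t = (if t \<in> K then c t else c (\<kappa> (y 0)))" for t
  have c'_meas [measurable]: "c' \<in> borel_measurable borel"
  proof -
    have "c \<in> borel_measurable (restrict_space borel K)"
      using c(1) unfolding K_def by (rule borel_measurable_continuous_on_restrict)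
    then show ?thesis unfolding c'_def using K(1)
      by (subst measurable_If_restrict_space_iff) auto
  qed
  define \<nu> where "\<nu> = distr M borel c'"
  have \<nu>: "prob_space \<nu>" unfolding \<nu>_def by (rule M.prob_space_distr) simp
  have bdd: "\<exists>B. \<forall>x. norm (h x) \<le> B" if "continuous_on UNIV h" for h :: "'a \<Rightarrow> real"
    using compact_imp_bounded[OF compact_continuous_image[OF that comp]] unfolding bounded_iff by blast
  have lim: "(\<lambda>k. (\<Sum>j<Suc (s (r k)). h ((T ^^ j) (y (s (r k))))) / Suc (s (r k))) \<longlonglongrightarrow> (\<integral>x. h x \<partial>\<nu>)"
    if h: "continuous_on UNIV h" for h :: "'a \<Rightarrow> real"
  proof -
    obtain B where B: "\<And>x. norm (h x) \<le> B" using bdd[OF h] by blast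
    then have "B \<ge> 0" using norm_ge_zero order_trans by blast
    have "continuous_on K (\<lambda>t. h (c t))"
      using continuous_on_compose2[OF h c(1)] unfolding K_def by blast
    then obtain f where f: "continuous_on UNIV f" "\<And>t. t \<in> K \<Longrightarrow> f t = h (c t)" "\<And>t. norm (f t) \<le> B"
      using Tietze[of K "\<lambda>t. h (c t)" UNIV B] K(1) B \<open>B \<ge> 0\<close> by auto
    have 1: "(\<lambda>k. \<integral>t. f t \<partial>E (s (r k))) \<longlonglongrightarrow> (\<integral>t. f t \<partial>M)" by (rule conv[OF f(1,3)])
    have 2: "(\<integral>t. f t \<partial>E n) = (\<Sum>j<Suc n. h ((T ^^ j) (y n))) / Suc n" for n
      unfolding Eint[OF f(1)] using f(2) K(2) c(2) by simp
    have hm: "h \<in> borel_measurable borel" by (rule borel_measurable_continuous_onI[OF h])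
    have c'M: "c' \<in> measurable M borel"
      unfolding measurable_cong_sets[OF M.events_eq_borel refl] by (rule c'_meas)
    have "(\<integral>x. h x \<partial>\<nu>) = (\<integral>t. h (c' t) \<partial>M)"
      unfolding \<nu>_def by (rule integral_distr[OF c'M hm])
    also have "\<dots> = (\<integral>t. f t \<partial>M)"
    proof (rule integral_cong_AE)
      show "AE t in M. h (c' t) = f t"
        using AEK by eventually_elim (simp add: c'_def f(2))
      show "(\<lambda>t. h (c' t)) \<in> borel_measurable M" by (rule measurable_compose[OF c'M hm])
      show "f \<in> borel_measurable M"
        unfolding measurable_cong_sets[OF M.events_eq_borel refl] by (rule borel_measurable_continuous_onI[OF f(1)])
    qed
    finally show ?thesis using 1 unfolding 2 by (simp only:)
  qed
  have "distr \<nu> borel T = \<nu>"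
  proof (rule finite_measure_eqI_continuous)
    have Tm: "T \<in> borel_measurable borel" by (rule borel_measurable_continuous_onI[OF T])
    have s\<nu>: "sets \<nu> = sets borel" unfolding \<nu>_def by simp
    then have Tm': "T \<in> borel_measurable \<nu>" using Tm measurable_cong_sets by blast
    show "finite_measure (distr \<nu> borel T)" "finite_measure \<nu>"
      using \<nu> Tm' prob_space.finite_measure prob_space.prob_space_distr by blast+
    fix h :: "'a \<Rightarrow> real" assume h: "continuous_on UNIV h"
    obtain B where B: "\<And>x. norm (h x) \<le> B" using bdd[OF h] by blast
    have hT: "continuous_on UNIV (\<lambda>x. h (T x))" using continuous_on_compose2[OF h T] by blast
    let ?n = "\<lambda>k. Suc (s (r k))"
    have "(\<lambda>k. (\<Sum>j<?n k. h (T ((T ^^ j) (y (s (r k)))))) / ?n k - (\<Sum>j<?n k. h ((T ^^ j) (y (s (r k))))) / ?n k)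
       \<longlonglongrightarrow> (\<integral>x. h (T x) \<partial>\<nu>) - (\<integral>x. h x \<partial>\<nu>)"
      by (intro tendsto_diff lim h lim[OF hT])
    moreover have "(\<lambda>k. (\<Sum>j<?n k. h (T ((T ^^ j) (y (s (r k)))))) / ?n k - (\<Sum>j<?n k. h ((T ^^ j) (y (s (r k))))) / ?n k)
       \<longlonglongrightarrow> 0"
    proof (rule Lim_null_comparison)
      show "\<forall>\<^sub>F k in sequentially. norm ((\<Sum>j<?n k. h (T ((T ^^ j) (y (s (r k)))))) / ?n k
          - (\<Sum>j<?n k. h ((T ^^ j) (y (s (r k))))) / ?n k) \<le> (B + B) * (1 / ?n k)"
      proof (intro always_eventually allI)
        fix k
        let ?g = "\<lambda>j. h ((T ^^ j) (y (s (r k))))"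
        have "(\<Sum>j<?n k. ?g (Suc j)) - (\<Sum>j<?n k. ?g j) = ?g (?n k) - ?g 0"
          unfolding sum_subtractf[symmetric] by (rule sum_lessThan_telescope)
        then have "norm ((\<Sum>j<?n k. ?g (Suc j)) - (\<Sum>j<?n k. ?g j)) \<le> B + B"
          using norm_triangle_ineq4[of "?g (?n k)" "?g 0"] B[of "(T ^^ ?n k) (y (s (r k)))"] B[of "y (s (r k))"]
          by simp
        then have "norm (((\<Sum>j<?n k. ?g (Suc j)) - (\<Sum>j<?n k. ?g j)) / ?n k) \<le> (B + B) / ?n k"
          unfolding norm_divide by (intro divide_mono) auto
        then show "norm ((\<Sum>j<?n k. h (T ((T ^^ j) (y (s (r k)))))) / ?n k
          - (\<Sum>j<?n k. h ((T ^^ j) (y (s (r k))))) / ?n k) \<le> (B + B) * (1 / ?n k)"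
          by (simp add: diff_divide_distrib)
      qed
      have "(\<lambda>k. 1 / real (?n k)) \<longlonglongrightarrow> 0"
        using LIMSEQ_subseq_LIMSEQ[OF LIMSEQ_Suc[OF lim_1_over_n[where 'a = real]], of "s \<circ> r"]
          strict_mono_o[OF s r] by (simp add: o_def)
      then show "(\<lambda>k. (B + B) * (1 / real (?n k))) \<longlonglongrightarrow> 0" by (rule tendsto_mult_right_zero)
    qed
    ultimately have "(\<integral>x. h (T x) \<partial>\<nu>) - (\<integral>x. h x \<partial>\<nu>) = 0" by (rule LIMSEQ_unique)
    moreover have "(\<integral>x. h x \<partial>distr \<nu> borel T) = (\<integral>x. h (T x) \<partial>\<nu>)"
      using Tm' by (rule integral_distr) (rule borel_measurable_continuous_onI[OF h])
    ultimately show "(\<integral>x. h x \<partial>distr \<nu> borel T) = (\<integral>x. h x \<partial>\<nu>)" by simp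
  qed (auto simp: \<nu>_def)
  then have "invariant_prob T \<nu>" unfolding invariant_prob_def using \<nu> by (simp add: \<nu>_def)
  then show ?thesis by (intro exI[of _ r] exI[of _ \<nu>] conjI allI impI r lim)
qed

text \<open>If the averages failed to converge uniformly, badly chosen starting points would produce an
  invariant measure with a different integral of \<open>h\<close>.\<close>

lemma uniform_ergodic_theorem:
  fixes T :: "'a::metric_space \<Rightarrow> 'a" and h :: "'a \<Rightarrow> real"
  assumes comp: "compact (UNIV :: 'a set)" and T: "continuous_on UNIV T"
    and uniq: "\<And>\<nu>. invariant_prob T \<nu> \<Longrightarrow> \<nu> = \<mu>" and h: "continuous_on UNIV h" and e: "e > 0"
  obtains n0 where "\<And>n y. n \<ge> n0 \<Longrightarrow> \<bar>(\<Sum>j<n. h ((T ^^ j) y)) / n - (\<integral>x. h x \<partial>\<mu>)\<bar> < e"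
proof (rule ccontr)
  assume "\<not> thesis"
  define bad where "bad n y \<longleftrightarrow> \<bar>(\<Sum>j<Suc n. h ((T ^^ j) y)) / Suc n - (\<integral>x. h x \<partial>\<mu>)\<bar> \<ge> e" for n y
  have "\<exists>n\<ge>n0. \<exists>y. bad n y" for n0
  proof (rule ccontr)
    assume "\<not> (\<exists>n\<ge>n0. \<exists>y. bad n y)"
    then have "\<bar>(\<Sum>j<Suc n. h ((T ^^ j) y)) / Suc n - (\<integral>x. h x \<partial>\<mu>)\<bar> < e" if "n \<ge> n0" for n y
      using that unfolding bad_def by (meson not_le)
    then have "\<bar>(\<Sum>j<n. h ((T ^^ j) y)) / n - (\<integral>x. h x \<partial>\<mu>)\<bar> < e" if "n \<ge> Suc n0" for n y
      using that by (cases n) (simp_all del: sum.lessThan_Suc)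
    then show False using \<open>\<not> thesis\<close> that[of "Suc n0"] by (elim notE) simp
  qed
  then have "infinite {n. \<exists>y. bad n y}" unfolding infinite_nat_iff_unbounded_le by blast
  then obtain s :: "nat \<Rightarrow> nat" where s: "strict_mono s" "\<And>k. s k \<in> {n. \<exists>y. bad n y}"
    using infinite_enumerate by blast
  define y where "y n = (SOME z. bad n z)" for n
  have bad: "bad (s k) (y (s k))" for k
    unfolding y_def using s(2)[of k] by (intro someI_ex[of "bad (s k)"]) auto
  obtain r \<nu> where r: "strict_mono (r :: nat \<Rightarrow> nat)" "invariant_prob T \<nu>"
    "(\<lambda>k. (\<Sum>j<Suc (s (r k)). h ((T ^^ j) (y (s (r k))))) / Suc (s (r k))) \<longlonglongrightarrow> (\<integral>x. h x \<partial>\<nu>)"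
    using empirical_measures_cluster_at_invariant[OF comp T s(1), of y] h by (elim exE conjE) simp
  have "(\<lambda>k. (\<Sum>j<Suc (s (r k)). h ((T ^^ j) (y (s (r k))))) / Suc (s (r k))) \<longlonglongrightarrow> (\<integral>x. h x \<partial>\<mu>)"
    using r uniq by blast
  then have "\<forall>\<^sub>F k in sequentially. \<not> bad (s (r k)) (y (s (r k)))"
    using e by (auto dest!: tendstoD[where e = e] simp: dist_real_def bad_def elim!: eventually_mono)
  then show False using bad by (simp add: eventually_sequentially)
qed

section \<open>Returns of a minimal homeomorphism\<close>

lemma int_iter_simps:
  assumes "bij T"
  shows int_iter_0: "int_iter T 0 x = x"
    and int_iter_of_nat: "int_iter T (int n) x = (T ^^ n) x"
    and int_iter_1: "T (int_iter T k x) = int_iter T (k + 1) x"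
proof -
  show "int_iter T 0 x = x" "int_iter T (int n) x = (T ^^ n) x" by (auto simp: int_iter_def)
  show "T (int_iter T k x) = int_iter T (k + 1) x"
  proof (cases "0 \<le> k")
    case True
    then have "nat (k + 1) = Suc (nat k)" by simp
    then show ?thesis using True by (simp add: int_iter_def)
  next
    case False
    then obtain m where m: "nat (- k) = Suc m" "m = nat (- (k + 1))"
      using nat_diff_distrib[of 1 "-k"] by (metis Suc_nat_eq_nat_zadd1 add.commute diff_add_cancel minus_add_distrib neg_0_le_iff_le not_le uminus_add_conv_diff zle_diff1_eq zless_imp_add1_zle add_diff_cancel_left' minus_diff_eq)
    have "T (int_iter T k x) = T (inv_into UNIV T ((inv_into UNIV T ^^ m) x))"
      using False m by (simp add: int_iter_def)
    also have "\<dots> = (inv_into UNIV T ^^ m) x"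
      using assms by (simp add: bij_is_surj surj_f_inv_f)
    also have "\<dots> = int_iter T (k + 1) x"
      using False m by (cases "k = -1") (auto simp: int_iter_def)
    finally show ?thesis .
  qed
qed

lemma int_iter_add:
  assumes "bij T" shows "int_iter T j (int_iter T k x) = int_iter T (j + k) x"
proof (induction j rule: int_induct[where k = 0])
  case base
  show ?case by (simp add: int_iter_0[OF assms])
next
  case (step1 i)
  then show ?case using int_iter_1[OF assms] by (metis add.commute add.left_commute)
next
  case (step2 i)
  have "T (int_iter T (i - 1) (int_iter T k x)) = T (int_iter T (i - 1 + k) x)"
    using step2 int_iter_1[OF assms, of "i - 1"] int_iter_1[OF assms, of "i - 1 + k"] by (simp add: algebra_simps)
  then show ?case using assms by (meson bij_is_inj injD)
qed

lemma continuous_int_iter: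
  assumes "homeomorphism UNIV UNIV T (inv_into UNIV T)"
  shows "continuous_on UNIV (int_iter T k)"
proof -
  have c: "continuous_on UNIV (f ^^ n)" if "continuous_on UNIV f" for f :: "'a \<Rightarrow> 'a" and n
  proof (induction n)
    case (Suc n)
    then show ?case using continuous_on_compose2[OF that Suc] by (simp add: o_def)
  qed (simp add: id_def)
  show ?thesis unfolding int_iter_def
    using c[of T "nat k"] c[of "inv_into UNIV T" "nat (- k)"] assms
    by (cases "0 \<le> k") (auto simp: homeomorphism_def)
qed

lemma bij_of_homeomorphism:
  assumes "homeomorphism UNIV UNIV T (inv_into UNIV T)" shows "bij T"
  using assms unfolding homeomorphism_def bij_def by (metis injI UNIV_I)

text \<open>An orbit subsequence accumulates at some \<open>z\<close>, and the full orbit of \<open>z\<close> meets \<open>V\<close>, possibly at a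
  negative time \<open>k\<close>. Points \<open>T^(r n) y\<close> close to \<open>z\<close> then reach \<open>V\<close> at time \<open>r n + k\<close>, which is large and positive.\<close>

lemma minimal_forward_recurrence:
  fixes T :: "'a::metric_space \<Rightarrow> 'a"
  assumes comp: "compact (UNIV :: 'a set)" and homeo: "homeomorphism UNIV UNIV T (inv_into UNIV T)"
    and min: "minimal_system T" and V: "open V" "V \<noteq> {}"
  shows "\<exists>n\<ge>n0. (T ^^ n) y \<in> V"
proof -
  have bij: "bij T" by (rule bij_of_homeomorphism[OF homeo])
  obtain z and r :: "nat \<Rightarrow> nat" where r: "strict_mono r" and z: "((\<lambda>n. (T ^^ n) y) \<circ> r) \<longlonglongrightarrow> z"
    using comp unfolding compact_def by blast
  have "V \<inter> closure (range (\<lambda>n. int_iter T n z)) \<noteq> {}"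
    using min V unfolding minimal_system_def by auto
  then have "V \<inter> range (\<lambda>n. int_iter T n z) \<noteq> {}" using V(1) open_Int_closure_eq_empty by blast
  then obtain k where k: "int_iter T k z \<in> V" by blast
  have "(\<lambda>n. int_iter T k ((T ^^ r n) y)) \<longlonglongrightarrow> int_iter T k z"
    using continuous_on_tendsto_compose[OF continuous_int_iter[OF homeo] z] by (simp add: o_def)
  then have "\<forall>\<^sub>F n in sequentially. int_iter T k ((T ^^ r n) y) \<in> V"
    using V(1) k topological_tendstoD by blast
  moreover have "\<forall>\<^sub>F n in sequentially. n \<ge> n0 + nat \<bar>k\<bar>" by (rule eventually_ge_at_top)
  ultimately have "\<forall>\<^sub>F n in sequentially. int_iter T k ((T ^^ r n) y) \<in> V \<and> n \<ge> n0 + nat \<bar>k\<bar>"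
    by eventually_elim auto
  then obtain n where n: "int_iter T k ((T ^^ r n) y) \<in> V" "n \<ge> n0 + nat \<bar>k\<bar>"
    using eventually_happens by fastforce
  have rn: "r n \<ge> n0 + nat \<bar>k\<bar>" using seq_suble[OF r, of n] n(2) by linarith
  define m where "m = nat (k + int (r n))"
  have "int_iter T k ((T ^^ r n) y) = int_iter T (k + int (r n)) y"
    by (metis int_iter_add[OF bij] int_iter_of_nat[OF bij])
  also have "k + int (r n) = int m" unfolding m_def using rn by simp
  finally have "(T ^^ m) y \<in> V" using n(1) by (simp add: int_iter_of_nat[OF bij])
  moreover have "m \<ge> n0" unfolding m_def using rn by linarith
  ultimately show ?thesis by blast
qed

lemma minimal_syndetic_returns:
  fixes T :: "'a::metric_space \<Rightarrow> 'a"
  assumes comp: "compact (UNIV :: 'a set)" and homeo: "homeomorphism UNIV UNIV T (inv_into UNIV T)"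
    and min: "minimal_system T" and V: "open V" "V \<noteq> {}"
  obtains B where "\<And>y. \<exists>n\<le>B. (T ^^ n) y \<in> V"
proof -
  have cont: "continuous_on UNIV (T ^^ n)" for n
    using continuous_int_iter[OF homeo, of "int n"] by (simp add: int_iter_def)
  have op: "open ((T ^^ n) -` V)" for n using cont V(1) by (simp add: open_vimage continuous_on_open_vimage)
  have "(UNIV :: 'a set) \<subseteq> (\<Union>n. (T ^^ n) -` V)"
    using minimal_forward_recurrence[OF comp homeo min V, of 0] by blast
  then obtain N where N: "finite N" "(UNIV :: 'a set) \<subseteq> (\<Union>n\<in>N. (T ^^ n) -` V)"
    using compactE_image[OF comp, of UNIV "\<lambda>n. (T ^^ n) -` V"] op by (metis UNIV_I)
  show ?thesis
  proof (rule that)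
    fix y
    obtain n where "n \<in> N" "(T ^^ n) y \<in> V" using N(2) by blast
    then show "\<exists>n\<le>Max N. (T ^^ n) y \<in> V" using N(1) Max_ge by blast
  qed
qed

section \<open>Continuants\<close>

text \<open>The determinant of the tridiagonal matrix with diagonal \<open>q a, \<dots>, q (a + n - 1)\<close> whose two off-diagonal
  entries at each bond have product 1; as a function of \<open>n\<close> it solves \<open>c (n + 1) = q c n - c (n - 1)\<close>.\<close>

fun continuant :: "(int \<Rightarrow> complex) \<Rightarrow> int \<Rightarrow> nat \<Rightarrow> complex" where
  "continuant q a 0 = 1"
| "continuant q a (Suc 0) = q a"
| "continuant q a (Suc (Suc n)) = q (a + int n + 1) * continuant q a (Suc n) - continuant q a n"

lemma continuant_shift: "continuant (\<lambda>k. q (k + s)) a n = continuant q (a + s) n"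
  by (induction q a n rule: continuant.induct) (auto simp: algebra_simps)

lemma continuant_cong:
  assumes "\<And>k. a \<le> k \<Longrightarrow> k < a + int n \<Longrightarrow> q k = q' k"
  shows "continuant q a n = continuant q' a n"
  using assms by (induction q a n rule: continuant.induct) auto

lemma continuant_cnj: "continuant (\<lambda>k. cnj (q k)) a n = cnj (continuant q a n)"
  by (induction q a n rule: continuant.induct) auto

lemma continuant_left:
  "continuant q a (Suc (Suc n)) = q a * continuant q (a + 1) (Suc n) - continuant q (a + 2) n"
proof (induction n rule: induct_nat_012)
  case (ge2 n)
  have e: "continuant q a (Suc (Suc (Suc (Suc n)))) =
      q (a + int n + 3) * continuant q a (Suc (Suc (Suc n))) - continuant q a (Suc (Suc n))"
    by (simp add: algebra_simps)
  have e2: "continuant q (a + 1) (Suc (Suc (Suc n))) =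
      q (a + int n + 3) * continuant q (a + 1) (Suc (Suc n)) - continuant q (a + 1) (Suc n)"
    by (simp add: algebra_simps)
  have e3: "continuant q (a + 2) (Suc (Suc n)) =
      q (a + int n + 3) * continuant q (a + 2) (Suc n) - continuant q (a + 2) n"
    by (simp add: algebra_simps)
  show ?case unfolding e e2 e3 ge2 by (simp only: algebra_simps)
qed (auto simp: algebra_simps)

text \<open>Splitting the determinant at one bond: either the bond is not used, or both of its ends are removed.\<close>

lemma continuant_split:
  "continuant q a (Suc n + Suc m) =
     continuant q a (Suc n) * continuant q (a + int n + 1) (Suc m)
     - continuant q a n * continuant q (a + int n + 2) m"
proof (induction m rule: induct_nat_012)
  case (ge2 m)
  have e: "continuant q a (Suc n + Suc (Suc (Suc m))) =
      q (a + int n + int m + 3) * continuant q a (Suc n + Suc (Suc m)) - continuant q a (Suc n + Suc m)"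
    by (simp add: algebra_simps)
  have e2: "continuant q (a + int n + 1) (Suc (Suc (Suc m))) =
      q (a + int n + int m + 3) * continuant q (a + int n + 1) (Suc (Suc m))
      - continuant q (a + int n + 1) (Suc m)"
    by (simp add: algebra_simps)
  have e3: "continuant q (a + int n + 2) (Suc (Suc m)) =
      q (a + int n + int m + 3) * continuant q (a + int n + 2) (Suc m) - continuant q (a + int n + 2) m"
    by (simp add: algebra_simps)
  show ?case unfolding e e2 e3 ge2 by (simp only: algebra_simps)
qed (auto simp: algebra_simps)

text \<open>The left side is the Wronskian of the two solutions \<open>n \<mapsto> continuant q a n\<close> and \<open>n \<mapsto> continuant q (a + 1) (n - 1)\<close>
  of the same three-term recurrence, hence constant in \<open>n\<close>.\<close>

lemma continuant_casorati:
  "continuant q a (Suc n) * continuant q (a + 1) (Suc n)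
     - continuant q a (Suc (Suc n)) * continuant q (a + 1) n = 1"
proof (induction n)
  case (Suc n)
  have e2: "continuant q (a + 1) (Suc (Suc n)) =
      q (a + int n + 2) * continuant q (a + 1) (Suc n) - continuant q (a + 1) n"
    by (simp add: algebra_simps)
  have e3: "continuant q a (Suc (Suc (Suc n))) =
      q (a + int n + 2) * continuant q a (Suc (Suc n)) - continuant q a (Suc n)"
    by (simp add: algebra_simps)
  show ?case unfolding e2 e3 using Suc by (simp add: algebra_simps del: continuant.simps)
qed (auto simp: algebra_simps)

lemma Im_neg_inverse_le:
  assumes "Im z \<le> - \<eta>" "\<eta> > 0" shows "Im (- (1 / z)) \<le> 0"
proof -
  have "Im (- (1 / z)) = Im z / (cmod z)\<^sup>2"
    by (simp add: Im_divide cmod_def power2_eq_square)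
  then show ?thesis using assms by (simp add: divide_nonpos_nonneg)
qed

text \<open>For a real potential and an energy with positive imaginary part, \<open>q = w - E\<close> lies in the half plane
  \<open>Im \<le> - \<eta>\<close>. The map \<open>r \<mapsto> q - 1 / r\<close> sends this half plane into itself, so all ratios of
  neighbouring continuants stay there: they can neither vanish nor be small.\<close>

locale lower_half_plane_potential =
  fixes q :: "int \<Rightarrow> complex" and \<eta> B :: real
  assumes eta_pos: "\<eta> > 0" and Im_q: "\<And>k. Im (q k) \<le> - \<eta>" and q_bound: "\<And>k. cmod (q k) \<le> B"
begin

lemma right_ratio:
  "continuant q a n \<noteq> 0 \<and> Im (continuant q a (Suc n) / continuant q a n) \<le> - \<eta>"
proof (induction n)
  case 0
  then show ?case using Im_q by simp
next
  case (Suc n)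
  let ?r = "continuant q a (Suc n) / continuant q a n"
  have nz: "continuant q a (Suc n) \<noteq> 0" using Suc eta_pos by auto
  have "continuant q a (Suc (Suc n)) / continuant q a (Suc n) = q (a + int n + 1) + (- (1 / ?r))"
    using nz Suc by (simp add: field_simps)
  then have "Im (continuant q a (Suc (Suc n)) / continuant q a (Suc n)) \<le> - \<eta>"
    using Im_neg_inverse_le[of ?r \<eta>] Suc eta_pos Im_q[of "a + int n + 1"]
    by (simp del: continuant.simps)
  then show ?case using nz by auto
qed

lemma left_ratio:
  "Im (continuant q a (Suc n) / continuant q (a + 1) n) \<le> - \<eta>"
proof (induction n arbitrary: a)
  case 0
  then show ?case using Im_q by simp
next
  case (Suc n)
  let ?r = "continuant q (a + 1) (Suc n) / continuant q (a + 2) n"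
  have nz: "continuant q (a + 1) (Suc n) \<noteq> 0" "continuant q (a + 2) n \<noteq> 0"
    using right_ratio by blast+
  have "continuant q a (Suc (Suc n)) / continuant q (a + 1) (Suc n) = q a + (- (1 / ?r))"
    unfolding continuant_left[of q a n] using nz by (simp add: field_simps del: continuant.simps)
  then show ?case
    using Im_neg_inverse_le[of ?r \<eta>] Suc[of "a + 1"] eta_pos Im_q[of a]
    by (simp add: add.assoc del: continuant.simps)
qed

lemma continuant_nonzero: "continuant q a n \<noteq> 0"
  using right_ratio by blast

lemma cmod_ge_if_Im: "Im z \<le> - \<eta> \<Longrightarrow> cmod z \<ge> \<eta>"
  using abs_Im_le_cmod[of z] eta_pos by linarith

lemma B_ge: "B \<ge> \<eta>"
  using cmod_ge_if_Im[OF Im_q[of 0]] q_bound[of 0] by linarith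

lemma right_ratio_lower: "\<eta> * cmod (continuant q a n) \<le> cmod (continuant q a (Suc n))"
proof -
  have "\<eta> \<le> cmod (continuant q a (Suc n) / continuant q a n)"
    using cmod_ge_if_Im right_ratio by blast
  then show ?thesis using continuant_nonzero[of a n] by (simp add: norm_divide field_simps del: continuant.simps)
qed

lemma right_ratio_upper: "cmod (continuant q a (Suc n)) \<le> (B + 1 / \<eta>) * cmod (continuant q a n)"
proof (cases n)
  case 0
  then show ?thesis using q_bound[of a] eta_pos by (simp add: add_increasing2)
next
  case (Suc m)
  have "cmod (continuant q a (Suc n)) \<le> cmod (q (a + int m + 1)) * cmod (continuant q a n)
          + cmod (continuant q a m)"
    unfolding Suc continuant.simps using norm_triangle_ineq4 norm_mult by metis
  also have "\<dots> \<le> B * cmod (continuant q a n) + 1 / \<eta> * cmod (continuant q a n)"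
    using right_ratio_lower[of a m] Suc eta_pos q_bound
    by (intro add_mono mult_right_mono) (auto simp: field_simps)
  finally show ?thesis by (simp add: algebra_simps)
qed

text \<open>\<open>1 - 1 / (z w) = (z - 1 / w) / z\<close>, and subtracting \<open>1 / w\<close> from \<open>z\<close> moves \<open>z\<close> further down in the half plane.
  This rules out cancellation between the two terms of \<open>continuant_split\<close>.\<close>

lemma one_minus_inverse_product_bound:
  assumes "Im z \<le> - \<eta>" "Im w \<le> - \<eta>" "cmod z \<le> B'"
  shows "cmod (1 - 1 / (z * w)) \<ge> \<eta> / B'"
proof -
  have z: "cmod z \<ge> \<eta>" and w: "cmod w \<ge> \<eta>" using assms cmod_ge_if_Im by auto
  then have nz: "z \<noteq> 0" "w \<noteq> 0" using eta_pos by auto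
  have "Im (z + - (1 / w)) \<le> - \<eta>"
    using Im_neg_inverse_le[of w \<eta>] assms eta_pos by simp
  then have "cmod (z - 1 / w) \<ge> \<eta>" using cmod_ge_if_Im by fastforce
  moreover have "1 - 1 / (z * w) = (z - 1 / w) / z" using nz by (simp add: field_simps)
  ultimately have "cmod (1 - 1 / (z * w)) \<ge> \<eta> / cmod z"
    using nz by (simp add: norm_divide divide_right_mono)
  moreover have "\<eta> / cmod z \<ge> \<eta> / B'"
    using assms z eta_pos nz by (intro divide_left_mono) (auto intro!: mult_pos_pos)
  ultimately show ?thesis by linarith
qed

lemma inverse_product_upper:
  assumes "Im z \<le> - \<eta>" "Im w \<le> - \<eta>"
  shows "cmod (1 / (z * w)) \<le> 1 / \<eta>\<^sup>2"
proof -
  have z: "cmod z \<ge> \<eta>" and w: "cmod w \<ge> \<eta>" using assms cmod_ge_if_Im by auto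
  have "cmod z * cmod w \<ge> \<eta> * \<eta>" using z w eta_pos by (intro mult_mono) auto
  then show ?thesis using eta_pos
    by (simp add: norm_divide norm_mult power2_eq_square frac_le)
qed

definition lo :: real where "lo = \<eta> / (B + 1 / \<eta>)"
definition up :: real where "up = 1 + 1 / \<eta>\<^sup>2"

lemma lo_pos: "lo > 0"
  unfolding lo_def using eta_pos B_ge by (simp add: add_pos_pos)

lemma lo_le_1: "lo \<le> 1"
  unfolding lo_def using eta_pos B_ge by (simp add: add_pos_pos divide_le_eq add_increasing2)

lemma up_ge_1: "up \<ge> 1" unfolding up_def by simp

text \<open>By \<open>continuant_split\<close>, the quotient of the two sides is \<open>1 - 1 / (z w)\<close> for a right ratio \<open>z\<close> and a left
  ratio \<open>w\<close>.\<close>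

lemma continuant_almost_multiplicative:
  "lo * (cmod (continuant q a n) * cmod (continuant q (a + int n) m)) \<le> cmod (continuant q a (n + m))"
  "cmod (continuant q a (n + m)) \<le> up * (cmod (continuant q a n) * cmod (continuant q (a + int n) m))"
proof -
  have "lo * (cmod (continuant q a n) * cmod (continuant q (a + int n) m)) \<le> cmod (continuant q a (n + m)) \<and>
    cmod (continuant q a (n + m)) \<le> up * (cmod (continuant q a n) * cmod (continuant q (a + int n) m))"
  proof (cases "n = 0 \<or> m = 0")
    case True
    then show ?thesis using lo_le_1 lo_pos up_ge_1
      by (auto simp: mult_le_cancel_right1 mult_le_cancel_right2 mult_left_le_one_le)
  next
    case False
    then obtain n' m' where nm: "n = Suc n'" "m = Suc m'" by (meson not0_implies_Suc)
    let ?z = "continuant q a (Suc n') / continuant q a n'"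
    let ?w = "continuant q (a + int n' + 1) (Suc m') / continuant q (a + int n' + 2) m'"
    have z: "Im ?z \<le> - \<eta>" using right_ratio by blast
    have w: "Im ?w \<le> - \<eta>" using left_ratio[of "a + int n' + 1" m'] by (simp add: add.assoc del: continuant.simps)
    have zB: "cmod ?z \<le> B + 1 / \<eta>"
      using right_ratio_upper[of a n'] continuant_nonzero[of a n']
      by (simp add: norm_divide field_simps del: continuant.simps)
    have e: "continuant q a (n + m) = continuant q a n * continuant q (a + int n) m * (1 - 1 / (?z * ?w))"
      unfolding nm continuant_split[of q a n' m']
      using continuant_nonzero by (simp add: field_simps del: continuant.simps)
    have "cmod (1 - 1 / (?z * ?w)) \<ge> lo"
      unfolding lo_def by (rule one_minus_inverse_product_bound[OF z w zB])
    moreover have "cmod (1 - 1 / (?z * ?w)) \<le> up"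
      unfolding up_def using norm_triangle_ineq4[of 1 "1 / (?z * ?w)"] inverse_product_upper[OF z w]
      by simp
    ultimately have "lo * cmod (continuant q a n * continuant q (a + int n) m)
          \<le> cmod (1 - 1 / (?z * ?w)) * cmod (continuant q a n * continuant q (a + int n) m)"
        "cmod (1 - 1 / (?z * ?w)) * cmod (continuant q a n * continuant q (a + int n) m)
          \<le> up * cmod (continuant q a n * continuant q (a + int n) m)"
      by (intro mult_right_mono; simp)+
    then show ?thesis
      unfolding e by (simp only: norm_mult mult_ac simp_thms)
  qed
  then show "lo * (cmod (continuant q a n) * cmod (continuant q (a + int n) m)) \<le> cmod (continuant q a (n + m))"
    "cmod (continuant q a (n + m)) \<le> up * (cmod (continuant q a n) * cmod (continuant q (a + int n) m))"
    by auto
qed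

end

section \<open>Zeros of Jacobi continuants\<close>

abbreviation jacobi_det :: "(int \<Rightarrow> real) \<Rightarrow> complex \<Rightarrow> int \<Rightarrow> nat \<Rightarrow> complex" where
  "jacobi_det w E a n \<equiv> continuant (\<lambda>k. of_real (w k) - E) a n"

lemma jacobi_det_cnj: "jacobi_det w (cnj E) a n = cnj (jacobi_det w E a n)"
  using continuant_cnj[of "\<lambda>k. of_real (w k) - E" a n] by simp

lemma jacobi_potential_lower_half_plane:
  assumes "Im E > 0" "\<And>k. \<bar>w k\<bar> \<le> V"
  shows "lower_half_plane_potential (\<lambda>k. of_real (w k) - E) (Im E) (V + cmod E)"
proof
  show "cmod (of_real (w k) - E) \<le> V + cmod E" for k
    using norm_triangle_ineq4[of "of_real (w k)" E] assms(2)[of k] by simp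
qed (use assms in auto)

lemma jacobi_det_nonzero:
  assumes "Im E \<noteq> 0" shows "jacobi_det w E a n \<noteq> 0"
proof -
  have *: "jacobi_det w E a n \<noteq> 0" if E: "Im E > 0" for E
  proof -
    define V where "V = Max ((\<lambda>k. \<bar>w k\<bar>) ` insert a {a..<a + int n})"
    define w' where "w' = (\<lambda>k. if k \<in> {a..<a + int n} then w k else 0)"
    have V: "\<bar>w k\<bar> \<le> V" if "k \<in> insert a {a..<a + int n}" for k
      unfolding V_def using that by (intro Max_ge) auto
    have "V \<ge> 0" using V[of a] abs_ge_zero[of "w a"] by (meson insertI1 order_trans)
    then have "\<bar>w' k\<bar> \<le> V" for k unfolding w'_def using V by auto
    then interpret lower_half_plane_potential "\<lambda>k. of_real (w' k) - E" "Im E" "V + cmod E"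
      using E by (intro jacobi_potential_lower_half_plane) auto
    have "jacobi_det w E a n = jacobi_det w' E a n"
      by (intro continuant_cong) (auto simp: w'_def)
    then show ?thesis using continuant_nonzero by simp
  qed
  show ?thesis
  proof (cases "Im E > 0")
    case False
    then have "Im (cnj E) > 0" using assms by simp
    then have "jacobi_det w (cnj E) a n \<noteq> 0" by (rule *)
    then show ?thesis by (simp add: jacobi_det_cnj)
  qed (rule *)
qed

fun jacobi_poly :: "(int \<Rightarrow> real) \<Rightarrow> int \<Rightarrow> nat \<Rightarrow> complex poly" where
  "jacobi_poly w a 0 = 1"
| "jacobi_poly w a (Suc 0) = [:of_real (w a), -1:]"
| "jacobi_poly w a (Suc (Suc n)) =
     [:of_real (w (a + int n + 1)), -1:] * jacobi_poly w a (Suc n) - jacobi_poly w a n"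

lemma poly_jacobi_poly: "poly (jacobi_poly w a n) E = jacobi_det w E a n"
  by (induction w a n rule: jacobi_poly.induct) (auto simp: algebra_simps)

lemma degree_jacobi_poly:
  "degree (jacobi_poly w a n) = n \<and> lead_coeff (jacobi_poly w a n) = (-1) ^ n"
proof (induction n rule: induct_nat_012)
  case (ge2 n)
  let ?p = "[:of_real (w (a + int n + 1)), -1:] * jacobi_poly w a (Suc n)"
  have nz: "jacobi_poly w a (Suc n) \<noteq> 0" using ge2 by auto
  have d: "degree ?p = Suc (Suc n)" using nz ge2 by (subst degree_mult_eq) auto
  have l: "lead_coeff ?p = (-1) ^ Suc (Suc n)" using ge2 by (subst lead_coeff_mult) auto
  have lt: "degree (- jacobi_poly w a n) < degree ?p" using ge2 d by simp
  have "degree (?p + - jacobi_poly w a n) = degree ?p" by (rule degree_add_eq_left[OF lt])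
  moreover have "coeff (jacobi_poly w a n) (Suc (Suc n)) = 0" using ge2 by (intro coeff_eq_0) auto
  ultimately show ?case using d l by simp
qed auto

text \<open>The Christoffel--Darboux formula on the diagonal. At a real common zero of the polynomial and its derivative
  the left side vanishes while the right side is at most \<open>- 1\<close>; zeros of continuants are therefore simple.\<close>

lemma jacobi_poly_wronskian:
  "pderiv (jacobi_poly w a (Suc n)) * jacobi_poly w a n
     - jacobi_poly w a (Suc n) * pderiv (jacobi_poly w a n) = - (\<Sum>k\<le>n. (jacobi_poly w a k)\<^sup>2)"
proof (induction n)
  case 0
  show ?case by (simp add: pderiv_pCons) (simp add: one_pCons)
next
  case (Suc n)
  let ?P = "jacobi_poly w a"
  have e: "?P (Suc (Suc n)) = [:of_real (w (a + int n + 1)), -1:] * ?P (Suc n) - ?P n" by simp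
  have d: "pderiv (?P (Suc (Suc n))) = - ?P (Suc n)
      + [:of_real (w (a + int n + 1)), -1:] * pderiv (?P (Suc n)) - pderiv (?P n)"
    unfolding e pderiv_diff pderiv_mult by (simp add: pderiv_pCons algebra_simps)
  have "pderiv (?P (Suc (Suc n))) * ?P (Suc n) - ?P (Suc (Suc n)) * pderiv (?P (Suc n)) =
     - (?P (Suc n))\<^sup>2 + (pderiv (?P (Suc n)) * ?P n - ?P (Suc n) * pderiv (?P n))"
    by (subst d, subst e) (simp only: algebra_simps power2_eq_square mult_minus_right)
  also have "\<dots> = - (\<Sum>k\<le>Suc n. (?P k)\<^sup>2)" unfolding Suc by simp
  finally show ?case .
qed

lemma jacobi_det_real: "jacobi_det w (of_real t) a n \<in> \<real>"
  by (induction w a n rule: jacobi_poly.induct) auto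

lemma rsquarefree_jacobi_poly: "rsquarefree (jacobi_poly w a n)"
  unfolding rsquarefree_roots
proof (intro allI notI)
  fix z assume z: "poly (jacobi_poly w a n) z = 0 \<and> poly (pderiv (jacobi_poly w a n)) z = 0"
  then obtain m where n: "n = Suc m" by (cases n) auto
  have "Im z = 0" using z jacobi_det_nonzero unfolding poly_jacobi_poly by blast
  then have zr: "z = of_real (Re z)" by (simp add: complex_eq_iff)
  have "(\<Sum>k\<le>m. (jacobi_det w z a k)\<^sup>2) = 0"
    using arg_cong[OF jacobi_poly_wronskian[of w a m], of "\<lambda>p. poly p z"] z
    unfolding n by (simp add: poly_sum poly_jacobi_poly)
  moreover have "(\<Sum>k\<le>m. (jacobi_det w z a k)\<^sup>2) = of_real (\<Sum>k\<le>m. (Re (jacobi_det w z a k))\<^sup>2)"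
    unfolding of_real_sum
  proof (intro sum.cong refl)
    fix k
    have "jacobi_det w z a k = of_real (Re (jacobi_det w z a k))"
      using jacobi_det_real[of w "Re z" a k] zr by simp
    then show "(jacobi_det w z a k)\<^sup>2 = of_real ((Re (jacobi_det w z a k))\<^sup>2)" by (metis of_real_power)
  qed
  ultimately have "(\<Sum>k\<le>m. (Re (jacobi_det w z a k))\<^sup>2) = 0" by (metis of_real_eq_0_iff)
  then have "\<forall>k\<in>{..m}. (Re (jacobi_det w z a k))\<^sup>2 = 0" by (subst (asm) sum_nonneg_eq_0_iff) auto
  then have "(Re (jacobi_det w z a 0))\<^sup>2 = 0" by blast
  then show False by simp
qed

text \<open>The eigenvalues of the real symmetric Jacobi matrix on \<open>a, \<dots>, a + n - 1\<close>, as zeros of its determinant.\<close>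

definition jacobi_spectrum :: "(int \<Rightarrow> real) \<Rightarrow> int \<Rightarrow> nat \<Rightarrow> real set" where
  "jacobi_spectrum w a n = {t. jacobi_det w (of_real t) a n = 0}"

lemma jacobi_spectrum:
  shows finite_jacobi_spectrum: "finite (jacobi_spectrum w a n)"
    and card_jacobi_spectrum: "card (jacobi_spectrum w a n) = n"
    and jacobi_det_factorization: "jacobi_det w E a n = (\<Prod>t\<in>jacobi_spectrum w a n. of_real t - E)"
proof -
  let ?P = "jacobi_poly w a n" and ?S = "jacobi_spectrum w a n"
  have P0: "?P \<noteq> 0" using degree_jacobi_poly[of w a n] by auto
  have roots: "{z. poly ?P z = 0} = of_real ` ?S"
  proof (intro equalityI subsetI)
    fix z assume "z \<in> {z. poly ?P z = 0}"
    then have z: "jacobi_det w z a n = 0" by (simp add: poly_jacobi_poly)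
    then have "Im z = 0" using jacobi_det_nonzero by blast
    then have zr: "z = of_real (Re z)" by (simp add: complex_eq_iff)
    then have "Re z \<in> ?S" unfolding jacobi_spectrum_def using z by simp
    then show "z \<in> of_real ` ?S" using zr by blast
  qed (auto simp: jacobi_spectrum_def poly_jacobi_poly)
  have inj: "inj_on (of_real :: real \<Rightarrow> complex) ?S" by (simp add: inj_on_def)
  have dec: "Polynomial.smult (lead_coeff ?P) (\<Prod>z|poly ?P z = 0. [:-z, 1:]) = ?P"
    by (rule complex_poly_decompose_rsquarefree[OF rsquarefree_jacobi_poly])
  have "finite {z. poly ?P z = 0}" by (rule poly_roots_finite[OF P0])
  then show fin: "finite ?S" unfolding roots using inj by (simp add: finite_image_iff)
  have "degree (\<Prod>z\<in>of_real ` ?S. [:-z, 1::complex:]) = n"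
    using arg_cong[OF dec, of degree] degree_jacobi_poly[of w a n] P0 unfolding roots
    by (simp del: leading_coeff_0_iff split: if_splits)
  moreover have "degree (\<Prod>z\<in>of_real ` ?S. [:-z, 1::complex:]) = (\<Sum>z\<in>of_real ` ?S. degree [:-z, 1::complex:])"
    by (intro degree_prod_sum_eq) auto
  ultimately have "card ((of_real :: real \<Rightarrow> complex) ` ?S) = n" by simp
  then show card: "card ?S = n" using inj by (simp add: card_image)
  have "jacobi_det w E a n = (-1) ^ n * (\<Prod>z\<in>of_real ` ?S. poly [:-z, 1:] E)"
    using arg_cong[OF dec, of "\<lambda>p. poly p E"] conjunct2[OF degree_jacobi_poly[of w a n]]
    unfolding roots by (simp only: poly_jacobi_poly poly_prod poly_smult)
  also have "\<dots> = (\<Prod>t\<in>?S. (-1) * (E - of_real t))"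
    unfolding prod.distrib by (simp add: prod.reindex[OF inj] card)
  also have "\<dots> = (\<Prod>t\<in>?S. of_real t - E)" by simp
  finally show "jacobi_det w E a n = (\<Prod>t\<in>?S. of_real t - E)" .
qed

text \<open>For larger \<open>|t|\<close> every coefficient of the recurrence has modulus at least 2, and then the modulus of the
  solution never decreases.\<close>

lemma jacobi_spectrum_bounded:
  assumes "\<And>k. \<bar>w k\<bar> \<le> V" "t \<in> jacobi_spectrum w a n" shows "\<bar>t\<bar> \<le> V + 2"
proof (rule ccontr)
  assume t: "\<not> \<bar>t\<bar> \<le> V + 2"
  have q: "cmod (of_real (w k) - of_real t) \<ge> 2" for k
    using t assms(1)[of k] unfolding of_real_diff[symmetric] norm_of_real by linarith
  have "jacobi_det w (of_real t) a n \<noteq> 0 \<and>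
      cmod (jacobi_det w (of_real t) a n) \<le> cmod (jacobi_det w (of_real t) a (Suc n))"
  proof (induction n)
    case 0
    then show ?case using q[of a] by simp
  next
    case (Suc n)
    let ?c = "jacobi_det w (of_real t) a"
    have "2 * cmod (?c (Suc n)) \<le> cmod (of_real (w (a + int n + 1)) - of_real t) * cmod (?c (Suc n))"
      using q by (intro mult_right_mono) auto
    also have "\<dots> \<le> cmod (?c (Suc (Suc n))) + cmod (?c n)"
      unfolding norm_mult[symmetric] using norm_triangle_ineq[of "?c (Suc (Suc n))" "?c n"] by simp
    finally show ?case using Suc by (auto simp del: continuant.simps)
  qed
  then show False using assms(2) unfolding jacobi_spectrum_def by simp
qed

lemma cmod_jacobi_det: "cmod (jacobi_det w E a n) = (\<Prod>t\<in>jacobi_spectrum w a n. cmod (of_real t - E))"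
  unfolding jacobi_det_factorization prod_norm ..

text \<open>Each factor \<open>|t - (x + i b)|\<close> grows with \<open>|b|\<close> by a ratio bounded away from 1, because the zeros \<open>t\<close> stay in a
  bounded set. Comparing growth rates on a vertical line rests on this uniform factor.\<close>

lemma jacobi_det_vertical_contraction:
  assumes w: "\<And>k. \<bar>w k\<bar> \<le> V" and b: "\<bar>b\<bar> \<le> \<bar>b'\<bar>" and R: "R = V + 2 + \<bar>x\<bar>"
    and b': "b' \<noteq> 0"
  shows "cmod (jacobi_det w (Complex x b) a n)
     \<le> sqrt ((R\<^sup>2 + b\<^sup>2) / (R\<^sup>2 + b'\<^sup>2)) ^ n * cmod (jacobi_det w (Complex x b') a n)"
proof -
  let ?S = "jacobi_spectrum w a n" and ?\<theta> = "sqrt ((R\<^sup>2 + b\<^sup>2) / (R\<^sup>2 + b'\<^sup>2))"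
  have bb: "b\<^sup>2 \<le> b'\<^sup>2" using b by (simp add: abs_le_square_iff)
  have pos: "b'\<^sup>2 > 0" using b' by simp
  have "(\<Prod>t\<in>?S. cmod (of_real t - Complex x b)) \<le> (\<Prod>t\<in>?S. ?\<theta> * cmod (of_real t - Complex x b'))"
  proof (intro prod_mono conjI)
    fix t assume "t \<in> ?S"
    then have "\<bar>t\<bar> \<le> V + 2" using jacobi_spectrum_bounded[of w V t a n] w by blast
    then have "\<bar>t - x\<bar> \<le> \<bar>R\<bar>" using R by linarith
    then have d: "(t - x)\<^sup>2 \<le> R\<^sup>2" by (simp add: abs_le_square_iff)
    have "((t - x)\<^sup>2 + b\<^sup>2) * (R\<^sup>2 + b'\<^sup>2) \<le> (R\<^sup>2 + b\<^sup>2) * ((t - x)\<^sup>2 + b'\<^sup>2)"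
    proof -
      have "0 \<le> (R\<^sup>2 - (t - x)\<^sup>2) * (b'\<^sup>2 - b\<^sup>2)" using d bb by simp
      then show ?thesis by (simp add: algebra_simps)
    qed
    then have "(t - x)\<^sup>2 + b\<^sup>2 \<le> (R\<^sup>2 + b\<^sup>2) / (R\<^sup>2 + b'\<^sup>2) * ((t - x)\<^sup>2 + b'\<^sup>2)"
      using pos by (simp add: field_simps add_nonneg_pos)
    then have "sqrt ((t - x)\<^sup>2 + b\<^sup>2) \<le> ?\<theta> * sqrt ((t - x)\<^sup>2 + b'\<^sup>2)"
      by (metis real_sqrt_le_mono real_sqrt_mult)
    then show "cmod (of_real t - Complex x b) \<le> ?\<theta> * cmod (of_real t - Complex x b')"
      by (simp add: cmod_def)
  qed auto
  then show ?thesis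
    unfolding cmod_jacobi_det prod.distrib by (simp add: card_jacobi_spectrum)
qed

lemma jacobi_det_vertical_mono:
  assumes b: "\<bar>b\<bar> \<le> \<bar>b'\<bar>"
  shows "cmod (jacobi_det w (Complex x b) a n) \<le> cmod (jacobi_det w (Complex x b') a n)"
  unfolding cmod_jacobi_det
  by (intro prod_mono) (use b in \<open>auto simp: cmod_def abs_le_square_iff\<close>)

text \<open>All zeros are real, hence at distance at least \<open>|Im E|\<close> from \<open>E\<close>.\<close>

lemma jacobi_det_perturb:
  assumes "Im E \<noteq> 0"
  shows "cmod (jacobi_det w z a n) \<le> (1 + cmod (z - E) / \<bar>Im E\<bar>) ^ n * cmod (jacobi_det w E a n)"
proof -
  let ?S = "jacobi_spectrum w a n"
  have "(\<Prod>t\<in>?S. cmod (of_real t - z)) \<le> (\<Prod>t\<in>?S. (1 + cmod (z - E) / \<bar>Im E\<bar>) * cmod (of_real t - E))"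
  proof (intro prod_mono conjI)
    fix t
    have "cmod (of_real t - z) \<le> cmod (of_real t - E) + cmod (z - E)"
      using norm_triangle_ineq4[of "of_real t - E" "z - E"] by simp
    moreover have "cmod (z - E) \<le> cmod (z - E) / \<bar>Im E\<bar> * cmod (of_real t - E)"
    proof -
      have "\<bar>Im E\<bar> \<le> cmod (of_real t - E)" using abs_Im_le_cmod[of "of_real t - E"] by simp
      then have "cmod (z - E) / \<bar>Im E\<bar> * \<bar>Im E\<bar> \<le> cmod (z - E) / \<bar>Im E\<bar> * cmod (of_real t - E)"
        by (intro mult_left_mono) auto
      then show ?thesis using assms by simp
    qed
    ultimately show "cmod (of_real t - z) \<le> (1 + cmod (z - E) / \<bar>Im E\<bar>) * cmod (of_real t - E)"
      by (simp add: algebra_simps)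
  qed auto
  then show ?thesis
    unfolding cmod_jacobi_det prod.distrib by (simp add: card_jacobi_spectrum)
qed

section \<open>Operators with exponentially decaying kernels\<close>

lemma summable_on_exp_decay:
  assumes "\<delta> > 0"
  shows "(\<lambda>k::int. exp (- \<delta> * \<bar>real_of_int (k - s)\<bar>)) summable_on UNIV"
proof -
  let ?f = "\<lambda>k::int. exp (- \<delta> * \<bar>real_of_int k\<bar>)"
  have g: "summable (\<lambda>n. exp (- \<delta>) ^ n)" using assms by (intro summable_geometric) auto
  have nat: "(\<lambda>n. exp (- \<delta> * real n)) summable_on (UNIV :: nat set)"
    using norm_summable_imp_summable_on[of "\<lambda>n. exp (- \<delta> * real n)"] g
    by (simp add: exp_of_nat_mult[symmetric] mult.commute)
  have "?f summable_on (range int)"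
    by (subst summable_on_reindex) (use nat in \<open>auto simp: o_def\<close>)
  moreover have "?f summable_on (range (\<lambda>n. - int n))"
    by (subst summable_on_reindex) (use nat in \<open>auto simp: o_def inj_on_def\<close>)
  moreover have "range int \<union> range (\<lambda>n. - int n) = UNIV"
  proof -
    have "k \<in> range int \<union> range (\<lambda>n. - int n)" for k :: int by (cases k rule: int_cases2) auto
    then show ?thesis by blast
  qed
  ultimately have "?f summable_on UNIV" using summable_on_union by metis
  then have "?f summable_on range (\<lambda>k. k - s)" by (rule summable_on_subset) auto
  then show ?thesis
    by (subst (asm) summable_on_reindex) (auto simp: o_def inj_on_def)
qed

lemma infsum_finite_sum:
  fixes f :: "'i \<Rightarrow> int \<Rightarrow> real"
  assumes "finite F" "\<And>i. i \<in> F \<Longrightarrow> f i summable_on UNIV"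
  shows "(\<lambda>j. \<Sum>i\<in>F. f i j) summable_on UNIV \<and> (\<Sum>\<^sub>\<infinity>j. \<Sum>i\<in>F. f i j) = (\<Sum>i\<in>F. \<Sum>\<^sub>\<infinity>j. f i j)"
  using assms by (induction F) (auto simp: infsum_add summable_on_add)

lemma ell2_shift:
  assumes "u \<in> ell2" shows "(\<lambda>n. u (n + s)) \<in> ell2"
proof -
  have "(\<lambda>n. (cmod (u n))\<^sup>2) summable_on range (\<lambda>n. n + s)"
    using assms summable_on_subset unfolding ell2_def by blast
  then show ?thesis unfolding ell2_def
    by (subst (asm) summable_on_reindex) (auto simp: o_def inj_on_def)
qed

lemma ell2_comparison:
  assumes "u \<in> ell2" "\<And>n. cmod (w n) \<le> C * cmod (u n)" shows "w \<in> ell2"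
proof -
  have "(\<lambda>n. C\<^sup>2 * (cmod (u n))\<^sup>2) summable_on UNIV"
    using assms(1) unfolding ell2_def by (intro summable_on_cmult_right) auto
  then have "(\<lambda>n. (cmod (w n))\<^sup>2) summable_on UNIV"
  proof (rule summable_on_comparison_test)
    fix n
    show "(cmod (w n))\<^sup>2 \<le> C\<^sup>2 * (cmod (u n))\<^sup>2"
      using power_mono[OF assms(2)[of n], of 2] by (simp add: power_mult_distrib)
  qed auto
  then show ?thesis unfolding ell2_def by simp
qed

lemma ell2_add:
  assumes "u \<in> ell2" "w \<in> ell2" shows "(\<lambda>n. u n + w n) \<in> ell2"
proof -
  have "(\<lambda>n. 2 * (cmod (u n))\<^sup>2 + 2 * (cmod (w n))\<^sup>2) summable_on UNIV"
    using assms unfolding ell2_def by (intro summable_on_add summable_on_cmult_right) auto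
  then have "(\<lambda>n. (cmod (u n + w n))\<^sup>2) summable_on UNIV"
  proof (rule summable_on_comparison_test)
    fix n
    have "(cmod (u n + w n))\<^sup>2 \<le> (cmod (u n) + cmod (w n))\<^sup>2"
      by (intro power_mono norm_triangle_ineq) auto
    also have "\<dots> \<le> 2 * (cmod (u n))\<^sup>2 + 2 * (cmod (w n))\<^sup>2"
      using sum_squares_bound[of "cmod (u n)" "cmod (w n)"] by (simp add: power2_sum)
    finally show "(cmod (u n + w n))\<^sup>2 \<le> 2 * (cmod (u n))\<^sup>2 + 2 * (cmod (w n))\<^sup>2" .
  qed auto
  then show ?thesis unfolding ell2_def by simp
qed

lemma ell2_cmult: "u \<in> ell2 \<Longrightarrow> (\<lambda>n. c * u n) \<in> ell2"
  by (rule ell2_comparison[of u _ "cmod c"]) (auto simp: norm_mult)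

lemma ell2_mult_bounded:
  assumes "u \<in> ell2" "\<And>n. cmod (q n) \<le> B" shows "(\<lambda>n. q n * u n) \<in> ell2"
  by (rule ell2_comparison[OF assms(1), of _ B]) (simp add: norm_mult mult_right_mono assms(2))

text \<open>The row and column sums of such a kernel are bounded by \<open>A\<close>, so Schur's test bounds the operator by \<open>A\<close>.\<close>

locale decaying_kernel =
  fixes K :: "int \<Rightarrow> int \<Rightarrow> complex" and C \<delta> :: real
  assumes C: "C > 0" and delta: "\<delta> > 0"
    and decay: "\<And>i j. cmod (K i j) \<le> C * exp (- \<delta> * \<bar>real_of_int (i - j)\<bar>)"
begin

definition a :: "int \<Rightarrow> real" where "a k = C * exp (- \<delta> * \<bar>real_of_int k\<bar>)"

definition A :: real where "A = (\<Sum>\<^sub>\<infinity>k. a k)"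

definition op :: "(int \<Rightarrow> complex) \<Rightarrow> int \<Rightarrow> complex" where
  "op u i = (\<Sum>\<^sub>\<infinity>j. K i j * u j)"

lemma a_pos: "a k > 0" unfolding a_def using C by simp

lemma a_nonneg [simp]: "0 \<le> a k" using a_pos[of k] by simp

lemma a_le: "a k \<le> C" unfolding a_def using C delta by simp

lemma a_minus: "a (i - j) = a (j - i)" unfolding a_def by (simp add: abs_minus_commute)

lemma a_summable: "(\<lambda>k. a (k - s)) summable_on UNIV"
  unfolding a_def by (intro summable_on_cmult_right summable_on_exp_decay delta)

lemma a_infsum: "(\<Sum>\<^sub>\<infinity>k. a (k - s)) = A"
proof -
  have "bij_betw (\<lambda>k::int. k - s) UNIV UNIV"
    by (rule bij_betwI[of _ _ _ "\<lambda>k. k + s"]) auto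
  from infsum_reindex_bij_betw[OF this, of a] show ?thesis unfolding A_def .
qed

lemma A_pos: "A > 0"
proof -
  have "a 0 = (\<Sum>\<^sub>\<infinity>k\<in>{0}. a k)" by simp
  also have "\<dots> \<le> A" unfolding A_def
    using a_summable[of 0] a_pos by (intro infsum_mono_neutral) (auto intro: less_imp_le)
  finally show ?thesis using a_pos[of 0] by linarith
qed

lemma weighted_summable:
  assumes "u \<in> ell2" shows "(\<lambda>j. a (j - i) * (cmod (u j))\<^sup>2) summable_on UNIV"
proof (rule summable_on_comparison_test)
  show "(\<lambda>j. C * (cmod (u j))\<^sup>2) summable_on UNIV"
    using assms unfolding ell2_def by (intro summable_on_cmult_right) auto
qed (use a_le in \<open>auto intro: mult_right_mono\<close>)

lemma norm_kernel_le: "cmod (K i j * u j) \<le> a (j - i) * cmod (u j)"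
  unfolding norm_mult using decay[of i j] by (intro mult_right_mono) (auto simp: a_def abs_minus_commute)

lemma abs_product_summable:
  assumes "u \<in> ell2" shows "(\<lambda>j. a (j - i) * cmod (u j)) summable_on UNIV"
proof (rule summable_on_comparison_test)
  show "(\<lambda>j. a (j - i) + a (j - i) * (cmod (u j))\<^sup>2) summable_on UNIV"
    by (intro summable_on_add a_summable weighted_summable assms)
  show "a (j - i) * cmod (u j) \<le> a (j - i) + a (j - i) * (cmod (u j))\<^sup>2" for j
  proof -
    have "cmod (u j) \<le> 1 + (cmod (u j))\<^sup>2"
    proof -
      have "0 \<le> (cmod (u j) - 1 / 2)\<^sup>2" by simp
      then show ?thesis by (simp add: power2_diff power_divide)
    qed
    then have "a (j - i) * cmod (u j) \<le> a (j - i) * (1 + (cmod (u j))\<^sup>2)"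
      using a_pos by (intro mult_left_mono) (auto intro: less_imp_le)
    then show ?thesis by (simp add: algebra_simps)
  qed
qed auto

lemma kernel_summable:
  assumes "u \<in> ell2" shows "(\<lambda>j. K i j * u j) summable_on UNIV"
proof (rule abs_summable_summable, rule summable_on_comparison_test[OF abs_product_summable[OF assms, of i]])
  show "norm (K i j * u j) \<le> a (j - i) * cmod (u j)" for j by (rule norm_kernel_le)
qed (rule norm_ge_zero)

text \<open>The Cauchy--Schwarz inequality with weight \<open>a\<close>, in the form \<open>u \<le> s / 2 + u\<^sup>2 / (2 s)\<close> with the optimal \<open>s\<close>.\<close>

lemma op_square_le:
  assumes u: "u \<in> ell2"
  shows "(cmod (op u i))\<^sup>2 \<le> A * (\<Sum>\<^sub>\<infinity>j. a (j - i) * (cmod (u j))\<^sup>2)"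
proof (cases "op u i = 0")
  case True
  have "(\<Sum>\<^sub>\<infinity>j. a (j - i) * (cmod (u j))\<^sup>2) \<ge> 0"
    by (intro infsum_nonneg) auto
  then show ?thesis using True A_pos by simp
next
  case False
  define S where "S = (\<Sum>\<^sub>\<infinity>j. a (j - i) * (cmod (u j))\<^sup>2)"
  define r where "r = cmod (op u i)"
  define s where "s = r / A"
  have r: "r > 0" and s: "s > 0" using False A_pos by (auto simp: r_def s_def)
  have "r \<le> (\<Sum>\<^sub>\<infinity>j. a (j - i) * cmod (u j))"
    unfolding r_def op_def
    by (rule norm_infsum_le[OF has_sum_infsum[OF kernel_summable[OF u]] has_sum_infsum[OF abs_product_summable[OF u]]])
       (rule norm_kernel_le)
  also have "\<dots> \<le> (\<Sum>\<^sub>\<infinity>j. s / 2 * a (j - i) + 1 / (2 * s) * (a (j - i) * (cmod (u j))\<^sup>2))"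
  proof (rule infsum_mono)
    show "(\<lambda>j. s / 2 * a (j - i) + 1 / (2 * s) * (a (j - i) * (cmod (u j))\<^sup>2)) summable_on UNIV"
      by (intro summable_on_add summable_on_cmult_right a_summable weighted_summable u)
    fix j
    have "0 \<le> (s - cmod (u j))\<^sup>2" by simp
    then have "cmod (u j) * (2 * s) \<le> s\<^sup>2 + (cmod (u j))\<^sup>2" by (simp add: power2_diff mult_ac)
    then have "cmod (u j) \<le> s / 2 + 1 / (2 * s) * (cmod (u j))\<^sup>2"
      using s by (simp add: field_simps power2_eq_square)
    then have "a (j - i) * cmod (u j) \<le> a (j - i) * (s / 2 + 1 / (2 * s) * (cmod (u j))\<^sup>2)"
      using a_pos by (intro mult_left_mono) (auto intro: less_imp_le)
    then show "a (j - i) * cmod (u j) \<le> s / 2 * a (j - i) + 1 / (2 * s) * (a (j - i) * (cmod (u j))\<^sup>2)"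
      by (simp add: algebra_simps)
  qed (rule abs_product_summable[OF u])
  also have "\<dots> = (\<Sum>\<^sub>\<infinity>j. s / 2 * a (j - i)) + (\<Sum>\<^sub>\<infinity>j. 1 / (2 * s) * (a (j - i) * (cmod (u j))\<^sup>2))"
    by (rule infsum_add) (intro summable_on_cmult_right a_summable weighted_summable u)+
  also have "\<dots> = s / 2 * A + 1 / (2 * s) * S"
    unfolding infsum_cmult_right' S_def a_infsum ..
  finally have "r \<le> s / 2 * A + 1 / (2 * s) * S" .
  then have "r \<le> r / 2 + A * S / (2 * r)" unfolding s_def using A_pos r by (simp add: field_simps)
  then have "r\<^sup>2 \<le> A * S" using r by (simp add: field_simps power2_eq_square)
  then show ?thesis unfolding r_def S_def .
qed

lemma op_finite_square_sum:
  assumes u: "u \<in> ell2" and F: "finite F"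
  shows "(\<Sum>i\<in>F. (cmod (op u i))\<^sup>2) \<le> A\<^sup>2 * (\<Sum>\<^sub>\<infinity>j. (cmod (u j))\<^sup>2)"
proof -
  have "(\<Sum>i\<in>F. (cmod (op u i))\<^sup>2) \<le> (\<Sum>i\<in>F. A * (\<Sum>\<^sub>\<infinity>j. a (j - i) * (cmod (u j))\<^sup>2))"
    by (intro sum_mono op_square_le u)
  also have "\<dots> = A * (\<Sum>\<^sub>\<infinity>j. \<Sum>i\<in>F. a (j - i) * (cmod (u j))\<^sup>2)"
    unfolding sum_distrib_left[symmetric]
    using infsum_finite_sum[OF F, of "\<lambda>i j. a (j - i) * (cmod (u j))\<^sup>2"] weighted_summable[OF u] by simp
  also have "(\<Sum>\<^sub>\<infinity>j. \<Sum>i\<in>F. a (j - i) * (cmod (u j))\<^sup>2) \<le> (\<Sum>\<^sub>\<infinity>j. A * (cmod (u j))\<^sup>2)"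
  proof (rule infsum_mono)
    show "(\<lambda>j. \<Sum>i\<in>F. a (j - i) * (cmod (u j))\<^sup>2) summable_on UNIV"
      using infsum_finite_sum[OF F, of "\<lambda>i j. a (j - i) * (cmod (u j))\<^sup>2"] weighted_summable[OF u] by simp
    show "(\<lambda>j. A * (cmod (u j))\<^sup>2) summable_on UNIV"
      using u unfolding ell2_def by (intro summable_on_cmult_right) auto
    fix j
    have "(\<Sum>i\<in>F. a (j - i)) = (\<Sum>i\<in>F. a (i - j))" by (intro sum.cong refl a_minus)
    also have "\<dots> = (\<Sum>\<^sub>\<infinity>i\<in>F. a (i - j))" using F by simp
    also have "\<dots> \<le> (\<Sum>\<^sub>\<infinity>i. a (i - j))"
      using a_summable[of j] F a_pos by (intro infsum_mono_neutral) (auto intro: less_imp_le)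
    also have "\<dots> = A" by (rule a_infsum)
    finally show "(\<Sum>i\<in>F. a (j - i) * (cmod (u j))\<^sup>2) \<le> A * (cmod (u j))\<^sup>2"
      unfolding sum_distrib_right[symmetric] by (intro mult_right_mono) auto
  qed
  also have "(\<Sum>\<^sub>\<infinity>j. A * (cmod (u j))\<^sup>2) = A * (\<Sum>\<^sub>\<infinity>j. (cmod (u j))\<^sup>2)" by (rule infsum_cmult_right')
  finally show ?thesis using A_pos by (simp add: power2_eq_square mult.assoc)
qed

lemma op_ell2:
  assumes u: "u \<in> ell2"
  shows "op u \<in> ell2" "ell2_norm (op u) \<le> A * ell2_norm u"
proof -
  let ?B = "A\<^sup>2 * (\<Sum>\<^sub>\<infinity>j. (cmod (u j))\<^sup>2)"
  have sm: "(\<lambda>i. (cmod (op u i))\<^sup>2) summable_on UNIV"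
    by (rule nonneg_bdd_above_summable_on)
       (use op_finite_square_sum[OF u] in \<open>auto intro!: bdd_aboveI[of _ ?B]\<close>)
  then show "op u \<in> ell2" unfolding ell2_def by simp
  have "(\<Sum>\<^sub>\<infinity>i. (cmod (op u i))\<^sup>2) \<le> ?B"
    by (rule infsum_le_finite_sums[OF sm]) (use op_finite_square_sum[OF u] in auto)
  then have "sqrt (\<Sum>\<^sub>\<infinity>i. (cmod (op u i))\<^sup>2) \<le> sqrt ?B" by simp
  then show "ell2_norm (op u) \<le> A * ell2_norm u"
    unfolding ell2_norm_def using A_pos by (simp add: real_sqrt_mult)
qed

lemma bounded_operator_op: "bounded_operator_ell2 op"
  unfolding bounded_operator_ell2_def
proof (intro conjI ballI allI exI[of _ A])
  fix u w assume u: "u \<in> ell2" and w: "w \<in> ell2"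
  show "op (\<lambda>n. u n + w n) = (\<lambda>n. op u n + op w n)"
    unfolding op_def using kernel_summable[OF u] kernel_summable[OF w]
    by (simp add: distrib_left infsum_add)
next
  fix c u assume u: "u \<in> ell2"
  show "op (\<lambda>n. c * u n) = (\<lambda>n. c * op u n)"
    unfolding op_def by (simp add: mult.left_commute infsum_cmult_right')
qed (use op_ell2 in auto)

end

lemma infsum_diff_diff:
  fixes f1 f2 f3 :: "int \<Rightarrow> complex"
  assumes "f1 summable_on UNIV" "f2 summable_on UNIV" "f3 summable_on UNIV"
  shows "(\<Sum>\<^sub>\<infinity>j. f1 j - f2 j - f3 j) = (\<Sum>\<^sub>\<infinity>j. f1 j) - (\<Sum>\<^sub>\<infinity>j. f2 j) - (\<Sum>\<^sub>\<infinity>j. f3 j)"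
proof -
  have d: "(\<lambda>j. f j - h j) summable_on UNIV \<and> (\<Sum>\<^sub>\<infinity>j. f j - h j) = (\<Sum>\<^sub>\<infinity>j. f j) - (\<Sum>\<^sub>\<infinity>j. h j)"
    if f: "f summable_on UNIV" and h: "h summable_on UNIV" for f h :: "int \<Rightarrow> complex"
  proof -
    have h': "(\<lambda>j. - h j) summable_on UNIV" using h by (simp add: summable_on_uminus)
    show ?thesis using summable_on_add[OF f h'] infsum_add[OF f h'] by (simp add: infsum_uminus)
  qed
  show ?thesis using d[OF assms(1,2)] d[OF conjunct1[OF d[OF assms(1,2)]] assms(3)] by simp
qed

lemma infsum_shift_int: "(\<Sum>\<^sub>\<infinity>j. f (j + s :: int)) = (\<Sum>\<^sub>\<infinity>j. f j)"
proof -
  have "bij_betw (\<lambda>k::int. k + s) UNIV UNIV" by (rule bij_betwI[of _ _ _ "\<lambda>k. k - s"]) auto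
  from infsum_reindex_bij_betw[OF this, of f] show ?thesis .
qed

lemma infsum_delta_int: "(\<Sum>\<^sub>\<infinity>j. of_bool (n = j) * u j) = (u n :: complex)" for n :: int
proof -
  have "(\<Sum>\<^sub>\<infinity>j. of_bool (n = j) * u j) = (\<Sum>\<^sub>\<infinity>j\<in>{n}. u j)"
    by (rule infsum_cong_neutral) auto
  then show ?thesis by simp
qed

text \<open>Both identities are required: in infinite dimensions a right inverse need not be a left
  inverse.\<close>

lemma resolvent_from_decaying_inverse_kernel:
  fixes K :: "int \<Rightarrow> int \<Rightarrow> complex"
  assumes decay: "\<And>i j. cmod (K i j) \<le> C * exp (- \<delta> * \<bar>real_of_int (i - j)\<bar>)" and C: "C > 0" "\<delta> > 0"
    and bdd: "\<And>k. \<bar>v (int_iter T k x)\<bar> \<le> V"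
    and right: "\<And>n j. (of_real (v (int_iter T n x)) - z) * K n j
        - of_real (exp g) * K (n + 1) j - of_real (exp (- g)) * K (n - 1) j = of_bool (n = j)"
    and left: "\<And>i k. K i k * (of_real (v (int_iter T k x)) - z)
        - of_real (exp g) * K i (k - 1) - of_real (exp (- g)) * K i (k + 1) = of_bool (i = k)"
  shows "z \<in> resolvent_set_ell2 (hatano_nelson T v g x)"
proof -
  interpret decaying_kernel K C \<delta> by unfold_locales (use assms in auto)
  define q where "q n = of_real (v (int_iter T n x)) - z" for n
  have qB: "cmod (q n) \<le> V + cmod z" for n
    unfolding q_def using norm_triangle_ineq4[of "of_real (v (int_iter T n x))" z] bdd[of n] by simp
  have H: "hatano_nelson T v g x u n - z * u n =
      q n * u n - of_real (exp g) * u (n + 1) - of_real (exp (- g)) * u (n - 1)" for u n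
    unfolding hatano_nelson_def q_def by (simp add: algebra_simps)
  have L: "op (\<lambda>n. hatano_nelson T v g x u n - z * u n) = u" if u: "u \<in> ell2" for u
  proof
    fix i
    have s1: "(\<lambda>j. K i j * (q j * u j)) summable_on UNIV"
      by (rule kernel_summable[OF ell2_mult_bounded[OF u qB]])
    have s2: "(\<lambda>j. K i j * (of_real (exp g) * u (j + 1))) summable_on UNIV"
      by (intro kernel_summable ell2_cmult ell2_shift u)
    have s3: "(\<lambda>j. K i j * (of_real (exp (- g)) * u (j - 1))) summable_on UNIV"
      using kernel_summable[OF ell2_cmult[OF ell2_shift[OF u, of "-1"], of "of_real (exp (- g))"], of i] by simp
    have t2: "(\<lambda>j. K i (j - 1) * (of_real (exp g) * u j)) summable_on UNIV"
    proof -
      have "(\<lambda>j. K i j * (of_real (exp g) * u (j + 1))) summable_on range (\<lambda>j. j - 1)"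
        using s2 summable_on_subset by blast
      then show ?thesis by (subst (asm) summable_on_reindex) (auto simp: o_def inj_on_def)
    qed
    have t3: "(\<lambda>j. K i (j + 1) * (of_real (exp (- g)) * u j)) summable_on UNIV"
    proof -
      have "(\<lambda>j. K i j * (of_real (exp (- g)) * u (j - 1))) summable_on range (\<lambda>j. j + 1)"
        using s3 summable_on_subset by blast
      then show ?thesis by (subst (asm) summable_on_reindex) (auto simp: o_def inj_on_def)
    qed
    have "op (\<lambda>n. hatano_nelson T v g x u n - z * u n) i =
      (\<Sum>\<^sub>\<infinity>j. K i j * (q j * u j) - K i j * (of_real (exp g) * u (j + 1))
         - K i j * (of_real (exp (- g)) * u (j - 1)))"
      unfolding op_def H by (simp add: right_diff_distrib)
    also have "\<dots> = (\<Sum>\<^sub>\<infinity>j. K i j * (q j * u j)) - (\<Sum>\<^sub>\<infinity>j. K i (j - 1) * (of_real (exp g) * u j))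
         - (\<Sum>\<^sub>\<infinity>j. K i (j + 1) * (of_real (exp (- g)) * u j))"
      using infsum_shift_int[of "\<lambda>j. K i (j - 1) * (of_real (exp g) * u j)" 1]
        infsum_shift_int[of "\<lambda>j. K i (j + 1) * (of_real (exp (- g)) * u j)" "-1"]
      unfolding infsum_diff_diff[OF s1 s2 s3] by simp
    also have "\<dots> = (\<Sum>\<^sub>\<infinity>j. (K i j * q j - of_real (exp g) * K i (j - 1) - of_real (exp (- g)) * K i (j + 1)) * u j)"
      unfolding infsum_diff_diff[OF s1 t2 t3, symmetric] by (simp only: algebra_simps)
    also have "\<dots> = u i" unfolding q_def left by (rule infsum_delta_int)
    finally show "op (\<lambda>n. hatano_nelson T v g x u n - z * u n) i = u i" .
  qed
  have R: "(\<lambda>n. hatano_nelson T v g x (op u) n - z * op u n) = u" if u: "u \<in> ell2" for u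
  proof
    fix n
    have "hatano_nelson T v g x (op u) n - z * op u n =
       (\<Sum>\<^sub>\<infinity>j. q n * (K n j * u j)) - (\<Sum>\<^sub>\<infinity>j. of_real (exp g) * (K (n + 1) j * u j))
         - (\<Sum>\<^sub>\<infinity>j. of_real (exp (- g)) * (K (n - 1) j * u j))"
      unfolding H by (simp only: op_def infsum_cmult_right')
    also have "\<dots> = (\<Sum>\<^sub>\<infinity>j. q n * (K n j * u j) - of_real (exp g) * (K (n + 1) j * u j)
         - of_real (exp (- g)) * (K (n - 1) j * u j))"
      by (rule infsum_diff_diff[symmetric]) (intro summable_on_cmult_right kernel_summable u)+
    also have "\<dots> = (\<Sum>\<^sub>\<infinity>j. (q n * K n j - of_real (exp g) * K (n + 1) j - of_real (exp (- g)) * K (n - 1) j) * u j)"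
      by (simp add: algebra_simps)
    also have "\<dots> = u n" unfolding q_def right by (rule infsum_delta_int)
    finally show "hatano_nelson T v g x (op u) n - z * op u n = u n" .
  qed
  show ?thesis unfolding resolvent_set_ell2_def mem_Collect_eq
    by (intro exI[of _ op] conjI ballI bounded_operator_op L R)
qed

text \<open>Conjugating by \<open>u k \<mapsto> exp (g k) u k\<close> removes \<open>g\<close> from the operator. It is an unbounded change of variables,
  so a kernel inverting the operator with \<open>g = 0\<close> is useful exactly when it still decays after
  multiplication with \<open>exp (- g (i - j))\<close>.\<close>

lemma resolvent_from_gauged_kernel:
  fixes K :: "int \<Rightarrow> int \<Rightarrow> complex"
  assumes decay: "\<And>i j. exp (- g * real_of_int (i - j)) * cmod (K i j) \<le> C * exp (- \<delta> * \<bar>real_of_int (i - j)\<bar>)"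
    and C: "C > 0" "\<delta> > 0"
    and bdd: "\<And>k. \<bar>v (int_iter T k x)\<bar> \<le> V"
    and right: "\<And>n j. (of_real (v (int_iter T n x)) - z) * K n j - K (n + 1) j - K (n - 1) j = of_bool (n = j)"
    and left: "\<And>i k. K i k * (of_real (v (int_iter T k x)) - z) - K i (k - 1) - K i (k + 1) = of_bool (i = k)"
  shows "z \<in> resolvent_set_ell2 (hatano_nelson T v g x)"
proof (rule resolvent_from_decaying_inverse_kernel[where C = C and \<delta> = \<delta> and V = V
      and K = "\<lambda>i j. of_real (exp (- g * real_of_int (i - j))) * K i j"])
  show "cmod (of_real (exp (- g * real_of_int (i - j))) * K i j) \<le> C * exp (- \<delta> * \<bar>real_of_int (i - j)\<bar>)" for i j
    using decay[of i j] by (simp add: norm_mult)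
  have e: "exp g * exp (- g * (r + 1)) = exp (- g * r)" "exp (- g) * exp (- g * (r - 1)) = exp (- g * r)" for r :: real
    by (simp_all add: exp_add[symmetric] algebra_simps)
  have e1: "complex_of_real (exp g) * of_real (exp (- g * real_of_int (n + 1 - j))) = of_real (exp (- g * real_of_int (n - j)))" for n j
  proof -
    have r: "real_of_int (n + 1 - j) = real_of_int (n - j) + 1" by simp
    show ?thesis unfolding r of_real_mult[symmetric] e(1) ..
  qed
  have e2: "complex_of_real (exp (- g)) * of_real (exp (- g * real_of_int (n - 1 - j))) = of_real (exp (- g * real_of_int (n - j)))" for n j
  proof -
    have r: "real_of_int (n - 1 - j) = real_of_int (n - j) - 1" by simp
    show ?thesis unfolding r of_real_mult[symmetric] e(2) ..
  qed
  show "(of_real (v (int_iter T n x)) - z) * (of_real (exp (- g * real_of_int (n - j))) * K n j)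
        - of_real (exp g) * (of_real (exp (- g * real_of_int (n + 1 - j))) * K (n + 1) j)
        - of_real (exp (- g)) * (of_real (exp (- g * real_of_int (n - 1 - j))) * K (n - 1) j) = of_bool (n = j)" for n j
  proof -
    have "(of_real (v (int_iter T n x)) - z) * (of_real (exp (- g * real_of_int (n - j))) * K n j)
        - of_real (exp g) * (of_real (exp (- g * real_of_int (n + 1 - j))) * K (n + 1) j)
        - of_real (exp (- g)) * (of_real (exp (- g * real_of_int (n - 1 - j))) * K (n - 1) j)
      = of_real (exp (- g * real_of_int (n - j))) *
         ((of_real (v (int_iter T n x)) - z) * K n j - K (n + 1) j - K (n - 1) j)"
      unfolding mult.assoc[symmetric] e1 e2 by (simp only: algebra_simps)
    also have "\<dots> = of_bool (n = j)" unfolding right by (cases "n = j") auto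
    finally show ?thesis .
  qed
  show "of_real (exp (- g * real_of_int (i - k))) * K i k * (of_real (v (int_iter T k x)) - z)
        - of_real (exp g) * (of_real (exp (- g * real_of_int (i - (k - 1)))) * K i (k - 1))
        - of_real (exp (- g)) * (of_real (exp (- g * real_of_int (i - (k + 1)))) * K i (k + 1)) = of_bool (i = k)" for i k
  proof -
    have s: "i - (k - 1) = i + 1 - k" "i - (k + 1) = i - 1 - k" by auto
    have "of_real (exp (- g * real_of_int (i - k))) * K i k * (of_real (v (int_iter T k x)) - z)
        - of_real (exp g) * (of_real (exp (- g * real_of_int (i - (k - 1)))) * K i (k - 1))
        - of_real (exp (- g)) * (of_real (exp (- g * real_of_int (i - (k + 1)))) * K i (k + 1))
      = of_real (exp (- g * real_of_int (i - k))) *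
         (K i k * (of_real (v (int_iter T k x)) - z) - K i (k - 1) - K i (k + 1))"
      unfolding mult.assoc[symmetric] s e1 e2 by (simp only: algebra_simps)
    also have "\<dots> = of_bool (i = k)" unfolding left by (cases "i = k") auto
    finally show ?thesis .
  qed
qed (use C bdd in auto)

section \<open>Tridiagonal and periodic tridiagonal determinants\<close>

definition tridiagonal :: "(int \<Rightarrow> complex) \<Rightarrow> complex \<Rightarrow> complex \<Rightarrow> int \<Rightarrow> nat \<Rightarrow> complex Matrix.mat" where
  "tridiagonal q b c a n = Matrix.mat n n (\<lambda>(i, j).
     if i = j then q (a + int i) else if j = i + 1 then b else if i = j + 1 then c else 0)"

lemma tridiagonal_carrier: "tridiagonal q b c a n \<in> carrier_mat n n"
  by (simp add: tridiagonal_def)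

lemma det_tridiagonal:
  assumes bc: "b * c = 1"
  shows "Determinant.det (tridiagonal q b c a n) = continuant q a n"
proof (induction n arbitrary: a rule: induct_nat_012)
  case 0
  show ?case by (simp add: det_dim_zero[OF tridiagonal_carrier])
next
  case 1
  show ?case using det_single[OF tridiagonal_carrier[of q b c a 1]] by (simp add: tridiagonal_def)
next
  case (ge2 n)
  let ?A = "tridiagonal q b c a (Suc (Suc n))"
  have m0: "mat_delete ?A 0 0 = tridiagonal q b c (a + 1) (Suc n)"
    unfolding mat_delete_def tridiagonal_def by (rule eq_matI) (auto simp: algebra_simps)
  let ?B = "mat_delete ?A 0 1"
  have B: "?B \<in> carrier_mat (Suc n) (Suc n)"
    using mat_delete_carrier[OF tridiagonal_carrier, of q b c a "Suc (Suc n)" 0 1] by simp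
  have B0: "?B $$ (i, 0) = (if i = 0 then c else 0)" if "i < Suc n" for i
    using that unfolding mat_delete_def tridiagonal_def by auto
  have B00: "mat_delete ?B 0 0 = tridiagonal q b c (a + 2) n"
    unfolding mat_delete_def tridiagonal_def by (rule eq_matI) (auto simp: algebra_simps)
  have "Determinant.det ?B = (\<Sum>i<Suc n. ?B $$ (i, 0) * cofactor ?B i 0)"
    by (rule laplace_expansion_column[OF B]) simp
  also have "\<dots> = (\<Sum>i\<in>{0}. ?B $$ (i, 0) * cofactor ?B i 0)"
    by (rule sum.mono_neutral_right) (auto simp: B0[unfolded One_nat_def])
  also have "\<dots> = c * continuant q (a + 2) n"
    unfolding cofactor_def using B0[of 0] B00 ge2(1)[of "a + 2"] by simp
  finally have detB: "Determinant.det ?B = c * continuant q (a + 2) n" .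
  have "Determinant.det ?A = (\<Sum>j<Suc (Suc n). ?A $$ (0, j) * cofactor ?A 0 j)"
    by (rule laplace_expansion_row[OF tridiagonal_carrier]) simp
  also have "\<dots> = (\<Sum>j\<in>{0, 1}. ?A $$ (0, j) * cofactor ?A 0 j)"
    by (rule sum.mono_neutral_right) (auto simp: tridiagonal_def)
  also have "\<dots> = q a * continuant q (a + 1) (Suc n) - b * (c * continuant q (a + 2) n)"
    unfolding cofactor_def using m0 detB ge2(2)[of "a + 1"] by (simp add: tridiagonal_def)
  also have "\<dots> = continuant q a (Suc (Suc n))"
    unfolding continuant_left[of q a n] mult.assoc[symmetric] bc by simp
  finally show ?case .
qed

definition periodic_tridiagonal :: "(int \<Rightarrow> complex) \<Rightarrow> complex \<Rightarrow> complex \<Rightarrow> nat \<Rightarrow> complex Matrix.mat" where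
  "periodic_tridiagonal q b c n = Matrix.mat n n (\<lambda>(i, j).
     if i = j then q (int i) else if j = i + 1 \<or> (i = n - 1 \<and> j = 0) then b
     else if i = j + 1 \<or> (i = 0 \<and> j = n - 1) then c else 0)"

lemma det_lower_triangular_const:
  assumes A: "A \<in> carrier_mat m m" and l: "\<And>i j. i < j \<Longrightarrow> j < m \<Longrightarrow> A $$ (i, j) = 0"
    and d: "\<And>i. i < m \<Longrightarrow> A $$ (i, i) = (b :: complex)"
  shows "Determinant.det A = b ^ m"
proof -
  have "diag_mat A = replicate m b"
    unfolding diag_mat_def using A d by (intro nth_equalityI) auto
  then show ?thesis using det_lower_triangular[OF l A] by simp
qed

lemma det_upper_triangular_const:
  assumes A: "A \<in> carrier_mat m m" and l: "\<And>i j. j < i \<Longrightarrow> i < m \<Longrightarrow> A $$ (i, j) = 0"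
    and d: "\<And>i. i < m \<Longrightarrow> A $$ (i, i) = (b :: complex)"
  shows "Determinant.det A = b ^ m"
proof -
  have "diag_mat A = replicate m b"
    unfolding diag_mat_def using A d by (intro nth_equalityI) auto
  moreover have "upper_triangular A" using A l by (auto simp: upper_triangular_def)
  ultimately show ?thesis using det_upper_triangular[OF _ A] by simp
qed

text \<open>Laplace expansion along the first row. The two corner entries contribute one closed path in each direction
  around the cycle, which gives \<open>b^n\<close> and \<open>c^n\<close>, and the continuant with both end points removed.\<close>

lemma det_periodic_tridiagonal:
  assumes bc: "b * c = 1"
  shows "Determinant.det (periodic_tridiagonal q b c (Suc (Suc (Suc m)))) =
    continuant q 0 (Suc (Suc (Suc m))) - continuant q 1 (Suc m) + (-1) ^ m * (b ^ Suc (Suc (Suc m)) + c ^ Suc (Suc (Suc m)))"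
proof -
  let ?n = "Suc (Suc (Suc m))"
  let ?A = "periodic_tridiagonal q b c ?n"
  have A: "?A \<in> carrier_mat ?n ?n" by (simp add: periodic_tridiagonal_def)
  have m0: "mat_delete ?A 0 0 = tridiagonal q b c 1 (Suc (Suc m))"
    unfolding mat_delete_def tridiagonal_def periodic_tridiagonal_def
    by (rule eq_matI) (auto simp: algebra_simps)
  let ?B = "mat_delete ?A 0 1" and ?C = "mat_delete ?A 0 (Suc (Suc m))"
  have B: "?B \<in> carrier_mat (Suc (Suc m)) (Suc (Suc m))" and C: "?C \<in> carrier_mat (Suc (Suc m)) (Suc (Suc m))"
    using mat_delete_carrier[OF A] by simp_all
  have B0: "?B $$ (i, 0) = (if i = 0 then c else if i = Suc m then b else 0)" if "i < Suc (Suc m)" for i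
    using that unfolding mat_delete_def periodic_tridiagonal_def by auto
  have C0: "?C $$ (i, 0) = (if i = 0 then c else if i = Suc m then b else 0)" if "i < Suc (Suc m)" for i
    using that unfolding mat_delete_def periodic_tridiagonal_def by auto
  have B00: "mat_delete ?B 0 0 = tridiagonal q b c 2 (Suc m)"
    unfolding mat_delete_def tridiagonal_def periodic_tridiagonal_def
    by (rule eq_matI) (auto simp: algebra_simps)
  have B10: "Determinant.det (mat_delete ?B (Suc m) 0) = b ^ Suc m"
  proof (rule det_lower_triangular_const)
    show "mat_delete ?B (Suc m) 0 \<in> carrier_mat (Suc m) (Suc m)" using mat_delete_carrier[OF B] by simp
  qed (auto simp: mat_delete_def periodic_tridiagonal_def)
  have C00: "Determinant.det (mat_delete ?C 0 0) = c ^ Suc m"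
  proof (rule det_upper_triangular_const)
    show "mat_delete ?C 0 0 \<in> carrier_mat (Suc m) (Suc m)" using mat_delete_carrier[OF C] by simp
  qed (auto simp: mat_delete_def periodic_tridiagonal_def)
  have C10: "mat_delete ?C (Suc m) 0 = tridiagonal q b c 1 (Suc m)"
    unfolding mat_delete_def tridiagonal_def periodic_tridiagonal_def
    by (rule eq_matI) (auto simp: algebra_simps)
  have detB: "Determinant.det ?B = c * continuant q 2 (Suc m) + (-1) ^ Suc m * b * b ^ Suc m"
  proof -
    have "Determinant.det ?B = (\<Sum>i<Suc (Suc m). ?B $$ (i, 0) * cofactor ?B i 0)"
      by (rule laplace_expansion_column[OF B]) simp
    also have "\<dots> = (\<Sum>i\<in>{0, Suc m}. ?B $$ (i, 0) * cofactor ?B i 0)"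
      by (rule sum.mono_neutral_right) (auto simp: B0[unfolded One_nat_def])
    also have "\<dots> = c * continuant q 2 (Suc m) + (-1) ^ Suc m * b * b ^ Suc m"
      unfolding cofactor_def using B0[of 0] B0[of "Suc m"] B00 B10 det_tridiagonal[OF bc, of q 2 "Suc m"] by simp
    finally show ?thesis .
  qed
  have detC: "Determinant.det ?C = c * c ^ Suc m + (-1) ^ Suc m * b * continuant q 1 (Suc m)"
  proof -
    have "Determinant.det ?C = (\<Sum>i<Suc (Suc m). ?C $$ (i, 0) * cofactor ?C i 0)"
      by (rule laplace_expansion_column[OF C]) simp
    also have "\<dots> = (\<Sum>i\<in>{0, Suc m}. ?C $$ (i, 0) * cofactor ?C i 0)"
      by (rule sum.mono_neutral_right) (auto simp: C0)
    also have "\<dots> = c * c ^ Suc m + (-1) ^ Suc m * b * continuant q 1 (Suc m)"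
      unfolding cofactor_def using C0[of 0] C0[of "Suc m"] C00 C10 det_tridiagonal[OF bc, of q 1 "Suc m"] by simp
    finally show ?thesis .
  qed
  have "Determinant.det ?A = (\<Sum>j<?n. ?A $$ (0, j) * cofactor ?A 0 j)"
    by (rule laplace_expansion_row[OF A]) simp
  also have "\<dots> = (\<Sum>j\<in>{0, 1, Suc (Suc m)}. ?A $$ (0, j) * cofactor ?A 0 j)"
    by (rule sum.mono_neutral_right) (auto simp: periodic_tridiagonal_def)
  also have "\<dots> = ?A $$ (0, 0) * cofactor ?A 0 0 + ?A $$ (0, 1) * cofactor ?A 0 1
      + ?A $$ (0, Suc (Suc m)) * cofactor ?A 0 (Suc (Suc m))" by simp
  also have "\<dots> = q 0 * continuant q 1 (Suc (Suc m)) - b * Determinant.det ?B + (-1) ^ m * c * Determinant.det ?C"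
    unfolding cofactor_def m0 det_tridiagonal[OF bc] by (simp add: periodic_tridiagonal_def)
  also have "\<dots> = (q 0 * continuant q 1 (Suc (Suc m)) - (b * c) * continuant q 2 (Suc m))
      + (-1) ^ m * (-1) ^ m * (- (b * c) * continuant q 1 (Suc m))
      + (-1) ^ m * (b ^ ?n + c ^ ?n)"
    unfolding detB detC by (simp add: algebra_simps del: continuant.simps)
  also have "(-1) ^ m * (-1) ^ m = (1 :: complex)" by (simp add: power_add[symmetric])
  finally show ?thesis
    unfolding bc using continuant_left[of q 0 "Suc m"] by (simp del: continuant.simps)
qed

lemma periodic_hn_matrix_carrier: "periodic_hn_matrix T v g x n \<in> carrier_mat n n"
  by (simp add: periodic_hn_matrix_def)

lemma char_poly_periodic_hn_matrix:
  assumes n: "n \<ge> 3" and w_def: "w = (\<lambda>k. v (int_iter T k x))"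
  shows "poly (char_poly (periodic_hn_matrix T v g x n)) E =
    (-1) ^ n * (jacobi_det w E 0 n - jacobi_det w E 1 (n - 2) - of_real (exp (g * real n) + exp (- g * real n)))"
proof -
  obtain m where m: "n = Suc (Suc (Suc m))"
    using n by (metis Suc_le_D numeral_3_eq_3 Suc_le_mono)
  let ?H = "periodic_hn_matrix T v g x n"
  let ?b = "- complex_of_real (exp g)" and ?c = "- complex_of_real (exp (- g))"
  let ?q = "\<lambda>k. of_real (w k) - E"
  let ?M = "periodic_tridiagonal ?q ?b ?c n"
  have bc: "?b * ?c = 1"
    by (simp add: of_real_mult[symmetric] exp_minus del: of_real_mult)
  have "- char_matrix ?H E = (-1) \<cdot>\<^sub>m ?M"
    unfolding char_matrix_def periodic_hn_matrix_def periodic_tridiagonal_def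
    by (rule eq_matI) (auto simp: w_def int_iter_def)
  then have "poly (char_poly ?H) E = Determinant.det ((-1) \<cdot>\<^sub>m ?M)"
    using char_poly_matrix[OF periodic_hn_matrix_carrier, of T v g x n E] by simp
  also have "\<dots> = (-1) ^ n * Determinant.det ?M"
    unfolding det_smult by (simp add: periodic_tridiagonal_def)
  also have "Determinant.det ?M = jacobi_det w E 0 n - jacobi_det w E 1 (n - 2) + (-1) ^ m * (?b ^ n + ?c ^ n)"
    unfolding m using det_periodic_tridiagonal[OF bc, of ?q m] by (simp del: continuant.simps)
  also have "(-1) ^ m * (?b ^ n + ?c ^ n) = - of_real (exp (g * real n) + exp (- g * real n))"
  proof -
    have b: "?b ^ n = (-1) ^ n * of_real (exp (g * real n))"
      unfolding exp_of_nat2_mult by (subst power_minus) simp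
    have c: "?c ^ n = (-1) ^ n * of_real (exp (- g * real n))"
      unfolding exp_of_nat2_mult by (subst power_minus) simp
    have "(-1) ^ m * (-1 :: complex) ^ n = -1"
      unfolding m by (simp add: power_add[symmetric] mult_2[symmetric])
    then show ?thesis unfolding b c by (simp add: distrib_left[symmetric] mult.assoc[symmetric])
  qed
  finally show ?thesis by simp
qed

text \<open>An eigenvector of the matrix, read modulo \<open>n\<close>, solves the difference equation on one period.\<close>

lemma periodic_hn_eigenvector:
  assumes n: "n \<ge> 3" and root: "poly (char_poly (periodic_hn_matrix T v g x n)) E = 0"
  obtains u :: "int \<Rightarrow> complex" where "\<And>k. u (k + int n) = u k" "\<exists>k. u k \<noteq> 0"
    "\<And>k. 0 \<le> k \<Longrightarrow> k < int n \<Longrightarrow> (of_real (v (int_iter T k x)) - E) * u k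
       - of_real (exp g) * u (k + 1) - of_real (exp (- g)) * u (k - 1) = 0"
proof -
  let ?H = "periodic_hn_matrix T v g x n"
  obtain \<psi> where ev: "eigenvector ?H \<psi> E"
    using root eigenvalue_root_char_poly[OF periodic_hn_matrix_carrier, of T v g x n E]
    unfolding eigenvalue_def by blast
  have dr: "dim_row ?H = n" by (simp add: periodic_hn_matrix_def)
  have \<psi>: "\<psi> \<in> carrier_vec n" "\<psi> \<noteq> 0\<^sub>v n" and eq: "?H *\<^sub>v \<psi> = E \<cdot>\<^sub>v \<psi>"
    using ev unfolding eigenvector_def dr by auto
  define u where "u k = vec_index \<psi> (nat (k mod int n))" for k
  have n0: "int n > 0" using n by simp
  have ui: "u (int i) = vec_index \<psi> i" if "i < n" for i unfolding u_def using that by simp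
  show ?thesis
  proof (rule that)
    show "u (k + int n) = u k" for k unfolding u_def by simp
    obtain i where i: "i < n" "vec_index \<psi> i \<noteq> 0"
      using \<psi> by (metis carrier_vecD dim_vec eq_vecI index_zero_vec(1) index_zero_vec(2))
    then show "\<exists>k. u k \<noteq> 0" using ui by metis
    fix k :: int assume k: "0 \<le> k" "k < int n"
    define i where "i = nat k"
    have i: "k = int i" "i < n" using k by (auto simp: i_def)
    define ip where "ip = (if i = n - 1 then 0 else i + 1)"
    define im where "im = (if i = 0 then n - 1 else i - 1)"
    have up: "u (k + 1) = vec_index \<psi> ip"
    proof (cases "i = n - 1")
      case True
      then have "k + 1 = int n" using i n by simp
      then show ?thesis unfolding u_def ip_def using True by simp
    next
      case False
      then have "k + 1 = int ip" "ip < n" using i by (auto simp: ip_def)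
      then show ?thesis using ui by simp
    qed
    have um: "u (k - 1) = vec_index \<psi> im"
    proof (cases "i = 0")
      case True
      have "(-1) mod int n = int n - 1" using n0 by (simp add: zmod_minus1)
      then show ?thesis unfolding u_def im_def using True i n by (simp add: nat_diff_distrib)
    next
      case False
      then have "k - 1 = int im" "im < n" using i by (auto simp: im_def)
      then show ?thesis using ui by simp
    qed
    have dist: "i \<noteq> ip" "i \<noteq> im" "ip \<noteq> im" and lt: "ip < n" "im < n"
      using i n unfolding ip_def im_def by (auto split: if_splits)
    have entries: "?H $$ (i, i) = of_real (v ((T ^^ i) x))" "?H $$ (i, ip) = - of_real (exp g)"
      "?H $$ (i, im) = - of_real (exp (- g))"
      using i n dist lt unfolding periodic_hn_matrix_def ip_def im_def by (auto split: if_splits)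
    have zero: "?H $$ (i, j) = 0" if "j < n" "j \<notin> {i, ip, im}" for j
      using that i n unfolding periodic_hn_matrix_def ip_def im_def by (auto split: if_splits)
    have "vec_index (?H *\<^sub>v \<psi>) i = (\<Sum>j<n. ?H $$ (i, j) * vec_index \<psi> j)"
      using i \<psi>(1) dr periodic_hn_matrix_carrier[of T v g x n]
      by (auto simp: scalar_prod_def row_def intro!: sum.cong)
    also have "\<dots> = (\<Sum>j\<in>{i, ip, im}. ?H $$ (i, j) * vec_index \<psi> j)"
      by (rule sum.mono_neutral_right) (use zero i lt in auto)
    also have "\<dots> = of_real (v ((T ^^ i) x)) * vec_index \<psi> i - of_real (exp g) * vec_index \<psi> ip - of_real (exp (- g)) * vec_index \<psi> im"
      using dist by (simp add: entries)
    finally have "E * vec_index \<psi> i = of_real (v ((T ^^ i) x)) * vec_index \<psi> i - of_real (exp g) * vec_index \<psi> ip - of_real (exp (- g)) * vec_index \<psi> im"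
      unfolding eq using i \<psi>(1) by simp
    then show "(of_real (v (int_iter T k x)) - E) * u k
       - of_real (exp g) * u (k + 1) - of_real (exp (- g)) * u (k - 1) = 0"
      unfolding up um using i ui by (simp add: int_iter_def algebra_simps)
  qed
qed

section \<open>Operators that are bounded below\<close>

definition hn_op :: "real \<Rightarrow> (int \<Rightarrow> complex) \<Rightarrow> (int \<Rightarrow> complex) \<Rightarrow> int \<Rightarrow> complex" where
  "hn_op g q u n = q n * u n - of_real (exp g) * u (n + 1) - of_real (exp (- g)) * u (n - 1)"

text \<open>The set \<open>A\<close> contains the support of \<open>u\<close> and its neighbours, hence the support of \<open>hn_op g q u\<close>, so the finite
  sums are the full norms. Testing finitely supported sequences only makes the property pass to limits of
  the potential.\<close>

definition lower_bound :: "real \<Rightarrow> real \<Rightarrow> (int \<Rightarrow> complex) \<Rightarrow> bool" where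
  "lower_bound c g q \<longleftrightarrow> (\<forall>u A. finite A \<longrightarrow> (\<forall>k. u k \<noteq> 0 \<longrightarrow> {k - 1, k, k + 1} \<subseteq> A) \<longrightarrow>
     c * (\<Sum>k\<in>A. (cmod (u k))\<^sup>2) \<le> (\<Sum>k\<in>A. (cmod (hn_op g q u k))\<^sup>2))"

lemma lower_boundD:
  assumes "lower_bound c g q" "finite A" "\<And>k. u k \<noteq> 0 \<Longrightarrow> {k - 1, k, k + 1} \<subseteq> A"
  shows "c * (\<Sum>k\<in>A. (cmod (u k))\<^sup>2) \<le> (\<Sum>k\<in>A. (cmod (hn_op g q u k))\<^sup>2)"
  using assms(1)[unfolded lower_bound_def, rule_format, OF assms(2), of u] assms(3) by (simp only: simp_thms)

lemma hn_op_outside: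
  assumes "\<And>k. u k \<noteq> 0 \<Longrightarrow> {k - 1, k, k + 1} \<subseteq> A" "n \<notin> A"
  shows "hn_op g q u n = 0" "u n = 0"
proof -
  have "u n = 0" using assms by blast
  moreover have "u (n + 1) = 0" using assms(1)[of "n + 1"] assms(2) by auto
  moreover have "u (n - 1) = 0" using assms(1)[of "n - 1"] assms(2) by auto
  ultimately show "hn_op g q u n = 0" "u n = 0" by (auto simp: hn_op_def)
qed

lemma ell2_finite_support:
  assumes "finite A" "\<And>n. n \<notin> A \<Longrightarrow> u n = 0"
  shows "u \<in> ell2" "ell2_norm u = sqrt (\<Sum>k\<in>A. (cmod (u k))\<^sup>2)"
proof -
  have "((\<lambda>n. (cmod (u n))\<^sup>2) has_sum (\<Sum>k\<in>A. (cmod (u k))\<^sup>2)) UNIV"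
    by (rule has_sum_finite_neutralI) (use assms in auto)
  then show "u \<in> ell2" "ell2_norm u = sqrt (\<Sum>k\<in>A. (cmod (u k))\<^sup>2)"
    unfolding ell2_def ell2_norm_def using infsumI by (auto simp: summable_on_def)
qed

lemma lower_bound_of_resolvent:
  assumes "z \<in> resolvent_set_ell2 (hatano_nelson T v g x)"
  obtains c where "c > 0" "lower_bound c g (\<lambda>k. of_real (v (int_iter T k x)) - z)"
proof -
  let ?q = "\<lambda>k. of_real (v (int_iter T k x)) - z"
  obtain R where R0: "bounded_operator_ell2 R"
    and R1: "\<forall>u\<in>ell2. R (\<lambda>n. hatano_nelson T v g x u n - z * u n) = u \<and>
      (\<lambda>n. hatano_nelson T v g x (R u) n - z * R u n) = u"
    using assms unfolding resolvent_set_ell2_def by blast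
  have R: "R (\<lambda>n. hatano_nelson T v g x u n - z * u n) = u" if "u \<in> ell2" for u
    using R1 that by blast
  obtain C where C': "\<forall>u\<in>ell2. ell2_norm (R u) \<le> C * ell2_norm u"
    using R0 unfolding bounded_operator_ell2_def by blast
  then have C: "ell2_norm (R u) \<le> C * ell2_norm u" if "u \<in> ell2" for u using that by blast
  have H: "(\<lambda>n. hatano_nelson T v g x u n - z * u n) = hn_op g ?q u" for u
    unfolding hn_op_def hatano_nelson_def by (auto simp: algebra_simps)
  show ?thesis
  proof (rule that)
    show "inverse (C\<^sup>2 + 1) > 0" by (simp add: add_nonneg_pos)
    show "lower_bound (inverse (C\<^sup>2 + 1)) g ?q"
      unfolding lower_bound_def
    proof (intro allI impI)
      fix u :: "int \<Rightarrow> complex" and A :: "int set"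
      assume A: "finite A" "\<forall>k. u k \<noteq> 0 \<longrightarrow> {k - 1, k, k + 1} \<subseteq> A"
      let ?S = "\<Sum>k\<in>A. (cmod (u k))\<^sup>2" and ?S' = "\<Sum>k\<in>A. (cmod (hn_op g ?q u k))\<^sup>2"
      have out: "hn_op g ?q u n = 0" "u n = 0" if "n \<notin> A" for n
        using hn_op_outside[of u A n] A(2) that by blast+
      have u: "u \<in> ell2" "ell2_norm u = sqrt ?S" using ell2_finite_support[OF A(1)] out by blast+
      have h: "hn_op g ?q u \<in> ell2" "ell2_norm (hn_op g ?q u) = sqrt ?S'"
        using ell2_finite_support[OF A(1)] out by blast+
      have "ell2_norm u \<le> C * ell2_norm (hn_op g ?q u)"
        using C[OF h(1)] R[OF u(1)] unfolding H by simp
      then have "sqrt ?S \<le> C * sqrt ?S'" by (simp only: u(2) h(2))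
      then have "(sqrt ?S)\<^sup>2 \<le> (C * sqrt ?S')\<^sup>2" by (intro power_mono) (auto intro: sum_nonneg)
      then have "?S \<le> C\<^sup>2 * ?S'" by (simp add: power_mult_distrib sum_nonneg)
      also have "\<dots> \<le> (C\<^sup>2 + 1) * ?S'" by (intro mult_right_mono) (auto intro: sum_nonneg)
      finally have "inverse (C\<^sup>2 + 1) * ?S \<le> inverse (C\<^sup>2 + 1) * ((C\<^sup>2 + 1) * ?S')"
        by (rule mult_left_mono) simp
      also have "\<dots> = ?S'"
      proof -
        have "C\<^sup>2 + 1 \<noteq> 0" using add_nonneg_pos[of "C\<^sup>2" 1] by simp
        then show ?thesis unfolding mult.assoc[symmetric] by simp
      qed
      finally show "inverse (C\<^sup>2 + 1) * ?S \<le> ?S'" .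
    qed
  qed
qed

lemma hn_op_shift: "hn_op g q (\<lambda>k. u (k - s)) n = hn_op g (\<lambda>k. q (k + s)) u (n - s)"
  by (simp add: hn_op_def algebra_simps)

lemma lower_bound_shift:
  assumes "lower_bound c g q" shows "lower_bound c g (\<lambda>k. q (k + s))"
  unfolding lower_bound_def
proof (intro allI impI)
  fix u :: "int \<Rightarrow> complex" and A :: "int set"
  assume A: "finite A" "\<forall>k. u k \<noteq> 0 \<longrightarrow> {k - 1, k, k + 1} \<subseteq> A"
  let ?A = "(\<lambda>k. k + s) ` A"
  have inj: "inj_on (\<lambda>k. k + s) A" by (simp add: inj_on_def)
  have "{k - 1, k, k + 1} \<subseteq> ?A" if "u (k - s) \<noteq> 0" for k
  proof -
    have "{k - s - 1, k - s, k - s + 1} \<subseteq> A" using A(2) that by blast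
    then have "k - 1 \<in> ?A" "k \<in> ?A" "k + 1 \<in> ?A"
      using image_eqI[of "k - 1" "\<lambda>k. k + s" "k - s - 1" A] image_eqI[of k "\<lambda>k. k + s" "k - s" A]
        image_eqI[of "k + 1" "\<lambda>k. k + s" "k - s + 1" A] by simp_all
    then show ?thesis by blast
  qed
  then have "c * (\<Sum>k\<in>?A. (cmod (u (k - s)))\<^sup>2) \<le> (\<Sum>k\<in>?A. (cmod (hn_op g q (\<lambda>k. u (k - s)) k))\<^sup>2)"
    by (rule lower_boundD[OF assms finite_imageI[OF A(1)]])
  then show "c * (\<Sum>k\<in>A. (cmod (u k))\<^sup>2) \<le> (\<Sum>k\<in>A. (cmod (hn_op g (\<lambda>k. q (k + s)) u k))\<^sup>2)"
    unfolding hn_op_shift by (simp add: sum.reindex[OF inj])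
qed

text \<open>For a fixed test sequence the inequality is closed in the point and invariant along the orbit, and the orbit
  is dense.\<close>

lemma lower_bound_all_points:
  fixes T :: "'a::metric_space \<Rightarrow> 'a" and v :: "'a \<Rightarrow> real"
  assumes homeo: "homeomorphism UNIV UNIV T (inv_into UNIV T)" and min: "minimal_system T"
    and v: "continuous_on UNIV v"
    and lb: "lower_bound c g (\<lambda>k. of_real (v (int_iter T k x)) - z)"
  shows "lower_bound c g (\<lambda>k. of_real (v (int_iter T k y)) - z)"
  unfolding lower_bound_def
proof (intro allI impI)
  fix u :: "int \<Rightarrow> complex" and A :: "int set"
  assume A: "finite A" "\<forall>k. u k \<noteq> 0 \<longrightarrow> {k - 1, k, k + 1} \<subseteq> A"
  let ?F = "\<lambda>y. \<Sum>k\<in>A. (cmod (hn_op g (\<lambda>k. of_real (v (int_iter T k y)) - z) u k))\<^sup>2"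
  let ?c = "c * (\<Sum>k\<in>A. (cmod (u k))\<^sup>2)"
  have bij: "bij T" by (rule bij_of_homeomorphism[OF homeo])
  have cont: "continuous_on UNIV ?F"
    unfolding hn_op_def
    by (intro continuous_intros continuous_on_compose2[OF v continuous_int_iter[OF homeo]]) auto
  have "closed {y. ?c \<le> ?F y}" by (intro closed_Collect_le continuous_on_const cont)
  moreover have "range (\<lambda>n. int_iter T n x) \<subseteq> {y. ?c \<le> ?F y}"
  proof clarify
    fix s
    have "lower_bound c g (\<lambda>k. of_real (v (int_iter T (k + s) x)) - z)"
      by (rule lower_bound_shift[OF lb])
    from lower_boundD[OF this A(1), of u] A(2) show "?c \<le> ?F (int_iter T s x)"
      unfolding int_iter_add[OF bij] by (simp only: simp_thms)
  qed
  ultimately have "closure (range (\<lambda>n. int_iter T n x)) \<subseteq> {y. ?c \<le> ?F y}"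
    by (rule closure_minimal[rotated])
  then show "?c \<le> ?F y" using min unfolding minimal_system_def by blast
qed

text \<open>\<open>2 a\<^sup>2 + 2 b\<^sup>2\<close> bounds \<open>(a + b)\<^sup>2\<close>; half of the bound \<open>c\<close> survives this and a further quarter absorbs \<open>d\<close>.\<close>

lemma lower_bound_perturb:
  assumes lb: "lower_bound c g q" and d: "\<And>k. cmod (q' k - q k) \<le> d" "4 * d\<^sup>2 \<le> c"
  shows "lower_bound (c / 4) g q'"
  unfolding lower_bound_def
proof (intro allI impI)
  fix u :: "int \<Rightarrow> complex" and A :: "int set"
  assume A: "finite A" "\<forall>k. u k \<noteq> 0 \<longrightarrow> {k - 1, k, k + 1} \<subseteq> A"
  let ?S = "\<Sum>k\<in>A. (cmod (u k))\<^sup>2"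
  have "c * ?S \<le> (\<Sum>k\<in>A. (cmod (hn_op g q u k))\<^sup>2)"
    by (rule lower_boundD[OF lb A(1)]) (use A(2) in \<open>simp only: simp_thms\<close>)
  also have "\<dots> \<le> (\<Sum>k\<in>A. 2 * (cmod (hn_op g q' u k))\<^sup>2 + 2 * d\<^sup>2 * (cmod (u k))\<^sup>2)"
  proof (rule sum_mono)
    fix k
    have "hn_op g q u k = hn_op g q' u k - (q' k - q k) * u k" by (simp add: hn_op_def algebra_simps)
    then have "cmod (hn_op g q u k) \<le> cmod (hn_op g q' u k) + cmod (q' k - q k) * cmod (u k)"
      by (metis norm_triangle_ineq4 norm_mult)
    also have "\<dots> \<le> cmod (hn_op g q' u k) + d * cmod (u k)"
      using d(1)[of k] by (intro add_left_mono mult_right_mono) auto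
    finally have "(cmod (hn_op g q u k))\<^sup>2 \<le> (cmod (hn_op g q' u k) + d * cmod (u k))\<^sup>2"
      by (intro power_mono) auto
    also have "\<dots> \<le> 2 * (cmod (hn_op g q' u k))\<^sup>2 + 2 * (d * cmod (u k))\<^sup>2"
      using sum_squares_bound[of "cmod (hn_op g q' u k)" "d * cmod (u k)"] by (simp add: power2_sum)
    finally show "(cmod (hn_op g q u k))\<^sup>2 \<le> 2 * (cmod (hn_op g q' u k))\<^sup>2 + 2 * d\<^sup>2 * (cmod (u k))\<^sup>2"
      by (simp add: power_mult_distrib mult.assoc)
  qed
  also have "\<dots> = 2 * (\<Sum>k\<in>A. (cmod (hn_op g q' u k))\<^sup>2) + 2 * d\<^sup>2 * ?S"
    by (simp add: sum.distrib sum_distrib_left)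
  finally have "c * ?S \<le> 2 * (\<Sum>k\<in>A. (cmod (hn_op g q' u k))\<^sup>2) + 2 * d\<^sup>2 * ?S" .
  moreover have "2 * (2 * d\<^sup>2 * ?S) \<le> c * ?S"
    using mult_right_mono[OF d(2), of ?S] by (simp add: sum_nonneg mult.assoc)
  ultimately show "c / 4 * ?S \<le> (\<Sum>k\<in>A. (cmod (hn_op g q' u k))\<^sup>2)" by linarith
qed

section \<open>The resolvent set repels periodic spectra\<close>

lemma sum_periodic_shift:
  fixes f :: "int \<Rightarrow> real"
  assumes "\<And>k. f (k + int n) = f k"
  shows "(\<Sum>j<n. f (int j + s)) = (\<Sum>j<n. f (int j))"
proof -
  have step: "(\<Sum>j<n. f (int j + (s + 1))) = (\<Sum>j<n. f (int j + s))" for s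
  proof -
    have "(\<Sum>j<n. f (int (Suc j) + s)) - (\<Sum>j<n. f (int j + s)) = f (int n + s) - f (int 0 + s)"
      unfolding sum_subtractf[symmetric] by (rule sum_lessThan_telescope)
    moreover have "f (int n + s) = f s" using assms[of s] by (simp add: add.commute)
    ultimately show ?thesis by (simp add: algebra_simps)
  qed
  show ?thesis
  proof (induction s rule: int_induct[where k = 0])
    case (step1 i) then show ?case using step[of i] by simp
  next
    case (step2 i) then show ?case using step[of "i - 1"] by simp
  qed simp
qed

text \<open>The indicator of a window jumps only at its two ends.\<close>

lemma sum_boundary_indicator:
  fixes f :: "int \<Rightarrow> real"
  assumes f: "\<And>k. f k \<ge> 0" and K: "K > 0"
  shows "(\<Sum>k\<in>{j - 1..j + K}. of_bool ((k \<in> {j..<j + K}) \<noteq> (k + 1 \<in> {j..<j + K})) * f (k + 1)) \<le> f j + f (j + K)"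
    "(\<Sum>k\<in>{j - 1..j + K}. of_bool ((k \<in> {j..<j + K}) \<noteq> (k - 1 \<in> {j..<j + K})) * f (k - 1)) \<le> f (j - 1) + f (j + K - 1)"
proof -
  have "(\<Sum>k\<in>{j - 1..j + K}. of_bool ((k \<in> {j..<j + K}) \<noteq> (k + 1 \<in> {j..<j + K})) * f (k + 1))
      = (\<Sum>k\<in>{j - 1, j + K - 1}. of_bool ((k \<in> {j..<j + K}) \<noteq> (k + 1 \<in> {j..<j + K})) * f (k + 1))"
    using K by (intro sum.mono_neutral_right) auto
  then show "(\<Sum>k\<in>{j - 1..j + K}. of_bool ((k \<in> {j..<j + K}) \<noteq> (k + 1 \<in> {j..<j + K})) * f (k + 1)) \<le> f j + f (j + K)"
    using K by simp
  have "(\<Sum>k\<in>{j - 1..j + K}. of_bool ((k \<in> {j..<j + K}) \<noteq> (k - 1 \<in> {j..<j + K})) * f (k - 1))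
      = (\<Sum>k\<in>{j, j + K}. of_bool ((k \<in> {j..<j + K}) \<noteq> (k - 1 \<in> {j..<j + K})) * f (k - 1))"
    using K by (intro sum.mono_neutral_right) auto
  then show "(\<Sum>k\<in>{j - 1..j + K}. of_bool ((k \<in> {j..<j + K}) \<noteq> (k - 1 \<in> {j..<j + K})) * f (k - 1)) \<le> f (j - 1) + f (j + K - 1)"
    using K by simp
qed

text \<open>The commutator of the operator with the indicator of a window lives at the four sites near the ends of the window.\<close>

lemma cutoff_commutator_bound:
  assumes K: "K > 0" and sol: "\<And>k. j \<le> k \<Longrightarrow> k < j + K \<Longrightarrow> cmod (hn_op g q u k) \<le> \<epsilon> * cmod (u k)"
  defines "I \<equiv> {j..<j + K}"
  defines "\<phi> \<equiv> \<lambda>k. of_bool (k \<in> I) * u k"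
  shows "(\<Sum>k\<in>{j - 1..j + K}. (cmod (hn_op g q \<phi> k))\<^sup>2)
     \<le> 3 * \<epsilon>\<^sup>2 * (\<Sum>k\<in>I. (cmod (u k))\<^sup>2)
       + 3 * exp (2 * \<bar>g\<bar>) * ((cmod (u j))\<^sup>2 + (cmod (u (j + K)))\<^sup>2 + (cmod (u (j - 1)))\<^sup>2 + (cmod (u (j + K - 1)))\<^sup>2)"
proof -
  let ?e = "exp (2 * \<bar>g\<bar>)"
  let ?b1 = "\<lambda>k. of_bool ((k \<in> I) \<noteq> (k + 1 \<in> I)) * (cmod (u (k + 1)))\<^sup>2"
  let ?b2 = "\<lambda>k. of_bool ((k \<in> I) \<noteq> (k - 1 \<in> I)) * (cmod (u (k - 1)))\<^sup>2"
  have e: "(exp g)\<^sup>2 \<le> ?e" "(exp (- g))\<^sup>2 \<le> ?e" by (simp_all add: exp_double[symmetric])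
  have pt: "(cmod (hn_op g q \<phi> k))\<^sup>2 \<le> 3 * \<epsilon>\<^sup>2 * (of_bool (k \<in> I) * (cmod (u k))\<^sup>2) + 3 * ?e * ?b1 k + 3 * ?e * ?b2 k" for k
  proof -
    define A where "A = of_bool (k \<in> I) * hn_op g q u k"
    define B where "B = of_real (exp g) * (of_bool (k \<in> I) - of_bool (k + 1 \<in> I)) * u (k + 1)"
    define C where "C = of_real (exp (- g)) * (of_bool (k \<in> I) - of_bool (k - 1 \<in> I)) * u (k - 1)"
    have "hn_op g q \<phi> k = A + B + C" unfolding hn_op_def \<phi>_def A_def B_def C_def by (simp add: algebra_simps)
    then have "cmod (hn_op g q \<phi> k) \<le> cmod A + cmod B + cmod C"
      using norm_triangle_ineq[of "A + B" C] norm_triangle_ineq[of A B] by simp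
    then have "(cmod (hn_op g q \<phi> k))\<^sup>2 \<le> (cmod A + cmod B + cmod C)\<^sup>2" by (intro power_mono) auto
    also have "\<dots> \<le> 3 * (cmod A)\<^sup>2 + 3 * (cmod B)\<^sup>2 + 3 * (cmod C)\<^sup>2"
      using sum_squares_bound[of "cmod A" "cmod B"] sum_squares_bound[of "cmod A" "cmod C"]
        sum_squares_bound[of "cmod B" "cmod C"] by (simp add: power2_sum algebra_simps)
    also have "(cmod A)\<^sup>2 \<le> \<epsilon>\<^sup>2 * (of_bool (k \<in> I) * (cmod (u k))\<^sup>2)"
    proof (cases "k \<in> I")
      case True
      then have "cmod A \<le> \<epsilon> * cmod (u k)" using sol[of k] by (simp add: A_def I_def)
      then show ?thesis using True power_mono[of "cmod A" "\<epsilon> * cmod (u k)" 2] by (simp add: power_mult_distrib)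
    qed (simp add: A_def)
    also have "(cmod B)\<^sup>2 \<le> ?e * ?b1 k"
      using e(1) by (auto simp: B_def norm_mult power_mult_distrib intro!: mult_right_mono)
    also have "(cmod C)\<^sup>2 \<le> ?e * ?b2 k"
      using e(2) by (auto simp: C_def norm_mult power_mult_distrib intro!: mult_right_mono)
    finally show ?thesis by simp
  qed
  have "(\<Sum>k\<in>{j - 1..j + K}. (cmod (hn_op g q \<phi> k))\<^sup>2)
     \<le> (\<Sum>k\<in>{j - 1..j + K}. 3 * \<epsilon>\<^sup>2 * (of_bool (k \<in> I) * (cmod (u k))\<^sup>2) + 3 * ?e * ?b1 k + 3 * ?e * ?b2 k)"
    by (intro sum_mono pt)
  also have "\<dots> = 3 * \<epsilon>\<^sup>2 * (\<Sum>k\<in>{j - 1..j + K}. of_bool (k \<in> I) * (cmod (u k))\<^sup>2)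
      + 3 * ?e * (\<Sum>k\<in>{j - 1..j + K}. ?b1 k) + 3 * ?e * (\<Sum>k\<in>{j - 1..j + K}. ?b2 k)"
    by (simp only: sum.distrib sum_distrib_left)
  also have "(\<Sum>k\<in>{j - 1..j + K}. of_bool (k \<in> I) * (cmod (u k))\<^sup>2) = (\<Sum>k\<in>I. (cmod (u k))\<^sup>2)"
    by (rule sum.mono_neutral_cong_right) (auto simp: I_def)
  also have "(\<Sum>k\<in>{j - 1..j + K}. ?b1 k) \<le> (cmod (u j))\<^sup>2 + (cmod (u (j + K)))\<^sup>2"
    unfolding I_def by (rule sum_boundary_indicator(1)[of "\<lambda>k. (cmod (u k))\<^sup>2", OF _ K]) simp
  also have "(\<Sum>k\<in>{j - 1..j + K}. ?b2 k) \<le> (cmod (u (j - 1)))\<^sup>2 + (cmod (u (j + K - 1)))\<^sup>2"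
    unfolding I_def by (rule sum_boundary_indicator(2)[of "\<lambda>k. (cmod (u k))\<^sup>2", OF _ K]) simp
  finally show ?thesis by (simp add: algebra_simps)
qed

text \<open>Applying the lower bound to the cut-offs to \<open>{j..<j + K}\<close> and summing over one period of \<open>j\<close> counts the mass
  \<open>S\<close> of one period \<open>K\<close> times on the left, but the boundary terms only \<open>4\<close> times on the right. For large \<open>K\<close>
  this forces \<open>S = 0\<close>.\<close>

lemma no_almost_periodic_solution:
  fixes u :: "int \<Rightarrow> complex" and K n :: nat
  assumes lb: "lower_bound c g q" and c: "c > 0" and K: "real K * c > 24 * exp (2 * \<bar>g\<bar>)"
    and eps: "6 * \<epsilon>\<^sup>2 \<le> c"
    and per: "\<And>k. u (k + int n) = u k"
    and sol: "\<And>k. 0 \<le> k \<Longrightarrow> k < int n + int K \<Longrightarrow> cmod (hn_op g q u k) \<le> \<epsilon> * cmod (u k)"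
  shows "\<forall>k<n. u (int k) = 0"
proof -
  let ?e = "exp (2 * \<bar>g\<bar>)"
  let ?f = "\<lambda>k. (cmod (u k))\<^sup>2"
  define S where "S = (\<Sum>j<n. ?f (int j))"
  have K0: "K > 0" using K by (cases K) auto
  have shift: "(\<Sum>j<n. ?f (int j + s)) = S" for s
    unfolding S_def by (rule sum_periodic_shift) (simp add: per)
  have each: "c * (\<Sum>k\<in>{int j..<int j + int K}. ?f k) \<le> 3 * \<epsilon>\<^sup>2 * (\<Sum>k\<in>{int j..<int j + int K}. ?f k)
       + 3 * ?e * (?f (int j) + ?f (int j + int K) + ?f (int j - 1) + ?f (int j + int K - 1))" if "j < n" for j
  proof -
    let ?I = "{int j..<int j + int K}" and ?A = "{int j - 1..int j + int K}"
    let ?\<phi> = "\<lambda>k. of_bool (k \<in> ?I) * u k"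
    have "c * (\<Sum>k\<in>?A. (cmod (?\<phi> k))\<^sup>2) \<le> (\<Sum>k\<in>?A. (cmod (hn_op g q ?\<phi> k))\<^sup>2)"
      by (rule lower_boundD[OF lb]) (auto split: if_splits)
    also have "(\<Sum>k\<in>?A. (cmod (?\<phi> k))\<^sup>2) = (\<Sum>k\<in>?I. ?f k)"
      by (rule sum.mono_neutral_cong_right) auto
    also have "(\<Sum>k\<in>?A. (cmod (hn_op g q ?\<phi> k))\<^sup>2) \<le> 3 * \<epsilon>\<^sup>2 * (\<Sum>k\<in>?I. ?f k)
       + 3 * ?e * (?f (int j) + ?f (int j + int K) + ?f (int j - 1) + ?f (int j + int K - 1))"
      by (rule cutoff_commutator_bound) (use K0 sol that in auto)
    finally show ?thesis by simp
  qed
  have win: "(\<Sum>j<n. \<Sum>k\<in>{int j..<int j + int K}. ?f k) = real K * S"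
  proof -
    have "(\<Sum>k\<in>{int j..<int j + int K}. ?f k) = (\<Sum>i<K. ?f (int j + int i))" for j
      by (rule sum.reindex_bij_witness[of _ "\<lambda>i. int j + int i" "\<lambda>k. nat (k - int j)"]) auto
    then have "(\<Sum>j<n. \<Sum>k\<in>{int j..<int j + int K}. ?f k) = (\<Sum>j<n. \<Sum>i<K. ?f (int j + int i))" by simp
    also have "\<dots> = (\<Sum>i<K. \<Sum>j<n. ?f (int j + int i))" by (rule sum.swap)
    also have "\<dots> = real K * S" unfolding shift by simp
    finally show ?thesis .
  qed
  have "(\<Sum>j<n. c * (\<Sum>k\<in>{int j..<int j + int K}. ?f k)) \<le> (\<Sum>j<n. 3 * \<epsilon>\<^sup>2 * (\<Sum>k\<in>{int j..<int j + int K}. ?f k)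
       + 3 * ?e * (?f (int j) + ?f (int j + int K) + ?f (int j - 1) + ?f (int j + int K - 1)))"
    using each by (intro sum_mono) auto
  moreover have "(\<Sum>j<n. ?f (int j) + ?f (int j + int K) + ?f (int j - 1) + ?f (int j + int K - 1)) = 4 * S"
    using shift[of 0] shift[of "int K"] shift[of "-1"] shift[of "int K - 1"]
    by (simp add: sum.distrib add_diff_eq)
  ultimately have "c * (real K * S) \<le> 3 * \<epsilon>\<^sup>2 * (real K * S) + 3 * ?e * (4 * S)"
    unfolding sum.distrib sum_distrib_left[symmetric] win by simp
  moreover have "S \<ge> 0" unfolding S_def by (intro sum_nonneg) auto
  moreover have "6 * \<epsilon>\<^sup>2 * (real K * S) \<le> c * (real K * S)"
    using eps \<open>S \<ge> 0\<close> by (intro mult_right_mono) auto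
  ultimately have "real K * c * S \<le> 24 * ?e * S" by (simp add: algebra_simps)
  then have "S \<le> 0" using K \<open>S \<ge> 0\<close> by (metis mult_le_cancel_right not_less)
  then have "S = 0" using \<open>S \<ge> 0\<close> by simp
  then show ?thesis unfolding S_def by (subst (asm) sum_nonneg_eq_0_iff) auto
qed

text \<open>At a return time \<open>n\<close> the potential on \<open>{n..<n + K}\<close> nearly equals that on \<open>{0..<K}\<close>, so the periodic continuation
  of an eigenvector is an approximate solution also on the windows that straddle the end of the period.\<close>

theorem periodic_spectrum_avoids_resolvent_set:
  fixes T :: "'a::metric_space \<Rightarrow> 'a" and v :: "'a \<Rightarrow> real"
  assumes comp: "compact (UNIV :: 'a set)" and homeo: "homeomorphism UNIV UNIV T (inv_into UNIV T)"
    and min: "minimal_system T" and v: "continuous_on UNIV v"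
    and E0: "E0 \<in> resolvent_set_ell2 (hatano_nelson T v g x)"
  obtains r where "r > 0"
    "\<And>y m. \<exists>n\<ge>m. \<forall>E. dist E0 E < r \<longrightarrow> poly (char_poly (periodic_hn_matrix T v g y n)) E \<noteq> 0"
proof -
  obtain c where c: "c > 0" and lbx: "lower_bound c g (\<lambda>k. of_real (v (int_iter T k x)) - E0)"
    using lower_bound_of_resolvent[OF E0] by blast
  (* as 4 * r^2 = c, moving the energy by r leaves the lower bound c / 4 *)
  define r where "r = sqrt (c / 4)"
  have bij: "bij T" by (rule bij_of_homeomorphism[OF homeo])
  obtain K :: nat where K: "real K > 24 * exp (2 * \<bar>g\<bar>) / (c / 4)" using reals_Archimedean2 by blast
  define \<epsilon> where "\<epsilon> = sqrt (c / 24)"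
  have \<epsilon>: "\<epsilon> > 0" "6 * \<epsilon>\<^sup>2 \<le> c / 4" using c by (auto simp: \<epsilon>_def)
  show ?thesis
  proof (rule that)
    show "r > 0" using c by (simp add: r_def)
    fix y m
    define V where "V = (\<Inter>i\<in>{..<K}. {z. \<bar>v ((T ^^ i) z) - v ((T ^^ i) y)\<bar> < \<epsilon>})"
    have cont: "continuous_on UNIV (T ^^ i)" for i
      using continuous_int_iter[OF homeo, of "int i"] by (simp add: int_iter_def)
    have "open V" unfolding V_def
      by (intro open_INT finite_lessThan ballI open_Collect_less continuous_intros
          continuous_on_compose2[OF v cont]) auto
    moreover have "y \<in> V" using \<epsilon> unfolding V_def by simp
    ultimately obtain n where n: "n \<ge> max m (max 3 K)" "(T ^^ n) y \<in> V"
      using minimal_forward_recurrence[OF comp homeo min, of V "max m (max 3 K)" y] by blast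
    show "\<exists>n\<ge>m. \<forall>E. dist E0 E < r \<longrightarrow> poly (char_poly (periodic_hn_matrix T v g y n)) E \<noteq> 0"
    proof (intro exI[of _ n] conjI allI impI notI)
      show "m \<le> n" using n by simp
      fix E assume E: "dist E0 E < r" and root: "poly (char_poly (periodic_hn_matrix T v g y n)) E = 0"
      let ?q = "\<lambda>k. of_real (v (int_iter T k y)) - E"
      have lb: "lower_bound (c / 4) g ?q"
      proof (rule lower_bound_perturb)
        show "lower_bound c g (\<lambda>k. of_real (v (int_iter T k y)) - E0)"
          by (rule lower_bound_all_points[OF homeo min v lbx])
        show "cmod (?q k - (of_real (v (int_iter T k y)) - E0)) \<le> r" for k
          using E by (simp add: dist_norm)
        show "4 * r\<^sup>2 \<le> c" using c by (simp add: r_def)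
      qed
      obtain u where u: "\<And>k. u (k + int n) = u k" "\<exists>k. u k \<noteq> 0"
        "\<And>k. 0 \<le> k \<Longrightarrow> k < int n \<Longrightarrow> hn_op g ?q u k = 0"
        using periodic_hn_eigenvector[OF _ root] n(1) unfolding hn_op_def by auto
      have "\<forall>k<n. u (int k) = 0"
      proof (rule no_almost_periodic_solution[where u = u and n = n and K = K and \<epsilon> = \<epsilon>, OF lb _ _ \<epsilon>(2) u(1)])
        show "c / 4 > 0" "real K * (c / 4) > 24 * exp (2 * \<bar>g\<bar>)" using c K by (auto simp: field_simps)
        fix k assume k: "0 \<le> k" "k < int n + int K"
        show "cmod (hn_op g ?q u k) \<le> \<epsilon> * cmod (u k)"
        proof (cases "k < int n")
          case True
          then show ?thesis using u(3)[OF k(1)] \<epsilon>(1) by simp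
        next
          case False
          define i where "i = nat (k - int n)"
          have i: "k = int i + int n" "i < K" using False k by (auto simp: i_def)
          then have "i < n" using n(1) by simp
          have "hn_op g ?q u (int i) = 0" using u(3) \<open>i < n\<close> by simp
          moreover have "u k = u (int i)" "u (k + 1) = u (int i + 1)" "u (k - 1) = u (int i - 1)"
            unfolding i(1) using u(1)[of "int i"] u(1)[of "int i + 1"] u(1)[of "int i - 1"]
            by (simp_all add: algebra_simps)
          ultimately have "hn_op g ?q u k = of_real (v (int_iter T k y) - v (int_iter T (int i) y)) * u k"
            unfolding hn_op_def by (simp add: algebra_simps)
          moreover have "int_iter T k y = (T ^^ i) ((T ^^ n) y)"
            unfolding i(1) int_iter_add[OF bij, symmetric] int_iter_of_nat[OF bij] ..
          moreover have "\<bar>v ((T ^^ i) ((T ^^ n) y)) - v ((T ^^ i) y)\<bar> < \<epsilon>"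
            using n(2) i(2) unfolding V_def by blast
          ultimately show ?thesis
            by (simp add: norm_mult int_iter_of_nat[OF bij] mult_right_mono del: of_real_diff)
        qed
      qed
      moreover obtain k where k: "u k \<noteq> 0" using u(2) by blast
      moreover have "u k = u (k mod int n)"
      proof -
        have "u (j + int n * m') = u j" for j m'
        proof (induction m' rule: int_induct[where k = 0])
          case (step1 i) then show ?case using u(1)[of "j + int n * i"] by (simp add: algebra_simps)
        next
          case (step2 i) then show ?case using u(1)[of "j + int n * (i - 1)"] by (simp add: algebra_simps)
        qed simp
        from this[of "k mod int n" "k div int n"] show ?thesis by simp
      qed
      moreover have "k mod int n = int (nat (k mod int n))" "nat (k mod int n) < n"
        using n(1) pos_mod_bound[of "int n" k] pos_mod_sign[of "int n" k] by (simp_all add: nat_less_iff)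
      ultimately show False by metis
    qed
  qed
qed

section \<open>Uniform growth of continuants off the real axis\<close>

text \<open>Both sides of \<open>(\<Sum>j<n. a (j + K) - a j) = (\<Sum>i<K. a (n + i) - a i)\<close> are evaluated by almost additivity, once
  block by block and once at the ends. It turns the cocycle into a Birkhoff sum of \<open>a K\<close> up to an error of order \<open>n C\<close>.\<close>

lemma almost_additive_telescope:
  fixes a :: "nat \<Rightarrow> 'x \<Rightarrow> real" and T :: "'x \<Rightarrow> 'x"
  assumes add: "\<And>n m y. \<bar>a (n + m) y - a n y - a m ((T ^^ n) y)\<bar> \<le> C"
    and M: "\<And>i y. i < K \<Longrightarrow> \<bar>a i y\<bar> \<le> M"
  shows "\<bar>real K * a n y - (\<Sum>j<n. a K ((T ^^ j) y))\<bar> \<le> real n * C + real K * (C + 2 * M)"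
proof -
  have tele: "(\<Sum>j<n. a (j + K) y - a j y) = (\<Sum>i<K. a (n + i) y - a i y)"
  proof (induction n)
    case (Suc n)
    have "(\<Sum>i<K. a (Suc n + i) y) - (\<Sum>i<K. a (n + i) y) = a (n + K) y - a n y"
      using sum_lessThan_telescope[of "\<lambda>i. a (n + i) y" K] by (simp add: sum_subtractf)
    then show ?case using Suc by (simp add: sum_subtractf)
  qed simp
  have "\<bar>(\<Sum>j<n. a (j + K) y - a j y) - (\<Sum>j<n. a K ((T ^^ j) y))\<bar> \<le> (\<Sum>j<n. C)"
    unfolding sum_subtractf[symmetric]
    by (intro order_trans[OF sum_abs] sum_mono add)
  moreover have "\<bar>(\<Sum>i<K. a (n + i) y - a i y) - real K * a n y\<bar> \<le> (\<Sum>i<K. C + 2 * M)"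
  proof -
    have "(\<Sum>i<K. a (n + i) y - a i y) - real K * a n y = (\<Sum>i<K. a (n + i) y - a i y - a n y)"
      by (simp add: sum_subtractf)
    also have "\<bar>\<dots>\<bar> \<le> (\<Sum>i<K. C + 2 * M)"
    proof (intro order_trans[OF sum_abs] sum_mono)
      fix i assume "i \<in> {..<K}"
      then show "\<bar>a (n + i) y - a i y - a n y\<bar> \<le> C + 2 * M"
        using add[of n i y] M[of i y] M[of i "(T ^^ n) y"] by simp
    qed
    finally show ?thesis .
  qed
  ultimately show ?thesis unfolding tele by simp
qed

text \<open>The averages \<open>a n / n\<close> are eventually within \<open>(C + 2) / K\<close> of the mean of \<open>a K / K\<close>, uniformly in the point. The
  means are thus a Cauchy sequence in \<open>K\<close>.\<close>

lemma almost_additive_uniform_limit: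
  fixes a :: "nat \<Rightarrow> 'a::metric_space \<Rightarrow> real" and T :: "'a \<Rightarrow> 'a"
  assumes comp: "compact (UNIV :: 'a set)" and T: "continuous_on UNIV T"
    and uniq: "\<And>\<nu>. invariant_prob T \<nu> \<Longrightarrow> \<nu> = \<mu>"
    and cont: "\<And>n. continuous_on UNIV (a n)"
    and add: "\<And>n m y. \<bar>a (n + m) y - a n y - a m ((T ^^ n) y)\<bar> \<le> C"
  shows "\<exists>\<Lambda>. \<forall>\<epsilon>>0. \<exists>n0. \<forall>n\<ge>n0. \<forall>y. \<bar>a n y / real n - \<Lambda>\<bar> \<le> \<epsilon>"
proof -
  have C0: "C \<ge> 0" using add[of 0 0 undefined] abs_ge_zero order_trans by blast
  define I where "I K = (\<integral>y. a K y \<partial>\<mu>)" for K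
  have bound: "\<exists>M. \<forall>i<K. \<forall>y. \<bar>a i y\<bar> \<le> M" for K
  proof (induction K)
    case (Suc K)
    then obtain M where M: "\<forall>i<K. \<forall>y. \<bar>a i y\<bar> \<le> M" by blast
    have "bounded (range (a K))" by (rule compact_imp_bounded[OF compact_continuous_image[OF cont comp]])
    then obtain B where B: "\<And>y. \<bar>a K y\<bar> \<le> B" unfolding bounded_iff by auto
    have "\<forall>i<Suc K. \<forall>y. \<bar>a i y\<bar> \<le> max M B"
      using M B by (metis less_Suc_eq max.coboundedI1 max.coboundedI2)
    then show ?case by blast
  qed simp
  have approx: "\<exists>n1. \<forall>n\<ge>n1. \<forall>y. \<bar>a n y / real n - I K / real K\<bar> \<le> (C + 2) / real K" if K: "K > 0" for K
  proof -
    obtain M where M: "\<And>i y. i < K \<Longrightarrow> \<bar>a i y\<bar> \<le> M" using bound[of K] by blast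
    obtain n0 where n0: "\<And>n y. n \<ge> n0 \<Longrightarrow> \<bar>(\<Sum>j<n. a K ((T ^^ j) y)) / n - I K\<bar> < 1"
      unfolding I_def by (rule uniform_ergodic_theorem[OF comp T uniq cont, of 1]) auto
    obtain n2 :: nat where n2: "real n2 \<ge> real K * (C + 2 * M)" using real_arch_simple by blast
    show ?thesis
    proof (intro exI[of _ "max (max n0 n2) 1"] allI impI)
      fix n y assume n: "n \<ge> max (max n0 n2) 1"
      then have n': "real n > 0" "real n \<ge> real K * (C + 2 * M)" using n2 by auto
      let ?S = "\<Sum>j<n. a K ((T ^^ j) y)"
      have "\<bar>real K * a n y - ?S\<bar> \<le> real n * C + real n"
        using almost_additive_telescope[OF add M, of K n y] n'(2) by linarith
      then have "\<bar>real K * a n y - ?S\<bar> / real n \<le> C + 1"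
        using n'(1) by (simp add: field_simps)
      moreover have "\<bar>real K * a n y - ?S\<bar> / real n = \<bar>real K * (a n y / n) - ?S / n\<bar>"
        using n'(1) by (simp add: diff_divide_distrib[symmetric])
      moreover have "\<bar>?S / n - I K\<bar> < 1" using n0 n by simp
      moreover have "\<bar>x - y\<bar> \<le> C + 1 \<Longrightarrow> \<bar>y - z\<bar> < 1 \<Longrightarrow> \<bar>x - z\<bar> \<le> C + 2" for x y z :: real by linarith
      ultimately have "\<bar>real K * (a n y / n) - I K\<bar> \<le> C + 2" by metis
      then have "\<bar>real K * (a n y / n) - I K\<bar> / real K \<le> (C + 2) / real K"
        using K by (intro divide_right_mono) auto
      moreover have "\<bar>real K * (a n y / n) - I K\<bar> / real K = \<bar>(real K * (a n y / n) - I K) / real K\<bar>"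
        by simp
      moreover have "(real K * (a n y / n) - I K) / real K = a n y / n - I K / real K"
        using K by (simp add: diff_divide_distrib)
      ultimately show "\<bar>a n y / real n - I K / real K\<bar> \<le> (C + 2) / real K" by metis
    qed
  qed
  define L where "L K = I (Suc K) / real (Suc K)" for K
  have close: "\<bar>L j - L k\<bar> \<le> (C + 2) / real (Suc j) + (C + 2) / real (Suc k)" for j k
  proof -
    obtain n1 n2 where "\<forall>n\<ge>n1. \<forall>y. \<bar>a n y / real n - L j\<bar> \<le> (C + 2) / real (Suc j)"
      "\<forall>n\<ge>n2. \<forall>y. \<bar>a n y / real n - L k\<bar> \<le> (C + 2) / real (Suc k)"
      using approx[of "Suc j"] approx[of "Suc k"] unfolding L_def by blast
    then have "\<bar>a (max n1 n2) undefined / real (max n1 n2) - L j\<bar> \<le> (C + 2) / real (Suc j)"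
      "\<bar>a (max n1 n2) undefined / real (max n1 n2) - L k\<bar> \<le> (C + 2) / real (Suc k)" by auto
    then show ?thesis by linarith
  qed
  have small: "\<exists>k. (C + 2) / real (Suc k) < \<epsilon>" if "\<epsilon> > 0" for \<epsilon>
  proof -
    obtain k :: nat where "(C + 2) / \<epsilon> < real k" using reals_Archimedean2 by blast
    then have "(C + 2) < \<epsilon> * real (Suc k)" using that by (simp add: field_simps)
    then show ?thesis by (intro exI[of _ k]) (simp add: field_simps)
  qed
  have "Cauchy L"
  proof (rule CauchyI')
    fix \<epsilon> :: real assume "\<epsilon> > 0"
    then obtain k where k: "(C + 2) / real (Suc k) < \<epsilon> / 2" using small[of "\<epsilon> / 2"] by auto
    show "\<exists>M. \<forall>m\<ge>M. \<forall>n>m. dist (L m) (L n) < \<epsilon>"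
    proof (intro exI[of _ k] allI impI)
      fix m n assume mn: "k \<le> m" "m < n"
      have "(C + 2) / real (Suc m) \<le> (C + 2) / real (Suc k)" "(C + 2) / real (Suc n) \<le> (C + 2) / real (Suc k)"
        using mn C0 by (intro divide_left_mono; simp)+
      then show "dist (L m) (L n) < \<epsilon>" using close[of m n] k unfolding dist_real_def by linarith
    qed
  qed
  then obtain \<Lambda> where \<Lambda>: "L \<longlonglongrightarrow> \<Lambda>" using Cauchy_convergent convergent_def by blast
  show ?thesis
  proof (intro exI[of _ \<Lambda>] allI impI)
    fix \<epsilon> :: real assume "\<epsilon> > 0"
    then obtain k where k: "(C + 2) / real (Suc k) < \<epsilon> / 4" using small[of "\<epsilon> / 4"] by auto
    have "\<forall>\<^sub>F j in sequentially. dist (L j) \<Lambda> < \<epsilon> / 4 \<and> j \<ge> k"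
      using tendstoD[OF \<Lambda>, of "\<epsilon> / 4"] \<open>\<epsilon> > 0\<close> eventually_ge_at_top[of k] by (simp add: eventually_conj)
    then obtain j where j: "dist (L j) \<Lambda> < \<epsilon> / 4" "j \<ge> k" using eventually_happens by fastforce
    have jk: "(C + 2) / real (Suc j) \<le> (C + 2) / real (Suc k)" using j C0 by (intro divide_left_mono) auto
    obtain n1 where n1: "\<forall>n\<ge>n1. \<forall>y. \<bar>a n y / real n - L j\<bar> \<le> (C + 2) / real (Suc j)"
      using approx[of "Suc j"] unfolding L_def by blast
    have "\<bar>a n y / real n - \<Lambda>\<bar> \<le> \<epsilon>" if "n \<ge> n1" for n y
    proof -
      have "\<bar>a n y / real n - L j\<bar> \<le> (C + 2) / real (Suc j)" using n1 that by blast
      then show ?thesis using jk j(1) k \<open>\<epsilon> > 0\<close> unfolding dist_real_def by linarith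
    qed
    then show "\<exists>n0. \<forall>n\<ge>n0. \<forall>y. \<bar>a n y / real n - \<Lambda>\<bar> \<le> \<epsilon>" by blast
  qed
qed

locale strictly_ergodic_potential =
  fixes T :: "'a::metric_space \<Rightarrow> 'a" and v :: "'a \<Rightarrow> real" and \<mu> :: "'a measure" and V :: real
  assumes comp: "compact (UNIV :: 'a set)" and homeo: "homeomorphism UNIV UNIV T (inv_into UNIV T)"
    and minimal: "minimal_system T" and uniq: "\<And>\<nu>. invariant_prob T \<nu> \<Longrightarrow> \<nu> = \<mu>"
    and v_cont: "continuous_on UNIV v" and v_bound: "\<And>y. \<bar>v y\<bar> \<le> V"
begin

definition w :: "'a \<Rightarrow> int \<Rightarrow> real" where "w y k = v (int_iter T k y)"

abbreviation D :: "'a \<Rightarrow> complex \<Rightarrow> int \<Rightarrow> nat \<Rightarrow> complex" where "D y E \<equiv> jacobi_det (w y) E"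

lemma bij: "bij T" by (rule bij_of_homeomorphism[OF homeo])

lemma T_cont: "continuous_on UNIV T" using homeo by (simp add: homeomorphism_def)

lemma w_bound: "\<bar>w y k\<bar> \<le> V" unfolding w_def by (rule v_bound)

lemma w_shift: "w (int_iter T s y) k = w y (k + s)"
  unfolding w_def int_iter_add[OF bij] ..

lemma D_shift: "D (int_iter T s y) E a n = D y E (a + s) n"
  unfolding w_shift using continuant_shift[of "\<lambda>k. of_real (w y k) - E" s a n] by simp

lemma D_shift_nat: "D ((T ^^ m) y) E 0 n = D y E (int m) n"
  using D_shift[of "int m" y E 0 n] by (simp add: int_iter_of_nat[OF bij])

lemma w_cont: "continuous_on UNIV (\<lambda>y. w y k)"
  unfolding w_def using continuous_on_compose2[OF v_cont continuous_int_iter[OF homeo]] by simp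

lemma D_cont: "continuous_on UNIV (\<lambda>y. D y E a n)"
  by (induction n rule: induct_nat_012) (auto intro!: continuous_intros w_cont simp del: continuant.simps(3) simp: continuant.simps(3))

lemma D_lower_half_plane:
  "Im E > 0 \<Longrightarrow> lower_half_plane_potential (\<lambda>k. of_real (w y k) - E) (Im E) (V + cmod E)"
  by (rule jacobi_potential_lower_half_plane) (auto intro: w_bound)

lemma V_nonneg: "V \<ge> 0" using v_bound[of undefined] abs_ge_zero order_trans by blast

text \<open>The constants depend on \<open>E\<close> only through \<open>|Im E|\<close> and \<open>|E|\<close>, which makes them uniform on compact sets off the
  real axis. The lower half plane is reached by complex conjugation.\<close>

lemma D_almost_multiplicative_explicit:
  assumes E: "Im E \<noteq> 0"
  shows "\<bar>Im E\<bar> / (V + cmod E + 1 / \<bar>Im E\<bar>) * (cmod (D y E a n) * cmod (D y E (a + int n) m)) \<le> cmod (D y E a (n + m))"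
    "cmod (D y E a (n + m)) \<le> (1 + 1 / (Im E)\<^sup>2) * (cmod (D y E a n) * cmod (D y E (a + int n) m))"
proof -
  define F where "F = (if Im E > 0 then E else cnj E)"
  have F: "Im F > 0" "\<And>y a n. cmod (D y F a n) = cmod (D y E a n)" "\<bar>Im E\<bar> = Im F" "cmod E = cmod F" "(Im E)\<^sup>2 = (Im F)\<^sup>2"
    using E by (auto simp: F_def jacobi_det_cnj)
  interpret lower_half_plane_potential "\<lambda>k. of_real (w y k) - F" "Im F" "V + cmod F"
    by (rule D_lower_half_plane[OF F(1)])
  show "\<bar>Im E\<bar> / (V + cmod E + 1 / \<bar>Im E\<bar>) * (cmod (D y E a n) * cmod (D y E (a + int n) m)) \<le> cmod (D y E a (n + m))"
    using continuant_almost_multiplicative(1)[of a n m] unfolding F(2,3,4) lo_def .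
  show "cmod (D y E a (n + m)) \<le> (1 + 1 / (Im E)\<^sup>2) * (cmod (D y E a n) * cmod (D y E (a + int n) m))"
    using continuant_almost_multiplicative(2)[of a n m] unfolding F(2,5) up_def .
qed

lemma D_almost_multiplicative:
  assumes E: "Im E \<noteq> 0"
  shows "\<exists>l u. l > 0 \<and> u > 0 \<and>
    (\<forall>y a n m. l * (cmod (D y E a n) * cmod (D y E (a + int n) m)) \<le> cmod (D y E a (n + m)) \<and>
       cmod (D y E a (n + m)) \<le> u * (cmod (D y E a n) * cmod (D y E (a + int n) m)))"
proof (rule exI[of _ "\<bar>Im E\<bar> / (V + cmod E + 1 / \<bar>Im E\<bar>)"], rule exI[of _ "1 + 1 / (Im E)\<^sup>2"], intro conjI allI)
  show "\<bar>Im E\<bar> / (V + cmod E + 1 / \<bar>Im E\<bar>) > 0"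
    using E V_nonneg by (intro divide_pos_pos add_nonneg_pos) auto
  show "1 + 1 / (Im E)\<^sup>2 > 0" by (intro add_pos_nonneg) auto
qed (rule D_almost_multiplicative_explicit[OF E])+

lemma D_nonzero: "Im E \<noteq> 0 \<Longrightarrow> D y E a n \<noteq> 0" by (rule jacobi_det_nonzero)

lemma growth_rate_exists:
  assumes E: "Im E \<noteq> 0"
  shows "\<exists>\<Lambda>. \<forall>\<epsilon>>0. \<exists>n0. \<forall>n\<ge>n0. \<forall>y. \<bar>ln (cmod (D y E 0 n)) / real n - \<Lambda>\<bar> \<le> \<epsilon>"
proof -
  obtain l u where lu: "l > 0" "u > 0"
    "\<And>y a n m. l * (cmod (D y E a n) * cmod (D y E (a + int n) m)) \<le> cmod (D y E a (n + m))"
    "\<And>y a n m. cmod (D y E a (n + m)) \<le> u * (cmod (D y E a n) * cmod (D y E (a + int n) m))"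
    using D_almost_multiplicative[OF E] by metis
  show ?thesis
  proof (rule almost_additive_uniform_limit[OF comp T_cont uniq])
    show "continuous_on UNIV (\<lambda>y. ln (cmod (D y E 0 n)))" for n
      using D_nonzero[OF E] by (intro continuous_on_ln continuous_on_norm D_cont) auto
    show "\<bar>ln (cmod (D y E 0 (n + m))) - ln (cmod (D y E 0 n)) - ln (cmod (D ((T ^^ n) y) E 0 m))\<bar>
      \<le> max \<bar>ln l\<bar> \<bar>ln u\<bar>" for n m y
    proof -
      have pos: "cmod (D y E a n) > 0" for a n using D_nonzero[OF E] by simp
      have lnm: "ln (c * (cmod (D y E 0 n) * cmod (D y E (int n) m)))
          = ln c + (ln (cmod (D y E 0 n)) + ln (cmod (D y E (int n) m)))" if "c > 0" for c
        using that pos[of 0 n] pos[of "int n" m] by (subst ln_mult; (subst ln_mult)?) auto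
      have pp: "c * (cmod (D y E 0 n) * cmod (D y E (int n) m)) > 0" if "c > 0" for c
        by (intro mult_pos_pos that pos)
      have "ln (l * (cmod (D y E 0 n) * cmod (D y E (int n) m))) \<le> ln (cmod (D y E 0 (n + m)))"
        using lu(3)[of y 0 n m] by (intro ln_le_cancel_iff[OF pp[OF lu(1)] pos, THEN iffD2]) simp
      moreover have "ln (cmod (D y E 0 (n + m))) \<le> ln (u * (cmod (D y E 0 n) * cmod (D y E (int n) m)))"
        using lu(4)[of y 0 n m] by (intro ln_le_cancel_iff[OF pos pp[OF lu(2)], THEN iffD2]) simp
      ultimately show ?thesis unfolding D_shift_nat lnm[OF lu(1)] lnm[OF lu(2)] by linarith
    qed
  qed (use uniq in auto)
qed

text \<open>The Lyapunov exponent at nonreal energies, as a rate that holds uniformly in the point. Only nonreal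
  arguments are meaningful.\<close>

definition growth :: "complex \<Rightarrow> real" where
  "growth E = (SOME \<Lambda>. \<forall>\<epsilon>>0. \<exists>n0. \<forall>n\<ge>n0. \<forall>y. \<bar>ln (cmod (D y E 0 n)) / real n - \<Lambda>\<bar> \<le> \<epsilon>)"

lemma growth:
  assumes E: "Im E \<noteq> 0" and e: "\<epsilon> > 0"
  obtains n0 where "\<And>n y. n \<ge> n0 \<Longrightarrow> exp ((growth E - \<epsilon>) * real n) \<le> cmod (D y E 0 n)"
    "\<And>n y. n \<ge> n0 \<Longrightarrow> cmod (D y E 0 n) \<le> exp ((growth E + \<epsilon>) * real n)"
proof -
  obtain n0 where n0: "\<forall>n\<ge>n0. \<forall>y. \<bar>ln (cmod (D y E 0 n)) / real n - growth E\<bar> \<le> \<epsilon>"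
    using someI_ex[OF growth_rate_exists[OF E]] e unfolding growth_def by blast
  have *: "exp ((growth E - \<epsilon>) * real n) \<le> cmod (D y E 0 n) \<and> cmod (D y E 0 n) \<le> exp ((growth E + \<epsilon>) * real n)"
    if n: "n \<ge> max n0 1" for n y
  proof -
    have pos: "cmod (D y E 0 n) > 0" using D_nonzero[OF E] by simp
    have n': "real n > 0" using n by simp
    have "\<bar>ln (cmod (D y E 0 n)) / real n - growth E\<bar> \<le> \<epsilon>" using n0 n by simp
    then have "growth E - \<epsilon> \<le> ln (cmod (D y E 0 n)) / real n" "ln (cmod (D y E 0 n)) / real n \<le> growth E + \<epsilon>"
      by linarith+
    then have "(growth E - \<epsilon>) * real n \<le> ln (cmod (D y E 0 n))" "ln (cmod (D y E 0 n)) \<le> (growth E + \<epsilon>) * real n"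
      using n' by (simp_all add: pos_le_divide_eq pos_divide_le_eq)
    then show ?thesis using pos by (metis exp_le_cancel_iff exp_ln)
  qed
  show thesis by (rule that[of "max n0 1"]) (use * in blast)+
qed

end

section \<open>Logarithmic potentials of limits of root measures\<close>

text \<open>A pointwise form of Jensen's inequality. Replacing the factor of each zero inside the circle by its
  reflection \<open>(\<rho>\<^sup>2 - cnj (t - E) (z - E)) / \<rho>\<close> keeps the modulus on the circle and raises the value at the centre to
  \<open>max \<rho> |E - t|\<close>; then the maximum principle applies.\<close>

lemma circle_max_ge_jensen:
  fixes t :: "nat \<Rightarrow> complex"
  assumes \<rho>: "\<rho> > 0"
  shows "\<exists>z. cmod (z - E) = \<rho> \<and> (\<Prod>i<n. cmod (z - t i)) \<ge> (\<Prod>i<n. max \<rho> (cmod (E - t i)))"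
proof (rule ccontr)
  let ?B = "\<Prod>i<n. max \<rho> (cmod (E - t i))"
  assume "\<not> ?thesis"
  then have less: "(\<Prod>i<n. cmod (z - t i)) < ?B" if "cmod (z - E) = \<rho>" for z using that by fastforce
  define h where "h i z = (if cmod (E - t i) \<ge> \<rho> then z - t i
      else (of_real (\<rho>\<^sup>2) - cnj (t i - E) * (z - E)) / of_real \<rho>)" for i z
  define G where "G z = (\<Prod>i<n. h i z)" for z
  have h_circle: "cmod (h i z) = cmod (z - t i)" if z: "cmod (z - E) = \<rho>" for i z
  proof (cases "cmod (E - t i) \<ge> \<rho>")
    case False
    have "of_real (\<rho>\<^sup>2) = (z - E) * cnj (z - E)"
      using z complex_norm_square[of "z - E"] by simp
    then have "of_real (\<rho>\<^sup>2) - cnj (t i - E) * (z - E) = (z - E) * cnj (z - t i)"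
      by (simp add: algebra_simps)
    then have "cmod (of_real (\<rho>\<^sup>2) - cnj (t i - E) * (z - E)) = \<rho> * cmod (z - t i)"
      by (simp only: norm_mult complex_mod_cnj z)
    then show ?thesis using False \<rho> by (simp only: h_def norm_divide norm_of_real if_False) simp
  qed (simp add: h_def)
  have h_E: "cmod (h i E) = max \<rho> (cmod (E - t i))" for i
    using \<rho> by (auto simp: h_def power2_eq_square norm_mult norm_divide)
  have hol: "G holomorphic_on UNIV"
    unfolding G_def
  proof (intro holomorphic_on_prod)
    fix i
    show "h i holomorphic_on UNIV"
      unfolding h_def using \<rho> by (cases "cmod (E - t i) \<ge> \<rho>") (auto intro!: holomorphic_intros)
  qed
  have cont: "continuous_on A G" for A
    using holomorphic_on_imp_continuous_on[OF hol] continuous_on_subset by blast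
  have "compact (sphere E \<rho>)" "sphere E \<rho> \<noteq> {}" using \<rho> by auto
  then obtain z0 where z0: "z0 \<in> sphere E \<rho>" "\<And>z. z \<in> sphere E \<rho> \<Longrightarrow> cmod (G z) \<le> cmod (G z0)"
    using continuous_attains_sup[of "sphere E \<rho>" "\<lambda>z. cmod (G z)"] continuous_on_norm[OF cont] by blast
  have G_sphere: "cmod (G z) = (\<Prod>i<n. cmod (z - t i))" if "z \<in> sphere E \<rho>" for z
    unfolding G_def prod_norm[symmetric] using h_circle that by (simp add: dist_norm norm_minus_commute)
  have "cmod (G E) \<le> cmod (G z0)"
  proof (rule maximum_modulus_frontier[where S = "ball E \<rho>" and f = G and \<xi> = E])
    show "G holomorphic_on interior (ball E \<rho>)" by (rule holomorphic_on_subset[OF hol]) simp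
    show "cmod (G z) \<le> cmod (G z0)" if "z \<in> frontier (ball E \<rho>)" for z
      using that z0(2) \<rho> by (simp add: frontier_ball)
  qed (use \<rho> in \<open>auto intro: cont\<close>)
  moreover have "cmod (G E) = ?B" unfolding G_def prod_norm[symmetric] h_E ..
  moreover have "cmod (G z0) < ?B"
    unfolding G_sphere[OF z0(1)] using z0(1) by (intro less) (simp add: dist_norm norm_minus_commute)
  ultimately show False by simp
qed

lemma prod_roots_of_unity:
  assumes "n > 0"
  shows "(\<Prod>\<omega>\<in>{\<omega>::complex. \<omega> ^ n = 1}. X - Y * \<omega>) = X ^ n - Y ^ n"
proof (cases "Y = 0")
  case True
  then show ?thesis using assms card_roots_unity_eq[OF assms] by simp
next
  case False
  let ?p = "monom 1 n - 1 :: complex poly"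
  have poly: "poly ?p z = z ^ n - 1" for z by (simp add: poly_monom)
  have deg: "degree ?p = n \<and> lead_coeff ?p = 1"
  proof -
    have "degree (monom 1 n + - 1 :: complex poly) = degree (monom 1 n :: complex poly)"
      using assms by (intro degree_add_eq_left) (simp add: degree_monom_eq)
    then have d: "degree ?p = n" by (simp add: degree_monom_eq)
    have "coeff (1 :: complex poly) n = 0" using assms by (cases n) (auto simp: one_pCons)
    then have "coeff ?p n = 1" by simp
    then show ?thesis using d by (simp only: simp_thms)
  qed
  have "rsquarefree ?p" unfolding rsquarefree_roots
  proof (intro allI notI)
    fix a assume "poly ?p a = 0 \<and> poly (pderiv ?p) a = 0"
    then have "a ^ n = 1" "of_nat n * a ^ (n - 1) = (0 :: complex)"
      by (auto simp: poly pderiv_diff pderiv_monom poly_monom)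
    then show False using assms by (auto simp: power_0_left)
  qed
  from complex_poly_decompose_rsquarefree[OF this]
  have "?p = (\<Prod>z | poly ?p z = 0. [:-z, 1:])"
    by (simp only: conjunct2[OF deg] smult_1_left)
  then have "poly ?p (X / Y) = poly (\<Prod>z | poly ?p z = 0. [:-z, 1:]) (X / Y)" by (rule arg_cong)
  also have "\<dots> = (\<Prod>z | poly ?p z = 0. X / Y - z)" unfolding poly_prod by simp
  finally have "poly ?p (X / Y) = (\<Prod>z | poly ?p z = 0. X / Y - z)" .
  then have "(X / Y) ^ n - 1 = (\<Prod>\<omega>\<in>{\<omega>. \<omega> ^ n = 1}. X / Y - \<omega>)" unfolding poly by simp
  then have "Y ^ n * ((X / Y) ^ n - 1) = (\<Prod>\<omega>\<in>{\<omega>::complex. \<omega> ^ n = 1}. Y * (X / Y - \<omega>))"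
    unfolding prod.distrib using card_roots_unity_eq[OF assms] by simp
  then show ?thesis using False by (simp add: right_diff_distrib power_divide)
qed

lemma ln_diff_le_divide:
  fixes x y :: real
  assumes "x > 0" "y > 0" shows "ln x - ln y \<le> (x - y) / y"
proof -
  have "1 + (x - y) / y = x / y" using assms by (simp add: field_simps)
  then have "ln x - ln y = ln (1 + (x - y) / y)" using assms by (simp add: ln_div)
  also have "\<dots> \<le> (x - y) / y" using assms by (intro ln_add_one_self_le_self2) (simp add: field_simps)
  finally show ?thesis .
qed

text \<open>The points \<open>rt n 0, \<dots>, rt n (n - 1)\<close> are the roots of monic polynomials \<open>P n\<close> whose normalised counting measures
  converge weakly to \<open>N\<close>.\<close>

locale weak_root_limit =
  fixes rt :: "nat \<Rightarrow> nat \<Rightarrow> complex" and N :: "complex measure" and R :: real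
  assumes rt_bounded: "\<And>n i. n \<ge> 3 \<Longrightarrow> i < n \<Longrightarrow> cmod (rt n i) \<le> R"
    and weak: "\<And>f :: complex \<Rightarrow> real. continuous_on UNIV f \<Longrightarrow> bounded (range f) \<Longrightarrow>
      (\<lambda>n. (\<Sum>i<n. f (rt n i)) / real n) \<longlonglongrightarrow> (\<integral>z. f z \<partial>N)"
    and sets_N: "sets N = sets borel" and finite_N: "finite_measure N"
begin

definition P :: "nat \<Rightarrow> complex \<Rightarrow> complex" where "P n E = (\<Prod>i<n. E - rt n i)"

sublocale N: finite_measure N by (rule finite_N)

lemma space_N: "space N = UNIV" using sets_eq_imp_space_eq[OF sets_N] by simp

lemma borel_N: "f \<in> borel_measurable borel \<Longrightarrow> f \<in> borel_measurable N"
  using measurable_cong_sets[OF sets_N refl] by blast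

lemma R_nonneg: "R \<ge> 0" using rt_bounded[of 3 0] norm_ge_zero order_trans by (metis le_refl zero_less_numeral)

lemma mass: "measure N UNIV = 1"
proof -
  have lim: "(\<lambda>n. (\<Sum>i<n. (1::real)) / real n) \<longlonglongrightarrow> (\<integral>z. 1 \<partial>N)" by (rule weak) auto
  have "\<forall>\<^sub>F n in sequentially. (\<Sum>i<n. (1::real)) / real n = 1"
    using eventually_gt_at_top[of 0] by eventually_elim simp
  from LIMSEQ_unique[OF lim tendsto_eventually[OF this]] have "(\<integral>z. (1::real) \<partial>N) = 1" .
  then show ?thesis by (simp add: space_N)
qed

lemma prob_N: "prob_space N"
  by (rule prob_spaceI) (use mass in \<open>simp add: N.emeasure_eq_measure space_N\<close>)

lemma integrable_bounded:
  fixes f :: "complex \<Rightarrow> real"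
  assumes "continuous_on UNIV f" "bounded (range f)" shows "integrable N f"
proof -
  obtain B where "\<And>z. norm (f z) \<le> B" using assms(2) unfolding bounded_iff by blast
  then show ?thesis
    by (intro N.integrable_const_bound[of _ B] borel_N borel_measurable_continuous_onI assms) auto
qed

lemma AE_zero_if:
  fixes f :: "complex \<Rightarrow> real"
  assumes f: "continuous_on UNIV f" "bounded (range f)" "\<And>z. f z \<ge> 0"
    and zero: "\<And>n. n \<ge> 3 \<Longrightarrow> (\<Sum>i<n. f (rt n i)) = 0"
  shows "AE z in N. f z = 0"
proof -
  have "\<forall>\<^sub>F n in sequentially. (\<Sum>i<n. f (rt n i)) / real n = 0"
    using eventually_ge_at_top[of 3] by eventually_elim (simp add: zero)
  from LIMSEQ_unique[OF weak[OF f(1,2)] tendsto_eventually[OF this]] have "(\<integral>z. f z \<partial>N) = 0" .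
  then show ?thesis using integral_nonneg_eq_0_iff_AE[OF integrable_bounded[OF f(1,2)]] f(3) by simp
qed

lemma AE_bounded: "AE z in N. cmod z \<le> R"
proof -
  let ?f = "\<lambda>z. min 1 (max 0 (cmod z - R))"
  have "AE z in N. ?f z = 0"
  proof (rule AE_zero_if)
    show "continuous_on UNIV ?f" by (intro continuous_intros)
    show "bounded (range ?f)" by (rule boundedI[of _ 1]) auto
    show "(\<Sum>i<n. ?f (rt n i)) = 0" if "n \<ge> 3" for n
      using rt_bounded[OF that] by (intro sum.neutral) auto
  qed auto
  then show ?thesis by eventually_elim (auto simp: min_def max_def split: if_splits)
qed

end

text \<open>On the disc of radius \<open>r\<close> about \<open>E0\<close> the logarithmic potential of \<open>N\<close> involves only points at distance at
  least \<open>3 r\<close>. The polynomials \<open>P n\<close> themselves may still have \<open>o(n)\<close> roots in the disc.\<close>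

locale zero_free_disc = weak_root_limit +
  fixes E0 :: complex and r :: real
  assumes r: "r > 0" and null: "emeasure N (ball E0 (4 * r)) = 0"
begin

definition M :: real where "M = R + cmod E0 + 4 * r"

text \<open>The logarithmic kernel, truncated at both ends to be bounded and continuous, so that weak convergence
  applies. Lowering the cut-off \<open>\<rho>\<close> changes nothing for the limit measure.\<close>

definition \<phi> :: "real \<Rightarrow> complex \<Rightarrow> complex \<Rightarrow> real" where
  "\<phi> \<rho> E t = ln (max \<rho> (min M (cmod (E - t))))"

definition U :: "complex \<Rightarrow> real" where "U E = (\<integral>t. ln (max r (min M (cmod (E - t)))) \<partial>N)"

lemma M_ge: "M \<ge> 4 * r" unfolding M_def using R_nonneg by simp

lemma AE_far: "AE t in N. cmod (E0 - t) \<ge> 4 * r \<and> cmod t \<le> R"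
proof -
  have "AE t in N. t \<notin> ball E0 (4 * r)"
    using null by (intro AE_not_in null_setsI) (auto simp: sets_N)
  then show ?thesis using AE_bounded by eventually_elim (auto simp: dist_norm)
qed

lemma AE_far_from:
  assumes "E \<in> cball E0 r"
  shows "AE t in N. 3 * r \<le> cmod (E - t) \<and> cmod (E - t) \<le> M"
  using AE_far
proof eventually_elim
  case (elim t)
  have "cmod (E0 - t) \<le> cmod (E0 - E) + cmod (E - t)" using norm_triangle_ineq[of "E0 - E" "E - t"] by simp
  moreover have "cmod (E - t) \<le> cmod (E0 - E) + cmod E0 + cmod t"
    using norm_triangle_ineq4[of "E - E0" "t - E0"] norm_triangle_ineq4[of t E0]
    by (simp add: norm_minus_commute)
  ultimately show ?case using elim assms r unfolding M_def by (auto simp: dist_norm)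
qed

lemma \<phi>_cont: "\<rho> > 0 \<Longrightarrow> continuous_on UNIV (\<phi> \<rho> E)"
  unfolding \<phi>_def by (intro continuous_intros) (auto simp: max_def)

lemma \<phi>_bounds:
  assumes "0 < \<rho>" "\<rho> \<le> r" shows "ln \<rho> \<le> \<phi> \<rho> E t" "\<phi> \<rho> E t \<le> ln M"
  using assms M_ge r unfolding \<phi>_def by (auto simp: max_def min_def)

lemma \<phi>_bounded:
  assumes "0 < \<rho>" "\<rho> \<le> r" shows "bounded (range (\<phi> \<rho> E))"
proof (rule boundedI[of _ "\<bar>ln \<rho>\<bar> + \<bar>ln M\<bar>"])
  fix x assume "x \<in> range (\<phi> \<rho> E)"
  then obtain t where "x = \<phi> \<rho> E t" by blast
  then show "norm x \<le> \<bar>ln \<rho>\<bar> + \<bar>ln M\<bar>" using \<phi>_bounds[OF assms, of E t] unfolding real_norm_def by linarith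
qed

lemma \<phi>_AE:
  assumes "E \<in> cball E0 r" "0 < \<rho>" "\<rho> \<le> r"
  shows "AE t in N. \<phi> \<rho> E t = ln (cmod (E - t))"
  using AE_far_from[OF assms(1)] by eventually_elim (use assms in \<open>auto simp: \<phi>_def max_def min_def\<close>)

lemma \<phi>_integrable: "0 < \<rho> \<Longrightarrow> \<rho> \<le> r \<Longrightarrow> integrable N (\<phi> \<rho> E)"
  by (intro integrable_bounded \<phi>_cont \<phi>_bounded)

lemma \<phi>_integral:
  assumes E: "E \<in> cball E0 r" and \<rho>: "0 < \<rho>" "\<rho> \<le> r"
  shows "(\<integral>t. \<phi> \<rho> E t \<partial>N) = U E"
proof -
  have U: "U E = (\<integral>t. \<phi> r E t \<partial>N)" unfolding U_def \<phi>_def ..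
  show ?thesis unfolding U
  proof (rule integral_cong_AE)
    show "AE t in N. \<phi> \<rho> E t = \<phi> r E t"
      using \<phi>_AE[OF E \<rho>] \<phi>_AE[OF E r order_refl] by eventually_elim simp
  qed (use r \<rho> in \<open>auto intro!: borel_N borel_measurable_continuous_onI \<phi>_cont\<close>)
qed

lemma potential_limit:
  assumes "E \<in> cball E0 r" "0 < \<rho>" "\<rho> \<le> r"
  shows "(\<lambda>n. (\<Sum>i<n. \<phi> \<rho> E (rt n i)) / real n) \<longlonglongrightarrow> U E"
  unfolding \<phi>_integral[OF assms, symmetric] by (rule weak[OF \<phi>_cont \<phi>_bounded]) (use assms in auto)

lemma rt_far:
  assumes "E \<in> cball E0 r" "n \<ge> 3" "i < n" shows "cmod (E - rt n i) \<le> M"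
proof -
  have "cmod (E - rt n i) \<le> cmod (E - E0) + cmod E0 + cmod (rt n i)"
    using norm_triangle_ineq4[of "E - E0" "rt n i - E0"] norm_triangle_ineq4[of "rt n i" E0] by simp
  then show ?thesis using assms rt_bounded[OF assms(2,3)] r unfolding M_def
    by (auto simp: dist_norm norm_minus_commute)
qed

lemma exp_\<phi>:
  assumes "0 < \<rho>" "cmod (E - t) \<le> M" shows "exp (\<phi> \<rho> E t) = max \<rho> (cmod (E - t))"
proof -
  have "max \<rho> (min M (cmod (E - t))) = max \<rho> (cmod (E - t))" using assms(2) by simp
  moreover have "max \<rho> (cmod (E - t)) > 0" using assms(1) by simp
  ultimately show ?thesis unfolding \<phi>_def by (simp only: exp_ln)
qed

text \<open>Raising the small factors to \<open>r\<close> only increases the product, so stray roots in the disc do no harm here.\<close>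

lemma potential_upper:
  assumes E: "E \<in> cball E0 r" and e: "\<epsilon> > 0"
  shows "\<forall>\<^sub>F n in sequentially. cmod (P n E) \<le> exp ((U E + \<epsilon>) * real n)"
proof -
  have "\<forall>\<^sub>F n in sequentially. (\<Sum>i<n. \<phi> r E (rt n i)) / real n < U E + \<epsilon>"
    using potential_limit[OF E r order_refl] e by (intro order_tendstoD(2)) auto
  then show ?thesis using eventually_ge_at_top[of 3]
  proof eventually_elim
    case (elim n)
    have "cmod (P n E) = (\<Prod>i<n. cmod (E - rt n i))" unfolding P_def prod_norm ..
    also have "\<dots> \<le> (\<Prod>i<n. exp (\<phi> r E (rt n i)))"
    proof (intro prod_mono conjI)
      fix i assume "i \<in> {..<n}"
      then have "cmod (E - rt n i) \<le> M" using rt_far[OF E] elim(2) by simp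
      then show "cmod (E - rt n i) \<le> exp (\<phi> r E (rt n i))" using exp_\<phi>[OF r] by simp
    qed auto
    also have "\<dots> = exp (\<Sum>i<n. \<phi> r E (rt n i))" by (simp add: exp_sum)
    also have "\<dots> \<le> exp ((U E + \<epsilon>) * real n)" using elim by (simp add: pos_divide_less_eq)
    finally show ?case .
  qed
qed

text \<open>Stray roots near \<open>E\<close> can make \<open>P n E\<close> small; the lower bound is recovered at some point of any small circle
  about \<open>E\<close>.\<close>

lemma potential_lower:
  assumes E: "E \<in> cball E0 r" and e: "\<epsilon> > 0" and \<rho>: "0 < \<rho>" "\<rho> \<le> r"
  shows "\<forall>\<^sub>F n in sequentially. \<exists>z. cmod (z - E) = \<rho> \<and> cmod (P n z) \<ge> exp ((U E - \<epsilon>) * real n)"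
proof -
  have "\<forall>\<^sub>F n in sequentially. (\<Sum>i<n. \<phi> \<rho> E (rt n i)) / real n > U E - \<epsilon>"
    using potential_limit[OF E \<rho>] e by (intro order_tendstoD(1)) auto
  then show ?thesis using eventually_ge_at_top[of 3]
  proof eventually_elim
    case (elim n)
    obtain z where z: "cmod (z - E) = \<rho>" "(\<Prod>i<n. cmod (z - rt n i)) \<ge> (\<Prod>i<n. max \<rho> (cmod (E - rt n i)))"
      using circle_max_ge_jensen[OF \<rho>(1)] by blast
    have "exp ((U E - \<epsilon>) * real n) \<le> exp (\<Sum>i<n. \<phi> \<rho> E (rt n i))" using elim by (simp add: pos_less_divide_eq)
    also have "\<dots> = (\<Prod>i<n. exp (\<phi> \<rho> E (rt n i)))" by (simp add: exp_sum)
    also have "\<dots> = (\<Prod>i<n. max \<rho> (cmod (E - rt n i)))"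
    proof (intro prod.cong refl)
      fix i assume "i \<in> {..<n}"
      then have "cmod (E - rt n i) \<le> M" using rt_far[OF E] elim(2) by simp
      then show "exp (\<phi> \<rho> E (rt n i)) = max \<rho> (cmod (E - rt n i))" using exp_\<phi>[OF \<rho>(1)] by simp
    qed
    also have "\<dots> \<le> cmod (P n z)" using z(2) unfolding P_def prod_norm by simp
    finally show ?case using z(1) by blast
  qed
qed

lemma integral_le_const:
  assumes "integrable N f" "AE t in N. f t \<le> (c :: real)" shows "(\<integral>t. f t \<partial>N) \<le> c"
  using prob_space.integral_le_const[OF prob_N assms] .

lemma U_lipschitz:
  assumes "E \<in> cball E0 r" "E' \<in> cball E0 r" shows "U E - U E' \<le> cmod (E - E') / (3 * r)"
proof -
  have i: "integrable N (\<lambda>t. \<phi> r E t - \<phi> r E' t)"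
    using r by (intro Bochner_Integration.integrable_diff \<phi>_integrable) auto
  have "U E - U E' = (\<integral>t. \<phi> r E t - \<phi> r E' t \<partial>N)"
    unfolding \<phi>_integral[OF assms(1) r order_refl, symmetric] \<phi>_integral[OF assms(2) r order_refl, symmetric]
    using r by (intro Bochner_Integration.integral_diff[symmetric] \<phi>_integrable) auto
  also have "\<dots> \<le> cmod (E - E') / (3 * r)"
  proof (rule integral_le_const[OF i])
    show "AE t in N. \<phi> r E t - \<phi> r E' t \<le> cmod (E - E') / (3 * r)"
      using \<phi>_AE[OF assms(1) r order_refl] \<phi>_AE[OF assms(2) r order_refl]
        AE_far_from[OF assms(1)] AE_far_from[OF assms(2)]
    proof eventually_elim
      case (elim t)
      have "\<phi> r E t - \<phi> r E' t \<le> (cmod (E - t) - cmod (E' - t)) / cmod (E' - t)"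
        unfolding elim(1,2) using elim(3,4) r by (intro ln_diff_le_divide) auto
      also have "\<dots> \<le> cmod (E - E') / cmod (E' - t)"
        using norm_triangle_ineq2[of "E - t" "E' - t"] by (intro divide_right_mono) auto
      also have "\<dots> \<le> cmod (E - E') / (3 * r)"
        using elim(4) r by (intro divide_left_mono) (auto intro!: mult_pos_pos)
      finally show ?case .
    qed
  qed
  finally show ?thesis .
qed

text \<open>A discrete mean value property: \<open>(\<Prod>\<omega>. X - z \<omega>) = X^n - z^n\<close> over the \<open>n\<close>-th roots of unity, and
  \<open>|z / X| \<le> 1 / 4\<close> as the points of \<open>N\<close> are at distance at least \<open>4 r\<close> from the centre.\<close>

lemma U_roots_of_unity:
  assumes z: "cmod z \<le> r" and n: "n > 0"
  shows "(\<Sum>\<omega>\<in>{\<omega>::complex. \<omega> ^ n = 1}. U (E0 + z * \<omega>)) \<le> real n * U E0 + (1/4) ^ n"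
proof -
  let ?G = "{\<omega>::complex. \<omega> ^ n = 1}"
  have G: "finite ?G" using n by (intro finite_roots_unity) auto
  have nG: "cmod \<omega> = 1" if "\<omega> \<in> ?G" for \<omega>
    using power_eq_1_iff[of \<omega> n] that n by simp
  have inD: "E0 + z * \<omega> \<in> cball E0 r" if "\<omega> \<in> ?G" for \<omega>
    using z nG[OF that] by (simp add: dist_norm norm_mult)
  have E0: "E0 \<in> cball E0 r" using r by simp
  have i: "integrable N (\<lambda>t. (\<Sum>\<omega>\<in>?G. \<phi> r (E0 + z * \<omega>) t) - real n * \<phi> r E0 t)"
    using r by (intro Bochner_Integration.integrable_diff Bochner_Integration.integrable_sum
        integrable_mult_right \<phi>_integrable) auto
  have "(\<Sum>\<omega>\<in>?G. U (E0 + z * \<omega>)) - real n * U E0 = (\<Sum>\<omega>\<in>?G. \<integral>t. \<phi> r (E0 + z * \<omega>) t \<partial>N) - real n * (\<integral>t. \<phi> r E0 t \<partial>N)"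
    using \<phi>_integral[OF inD r order_refl] \<phi>_integral[OF E0 r order_refl] by simp
  also have "\<dots> = (\<integral>t. (\<Sum>\<omega>\<in>?G. \<phi> r (E0 + z * \<omega>) t) - real n * \<phi> r E0 t \<partial>N)"
  proof -
    have "(\<integral>t. (\<Sum>\<omega>\<in>?G. \<phi> r (E0 + z * \<omega>) t) \<partial>N) = (\<Sum>\<omega>\<in>?G. \<integral>t. \<phi> r (E0 + z * \<omega>) t \<partial>N)"
      using r by (intro Bochner_Integration.integral_sum \<phi>_integrable) auto
    then show ?thesis
      using r by (subst Bochner_Integration.integral_diff) (auto intro!: \<phi>_integrable)
  qed
  also have "\<dots> \<le> (1/4) ^ n"
  proof (rule integral_le_const[OF i])
    have "AE t in N. \<forall>\<omega>\<in>?G. \<phi> r (E0 + z * \<omega>) t = ln (cmod (E0 + z * \<omega> - t)) \<and> 3 * r \<le> cmod (E0 + z * \<omega> - t)"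
    proof (rule AE_finite_allI[OF G])
      fix \<omega> assume "\<omega> \<in> ?G"
      from \<phi>_AE[OF inD[OF this] r order_refl] AE_far_from[OF inD[OF this]]
      show "AE t in N. \<phi> r (E0 + z * \<omega>) t = ln (cmod (E0 + z * \<omega> - t)) \<and> 3 * r \<le> cmod (E0 + z * \<omega> - t)"
        by eventually_elim simp
    qed
    then show "AE t in N. (\<Sum>\<omega>\<in>?G. \<phi> r (E0 + z * \<omega>) t) - real n * \<phi> r E0 t \<le> (1/4) ^ n"
      using \<phi>_AE[OF E0 r order_refl] AE_far
    proof eventually_elim
      case (elim t)
      define X where "X = t - E0"
      have X: "cmod X \<ge> 4 * r" using elim(3) by (simp add: X_def norm_minus_commute)
      then have X0: "cmod X > 0" using r by linarith
      have nz: "cmod (E0 + z * \<omega> - t) > 0" if "\<omega> \<in> ?G" for \<omega> using elim(1) that r by fastforce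
      have "(\<Sum>\<omega>\<in>?G. \<phi> r (E0 + z * \<omega>) t) = (\<Sum>\<omega>\<in>?G. ln (cmod (E0 + z * \<omega> - t)))"
        using elim(1) by (intro sum.cong) auto
      also have "\<dots> = ln (\<Prod>\<omega>\<in>?G. cmod (E0 + z * \<omega> - t))"
        using nz G by (subst ln_prod) auto
      also have "(\<Prod>\<omega>\<in>?G. cmod (E0 + z * \<omega> - t)) = (\<Prod>\<omega>\<in>?G. cmod (X - z * \<omega>))"
      proof (intro prod.cong refl)
        fix \<omega>
        have "E0 + z * \<omega> - t = - (X - z * \<omega>)" by (simp add: X_def algebra_simps)
        then show "cmod (E0 + z * \<omega> - t) = cmod (X - z * \<omega>)" by (simp only: norm_minus_cancel)
      qed
      also have "\<dots> = cmod (X ^ n - z ^ n)" unfolding prod_norm prod_roots_of_unity[OF n] ..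
      finally have s: "(\<Sum>\<omega>\<in>?G. \<phi> r (E0 + z * \<omega>) t) = ln (cmod (X ^ n - z ^ n))" .
      have zX: "cmod z ^ n \<le> (1/4) ^ n * cmod X ^ n"
        unfolding power_mult_distrib[symmetric] using z X by (intro power_mono) auto
      have "0 < cmod (X ^ n - z ^ n)"
      proof -
        have "cmod z ^ n < cmod X ^ n" using z X r n by (intro power_strict_mono) auto
        then show ?thesis by (metis norm_power less_irrefl right_minus_eq zero_less_norm_iff)
      qed
      then have "ln (cmod (X ^ n - z ^ n)) - ln (cmod X ^ n) \<le> (cmod (X ^ n - z ^ n) - cmod X ^ n) / cmod X ^ n"
        using X0 by (intro ln_diff_le_divide) auto
      also have "\<dots> \<le> (1/4) ^ n"
        using zX norm_triangle_ineq4[of "X ^ n" "z ^ n"] X0 by (simp add: pos_divide_le_eq norm_power)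
      finally show ?case
        unfolding s elim(2) using X0 by (simp add: ln_realpow X_def norm_minus_commute)
    qed
  qed
  finally show ?thesis by simp
qed

text \<open>All terms of the discrete mean are at least \<open>g\<close>, so a single value above \<open>g\<close> by more than \<open>(1 / 4)^n\<close> would
  lift the mean above the value at the centre.\<close>

lemma U_minimum_principle:
  assumes ge: "\<And>E. E \<in> cball E0 r \<Longrightarrow> g \<le> U E" and min: "U E0 \<le> g" and z: "cmod z \<le> r"
  shows "U (E0 + z) \<le> g"
proof (rule ccontr)
  assume "\<not> U (E0 + z) \<le> g"
  then have pos: "U (E0 + z) - g > 0" by simp
  then obtain m where m: "(1/4 :: real) ^ m < U (E0 + z) - g" using real_arch_pow_inv[OF pos, of "1/4"] by auto
  let ?n = "Suc m"
  let ?G = "{\<omega>::complex. \<omega> ^ ?n = 1}"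
  have G: "finite ?G" "card ?G = ?n" using finite_roots_unity[of ?n] card_roots_unity_eq[of ?n] by auto
  have nG: "cmod \<omega> = 1" if "\<omega> \<in> ?G" for \<omega>
    using power_eq_1_iff[of \<omega> ?n] that by simp
  have "U (E0 + z) - g = (\<Sum>\<omega>\<in>{1}. U (E0 + z * \<omega>) - g)" by simp
  also have "\<dots> \<le> (\<Sum>\<omega>\<in>?G. U (E0 + z * \<omega>) - g)"
  proof (rule sum_mono2[OF G(1)])
    show "0 \<le> U (E0 + z * \<omega>) - g" if "\<omega> \<in> ?G - {1}" for \<omega>
      using ge[of "E0 + z * \<omega>"] z nG[of \<omega>] that by (simp add: dist_norm norm_mult)
  qed auto
  also have "\<dots> = (\<Sum>\<omega>\<in>?G. U (E0 + z * \<omega>)) - real ?n * g" using G(2) by (simp add: sum_subtractf)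
  also have "\<dots> \<le> real ?n * U E0 + (1/4) ^ ?n - real ?n * g"
    using U_roots_of_unity[OF z, of ?n] by simp
  also have "\<dots> \<le> (1/4) ^ ?n" using mult_left_mono[OF min, of "real ?n"] by simp
  also have "\<dots> \<le> (1/4) ^ m" by simp
  finally show False using m by simp
qed

text \<open>Pairing conjugate heights, \<open>(x + i c - t) (x - i c - t) = (x - t)\<^sup>2 + c\<^sup>2\<close>, shows that only \<open>c\<^sup>2\<close> enters. This
  is the smoothness of \<open>U\<close> across the real axis from which eigenvalues will be counted.\<close>

lemma U_vertical_second_difference:
  assumes b: "Complex x b \<in> cball E0 r" "Complex x (- b) \<in> cball E0 r"
  shows "U (Complex x b) + U (Complex x (- b)) - U (Complex x (b / 2)) - U (Complex x (- b / 2)) \<le> b\<^sup>2 / r\<^sup>2"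
proof -
  have conv: "convex (cball E0 r)" by simp
  have seg: "Complex x (s * b) \<in> cball E0 r" if "s \<in> {-1..1}" for s
  proof -
    have "Complex x (s * b) = ((1 + s) / 2) *\<^sub>R Complex x b + ((1 - s) / 2) *\<^sub>R Complex x (- b)"
      by (simp add: complex_eq_iff field_simps)
    also have "\<dots> \<in> cball E0 r" using that by (intro convexD[OF conv b]) (auto simp: field_simps)
    finally show ?thesis .
  qed
  have h: "Complex x (b / 2) \<in> cball E0 r" "Complex x (- b / 2) \<in> cball E0 r"
    using seg[of "1/2"] seg[of "-1/2"] by auto
  note I = b h
  have i: "integrable N (\<lambda>t. \<phi> r (Complex x b) t + \<phi> r (Complex x (- b)) t - \<phi> r (Complex x (b / 2)) t - \<phi> r (Complex x (- b / 2)) t)"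
    using r by (intro Bochner_Integration.integrable_diff Bochner_Integration.integrable_add \<phi>_integrable) auto
  have "U (Complex x b) + U (Complex x (- b)) - U (Complex x (b / 2)) - U (Complex x (- b / 2)) =
     (\<integral>t. \<phi> r (Complex x b) t + \<phi> r (Complex x (- b)) t - \<phi> r (Complex x (b / 2)) t - \<phi> r (Complex x (- b / 2)) t \<partial>N)"
    unfolding I[THEN \<phi>_integral[OF _ r order_refl], symmetric]
    using r by (simp add: \<phi>_integrable)
  also have "\<dots> \<le> b\<^sup>2 / r\<^sup>2"
  proof (rule integral_le_const[OF i])
    show "AE t in N. \<phi> r (Complex x b) t + \<phi> r (Complex x (- b)) t - \<phi> r (Complex x (b / 2)) t - \<phi> r (Complex x (- b / 2)) t \<le> b\<^sup>2 / r\<^sup>2"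
      using I[THEN \<phi>_AE[OF _ r order_refl]] I[THEN AE_far_from]
    proof eventually_elim
      case (elim t)
      let ?z = "of_real x - t"
      have prod: "cmod (Complex x c - t) * cmod (Complex x (- c) - t) = cmod (?z\<^sup>2 + of_real (c\<^sup>2))" for c
      proof -
        have "(Complex x c - t) * (Complex x (- c) - t) = ?z\<^sup>2 + of_real (c\<^sup>2)"
          by (simp add: complex_eq_iff power2_eq_square algebra_simps)
        then show ?thesis by (metis norm_mult)
      qed
      let ?p = "cmod (?z\<^sup>2 + of_real (b\<^sup>2))" and ?q = "cmod (?z\<^sup>2 + of_real ((b / 2)\<^sup>2))"
      have pos: "cmod (Complex x b - t) > 0" "cmod (Complex x (- b) - t) > 0"
        "cmod (Complex x (b / 2) - t) \<ge> r" "cmod (Complex x (- b / 2) - t) \<ge> r"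
        using elim(5-8) r by linarith+
      have q: "?q \<ge> r\<^sup>2"
        using mult_mono[OF pos(3,4)] r unfolding prod[of "b / 2", symmetric] by (simp add: power2_eq_square)
      then have q0: "?q > 0" using r by (smt (verit) zero_less_power)
      have "\<phi> r (Complex x b) t + \<phi> r (Complex x (- b)) t - \<phi> r (Complex x (b / 2)) t - \<phi> r (Complex x (- b / 2)) t
         = ln ?p - ln ?q"
      proof -
        have "ln ?p = ln (cmod (Complex x b - t)) + ln (cmod (Complex x (- b) - t))"
          unfolding prod[symmetric] using pos by (subst ln_mult) auto
        moreover have "ln ?q = ln (cmod (Complex x (b / 2) - t)) + ln (cmod (Complex x (- b / 2) - t))"
          using prod[of "b / 2"] pos r ln_mult[of "cmod (Complex x (b / 2) - t)" "cmod (Complex x (- b / 2) - t)"] by force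
        ultimately show ?thesis unfolding elim(1-4) by simp
      qed
      also have "\<dots> \<le> (?p - ?q) / ?q"
        using q0 mult_pos_pos[OF pos(1,2)] unfolding prod by (intro ln_diff_le_divide) auto
      also have "\<dots> \<le> b\<^sup>2 / ?q"
      proof (intro divide_right_mono)
        have "?p \<le> ?q + cmod (of_real (b\<^sup>2 - (b / 2)\<^sup>2))"
          using norm_triangle_ineq[of "?z\<^sup>2 + of_real ((b / 2)\<^sup>2)" "of_real (b\<^sup>2 - (b / 2)\<^sup>2)"] by simp
        also have "cmod (of_real (b\<^sup>2 - (b / 2)\<^sup>2)) = b\<^sup>2 - (b / 2)\<^sup>2"
          unfolding norm_of_real by (simp add: power_divide)
        finally show "?p - ?q \<le> b\<^sup>2" using zero_le_power2[of "b / 2"] by linarith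
      qed simp
      also have "\<dots> \<le> b\<^sup>2 / r\<^sup>2" using q q0 r by (intro divide_left_mono) auto
      finally show ?case .
    qed
  qed
  finally show ?thesis .
qed

end

section \<open>Green functions of finite intervals\<close>

text \<open>The continuant of the sites \<open>a \<le> k < b\<close>. The value 0 for \<open>b = a - 1\<close> and the value 1 for \<open>b = a\<close> are the boundary
  conditions that make the recurrences hold at the ends.\<close>

definition cz :: "(int \<Rightarrow> complex) \<Rightarrow> int \<Rightarrow> int \<Rightarrow> complex" where
  "cz q a b = (if b < a then 0 else continuant q a (nat (b - a)))"

lemma cz_right: "a \<le> b \<Longrightarrow> cz q a (b + 1) = q b * cz q a b - cz q a (b - 1)"
proof (cases "b = a")
  case False
  assume "a \<le> b"
  then obtain n where n: "b = a + int n + 1" using False by (metis add.commute add.left_commute linorder_neqE_linordered_idom not_less zless_iff_Suc_zadd of_nat_Suc)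
  have "nat (b + 1 - a) = Suc (Suc n)" "nat (b - a) = Suc n" "nat (b - 1 - a) = n" using n by auto
  then show ?thesis using n unfolding cz_def by auto
qed (auto simp: cz_def)

lemma cz_left: "a < b \<Longrightarrow> cz q a b = q a * cz q (a + 1) b - cz q (a + 2) b"
proof (cases "b = a + 1")
  case False
  assume "a < b"
  then obtain n where n: "b = a + int n + 2" using False by (intro that[of "nat (b - a - 2)"]) auto
  have "nat (b - a) = Suc (Suc n)" "nat (b - (a + 1)) = Suc n" "nat (b - (a + 2)) = n" using n by auto
  then show ?thesis using n continuant_left[of q a n] unfolding cz_def by (auto simp del: continuant.simps)
qed (auto simp: cz_def)

lemma cz_split:
  assumes "a \<le> j" "j < b"
  shows "cz q a b = cz q a (j + 1) * cz q (j + 1) b - cz q a j * cz q (j + 2) b"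
proof (cases "b = j + 1")
  case False
  obtain n where n: "j = a + int n" using assms by (intro that[of "nat (j - a)"]) auto
  obtain m where m: "b = j + int m + 2" using False assms by (intro that[of "nat (b - j - 2)"]) auto
  have "nat (b - a) = Suc n + Suc m" "nat (j + 1 - a) = Suc n" "nat (b - (j + 1)) = Suc m"
    "nat (j - a) = n" "nat (b - (j + 2)) = m" "j + 1 = a + int n + 1" "j + 2 = a + int n + 2"
    using n m by auto
  then show ?thesis using n m continuant_split[of q a n m] unfolding cz_def by (auto simp del: continuant.simps)
qed (auto simp: cz_def)

text \<open>Cramer's rule for the inverse of a tridiagonal matrix on the sites \<open>a \<le> k < b\<close>.\<close>

definition finite_green :: "(int \<Rightarrow> complex) \<Rightarrow> int \<Rightarrow> int \<Rightarrow> int \<Rightarrow> int \<Rightarrow> complex" where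
  "finite_green q a b i j = cz q a (min i j) * cz q (max i j + 1) b / cz q a b"

lemma finite_green_sym: "finite_green q a b i j = finite_green q a b j i"
  by (simp add: finite_green_def min.commute max.commute)

lemma finite_green_eq:
  assumes nz: "cz q a b \<noteq> 0" and n: "a \<le> n" "n < b" and j: "a \<le> j" "j < b"
  shows "q n * finite_green q a b n j - finite_green q a b (n + 1) j - finite_green q a b (n - 1) j = of_bool (n = j)"
proof -
  consider "n < j" | "n = j" | "n > j" by linarith
  then show ?thesis
  proof cases
    case 1
    then have m: "min n j = n" "min (n + 1) j = n + 1" "min (n - 1) j = n - 1" "max n j = j" "max (n + 1) j = j" "max (n - 1) j = j"
      by auto
    show ?thesis unfolding finite_green_def m cz_right[OF n(1)] using 1 nz by (simp add: field_simps)
  next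
    case 2
    have m: "min n j = j" "min (n + 1) j = j" "min (n - 1) j = j - 1" "max n j = j" "max (n + 1) j = j + 1" "max (n - 1) j = j"
      using 2 by auto
    have "q j * (cz q a j * cz q (j + 1) b) - cz q a j * cz q (j + 2) b - cz q a (j - 1) * cz q (j + 1) b = cz q a b"
      unfolding cz_split[OF j] cz_right[OF j(1)] by (simp add: algebra_simps)
    then have "(q j * (cz q a j * cz q (j + 1) b) - cz q a j * cz q (j + 2) b - cz q a (j - 1) * cz q (j + 1) b) / cz q a b = 1"
      using nz by simp
    then show ?thesis unfolding finite_green_def m using 2 by (simp add: diff_divide_distrib add.assoc)
  next
    case 3
    then have m: "min n j = j" "min (n + 1) j = j" "min (n - 1) j = j" "max n j = n" "max (n + 1) j = n + 1" "max (n - 1) j = n - 1"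
      by auto
    have "q n * (cz q a j * cz q (n + 1) b) - cz q a j * cz q (n + 2) b - cz q a j * cz q n b = 0"
      unfolding cz_left[OF n(2)] by (simp add: algebra_simps)
    then have "(q n * (cz q a j * cz q (n + 1) b) - cz q a j * cz q (n + 2) b - cz q a j * cz q n b) / cz q a b = 0"
      by simp
    then show ?thesis unfolding finite_green_def m using 3 by (simp add: diff_divide_distrib add.assoc)
  qed
qed

section \<open>Green kernels on the line\<close>

definition green_kernel :: "(int \<Rightarrow> complex) \<Rightarrow> real \<Rightarrow> real \<Rightarrow> (int \<Rightarrow> int \<Rightarrow> complex) \<Rightarrow> bool" where
  "green_kernel q C \<kappa> K \<longleftrightarrow> (\<forall>i j. cmod (K i j) \<le> C * exp (- \<kappa> * \<bar>real_of_int (i - j)\<bar>)) \<and>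
     (\<forall>i j. K i j = K j i) \<and> (\<forall>n j. q n * K n j - K (n + 1) j - K (n - 1) j = of_bool (n = j))"

text \<open>A diagonal subsequence of the finite Green functions converges entrywise, and the bound, the symmetry
  and the equation survive the limit.\<close>

lemma green_kernel_of_finite_volumes:
  assumes nz: "\<And>N. cz q (- int N) (int N) \<noteq> 0"
    and bd: "\<And>N i j. - int N \<le> i \<Longrightarrow> i < int N \<Longrightarrow> - int N \<le> j \<Longrightarrow> j < int N \<Longrightarrow>
      cmod (finite_green q (- int N) (int N) i j) \<le> C * exp (- \<kappa> * \<bar>real_of_int (i - j)\<bar>)"
    and C: "C > 0" "\<kappa> > 0"
  obtains K where "green_kernel q C \<kappa> K"
proof -
  define F where "F N p = (if - int N \<le> fst p \<and> fst p < int N \<and> - int N \<le> snd p \<and> snd p < int N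
     then finite_green q (- int N) (int N) (fst p) (snd p) else 0)" for N and p :: "int \<times> int"
  have Fb: "cmod (F N p) \<le> C * exp (- \<kappa> * \<bar>real_of_int (fst p - snd p)\<bar>)" for N p
    unfolding F_def using bd[of N "fst p" "snd p"] C by auto
  have FC: "cmod (F N p) \<le> C" for N p
  proof -
    have "C * exp (- \<kappa> * \<bar>real_of_int (fst p - snd p)\<bar>) \<le> C * 1"
      using C by (intro mult_left_mono) auto
    then show ?thesis using Fb[of N p] by simp
  qed
  have cnt: "countable (UNIV :: (int \<times> int) set)" by simp
  obtain r :: "nat \<Rightarrow> nat" where r: "strict_mono r" "\<And>p. \<exists>l. (\<lambda>n. F (r n) p) \<longlonglongrightarrow> l"
    by (rule function_convergent_subsequence[OF cnt, of F C]) (use FC in auto)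
  then obtain K where K: "\<And>p. (\<lambda>n. F (r n) p) \<longlonglongrightarrow> K p" by metis
  have rn: "n \<le> r n" for n by (rule seq_suble[OF r(1)])
  have inside: "\<forall>\<^sub>F n in sequentially. - int (r n) \<le> i \<and> i < int (r n)" for i
    using eventually_ge_at_top[of "nat \<bar>i\<bar> + 1"]
  proof eventually_elim
    case (elim n)
    then show ?case using rn[of n] by linarith
  qed
  have Feq: "\<forall>\<^sub>F n in sequentially. F (r n) (i, j) = finite_green q (- int (r n)) (int (r n)) i j" for i j
    using inside[of i] inside[of j] by eventually_elim (simp add: F_def)
  show ?thesis
  proof (rule that[of "\<lambda>i j. K (i, j)"], unfold green_kernel_def, intro conjI allI)
    fix i j
    show "cmod (K (i, j)) \<le> C * exp (- \<kappa> * \<bar>real_of_int (i - j)\<bar>)"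
      by (rule LIMSEQ_le_const2[OF tendsto_norm[OF K]]) (use Fb[of _ "(i, j)"] in auto)
    have "\<forall>\<^sub>F n in sequentially. F (r n) (i, j) = F (r n) (j, i)"
      using Feq[of i j] Feq[of j i] by eventually_elim (simp add: finite_green_sym)
    from Lim_transform_eventually[OF K[of "(i, j)"] this]
    show "K (i, j) = K (j, i)" by (rule LIMSEQ_unique[OF _ K[of "(j, i)"]])
  next
    fix n j
    have lim: "(\<lambda>k. q n * F (r k) (n, j) - F (r k) (n + 1, j) - F (r k) (n - 1, j)) \<longlonglongrightarrow> q n * K (n, j) - K (n + 1, j) - K (n - 1, j)"
      by (intro tendsto_intros K)
    have "\<forall>\<^sub>F k in sequentially. q n * F (r k) (n, j) - F (r k) (n + 1, j) - F (r k) (n - 1, j) = of_bool (n = j)"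
      using Feq[of n j] Feq[of "n + 1" j] Feq[of "n - 1" j] inside[of n] inside[of j]
    proof eventually_elim
      case (elim k)
      show ?case unfolding elim(1-3) by (rule finite_green_eq[OF nz]) (use elim in auto)
    qed
    from LIMSEQ_unique[OF lim tendsto_eventually[OF this]]
    show "q n * K (n, j) - K (n + 1, j) - K (n - 1, j) = of_bool (n = j)" .
  qed
qed

context strictly_ergodic_potential
begin

lemma cmod_D_ge: "\<bar>Im E\<bar> ^ n \<le> cmod (D y E a n)"
proof -
  have "(\<Prod>t\<in>jacobi_spectrum (w y) a n. \<bar>Im E\<bar>) \<le> (\<Prod>t\<in>jacobi_spectrum (w y) a n. cmod (of_real t - E))"
    using abs_Im_le_cmod[of "of_real _ - E"] by (intro prod_mono) auto
  then show ?thesis unfolding cmod_jacobi_det by (simp add: card_jacobi_spectrum)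
qed

lemma cmod_D_le: "cmod (D y E a n) \<le> (V + 2 + cmod E) ^ n"
proof -
  have "(\<Prod>t\<in>jacobi_spectrum (w y) a n. cmod (of_real t - E)) \<le> (\<Prod>t\<in>jacobi_spectrum (w y) a n. V + 2 + cmod E)"
  proof (intro prod_mono conjI)
    fix t assume "t \<in> jacobi_spectrum (w y) a n"
    then have "\<bar>t\<bar> \<le> V + 2" by (rule jacobi_spectrum_bounded[OF w_bound])
    then show "cmod (of_real t - E) \<le> V + 2 + cmod E" using norm_triangle_ineq4[of "of_real t" E] by simp
  qed auto
  then show ?thesis unfolding cmod_jacobi_det by (simp add: card_jacobi_spectrum)
qed

lemma finitely_many_positive_ratio:
  fixes f :: "nat \<Rightarrow> real" assumes "\<And>n. f n > 0" shows "\<exists>c>0. \<forall>n<n0. c \<le> f n"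
proof (induction n0)
  case (Suc n0)
  then obtain c where c: "c > 0" "\<forall>n<n0. c \<le> f n" by blast
  show ?case by (rule exI[of _ "min c (f n0)"]) (use c assms[of n0] in \<open>auto simp: less_Suc_eq\<close>)
qed (auto intro: exI[of _ 1])

lemma growth_eventually:
  assumes "Im E \<noteq> 0" "\<epsilon> > 0"
  shows "\<exists>n0. \<forall>n\<ge>n0. \<forall>y. exp ((growth E - \<epsilon>) * real n) \<le> cmod (D y E 0 n) \<and>
    cmod (D y E 0 n) \<le> exp ((growth E + \<epsilon>) * real n)"
  by (rule growth[OF assms]) blast

lemma growth_lower:
  assumes E: "Im E \<noteq> 0" and \<kappa>: "\<kappa> < growth E"
  obtains c where "c > 0" "\<And>y a n. c * exp (\<kappa> * real n) \<le> cmod (D y E a n)"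
proof -
  from growth_eventually[OF E, of "growth E - \<kappa>"] \<kappa>
  obtain n0 where n0: "\<And>n y. n \<ge> n0 \<Longrightarrow> exp (\<kappa> * real n) \<le> cmod (D y E 0 n)" by auto
  obtain c where c: "c > 0" "\<forall>n<n0. c \<le> \<bar>Im E\<bar> ^ n / exp (\<kappa> * real n)"
    using finitely_many_positive_ratio[of "\<lambda>n. \<bar>Im E\<bar> ^ n / exp (\<kappa> * real n)" n0] E by auto
  have *: "min c 1 * exp (\<kappa> * real n) \<le> cmod (D y E 0 n)" for y n
  proof (cases "n \<ge> n0")
    case True
    have "min c 1 * exp (\<kappa> * real n) \<le> 1 * exp (\<kappa> * real n)" by (intro mult_right_mono) auto
    then show ?thesis using n0[OF True, of y] by linarith
  next
    case False
    then have "c \<le> \<bar>Im E\<bar> ^ n / exp (\<kappa> * real n)" using c(2)[rule_format, of n] by linarith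
    then have "min c 1 \<le> \<bar>Im E\<bar> ^ n / exp (\<kappa> * real n)" by (rule min.coboundedI1)
    then have "min c 1 * exp (\<kappa> * real n) \<le> \<bar>Im E\<bar> ^ n" by (simp add: pos_le_divide_eq)
    then show ?thesis using cmod_D_ge[of E n y 0] by linarith
  qed
  show ?thesis
  proof (rule that[of "min c 1"])
    fix y a n
    show "min c 1 * exp (\<kappa> * real n) \<le> cmod (D y E a n)"
      using *[of n "int_iter T a y"] unfolding D_shift by simp
  qed (use c in auto)
qed

lemma growth_upper:
  assumes E: "Im E \<noteq> 0" and \<kappa>: "growth E < \<kappa>"
  obtains C where "C > 0" "\<And>y a n. cmod (D y E a n) \<le> C * exp (\<kappa> * real n)"
proof -
  from growth_eventually[OF E, of "\<kappa> - growth E"] \<kappa>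
  obtain n0 where n0: "\<And>n y. n \<ge> n0 \<Longrightarrow> cmod (D y E 0 n) \<le> exp (\<kappa> * real n)" by auto
  have pos: "V + 2 + cmod E > 0" using V_nonneg by (simp add: add_nonneg_pos add_pos_nonneg)
  obtain c where c: "c > 0" "\<forall>n<n0. c \<le> exp (\<kappa> * real n) / (V + 2 + cmod E) ^ n"
    using finitely_many_positive_ratio[of "\<lambda>n. exp (\<kappa> * real n) / (V + 2 + cmod E) ^ n" n0] pos by auto
  have *: "cmod (D y E 0 n) \<le> max (1 / c) 1 * exp (\<kappa> * real n)" for y n
  proof (cases "n \<ge> n0")
    case True
    have "1 * exp (\<kappa> * real n) \<le> max (1 / c) 1 * exp (\<kappa> * real n)" by (intro mult_right_mono) auto
    then show ?thesis using n0[OF True, of y] by linarith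
  next
    case False
    then have "c \<le> exp (\<kappa> * real n) / (V + 2 + cmod E) ^ n" using c(2)[rule_format, of n] by linarith
    then have "c * (V + 2 + cmod E) ^ n \<le> exp (\<kappa> * real n)" using pos by (simp add: pos_le_divide_eq)
    then have "(V + 2 + cmod E) ^ n \<le> 1 / c * exp (\<kappa> * real n)" using c(1) by (simp add: field_simps)
    also have "\<dots> \<le> max (1 / c) 1 * exp (\<kappa> * real n)" by (intro mult_right_mono) auto
    finally show ?thesis using cmod_D_le[of y E 0 n] by linarith
  qed
  show ?thesis
  proof (rule that[of "max (1 / c) 1"])
    fix y a n
    show "cmod (D y E a n) \<le> max (1 / c) 1 * exp (\<kappa> * real n)"
      using *[of "int_iter T a y" n] unfolding D_shift by simp
  qed auto
qed

text \<open>By \<open>jacobi_det_perturb\<close> a lower bound at \<open>F\<close> persists, with a slightly smaller rate, on a neighbourhood of \<open>F\<close>;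
  finitely many neighbourhoods cover \<open>S\<close>.\<close>

lemma growth_lower_uniform:
  assumes S: "compact S" and \<theta>: "\<theta> > 0" "\<And>E. E \<in> S \<Longrightarrow> \<theta> \<le> \<bar>Im E\<bar>"
    and \<kappa>: "\<And>E. E \<in> S \<Longrightarrow> \<kappa> < growth E"
  shows "\<exists>c>0. \<forall>E\<in>S. \<forall>y a n. c * exp (\<kappa> * real n) \<le> cmod (D y E a n)"
proof -
  have loc: "\<exists>\<delta>>0. \<exists>c>0. \<forall>E\<in>ball F \<delta> \<inter> S. \<forall>y a n. c * exp (\<kappa> * real n) \<le> cmod (D y E a n)" if F: "F \<in> S" for F
  proof -
    have nF: "Im F \<noteq> 0" using \<theta>(1) \<theta>(2)[OF F] by auto
    define \<kappa>' where "\<kappa>' = (\<kappa> + growth F) / 2"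
    have \<kappa>': "\<kappa> < \<kappa>'" "\<kappa>' < growth F" using \<kappa>[OF F] by (auto simp: \<kappa>'_def)
    obtain c where c: "c > 0" "\<And>y a n. c * exp (\<kappa>' * real n) \<le> cmod (D y F a n)"
      by (rule growth_lower[OF nF \<kappa>'(2)]) blast
    define \<delta> where "\<delta> = \<theta> * (exp (\<kappa>' - \<kappa>) - 1)"
    have \<delta>: "\<delta> > 0" using \<theta>(1) \<kappa>'(1) by (simp add: \<delta>_def)
    have "c * exp (\<kappa> * real n) \<le> cmod (D y E a n)" if E: "E \<in> ball F \<delta> \<inter> S" for E y a n
    proof -
      have nE: "Im E \<noteq> 0" "\<theta> \<le> \<bar>Im E\<bar>" using \<theta>(1) \<theta>(2)[of E] E by auto
      have "1 + cmod (F - E) / \<bar>Im E\<bar> \<le> 1 + \<delta> / \<theta>"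
        using E nE \<theta>(1) \<delta> by (intro add_left_mono frac_le) (auto simp: dist_norm)
      also have "\<dots> = exp (\<kappa>' - \<kappa>)" using \<theta>(1) by (simp add: \<delta>_def)
      finally have "(1 + cmod (F - E) / \<bar>Im E\<bar>) ^ n \<le> exp (\<kappa>' - \<kappa>) ^ n" by (intro power_mono) auto
      then have "c * exp (\<kappa>' * real n) \<le> exp ((\<kappa>' - \<kappa>) * real n) * cmod (D y E a n)"
        using jacobi_det_perturb[OF nE(1), of "w y" F a n] c(2)[of n y a]
          mult_right_mono[of _ _ "cmod (D y E a n)"] unfolding exp_of_nat2_mult by (meson norm_ge_zero order_trans)
      moreover have "exp (\<kappa>' * real n) = exp ((\<kappa>' - \<kappa>) * real n) * exp (\<kappa> * real n)"
        by (simp add: exp_add[symmetric] algebra_simps)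
      ultimately have "exp ((\<kappa>' - \<kappa>) * real n) * (c * exp (\<kappa> * real n)) \<le> exp ((\<kappa>' - \<kappa>) * real n) * cmod (D y E a n)"
        by (simp add: mult_ac)
      then show ?thesis by simp
    qed
    then show ?thesis using \<delta> c(1) by blast
  qed
  then obtain \<delta> where \<delta>: "\<And>F. F \<in> S \<Longrightarrow> \<delta> F > 0"
    "\<And>F. F \<in> S \<Longrightarrow> \<exists>c>0. \<forall>E\<in>ball F (\<delta> F) \<inter> S. \<forall>y a n. c * exp (\<kappa> * real n) \<le> cmod (D y E a n)" by metis
  then obtain c where c: "\<And>F. F \<in> S \<Longrightarrow> c F > 0"
    "\<And>F E y a n. F \<in> S \<Longrightarrow> E \<in> ball F (\<delta> F) \<Longrightarrow> E \<in> S \<Longrightarrow> c F * exp (\<kappa> * real n) \<le> cmod (D y E a n)" by (metis IntI)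
  obtain S' where S': "S' \<subseteq> S" "finite S'" "S \<subseteq> (\<Union>F\<in>S'. ball F (\<delta> F))"
    by (rule compactE_image[OF S, of S "\<lambda>F. ball F (\<delta> F)"]) (use \<delta>(1) in force)+
  define c0 where "c0 = Min (insert 1 (c ` S'))"
  show ?thesis
  proof (intro exI[of _ c0] conjI ballI allI)
    show "c0 > 0" unfolding c0_def using S' c(1) by (subst Min_gr_iff) auto
    fix E y a n assume "E \<in> S"
    then obtain F where F: "F \<in> S'" "E \<in> ball F (\<delta> F)" using S'(3) by blast
    have "c0 \<le> c F" unfolding c0_def using S'(2) F(1) by (intro Min_le) auto
    then have "c0 * exp (\<kappa> * real n) \<le> c F * exp (\<kappa> * real n)" by (intro mult_right_mono) auto
    also have "\<dots> \<le> cmod (D y E a n)" using F S'(1) \<open>E \<in> S\<close> by (intro c(2)) auto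
    finally show "c0 * exp (\<kappa> * real n) \<le> cmod (D y E a n)" .
  qed
qed

text \<open>Almost multiplicativity cancels the continuants outside of \<open>{i..j}\<close> in Cramer's rule and leaves the
  reciprocal of the continuant between \<open>i\<close> and \<open>j\<close>, which grows at rate \<open>\<kappa>\<close>.\<close>

lemma off_axis_green_kernel:
  assumes E: "Im E \<noteq> 0" and \<kappa>: "0 < \<kappa>" and c: "c > 0" "\<And>y a n. c * exp (\<kappa> * real n) \<le> cmod (D y E a n)"
    and l: "0 < l" "l \<le> \<bar>Im E\<bar> / (V + cmod E + 1 / \<bar>Im E\<bar>)"
  shows "\<exists>K. green_kernel (\<lambda>k. of_real (w y k) - E) (1 / (l * l * c)) \<kappa> K"
proof -
  have lu: "l > 0" "\<And>y a n m. l * (cmod (D y E a n) * cmod (D y E (a + int n) m)) \<le> cmod (D y E a (n + m))"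
    using l(1) order_trans[OF mult_right_mono[OF l(2)] D_almost_multiplicative_explicit(1)[OF E]] by simp_all
  define C where "C = 1 / (l * l * c)"
  have C: "C > 0" unfolding C_def using lu(1) c(1) by simp
  show ?thesis unfolding C_def[symmetric]
  proof -
    let ?q = "\<lambda>k. of_real (w y k) - E"
    have czD: "cz ?q a b = D y E a (nat (b - a))" if "a \<le> b" for a b using that by (simp add: cz_def)
    have bd: "cmod (finite_green ?q a b i j) \<le> C * exp (- \<kappa> * \<bar>real_of_int (i - j)\<bar>)"
      if ij: "a \<le> i" "i \<le> j" "j < b" for a b i j
    proof -
      define n1 n2 n3 where "n1 = nat (i - a)" and "n2 = nat (j + 1 - i)" and "n3 = nat (b - (j + 1))"
      have e: "a + int n1 = i" "i + int n2 = j + 1" "n1 + (n2 + n3) = nat (b - a)" "a + int (n1 + n2) = j + 1"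
        using ij by (auto simp: n1_def n2_def n3_def)
      let ?A = "cmod (D y E a n1)" and ?B = "cmod (D y E i n2)" and ?F = "cmod (D y E (j + 1) n3)"
      have "l * (?A * cmod (D y E i (n2 + n3))) \<le> cmod (D y E a (nat (b - a)))"
        using lu(2)[of y a n1 "n2 + n3"] unfolding e .
      moreover have "l * (?B * ?F) \<le> cmod (D y E i (n2 + n3))" using lu(2)[of y i n2 n3] unfolding e .
      then have "l * (?A * (l * (?B * ?F))) \<le> l * (?A * cmod (D y E i (n2 + n3)))"
        using lu(1) by (intro mult_left_mono) auto
      ultimately have big: "l * (?A * (l * (?B * ?F))) \<le> cmod (D y E a (nat (b - a)))" by linarith
      have pos: "?A > 0" "?F > 0" "?B > 0" using D_nonzero[OF E] by auto
      have low: "c * exp (\<kappa> * \<bar>real_of_int (i - j)\<bar>) \<le> ?B"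
      proof -
        have "\<bar>real_of_int (i - j)\<bar> \<le> real n2" using ij by (simp add: n2_def)
        then have "c * exp (\<kappa> * \<bar>real_of_int (i - j)\<bar>) \<le> c * exp (\<kappa> * real n2)" using c(1) \<kappa> by simp
        then show ?thesis using c(2)[of n2 y i] by linarith
      qed
      have cp: "c * exp (\<kappa> * \<bar>real_of_int (i - j)\<bar>) > 0" using c(1) by simp
      have "cmod (finite_green ?q a b i j) = ?A * ?F / cmod (D y E a (nat (b - a)))"
        unfolding finite_green_def using ij by (simp add: min_absorb1 max_absorb2 czD norm_mult norm_divide n1_def n3_def)
      also have "\<dots> \<le> ?A * ?F / (l * (?A * (l * (?B * ?F))))"
      proof (rule divide_left_mono[OF big])
        have "l * (?A * (l * (?B * ?F))) > 0" by (intro mult_pos_pos lu(1) pos)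
        moreover from this have "cmod (D y E a (nat (b - a))) > 0" using big by linarith
        ultimately show "0 < cmod (D y E a (nat (b - a))) * (l * (?A * (l * (?B * ?F))))"
          by (rule mult_pos_pos[rotated])
      qed (use pos in simp)
      also have "\<dots> = 1 / (l * l) * (1 / ?B)" using pos lu(1) by (simp add: field_simps)
      also have "\<dots> \<le> 1 / (l * l) * (1 / (c * exp (\<kappa> * \<bar>real_of_int (i - j)\<bar>)))"
        using lu(1) low cp pos by (intro mult_left_mono divide_left_mono) auto
      also have "\<dots> = C * exp (- \<kappa> * \<bar>real_of_int (i - j)\<bar>)" unfolding C_def by (simp add: exp_minus field_simps)
      finally show ?thesis .
    qed
    show "\<exists>K. green_kernel ?q C \<kappa> K"
    proof (rule green_kernel_of_finite_volumes[OF _ _ C \<kappa>])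
      show "cz ?q (- int N) (int N) \<noteq> 0" for N using D_nonzero[OF E] by (simp add: czD)
      show "cmod (finite_green ?q (- int N) (int N) i j) \<le> C * exp (- \<kappa> * \<bar>real_of_int (i - j)\<bar>)"
        if "- int N \<le> i" "i < int N" "- int N \<le> j" "j < int N" for N i j
      proof (cases "i \<le> j")
        case False
        then have "cmod (finite_green ?q (- int N) (int N) j i) \<le> C * exp (- \<kappa> * \<bar>real_of_int (j - i)\<bar>)"
          using that by (intro bd) auto
        then show ?thesis by (simp add: finite_green_sym[of _ _ _ i j] abs_minus_commute)
      next
        case True
        then show ?thesis using that by (intro bd) auto
      qed
    qed blast
  qed
qed

lemma off_axis_green_kernel_uniform:
  assumes S: "compact S" and \<theta>: "\<theta> > 0" "\<And>E. E \<in> S \<Longrightarrow> \<theta> \<le> \<bar>Im E\<bar>"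
    and \<kappa>: "0 < \<kappa>" "\<And>E. E \<in> S \<Longrightarrow> \<kappa> < growth E"
  shows "\<exists>C>0. \<forall>E\<in>S. \<forall>y. \<exists>K. green_kernel (\<lambda>k. of_real (w y k) - E) C \<kappa> K"
proof -
  obtain c where c: "c > 0" "\<And>E y a n. E \<in> S \<Longrightarrow> c * exp (\<kappa> * real n) \<le> cmod (D y E a n)"
    using growth_lower_uniform[OF S \<theta> \<kappa>(2)] by metis
  obtain B where B: "\<And>E. E \<in> S \<Longrightarrow> cmod E \<le> B" using compact_imp_bounded[OF S] unfolding bounded_iff by blast
  define l where "l = \<theta> / (V + \<bar>B\<bar> + 1 / \<theta>)"
  have l: "l > 0" using \<theta>(1) V_nonneg unfolding l_def by (intro divide_pos_pos add_nonneg_pos) auto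
  show ?thesis
  proof (intro exI[of _ "1 / (l * l * c)"] conjI ballI allI)
    show "1 / (l * l * c) > 0" using l c(1) by simp
    fix E y assume E: "E \<in> S"
    have nE: "Im E \<noteq> 0" "\<theta> \<le> \<bar>Im E\<bar>" using \<theta>(1) \<theta>(2)[OF E] by auto
    have "1 / \<bar>Im E\<bar> \<le> 1 / \<theta>" using nE \<theta>(1) by (intro divide_left_mono mult_pos_pos) auto
    then have "l \<le> \<bar>Im E\<bar> / (V + cmod E + 1 / \<bar>Im E\<bar>)"
      unfolding l_def using nE \<theta>(1) B[OF E] V_nonneg by (intro frac_le add_nonneg_pos) auto
    then show "\<exists>K. green_kernel (\<lambda>k. of_real (w y k) - E) (1 / (l * l * c)) \<kappa> K"
      using c E by (intro off_axis_green_kernel[OF nE(1) \<kappa>(1) c(1) _ l]) auto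
  qed
qed

end

lemma resolvent_of_green_kernel:
  assumes K: "green_kernel (\<lambda>k. of_real (v (int_iter T k x)) - z) C \<kappa> K" and C: "C > 0" and \<kappa>: "\<bar>g\<bar> < \<kappa>"
    and bdd: "\<And>k. \<bar>v (int_iter T k x)\<bar> \<le> V"
  shows "z \<in> resolvent_set_ell2 (hatano_nelson T v g x)"
proof (rule resolvent_from_gauged_kernel[where g = g and v = v and T = T and x = x and z = z and V = V and K = K and C = C and \<delta> = "\<kappa> - \<bar>g\<bar>", OF _ C _ bdd])
  fix i j
  have "- g * real_of_int (i - j) \<le> \<bar>g\<bar> * \<bar>real_of_int (i - j)\<bar>"
    using abs_ge_self[of "- g * real_of_int (i - j)"] by (simp add: abs_mult)
  then have "exp (- g * real_of_int (i - j)) \<le> exp (\<bar>g\<bar> * \<bar>real_of_int (i - j)\<bar>)" by simp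
  moreover have "cmod (K i j) \<le> C * exp (- \<kappa> * \<bar>real_of_int (i - j)\<bar>)" using K unfolding green_kernel_def by blast
  ultimately have "exp (- g * real_of_int (i - j)) * cmod (K i j)
      \<le> exp (\<bar>g\<bar> * \<bar>real_of_int (i - j)\<bar>) * (C * exp (- \<kappa> * \<bar>real_of_int (i - j)\<bar>))"
    by (intro mult_mono) auto
  also have "\<dots> = C * exp (- (\<kappa> - \<bar>g\<bar>) * \<bar>real_of_int (i - j)\<bar>)"
    by (simp add: exp_add[symmetric] algebra_simps)
  finally show "exp (- g * real_of_int (i - j)) * cmod (K i j) \<le> C * exp (- (\<kappa> - \<bar>g\<bar>) * \<bar>real_of_int (i - j)\<bar>)" .
next
  fix n j
  show "(of_real (v (int_iter T n x)) - z) * K n j - K (n + 1) j - K (n - 1) j = of_bool (n = j)"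
    using K unfolding green_kernel_def by blast
next
  fix i k
  have "(of_real (v (int_iter T k x)) - z) * K k i - K (k + 1) i - K (k - 1) i = of_bool (k = i)"
    using K unfolding green_kernel_def by blast
  moreover have "K k i = K i k" "K (k + 1) i = K i (k + 1)" "K (k - 1) i = K i (k - 1)"
    using K unfolding green_kernel_def by blast+
  ultimately show "K i k * (of_real (v (int_iter T k x)) - z) - K i (k - 1) - K i (k + 1) = of_bool (i = k)"
    by (simp add: algebra_simps)
qed (use \<kappa> in auto)

section \<open>Continuation of the Green kernel to real energies\<close>

lemma ell2_norm_square: "(ell2_norm u)\<^sup>2 = (\<Sum>\<^sub>\<infinity>n. (cmod (u n))\<^sup>2)"
  unfolding ell2_norm_def by (simp add: infsum_nonneg)

lemma ell2_norm_nonneg: "ell2_norm u \<ge> 0"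
  unfolding ell2_norm_def by (simp add: infsum_nonneg)

lemma ell2_finite_sum_le:
  assumes "u \<in> ell2" "finite F" shows "(\<Sum>k\<in>F. (cmod (u k))\<^sup>2) \<le> (ell2_norm u)\<^sup>2"
  unfolding ell2_norm_square
proof (rule finite_sum_le_infsum)
  show "(\<lambda>k. (cmod (u k))\<^sup>2) summable_on UNIV" using assms(1) unfolding ell2_def by simp
qed (use assms(2) in simp_all)

lemma ell2_norm_ge_point:
  assumes "u \<in> ell2" shows "cmod (u i) \<le> ell2_norm u"
  using ell2_finite_sum_le[OF assms, of "{i}"] by (intro power2_le_imp_le[OF _ ell2_norm_nonneg]) simp

lemma hn_op_0: "hn_op 0 q u n = q n * u n - u (n + 1) - u (n - 1)"
  by (simp add: hn_op_def)

lemma hn_op_ell2: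
  assumes u: "u \<in> ell2" and q: "\<And>k. cmod (q k) \<le> B"
  shows "hn_op 0 q u \<in> ell2"
proof -
  have 1: "(\<lambda>n. q n * u n) \<in> ell2" by (rule ell2_mult_bounded[OF u q])
  have 2: "(\<lambda>n. (-1) * u (n + 1)) \<in> ell2" by (rule ell2_cmult[OF ell2_shift[OF u]])
  have 3: "(\<lambda>n. (-1) * u (n + (-1))) \<in> ell2" by (rule ell2_cmult[OF ell2_shift[OF u]])
  have "hn_op 0 q u = (\<lambda>n. q n * u n + (-1) * u (n + 1) + (-1) * u (n + (-1)))"
    by (rule ext) (simp add: hn_op_0)
  then show ?thesis using ell2_add[OF ell2_add[OF 1 2] 3] by simp
qed

lemma square_sum_two_le: "(x + y)\<^sup>2 \<le> 2 * x\<^sup>2 + 2 * y\<^sup>2" for x y :: real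
  using zero_le_power2[of "x - y"] unfolding power2_diff power2_sum by linarith

lemma square_sum_three_le: "(x + y + z)\<^sup>2 \<le> 3 * (x\<^sup>2 + y\<^sup>2 + z\<^sup>2)" for x y z :: real
proof -
  have "3 * (x\<^sup>2 + y\<^sup>2 + z\<^sup>2) - (x + y + z)\<^sup>2 = (x - y)\<^sup>2 + (y - z)\<^sup>2 + (x - z)\<^sup>2"
    by (simp add: power2_eq_square algebra_simps)
  then show ?thesis using zero_le_power2[of "x - y"] zero_le_power2[of "y - z"] zero_le_power2[of "x - z"] by linarith
qed

text \<open>Cut \<open>u\<close> off at a large distance; the cut-off error is controlled by the tail of the norm.\<close>

lemma lower_bound_ell2:
  assumes lb: "lower_bound c 0 q" and c: "c > 0" and q: "\<And>k. cmod (q k) \<le> B" and u: "u \<in> ell2"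
  shows "c * (ell2_norm u)\<^sup>2 \<le> 2 * (ell2_norm (hn_op 0 q u))\<^sup>2"
proof (rule field_le_epsilon)
  fix e :: real assume e: "e > 0"
  let ?S = "(ell2_norm u)\<^sup>2" and ?H = "(ell2_norm (hn_op 0 q u))\<^sup>2"
  define C where "C = c + 6 * (B\<^sup>2 + 2)"
  have C: "C > 0" using c by (simp add: C_def add_pos_nonneg)
  have hs: "((\<lambda>k. (cmod (u k))\<^sup>2) has_sum ?S) UNIV"
    unfolding ell2_norm_square using u unfolding ell2_def by (intro has_sum_infsum) auto
  have "e / C > 0" using e C by simp
  from has_sum_finite_approximation[OF hs this]
  obtain F where F: "finite F" "dist (\<Sum>k\<in>F. (cmod (u k))\<^sup>2) ?S \<le> e / C" by blast
  obtain n :: nat where n: "F \<subseteq> {- int n..int n}"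
  proof -
    define a where "a = Max (insert 0 (abs ` F))"
    have a: "\<bar>k\<bar> \<le> a" if "k \<in> F" for k unfolding a_def using F(1) that by (intro Max_ge) auto
    show thesis by (rule that[of "nat a"]) (use a in fastforce)
  qed
  let ?I = "{- int n..int n}" and ?A = "{- int n - 1..int n + 1}"
  define \<phi> where "\<phi> k = (if k \<in> ?I then u k else 0)" for k
  define \<delta> where "\<delta> k = (if k \<in> ?I then 0 else u k)" for k
  have tail: "(\<Sum>k\<in>G. (cmod (\<delta> k))\<^sup>2) \<le> e / C" if G: "finite G" for G
  proof -
    have "(\<Sum>k\<in>G. (cmod (\<delta> k))\<^sup>2) = (\<Sum>k\<in>G - ?I. (cmod (u k))\<^sup>2)"
      using G by (intro sum.mono_neutral_cong_right) (auto simp: \<delta>_def)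
    moreover have "(\<Sum>k\<in>G - ?I. (cmod (u k))\<^sup>2) + (\<Sum>k\<in>?I. (cmod (u k))\<^sup>2) \<le> ?S"
    proof -
      have "(\<Sum>k\<in>(G - ?I) \<union> ?I. (cmod (u k))\<^sup>2) = (\<Sum>k\<in>G - ?I. (cmod (u k))\<^sup>2) + (\<Sum>k\<in>?I. (cmod (u k))\<^sup>2)"
        by (rule sum.union_disjoint) (use G in auto)
      moreover have "(\<Sum>k\<in>(G - ?I) \<union> ?I. (cmod (u k))\<^sup>2) \<le> ?S"
        by (rule ell2_finite_sum_le[OF u]) (use G in simp)
      ultimately show ?thesis by linarith
    qed
    moreover have "(\<Sum>k\<in>F. (cmod (u k))\<^sup>2) \<le> (\<Sum>k\<in>?I. (cmod (u k))\<^sup>2)"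
      using n by (intro sum_mono2) auto
    ultimately show ?thesis using F(2) unfolding dist_real_def by linarith
  qed
  have shift_sum: "(\<Sum>k\<in>?A. (cmod (\<delta> (k + s)))\<^sup>2) \<le> e / C" for s
  proof -
    have "(\<Sum>k\<in>?A. (cmod (\<delta> (k + s)))\<^sup>2) = (\<Sum>k\<in>(\<lambda>k. k + s) ` ?A. (cmod (\<delta> k))\<^sup>2)"
      by (subst sum.reindex) (auto simp: inj_on_def)
    then show ?thesis using tail by simp
  qed
  have pt: "(cmod (hn_op 0 q \<phi> k))\<^sup>2 \<le> 2 * (cmod (hn_op 0 q u k))\<^sup>2
      + 6 * (B\<^sup>2 * (cmod (\<delta> (k + 0)))\<^sup>2 + (cmod (\<delta> (k + 1)))\<^sup>2 + (cmod (\<delta> (k + (-1))))\<^sup>2)" for k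
  proof -
    let ?a = "cmod (\<delta> k)" and ?b = "cmod (\<delta> (k + 1))" and ?d = "cmod (\<delta> (k - 1))" and ?h = "cmod (hn_op 0 q u k)"
    have u_split: "u j = \<phi> j + \<delta> j" for j by (simp add: \<phi>_def \<delta>_def)
    have "hn_op 0 q \<phi> k = hn_op 0 q u k - hn_op 0 q \<delta> k"
      unfolding hn_op_0 u_split by (simp only: algebra_simps)
    then have "cmod (hn_op 0 q \<phi> k) \<le> ?h + cmod (hn_op 0 q \<delta> k)" by (metis norm_triangle_ineq4)
    also have "cmod (hn_op 0 q \<delta> k) \<le> B * ?a + ?b + ?d"
    proof -
      have "cmod (hn_op 0 q \<delta> k) \<le> cmod (q k * \<delta> k) + ?b + ?d"
        unfolding hn_op_0 using norm_triangle_ineq4[of "q k * \<delta> k - \<delta> (k + 1)" "\<delta> (k - 1)"]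
          norm_triangle_ineq4[of "q k * \<delta> k" "\<delta> (k + 1)"] by linarith
      moreover have "cmod (q k * \<delta> k) \<le> B * ?a" unfolding norm_mult using q by (intro mult_right_mono) auto
      ultimately show ?thesis by linarith
    qed
    finally have "(cmod (hn_op 0 q \<phi> k))\<^sup>2 \<le> (?h + (B * ?a + ?b + ?d))\<^sup>2" by (intro power_mono) auto
    also have "\<dots> \<le> 2 * ?h\<^sup>2 + 2 * (B * ?a + ?b + ?d)\<^sup>2"
      by (rule square_sum_two_le)
    also have "(B * ?a + ?b + ?d)\<^sup>2 \<le> 3 * ((B * ?a)\<^sup>2 + ?b\<^sup>2 + ?d\<^sup>2)"
      by (rule square_sum_three_le)
    finally show ?thesis by (simp add: power_mult_distrib)
  qed
  have "c * (\<Sum>k\<in>?A. (cmod (\<phi> k))\<^sup>2) \<le> (\<Sum>k\<in>?A. (cmod (hn_op 0 q \<phi> k))\<^sup>2)"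
    by (rule lower_boundD[OF lb]) (auto simp: \<phi>_def split: if_splits)
  also have "\<dots> \<le> (\<Sum>k\<in>?A. 2 * (cmod (hn_op 0 q u k))\<^sup>2
      + 6 * (B\<^sup>2 * (cmod (\<delta> (k + 0)))\<^sup>2 + (cmod (\<delta> (k + 1)))\<^sup>2 + (cmod (\<delta> (k + (-1))))\<^sup>2))"
    by (intro sum_mono pt)
  also have "\<dots> = 2 * (\<Sum>k\<in>?A. (cmod (hn_op 0 q u k))\<^sup>2)
      + 6 * (B\<^sup>2 * (\<Sum>k\<in>?A. (cmod (\<delta> (k + 0)))\<^sup>2) + (\<Sum>k\<in>?A. (cmod (\<delta> (k + 1)))\<^sup>2) + (\<Sum>k\<in>?A. (cmod (\<delta> (k + (-1))))\<^sup>2))"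
    by (simp only: sum.distrib sum_distrib_left[symmetric] add.assoc)
  also have "\<dots> \<le> 2 * ?H + 6 * (B\<^sup>2 * (e / C) + e / C + e / C)"
    using ell2_finite_sum_le[OF hn_op_ell2[OF u q], of ?A] shift_sum[of 0] shift_sum[of 1] shift_sum[of "-1"]
    by (intro add_mono mult_left_mono) auto
  finally have 1: "c * (\<Sum>k\<in>?A. (cmod (\<phi> k))\<^sup>2) \<le> 2 * ?H + 6 * (B\<^sup>2 + 2) * (e / C)" by (simp add: algebra_simps)
  have "?S \<le> (\<Sum>k\<in>F. (cmod (u k))\<^sup>2) + e / C" using F(2) unfolding dist_real_def by linarith
  also have "(\<Sum>k\<in>F. (cmod (u k))\<^sup>2) \<le> (\<Sum>k\<in>?I. (cmod (u k))\<^sup>2)" using n by (intro sum_mono2) auto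
  also have "(\<Sum>k\<in>?I. (cmod (u k))\<^sup>2) = (\<Sum>k\<in>?A. (cmod (\<phi> k))\<^sup>2)"
    by (rule sum.mono_neutral_cong_left) (auto simp: \<phi>_def)
  finally have "c * ?S \<le> c * ((\<Sum>k\<in>?A. (cmod (\<phi> k))\<^sup>2) + e / C)" using c by (intro mult_left_mono) auto
  moreover have "C * (e / C) = 6 * (B\<^sup>2 + 2) * (e / C) + c * (e / C)" by (subst (1) C_def) (simp only: distrib_right add_ac)
  ultimately have "c * ?S \<le> 2 * ?H + C * (e / C)" using 1 unfolding distrib_left by linarith
  then show "c * ?S \<le> 2 * ?H + e" using C by simp
qed

text \<open>The function is small away from the real axis and merely bounded near it. Rotating by a quarter turn about
  \<open>E\<close>, at each point of the circle \<open>|z| = R / 4\<close> at least one of \<open>E + z\<close> and \<open>E + i z\<close> is far from the axis, so the product of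
  the two values is at most \<open>A B\<close> there, and hence at the centre.\<close>

lemma two_rotations_step:
  fixes F :: "complex \<Rightarrow> complex"
  assumes E0: "Im E0 = 0" and R: "R > 0" and hol: "F holomorphic_on ball E0 R"
    and B: "\<And>E. E \<in> ball E0 R \<Longrightarrow> cmod (F E) \<le> B"
    and A: "\<And>E. E \<in> ball E0 R \<Longrightarrow> R / 16 \<le> \<bar>Im E\<bar> \<Longrightarrow> cmod (F E) \<le> A" and AB: "0 \<le> A" "A \<le> B"
    and E: "E \<in> ball E0 (R / 2)"
  shows "cmod (F E) \<le> sqrt (A * B)"
proof (cases "R / 16 \<le> \<bar>Im E\<bar>")
  case True
  then have "cmod (F E) \<le> A" using E R by (intro A) auto
  also have "A = sqrt (A * A)" using AB by simp
  also have "\<dots> \<le> sqrt (A * B)" using AB by (intro real_sqrt_le_mono mult_left_mono) auto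
  finally show ?thesis .
next
  case False
  define h where "h z = F (E + z) * F (E + \<i> * z)" for z
  have inB: "E + z \<in> ball E0 R" if "cmod z \<le> R / 4" for z
  proof -
    have "dist E0 (E + z) \<le> dist E0 E + cmod z"
      using norm_triangle_ineq4[of "E0 - E" z] by (simp add: dist_norm algebra_simps)
    then show ?thesis using that E R by simp
  qed
  have im1: "(\<lambda>z. E + z) ` cball 0 (R / 4) \<subseteq> ball E0 R"
    by (intro image_subsetI inB) simp
  have im2: "(\<lambda>z. E + \<i> * z) ` cball 0 (R / 4) \<subseteq> ball E0 R"
    by (intro image_subsetI inB) (simp add: norm_mult)
  have hol1: "(\<lambda>z. F (E + z)) holomorphic_on cball 0 (R / 4)"
    by (rule holomorphic_on_compose_gen[OF _ hol im1, unfolded o_def]) (intro holomorphic_intros)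
  have hol2: "(\<lambda>z. F (E + \<i> * z)) holomorphic_on cball 0 (R / 4)"
    by (rule holomorphic_on_compose_gen[OF _ hol im2, unfolded o_def]) (intro holomorphic_intros)
  have hol: "h holomorphic_on cball 0 (R / 4)" unfolding h_def by (intro holomorphic_on_mult hol1 hol2)
  have "cmod (h 0) \<le> A * B"
  proof (rule maximum_modulus_frontier[where S = "cball 0 (R / 4)" and f = h and \<xi> = 0])
    show "h holomorphic_on interior (cball 0 (R / 4))" by (rule holomorphic_on_subset[OF hol]) auto
    show "continuous_on (closure (cball 0 (R / 4))) h" using holomorphic_on_imp_continuous_on[OF hol] by simp
    fix z :: complex assume "z \<in> frontier (cball 0 (R / 4))"
    then have z: "cmod z = R / 4" using R by (simp add: frontier_cball)
    have in1: "E + z \<in> ball E0 R" and in2: "E + \<i> * z \<in> ball E0 R"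
      using inB[of z] inB[of "\<i> * z"] z by (auto simp: norm_mult)
    have "cmod z \<le> \<bar>Re z\<bar> + \<bar>Im z\<bar>" by (rule cmod_le)
    then consider "\<bar>Im z\<bar> \<ge> R / 8" | "\<bar>Re z\<bar> \<ge> R / 8" using z by linarith
    then show "cmod (h z) \<le> A * B"
    proof cases
      case 1
      moreover have "Im (E + z) = Im E + Im z" by simp
      ultimately have "R / 16 \<le> \<bar>Im (E + z)\<bar>" using False by linarith
      then have "cmod (F (E + z)) * cmod (F (E + \<i> * z)) \<le> A * B"
        using A[OF in1] B[OF in2] AB by (intro mult_mono) auto
      then show ?thesis by (simp add: h_def norm_mult)
    next
      case 2
      moreover have "Im (E + \<i> * z) = Im E + Re z" by simp
      ultimately have "R / 16 \<le> \<bar>Im (E + \<i> * z)\<bar>" using False by linarith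
      then have "cmod (F (E + z)) * cmod (F (E + \<i> * z)) \<le> B * A"
        using B[OF in1] A[OF in2] AB by (intro mult_mono) auto
      then show ?thesis by (simp add: h_def norm_mult mult.commute)
    qed
  qed (use R in auto)
  then have "(cmod (F E))\<^sup>2 \<le> A * B" by (simp add: h_def norm_mult power2_eq_square)
  then show ?thesis by (rule real_le_rsqrt)
qed

text \<open>Each halving of the radius halves the exponent of \<open>B / A\<close>. After many steps the bound near the axis is
  almost as good as the one off the axis.\<close>

lemma two_rotations_iterated:
  fixes F :: "complex \<Rightarrow> complex"
  assumes E0: "Im E0 = 0" and R: "R > 0" and hol: "F holomorphic_on ball E0 R"
    and B: "\<And>E. E \<in> ball E0 R \<Longrightarrow> cmod (F E) \<le> B"
    and A: "\<And>E. E \<in> ball E0 R \<Longrightarrow> R / 2 ^ m / 16 \<le> \<bar>Im E\<bar> \<Longrightarrow> cmod (F E) \<le> A" and AB: "0 < A" "A \<le> B"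
  shows "k \<le> m \<Longrightarrow> E \<in> ball E0 (R / 2 ^ k) \<Longrightarrow> cmod (F E) \<le> A * (B / A) powr (1 / 2 ^ k)"
proof (induction k arbitrary: E)
  case 0
  then show ?case using B AB by simp
next
  case (Suc k)
  let ?R = "R / 2 ^ k" and ?B = "A * (B / A) powr (1 / 2 ^ k)"
  have sub: "ball E0 ?R \<subseteq> ball E0 R" using R by (intro subset_ball) (simp add: divide_le_eq mult_ge1_I)
  have BA: "B / A \<ge> 1" using AB by simp
  have "cmod (F E) \<le> sqrt (A * ?B)"
  proof (rule two_rotations_step[where F = F and E = E and R = ?R and A = A and B = ?B, OF E0])
    show "?R > 0" using R by simp
    show "F holomorphic_on ball E0 ?R" by (rule holomorphic_on_subset[OF hol sub])
    show "cmod (F E) \<le> ?B" if "E \<in> ball E0 ?R" for E using Suc that by simp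
    show "cmod (F E) \<le> A" if "E \<in> ball E0 ?R" "?R / 16 \<le> \<bar>Im E\<bar>" for E
    proof (rule A)
      show "E \<in> ball E0 R" using that(1) sub by blast
      have "R / 2 ^ m \<le> R / 2 ^ k" using R Suc(2) by (intro divide_left_mono power_increasing) auto
      then have "R / 2 ^ m / 16 \<le> R / 2 ^ k / 16" by (rule divide_right_mono) simp
      then show "R / 2 ^ m / 16 \<le> \<bar>Im E\<bar>" using that(2) by (rule order_trans)
    qed
    show "0 \<le> A" using AB by simp
    show "A \<le> ?B" using AB BA by (simp add: ge_one_powr_ge_zero)
    show "E \<in> ball E0 (?R / 2)" using Suc(3) by (simp add: mult.commute)
  qed
  also have "sqrt (A * ?B) = A * (B / A) powr (1 / 2 ^ Suc k)"
  proof (rule real_sqrt_unique)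
    have "1 / 2 ^ Suc k + 1 / 2 ^ Suc k = (1 / 2 ^ k :: real)" by (simp add: field_simps)
    then have "((B / A) powr (1 / 2 ^ Suc k))\<^sup>2 = (B / A) powr (1 / 2 ^ k)"
      unfolding power2_eq_square powr_add[symmetric] by (simp only:)
    then show "(A * (B / A) powr (1 / 2 ^ Suc k))\<^sup>2 = A * ?B" by (simp add: power2_eq_square algebra_simps)
  qed (use AB in auto)
  finally show ?case .
qed

lemma green_kernel_column_ell2:
  assumes K: "green_kernel q C \<kappa> K" and \<kappa>: "\<kappa> > 0"
  shows "(\<lambda>i. K i j) \<in> ell2"
proof -
  have e: "(\<lambda>i. of_real (exp (- \<kappa> * \<bar>real_of_int (i - j)\<bar>))) \<in> ell2"
  proof -
    have "(\<lambda>i. exp (- (2 * \<kappa>) * \<bar>real_of_int (i - j)\<bar>)) summable_on UNIV"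
      using \<kappa> by (intro summable_on_exp_decay) simp
    then show ?thesis unfolding ell2_def by (simp add: exp_double[symmetric] mult.assoc)
  qed
  show ?thesis
    by (rule ell2_comparison[OF e, of _ C]) (use K in \<open>simp add: green_kernel_def\<close>)
qed

lemma green_kernel_column_eq:
  assumes K: "green_kernel q C \<kappa> K" shows "hn_op 0 q (\<lambda>i. K i j) n = of_bool (n = j)"
  using K unfolding green_kernel_def hn_op_0 by blast

lemma ell2_norm_cmult: "ell2_norm (\<lambda>n. c * u n) = cmod c * ell2_norm u"
proof -
  have "(\<Sum>\<^sub>\<infinity>n. (cmod (c * u n))\<^sup>2) = (cmod c)\<^sup>2 * (\<Sum>\<^sub>\<infinity>n. (cmod (u n))\<^sup>2)"
    unfolding norm_mult power_mult_distrib by (rule infsum_cmult_right')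
  then show ?thesis unfolding ell2_norm_def by (simp add: real_sqrt_mult)
qed

lemma ell2_delta: "(\<lambda>n. of_bool (n = j)) \<in> ell2" "ell2_norm (\<lambda>n. of_bool (n = j)) = 1"
  using ell2_finite_support[of "{j}" "\<lambda>n. of_bool (n = j)"] by auto

context strictly_ergodic_potential
begin

abbreviation q :: "'a \<Rightarrow> complex \<Rightarrow> int \<Rightarrow> complex" where "q y E \<equiv> \<lambda>k. of_real (w y k) - E"

lemma q_bound: "cmod (q y E k) \<le> V + cmod E"
  using norm_triangle_ineq4[of "of_real (w y k)" E] w_bound[of y k] by simp

lemma lower_bound_ell2_norm:
  assumes lb: "lower_bound c 0 (q y E)" and c: "c > 0" and u: "u \<in> ell2"
  shows "sqrt (c / 2) * ell2_norm u \<le> ell2_norm (hn_op 0 (q y E) u)"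
proof (rule power2_le_imp_le[OF _ ell2_norm_nonneg])
  show "(sqrt (c / 2) * ell2_norm u)\<^sup>2 \<le> (ell2_norm (hn_op 0 (q y E) u))\<^sup>2"
    using lower_bound_ell2[OF lb c q_bound u] c by (simp add: power_mult_distrib)
qed

text \<open>A column of the kernel solves the equation with a unit vector on the right. The resulting bound on its entries
  does not depend on the distance to the real axis.\<close>

lemma green_kernel_column_bound:
  assumes lb: "lower_bound c 0 (q y E)" and c: "c > 0" and K: "green_kernel (q y E) C \<kappa> K" and \<kappa>: "\<kappa> > 0"
  shows "cmod (K i j) \<le> 1 / sqrt (c / 2)"
proof -
  have u: "(\<lambda>i. K i j) \<in> ell2" by (rule green_kernel_column_ell2[OF K \<kappa>])
  have "hn_op 0 (q y E) (\<lambda>i. K i j) = (\<lambda>n. of_bool (n = j))" by (rule ext) (rule green_kernel_column_eq[OF K])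
  then have "sqrt (c / 2) * ell2_norm (\<lambda>i. K i j) \<le> 1"
    using lower_bound_ell2_norm[OF lb c u] ell2_delta(2)[of j] by simp
  then have "ell2_norm (\<lambda>i. K i j) \<le> 1 / sqrt (c / 2)" using c by (simp add: field_simps)
  then show ?thesis using ell2_norm_ge_point[OF u, of i] by linarith
qed

text \<open>The Neumann series of the resolvent about a nonreal \<open>E1\<close> next to \<open>E0\<close>. The lower bound, not the distance to
  the axis, controls the powers of the resolvent, so the disc of convergence contains a
  neighbourhood of \<open>E0\<close>.\<close>

lemma green_continuation:
  assumes E0: "Im E0 = 0" and \<rho>: "\<rho> > 0" and c: "c > 0"
    and lb: "\<And>E. E \<in> ball E0 \<rho> \<Longrightarrow> lower_bound c 0 (q y E)"
    and gk: "\<And>E. E \<in> ball E0 \<rho> \<Longrightarrow> Im E \<noteq> 0 \<Longrightarrow> \<exists>C \<kappa> K. C > 0 \<and> \<kappa> > 0 \<and> green_kernel (q y E) C \<kappa> K"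
    and R0: "R0 = min (sqrt (c / 2) / 4) (\<rho> / 2)"
  shows "\<exists>\<Phi>. \<forall>i. \<Phi> i holomorphic_on ball E0 R0 \<and>
    (\<forall>E\<in>ball E0 R0. \<forall>C \<kappa> K. \<kappa> > 0 \<longrightarrow> green_kernel (q y E) C \<kappa> K \<longrightarrow> \<Phi> i E = K i j)"
proof -
  define c' where "c' = sqrt (c / 2)"
  have c': "c' > 0" using c by (simp add: c'_def)
  have R0': "R0 > 0" "4 * R0 \<le> c'" "2 * R0 \<le> \<rho>" using R0 c' \<rho> unfolding c'_def[symmetric] by auto
  (* close enough to E0 that the disc of radius c' / 2 about E1 contains the ball of radius R0 about E0 *)
  define E1 where "E1 = E0 + \<i> * of_real (R0 / 2)"
  have E1: "E1 \<in> ball E0 \<rho>" "Im E1 \<noteq> 0" "cmod (E0 - E1) = R0 / 2"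
    using R0' E0 by (auto simp: E1_def dist_norm norm_mult)
  have near: "cmod (E - E1) \<le> c' / 2" if "E \<in> ball E0 R0" for E
  proof -
    have "cmod (E - E1) \<le> cmod (E0 - E) + cmod (E0 - E1)"
      using norm_triangle_ineq4[of "E0 - E1" "E0 - E"] by simp
    then show ?thesis using that E1(3) R0' by (simp add: dist_norm)
  qed
  obtain C1 \<kappa>1 K1 where K1: "C1 > 0" "\<kappa>1 > 0" "green_kernel (q y E1) C1 \<kappa>1 K1" using gk[OF E1(1,2)] by blast
  have "E1 \<in> resolvent_set_ell2 (hatano_nelson T v 0 y)"
    by (rule resolvent_of_green_kernel[OF K1(3)[unfolded w_def] K1(1) _ v_bound]) (use K1(2) in simp)
  then obtain Rs where Rs: "bounded_operator_ell2 Rs"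
    "\<forall>u\<in>ell2. Rs (\<lambda>n. hatano_nelson T v 0 y u n - E1 * u n) = u \<and>
       (\<lambda>n. hatano_nelson T v 0 y (Rs u) n - E1 * Rs u n) = u"
    unfolding resolvent_set_ell2_def by blast
  have Rs_ell2: "Rs u \<in> ell2" if "u \<in> ell2" for u using Rs(1) that unfolding bounded_operator_ell2_def by blast
  have Rs_eq: "hn_op 0 (q y E1) (Rs u) = u" if "u \<in> ell2" for u
  proof -
    have "(\<lambda>n. hatano_nelson T v 0 y (Rs u) n - E1 * Rs u n) = u" using Rs(2) that by blast
    moreover have "(\<lambda>n. hatano_nelson T v 0 y (Rs u) n - E1 * Rs u n) = hn_op 0 (q y E1) (Rs u)"
      by (rule ext) (simp add: hatano_nelson_def hn_op_0 w_def algebra_simps)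
    ultimately show ?thesis by simp
  qed
  define a where "a k = (Rs ^^ k) (\<lambda>n. of_bool (n = j))" for k
  have a0: "a 0 = (\<lambda>n. of_bool (n = j))" by (simp add: a_def)
  have aSuc: "a (Suc k) = Rs (a k)" for k by (simp add: a_def)
  have a_ell2: "a k \<in> ell2" for k by (induction k) (auto simp: a0 aSuc ell2_delta(1) Rs_ell2)
  have a_eq: "hn_op 0 (q y E1) (a (Suc k)) = a k" for k unfolding aSuc by (rule Rs_eq[OF a_ell2])
  have a_norm: "ell2_norm (a k) \<le> (1 / c') ^ k" for k
  proof (induction k)
    case (Suc k)
    have "c' * ell2_norm (a (Suc k)) \<le> ell2_norm (a k)"
      using lower_bound_ell2_norm[OF lb[OF E1(1)] c a_ell2, of "Suc k"] unfolding a_eq c'_def .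
    then have "ell2_norm (a (Suc k)) \<le> ell2_norm (a k) / c'" using c' by (simp add: field_simps)
    also have "\<dots> \<le> (1 / c') ^ k / c'" using Suc c' by (intro divide_right_mono) auto
    finally show ?case by simp
  qed (simp add: a0 ell2_delta(2))
  have a_pt: "cmod (a k i) \<le> (1 / c') ^ k" for k i
    using ell2_norm_ge_point[OF a_ell2, of k i] a_norm[of k] by linarith
  define \<Phi> where "\<Phi> i E = (\<Sum>k. a (Suc k) i * (E - E1) ^ k)" for i E
  have sm: "summable (\<lambda>k. a (Suc k) i * (E - E1) ^ k)" if E: "cmod (E - E1) \<le> c' / 2" for i E
  proof (rule summable_comparison_test'[of "\<lambda>k. 1 / c' * (1 / 2) ^ k" 0])
    show "summable (\<lambda>k. 1 / c' * (1 / 2) ^ k)" by (intro summable_mult summable_geometric) auto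
    fix k
    have "norm (a (Suc k) i * (E - E1) ^ k) \<le> (1 / c') ^ Suc k * (c' / 2) ^ k"
      unfolding norm_mult norm_power using a_pt[of "Suc k" i] E c' by (intro mult_mono power_mono) auto
    also have "\<dots> = 1 / c' * (1 / 2) ^ k" using c' by (simp add: power_divide field_simps)
    finally show "norm (a (Suc k) i * (E - E1) ^ k) \<le> 1 / c' * (1 / 2) ^ k" .
  qed
  (* partial sums of the Neumann series; applying the operator to them telescopes *)
  define S where "S m E i = (\<Sum>k<m. (E - E1) ^ k * a (Suc k) i)" for m E i
  have S_Suc: "S (Suc m) E = (\<lambda>i. S m E i + (E - E1) ^ m * a (Suc m) i)" for m E by (rule ext) (simp add: S_def)
  have S_ell2: "S m E \<in> ell2" for m E
  proof (induction m)
    case 0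
    have "S 0 E = (\<lambda>n. 0 * of_bool (n = j))" by (rule ext) (simp add: S_def)
    then show ?case using ell2_cmult[OF ell2_delta(1), of 0 j] by simp
  next
    case (Suc m)
    show ?case unfolding S_Suc by (rule ell2_add[OF Suc ell2_cmult[OF a_ell2]])
  qed
  have S_eq: "hn_op 0 (q y E) (S m E) n = of_bool (n = j) - (E - E1) ^ m * a m n" for m E n
  proof (induction m)
    case 0
    show ?case by (simp add: S_def hn_op_0 a0)
  next
    case (Suc m)
    have "hn_op 0 (q y E) (S (Suc m) E) n =
        hn_op 0 (q y E) (S m E) n + (E - E1) ^ m * (hn_op 0 (q y E1) (a (Suc m)) n - (E - E1) * a (Suc m) n)"
      unfolding S_Suc hn_op_0 by (simp add: algebra_simps)
    then show ?case unfolding Suc a_eq by (simp add: algebra_simps)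
  qed
  have lim: "\<Phi> i E = K i j" if E: "E \<in> ball E0 R0" and \<kappa>: "\<kappa> > 0" and K: "green_kernel (q y E) C \<kappa> K" for i E C \<kappa> K
  proof -
    let ?b = "\<lambda>i. K i j"
    have b: "?b \<in> ell2" by (rule green_kernel_column_ell2[OF K \<kappa>])
    have E\<rho>: "E \<in> ball E0 \<rho>" using E R0' by simp
    have bound: "cmod (S m E i - ?b i) \<le> 1 / c' * (1 / 2) ^ m" for m
    proof -
      let ?D = "\<lambda>n. S m E n + (-1) * ?b n"
      have D: "?D \<in> ell2" by (rule ell2_add[OF S_ell2 ell2_cmult[OF b]])
      have hD: "hn_op 0 (q y E) ?D = (\<lambda>n. (- ((E - E1) ^ m)) * a m n)"
      proof
        fix n
        have "hn_op 0 (q y E) ?D n = hn_op 0 (q y E) (S m E) n - hn_op 0 (q y E) ?b n"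
          unfolding hn_op_0 by (simp add: algebra_simps)
        then show "hn_op 0 (q y E) ?D n = (- ((E - E1) ^ m)) * a m n"
          unfolding S_eq green_kernel_column_eq[OF K] by simp
      qed
      have "c' * ell2_norm ?D \<le> cmod (- ((E - E1) ^ m)) * ell2_norm (a m)"
        using lower_bound_ell2_norm[OF lb[OF E\<rho>] c D] unfolding hD ell2_norm_cmult c'_def .
      also have "\<dots> \<le> (c' / 2) ^ m * (1 / c') ^ m"
        unfolding norm_minus_cancel norm_power using near[OF E] a_norm[of m] c'
        by (intro mult_mono power_mono) (auto simp: ell2_norm_nonneg)
      also have "\<dots> = (1 / 2) ^ m" using c' by (simp add: power_mult_distrib[symmetric])
      finally have "ell2_norm ?D \<le> 1 / c' * (1 / 2) ^ m" using c' by (simp add: field_simps)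
      then show ?thesis using ell2_norm_ge_point[OF D, of i] by simp
    qed
    have "(\<lambda>m. S m E i - ?b i) \<longlonglongrightarrow> 0"
    proof (rule Lim_null_comparison)
      show "\<forall>\<^sub>F m in sequentially. norm (S m E i - ?b i) \<le> 1 / c' * (1 / 2) ^ m" using bound by simp
      show "(\<lambda>m. 1 / c' * (1 / 2) ^ m) \<longlonglongrightarrow> 0" by (intro tendsto_mult_right_zero LIMSEQ_realpow_zero) auto
    qed
    then have "(\<lambda>m. S m E i) \<longlonglongrightarrow> ?b i" by (simp add: LIM_zero_iff)
    then have "(\<lambda>k. a (Suc k) i * (E - E1) ^ k) sums ?b i" unfolding sums_def S_def by (simp add: mult.commute)
    then show ?thesis unfolding \<Phi>_def using sums_unique by metis
  qed
  have hol: "\<Phi> i holomorphic_on ball E0 R0" for i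
  proof -
    have "\<Phi> i holomorphic_on ball E1 (c' / 2)"
    proof (rule power_series_holomorphic)
      fix E assume "E \<in> ball E1 (c' / 2)"
      then have "cmod (E - E1) \<le> c' / 2" by (simp add: dist_norm norm_minus_commute)
      from summable_sums[OF sm[OF this]] show "(\<lambda>k. a (Suc k) i * (E - E1) ^ k) sums \<Phi> i E" unfolding \<Phi>_def .
    qed
    moreover have "ball E0 R0 \<subseteq> ball E1 (c' / 2)"
    proof
      fix E assume E: "E \<in> ball E0 R0"
      have "cmod (E1 - E) \<le> cmod (E0 - E) + cmod (E0 - E1)"
        using norm_triangle_ineq4[of "E0 - E" "E0 - E1"] by simp
      then show "E \<in> ball E1 (c' / 2)" using E E1(3) R0' by (simp add: dist_norm)
    qed
    ultimately show ?thesis by (rule holomorphic_on_subset)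
  qed
  show ?thesis using hol lim by blast
qed

text \<open>The continued entries are bounded on a disc about \<open>E0\<close> and decay at rate \<open>\<kappa>\<close> off the axis with a constant that is
  uniform at each distance from it. Interpolation between the two costs an arbitrarily small part of the rate.\<close>

theorem green_kernel_at_real_energy:
  assumes E0: "Im E0 = 0" and \<rho>: "\<rho> > 0" and c: "c > 0"
    and lb: "\<And>y E. E \<in> ball E0 \<rho> \<Longrightarrow> lower_bound c 0 (q y E)"
    and gr: "\<And>E. E \<in> ball E0 \<rho> \<Longrightarrow> Im E \<noteq> 0 \<Longrightarrow> \<kappa> < growth E"
    and \<kappa>: "0 < \<kappa>'" "\<kappa>' < \<kappa>"
  shows "\<exists>C>0. \<forall>y. \<exists>K. green_kernel (q y E0) C \<kappa>' K"
proof -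
  define R0 where "R0 = min (sqrt (c / 2) / 4) (\<rho> / 2)"
  define R where "R = R0 / 2"
  have R0: "R0 > 0" "R0 < \<rho>" using c \<rho> by (auto simp: R0_def)
  have R: "R > 0" "R < R0" using R0 by (auto simp: R_def)
  have \<kappa>0: "\<kappa> > 0" using \<kappa> by simp
  obtain m where "(1 / 2) ^ m < 1 - \<kappa>' / \<kappa>" using real_arch_pow_inv[of "1 - \<kappa>' / \<kappa>" "1 / 2"] \<kappa> by auto
  then have m: "(1 / 2) ^ m \<le> 1 - \<kappa>' / \<kappa>" by simp
  define \<epsilon> :: real where "\<epsilon> = 1 / 2 ^ m"
  have \<epsilon>: "0 < \<epsilon>" "\<epsilon> \<le> 1" "\<kappa>' \<le> \<kappa> * (1 - \<epsilon>)"
  proof -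
    show "0 < \<epsilon>" "\<epsilon> \<le> 1" by (auto simp: \<epsilon>_def)
    have "\<kappa>' / \<kappa> \<le> 1 - \<epsilon>" using m by (simp add: \<epsilon>_def power_one_over)
    then show "\<kappa>' \<le> \<kappa> * (1 - \<epsilon>)" using \<kappa>0 by (simp add: pos_divide_le_eq mult.commute)
  qed
  define \<theta> where "\<theta> = R / 2 ^ m / 16"
  have \<theta>: "\<theta> > 0" using R by (simp add: \<theta>_def)
  have loc: "\<exists>C>0. \<forall>y. \<exists>K. green_kernel (q y E) C \<kappa> K" if "E \<in> ball E0 \<rho>" "Im E \<noteq> 0" for E
    using off_axis_green_kernel_uniform[of "{E}" "\<bar>Im E\<bar>" \<kappa>] that gr \<kappa>0 by auto
  have gk: "\<exists>C \<kappa> K. C > 0 \<and> \<kappa> > 0 \<and> green_kernel (q y E) C \<kappa> K" if "E \<in> ball E0 \<rho>" "Im E \<noteq> 0" for E y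
    using loc[OF that] \<kappa>0 by blast
  have "\<exists>\<Phi>. \<forall>i. \<Phi> i holomorphic_on ball E0 R0 \<and>
    (\<forall>E\<in>ball E0 R0. \<forall>C \<kappa> K. \<kappa> > 0 \<longrightarrow> green_kernel (q y E) C \<kappa> K \<longrightarrow> \<Phi> i E = K i j)" for y j
    by (rule green_continuation[OF E0 \<rho> c lb gk R0_def])
  then obtain \<Phi> where \<Phi>: "\<And>y j i. \<Phi> y j i holomorphic_on ball E0 R0"
    "\<And>y j i E C \<kappa> K. E \<in> ball E0 R0 \<Longrightarrow> \<kappa> > 0 \<Longrightarrow> green_kernel (q y E) C \<kappa> K \<Longrightarrow> \<Phi> y j i E = K i j" by metis
  define B where "B = 1 / sqrt (c / 2)"
  have B: "B > 0" using c by (simp add: B_def)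
  define En where "En n = E0 + \<i> * of_real (R / real (Suc n))" for n
  have approach: "\<exists>Z. (\<forall>n. Z n \<in> ball E0 R0 \<and> Im (Z n) \<noteq> 0) \<and> Z \<longlonglongrightarrow> E" if E: "E \<in> ball E0 R0" "Im E = 0" for E
  proof -
    define s where "s = (R0 - dist E0 E) / 2"
    have s: "s > 0" "dist E0 E + s < R0" using E(1) by (auto simp: s_def field_simps)
    define Z where "Z n = E + \<i> * of_real (s * (1 / real (Suc n)))" for n
    have "Z n \<in> ball E0 R0" for n
    proof -
      have "cmod (\<i> * of_real (s * (1 / real (Suc n)))) = s * (1 / real (Suc n))"
        using s by (simp only: norm_mult norm_of_real norm_ii) simp
      also have "\<dots> \<le> s * 1" using s(1) by (intro mult_left_mono) auto
      finally have "dist E (Z n) \<le> s" by (simp add: Z_def dist_norm norm_minus_commute del: of_real_mult)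
      then show ?thesis using dist_triangle[of E0 "Z n" E] s(2) by simp
    qed
    moreover have "Im (Z n) \<noteq> 0" for n using s(1) E(2) by (simp add: Z_def)
    moreover have "Z \<longlonglongrightarrow> E + \<i> * of_real (s * 0)"
      unfolding Z_def by (intro tendsto_intros LIMSEQ_Suc[OF lim_1_over_n])
    ultimately show ?thesis by auto
  qed
  have cont: "continuous_on (ball E0 R0) (\<Phi> y j i)" for y j i by (rule holomorphic_on_imp_continuous_on[OF \<Phi>(1)])
  have tend: "(\<lambda>n. \<Phi> y j i (Z n)) \<longlonglongrightarrow> \<Phi> y j i E" if "\<forall>n. Z n \<in> ball E0 R0 \<and> Im (Z n) \<noteq> 0" "Z \<longlonglongrightarrow> E" "E \<in> ball E0 R0" for Z E y j i
    using continuous_on_tendsto_compose[OF cont that(2,3)] that(1) by simp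
  have in\<rho>: "E \<in> ball E0 \<rho>" if "E \<in> ball E0 R0" for E using that R0 by simp
  have \<Phi>B: "cmod (\<Phi> y j i E) \<le> B" if E: "E \<in> ball E0 R0" for y j i E
  proof -
    have off: "cmod (\<Phi> y j i E) \<le> B" if E: "E \<in> ball E0 R0" "Im E \<noteq> 0" for E
    proof -
      obtain C K where K: "green_kernel (q y E) C \<kappa> K" using loc[OF in\<rho>[OF E(1)] E(2)] by blast
      show ?thesis unfolding \<Phi>(2)[OF E(1) \<kappa>0 K] B_def
        by (rule green_kernel_column_bound[OF lb[OF in\<rho>[OF E(1)]] c K \<kappa>0])
    qed
    show ?thesis
    proof (cases "Im E = 0")
      case True
      obtain Z where Z: "\<forall>n. Z n \<in> ball E0 R0 \<and> Im (Z n) \<noteq> 0" "Z \<longlonglongrightarrow> E" using approach[OF E True] by blast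
      show ?thesis
        by (rule LIMSEQ_le_const2[OF tendsto_norm[OF tend[OF Z E]]]) (use off Z(1) in auto)
    qed (rule off[OF E])
  qed
  define S where "S = cball E0 R \<inter> {E. \<theta> \<le> \<bar>Im E\<bar>}"
  have "compact S" unfolding S_def
    by (intro compact_Int_closed compact_cball closed_Collect_le continuous_intros)
  moreover have S: "E \<in> ball E0 R0" "Im E \<noteq> 0" "\<theta> \<le> \<bar>Im E\<bar>" if "E \<in> S" for E
    using that R \<theta> unfolding S_def by auto
  ultimately obtain C0 where C0: "C0 > 0" "\<And>E y. E \<in> S \<Longrightarrow> \<exists>K. green_kernel (q y E) C0 \<kappa> K"
    using off_axis_green_kernel_uniform[of S \<theta> \<kappa>] \<theta> \<kappa>0 gr in\<rho> by metis
  define C where "C = C0 powr (1 - \<epsilon>) * B powr \<epsilon>"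
  have C: "C > 0" using C0 B by (simp add: C_def)
  have decay: "cmod (\<Phi> y j i E0) \<le> C * exp (- \<kappa>' * \<bar>real_of_int (i - j)\<bar>)" for y j i
  proof -
    let ?d = "\<bar>real_of_int (i - j)\<bar>"
    (* the minimum with B guarantees A \<le> B, as interpolation requires *)
    define A where "A = min (C0 * exp (- \<kappa> * ?d)) B"
    have A: "0 < A" "A \<le> B" "A \<le> C0 * exp (- \<kappa> * ?d)" using C0(1) B by (auto simp: A_def)
    have sub: "ball E0 R \<subseteq> ball E0 R0" using R by (intro subset_ball) simp
    have "cmod (\<Phi> y j i E0) \<le> A * (B / A) powr (1 / 2 ^ m)"
    proof (rule two_rotations_iterated[where F = "\<Phi> y j i" and E = E0 and R = R and A = A and B = B and m = m and k = m, OF E0 R(1)])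
      show "\<Phi> y j i holomorphic_on ball E0 R" by (rule holomorphic_on_subset[OF \<Phi>(1) sub])
      show "cmod (\<Phi> y j i E) \<le> B" if "E \<in> ball E0 R" for E using \<Phi>B sub that by blast
      show "cmod (\<Phi> y j i E) \<le> A" if E: "E \<in> ball E0 R" "R / 2 ^ m / 16 \<le> \<bar>Im E\<bar>" for E
      proof -
        have ES: "E \<in> S" using E unfolding S_def \<theta>_def by auto
        obtain K where K: "green_kernel (q y E) C0 \<kappa> K" using C0(2)[OF ES] by blast
        have "cmod (\<Phi> y j i E) \<le> C0 * exp (- \<kappa> * ?d)"
          unfolding \<Phi>(2)[OF S(1)[OF ES] \<kappa>0 K] using K unfolding green_kernel_def by blast
        then show ?thesis using \<Phi>B[OF S(1)[OF ES]] unfolding A_def by simp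
      qed
    qed (use A R in auto)
    also have "A * (B / A) powr (1 / 2 ^ m) = A powr (1 - \<epsilon>) * B powr \<epsilon>"
      using A B unfolding \<epsilon>_def[symmetric] by (simp add: powr_divide powr_diff)
    also have "\<dots> \<le> (C0 * exp (- \<kappa> * ?d)) powr (1 - \<epsilon>) * B powr \<epsilon>"
      using A \<epsilon> by (intro mult_right_mono powr_mono2) auto
    also have "\<dots> = C * exp (- \<kappa> * (1 - \<epsilon>) * ?d)"
      using C0(1) by (simp add: powr_mult C_def exp_powr_real algebra_simps)
    also have "\<dots> \<le> C * exp (- \<kappa>' * ?d)"
      using C mult_right_mono[OF \<epsilon>(3), of ?d] by (intro mult_left_mono) auto
    finally show ?thesis .
  qed
  show ?thesis
  proof (intro exI[of _ C] conjI allI C)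
    fix y
    have E0in: "E0 \<in> ball E0 R0" using R0 by simp
    obtain Z where Z: "\<forall>n. Z n \<in> ball E0 R0 \<and> Im (Z n) \<noteq> 0" "Z \<longlonglongrightarrow> E0" using approach[OF E0in E0] by blast
    have "\<exists>K C. green_kernel (q y (Z n)) C \<kappa> K" for n
    proof -
      have Zn: "Z n \<in> ball E0 R0" "Im (Z n) \<noteq> 0" using Z(1) by auto
      show ?thesis using loc[OF in\<rho>[OF Zn(1)] Zn(2)] by blast
    qed
    then have "\<forall>n. \<exists>K C. green_kernel (q y (Z n)) C \<kappa> K" by blast
    from choice[OF this] obtain K where K: "\<And>n. \<exists>C. green_kernel (q y (Z n)) C \<kappa> (K n)" by blast
    have \<Phi>K: "\<Phi> y j i (Z n) = K n i j" for i j n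
    proof -
      obtain C' where C': "green_kernel (q y (Z n)) C' \<kappa> (K n)" using K by blast
      have "Z n \<in> ball E0 R0" using Z(1) by blast
      from \<Phi>(2)[OF this \<kappa>0 C'] show ?thesis .
    qed
    have sym: "K n i j = K n j i" for n i j using K[of n] unfolding green_kernel_def by blast
    have eqn: "q y (Z k) n * K k n j - K k (n + 1) j - K k (n - 1) j = of_bool (n = j)" for k n j
      using K[of k] unfolding green_kernel_def by blast
    note lim = tend[OF Z E0in]
    show "\<exists>K. green_kernel (q y E0) C \<kappa>' K"
    proof (intro exI[of _ "\<lambda>i j. \<Phi> y j i E0"], unfold green_kernel_def, intro conjI allI)
      fix i j
      show "cmod (\<Phi> y j i E0) \<le> C * exp (- \<kappa>' * \<bar>real_of_int (i - j)\<bar>)" by (rule decay)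
      have "(\<lambda>n. \<Phi> y j i (Z n)) = (\<lambda>n. \<Phi> y i j (Z n))"
        unfolding \<Phi>K by (rule ext) (rule sym)
      with lim[of y j i] have "(\<lambda>n. \<Phi> y i j (Z n)) \<longlonglongrightarrow> \<Phi> y j i E0" by (simp only:)
      then show "\<Phi> y j i E0 = \<Phi> y i j E0" by (rule LIMSEQ_unique[OF _ lim])
    next
      fix n j
      have "(\<lambda>k. q y (Z k) n * \<Phi> y j n (Z k) - \<Phi> y j (n + 1) (Z k) - \<Phi> y j (n - 1) (Z k))
         \<longlonglongrightarrow> q y E0 n * \<Phi> y j n E0 - \<Phi> y j (n + 1) E0 - \<Phi> y j (n - 1) E0"
        by (intro tendsto_intros lim Z(2))
      moreover have "(\<lambda>k. q y (Z k) n * \<Phi> y j n (Z k) - \<Phi> y j (n + 1) (Z k) - \<Phi> y j (n - 1) (Z k)) = (\<lambda>k. of_bool (n = j))"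
        unfolding \<Phi>K by (rule ext) (rule eqn)
      ultimately have "(\<lambda>k. of_bool (n = j)) \<longlonglongrightarrow> q y E0 n * \<Phi> y j n E0 - \<Phi> y j (n + 1) E0 - \<Phi> y j (n - 1) E0"
        by (simp only:)
      from LIMSEQ_unique[OF this tendsto_const]
      show "q y E0 n * \<Phi> y j n E0 - \<Phi> y j (n + 1) E0 - \<Phi> y j (n - 1) E0 = of_bool (n = j)" .
    qed
  qed
qed

end

section \<open>Few eigenvalues near an energy keep it out of the spectrum\<close>

lemma sum_int_nat: "(\<Sum>k\<in>{0..<int n}. f k) = (\<Sum>k<n. f (int k))"
  by (rule sum.reindex_bij_witness[of _ int nat]) auto

text \<open>For square matrices orthonormal rows give orthonormal columns.\<close>

lemma parseval_square:
  fixes M :: "nat \<Rightarrow> nat \<Rightarrow> real" and \<phi> :: "nat \<Rightarrow> complex"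
  assumes orth: "\<And>a b. a < n \<Longrightarrow> b < n \<Longrightarrow> (\<Sum>k<n. M a k * M b k) = of_bool (a = b)"
  shows "(\<Sum>a<n. (cmod (\<Sum>k<n. of_real (M a k) * \<phi> k))\<^sup>2) = (\<Sum>k<n. (cmod (\<phi> k))\<^sup>2)"
proof -
  define A where "A = Matrix.mat n n (\<lambda>(a, k). M a k)"
  define B where "B = Matrix.mat n n (\<lambda>(k, a). M a k)"
  have A: "A \<in> carrier_mat n n" and B: "B \<in> carrier_mat n n" by (auto simp: A_def B_def)
  have "A * B = 1\<^sub>m n"
  proof (rule eq_matI)
    fix i j assume "i < dim_row (1\<^sub>m n :: real Matrix.mat)" "j < dim_col (1\<^sub>m n :: real Matrix.mat)"
    then have ij: "i < n" "j < n" by auto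
    have "(A * B) $$ (i, j) = (\<Sum>k = 0..<n. M i k * M j k)"
      using ij by (simp add: A_def B_def scalar_prod_def)
    then show "(A * B) $$ (i, j) = 1\<^sub>m n $$ (i, j)" using orth[OF ij] ij by (simp add: atLeast0LessThan)
  qed (auto simp: A_def B_def)
  then have BA: "B * A = 1\<^sub>m n" by (rule mat_mult_left_right_inverse[OF A B])
  have col: "(\<Sum>a<n. M a k * M a l) = of_bool (k = l)" if kl: "k < n" "l < n" for k l
  proof -
    have "(B * A) $$ (k, l) = (\<Sum>a = 0..<n. M a k * M a l)"
      using kl by (simp add: A_def B_def scalar_prod_def)
    then show ?thesis using kl unfolding BA by (auto simp: atLeast0LessThan)
  qed
  have "complex_of_real (\<Sum>a<n. (cmod (\<Sum>k<n. of_real (M a k) * \<phi> k))\<^sup>2)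
      = (\<Sum>a<n. (\<Sum>k<n. of_real (M a k) * \<phi> k) * (\<Sum>l<n. of_real (M a l) * cnj (\<phi> l)))"
    by (simp add: complex_norm_square cnj_sum del: of_real_power)
  also have "\<dots> = (\<Sum>a<n. \<Sum>k<n. \<Sum>l<n. of_real (M a k * M a l) * (\<phi> k * cnj (\<phi> l)))"
    by (simp add: sum_product algebra_simps)
  also have "\<dots> = (\<Sum>k<n. \<Sum>a<n. \<Sum>l<n. of_real (M a k * M a l) * (\<phi> k * cnj (\<phi> l)))" by (rule sum.swap)
  also have "\<dots> = (\<Sum>k<n. \<Sum>l<n. \<Sum>a<n. of_real (M a k * M a l) * (\<phi> k * cnj (\<phi> l)))"
    by (intro sum.cong refl sum.swap)
  also have "\<dots> = (\<Sum>k<n. \<Sum>l<n. of_real (\<Sum>a<n. M a k * M a l) * (\<phi> k * cnj (\<phi> l)))"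
    by (simp add: sum_distrib_right del: of_real_mult)
  also have "\<dots> = (\<Sum>k<n. \<Sum>l<n. if k = l then \<phi> k * cnj (\<phi> l) else 0)"
    by (intro sum.cong refl) (simp add: col)
  also have "\<dots> = (\<Sum>k<n. \<phi> k * cnj (\<phi> k))" by simp
  also have "\<dots> = complex_of_real (\<Sum>k<n. (cmod (\<phi> k))\<^sup>2)"
    by (simp add: complex_norm_square del: of_real_power)
  finally show ?thesis unfolding of_real_eq_iff .
qed

lemma sum_shift_supported:
  fixes U \<phi> :: "int \<Rightarrow> complex"
  assumes "\<And>k. k \<notin> {0..<N} \<Longrightarrow> U k = 0" "\<And>k. k \<notin> {0..<N} \<Longrightarrow> \<phi> k = 0"
  shows "(\<Sum>k\<in>{0..<N}. U k * \<phi> (k + 1)) = (\<Sum>k\<in>{0..<N}. U (k - 1) * \<phi> k)"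
proof (rule sum.reindex_bij_witness_not_neutral[where S' = "{N - 1}" and T' = "{0}" and i = "\<lambda>k. k - 1" and j = "\<lambda>k. k + 1"])
qed (use assms in auto)

lemma hn_op_symmetric:
  assumes U: "\<And>k. k \<notin> {0..<N} \<Longrightarrow> U k = 0" and \<phi>: "\<And>k. k \<notin> {0..<N} \<Longrightarrow> \<phi> k = 0"
  shows "(\<Sum>k\<in>{0..<N}. U k * hn_op 0 q \<phi> k) = (\<Sum>k\<in>{0..<N}. hn_op 0 q U k * \<phi> k)"
proof -
  have "(\<Sum>k\<in>{0..<N}. U k * hn_op 0 q \<phi> k) = (\<Sum>k\<in>{0..<N}. q k * U k * \<phi> k)
      - (\<Sum>k\<in>{0..<N}. U k * \<phi> (k + 1)) - (\<Sum>k\<in>{0..<N}. U k * \<phi> (k - 1))"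
    unfolding hn_op_0 sum_subtractf[symmetric] by (rule sum.cong) (auto simp: algebra_simps)
  moreover have "(\<Sum>k\<in>{0..<N}. hn_op 0 q U k * \<phi> k) = (\<Sum>k\<in>{0..<N}. q k * U k * \<phi> k)
      - (\<Sum>k\<in>{0..<N}. \<phi> k * U (k + 1)) - (\<Sum>k\<in>{0..<N}. U (k - 1) * \<phi> k)"
    unfolding hn_op_0 sum_subtractf[symmetric] by (rule sum.cong) (auto simp: algebra_simps)
  moreover have "(\<Sum>k\<in>{0..<N}. U k * \<phi> (k + 1)) = (\<Sum>k\<in>{0..<N}. U (k - 1) * \<phi> k)"
    by (rule sum_shift_supported[OF U \<phi>])
  moreover have "(\<Sum>k\<in>{0..<N}. \<phi> k * U (k + 1)) = (\<Sum>k\<in>{0..<N}. \<phi> (k - 1) * U k)"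
    by (rule sum_shift_supported[OF \<phi> U])
  ultimately show ?thesis by (simp add: mult.commute)
qed

text \<open>The solution of the difference equation at energy \<open>t\<close> with value 0 at site \<open>- 1\<close> and 1 at site 0, cut off
  outside of \<open>{0..<n}\<close>. It is an eigenvector of the Jacobi matrix when it would vanish at \<open>n\<close>, that is, when \<open>t\<close> is in
  \<open>jacobi_spectrum w 0 n\<close>.\<close>

definition truncated_solution :: "(int \<Rightarrow> real) \<Rightarrow> nat \<Rightarrow> real \<Rightarrow> int \<Rightarrow> real" where
  "truncated_solution w n t k = (if 0 \<le> k \<and> k < int n then Re (jacobi_det w (of_real t) 0 (nat k)) else 0)"

lemma of_real_truncated_solution:
  "of_real (truncated_solution w n t k) = (if 0 \<le> k \<and> k < int n then jacobi_det w (of_real t) 0 (nat k) else 0)"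
  using jacobi_det_real[of w t 0] by (auto simp: truncated_solution_def)

lemma truncated_solution_eigenvector:
  assumes t: "t \<in> jacobi_spectrum w 0 n" and k: "0 \<le> k" "k < int n"
  shows "hn_op 0 (\<lambda>k. of_real (w k) - of_real E) (\<lambda>k. of_real (truncated_solution w n t k)) k
    = of_real ((t - E) * truncated_solution w n t k)"
proof -
  let ?c = "\<lambda>m. jacobi_det w (of_real t) 0 m"
  let ?u = "\<lambda>k. complex_of_real (truncated_solution w n t k)"
  have zero: "?c n = 0" using t by (simp add: jacobi_spectrum_def)
  obtain m where m: "k = int m" using k(1) nonneg_int_cases by blast
  have up: "?u (k + 1) = ?c (Suc m)"
  proof (cases "Suc m = n")
    case False then show ?thesis using k m by (auto simp: of_real_truncated_solution nat_add_distrib)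
  next
    case True
    have "?u (k + 1) = 0" using k m True by (simp add: of_real_truncated_solution)
    then show ?thesis using zero True by simp
  qed
  have at: "?u k = ?c m" using k m by (simp add: of_real_truncated_solution)
  have "?u (k + 1) + ?u (k - 1) = (of_real (w k) - of_real t) * ?u k"
  proof (cases m)
    case 0
    then show ?thesis unfolding up at using m by (simp add: of_real_truncated_solution)
  next
    case (Suc l)
    have "?u (k - 1) = ?c l" using k m Suc by (simp add: of_real_truncated_solution)
    then show ?thesis unfolding up at Suc using m Suc by (simp add: algebra_simps)
  qed
  then have "?u (k + 1) = (of_real (w k) - of_real t) * ?u k - ?u (k - 1)" by (simp add: algebra_simps)
  then show ?thesis unfolding hn_op_0 by (simp add: algebra_simps)
qed

lemma truncated_solution_outside: "k \<notin> {0..<int n} \<Longrightarrow> truncated_solution w n t k = 0"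
  by (auto simp: truncated_solution_def)

text \<open>Eigenvectors of a symmetric matrix with different eigenvalues; as there are \<open>n\<close> different eigenvalues, they form an
  orthogonal basis.\<close>

lemma truncated_solution_orthogonal:
  assumes t: "t \<in> jacobi_spectrum w 0 n" and s: "s \<in> jacobi_spectrum w 0 n" and ts: "t \<noteq> s"
  shows "(\<Sum>k<n. truncated_solution w n t (int k) * truncated_solution w n s (int k)) = 0"
proof -
  let ?t = "\<lambda>k. complex_of_real (truncated_solution w n t k)" and ?s = "\<lambda>k. complex_of_real (truncated_solution w n s k)"
  let ?q = "\<lambda>k. complex_of_real (w k) - of_real 0"
  let ?S = "\<Sum>k\<in>{0..<int n}. truncated_solution w n t k * truncated_solution w n s k"
  have "(\<Sum>k\<in>{0..<int n}. ?t k * hn_op 0 ?q ?s k) = (\<Sum>k\<in>{0..<int n}. hn_op 0 ?q ?t k * ?s k)"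
    by (rule hn_op_symmetric) (auto simp: truncated_solution_outside)
  moreover have "(\<Sum>k\<in>{0..<int n}. ?t k * hn_op 0 ?q ?s k) = of_real (s * ?S)"
    unfolding sum_distrib_left of_real_sum
    by (rule sum.cong) (auto simp: truncated_solution_eigenvector[OF s] simp del: of_real_0)
  moreover have "(\<Sum>k\<in>{0..<int n}. hn_op 0 ?q ?t k * ?s k) = of_real (t * ?S)"
    unfolding sum_distrib_left of_real_sum
    by (rule sum.cong) (auto simp: truncated_solution_eigenvector[OF t] simp del: of_real_0)
  ultimately have "s * ?S = t * ?S" by (metis of_real_eq_iff)
  then have "?S = 0" using ts by simp
  then show ?thesis unfolding sum_int_nat .
qed

lemma truncated_solution_norm_pos:
  assumes "n > 0" shows "(\<Sum>k<n. (truncated_solution w n t (int k))\<^sup>2) > 0"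
proof (rule sum_pos2[of _ 0])
  show "(truncated_solution w n t (int 0))\<^sup>2 > 0" using assms by (simp add: truncated_solution_def)
qed (use assms in auto)

lemma cmod_sum_mult_squared_le:
  "(cmod (\<Sum>k\<in>S. of_real (a k) * \<phi> k))\<^sup>2 \<le> (\<Sum>k\<in>S. (a k)\<^sup>2) * (\<Sum>k\<in>S. (cmod (\<phi> k))\<^sup>2)"
proof -
  have "cmod (\<Sum>k\<in>S. of_real (a k) * \<phi> k) \<le> (\<Sum>k\<in>S. \<bar>a k\<bar> * cmod (\<phi> k))"
    by (rule order_trans[OF norm_sum]) (simp add: norm_mult)
  then have "(cmod (\<Sum>k\<in>S. of_real (a k) * \<phi> k))\<^sup>2 \<le> (\<Sum>k\<in>S. \<bar>a k\<bar> * cmod (\<phi> k))\<^sup>2"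
    by (intro power_mono) auto
  also have "\<dots> \<le> (\<Sum>k\<in>S. \<bar>a k\<bar>\<^sup>2) * (\<Sum>k\<in>S. (cmod (\<phi> k))\<^sup>2)" by (rule Cauchy_Schwarz_ineq_sum)
  finally show ?thesis by simp
qed

text \<open>Each bump \<open>\<phi> i\<close> has at least half of its mass in the eigenspaces within \<open>r\<close> of \<open>E\<close>, as \<open>J - E\<close> would enlarge
  the remaining part by \<open>r\<close>. Bumps with disjoint supports are orthogonal, so by Bessel's inequality each eigenvector takes
  up at most one unit of their total mass.\<close>

lemma disjoint_bumps_force_eigenvalues:
  fixes \<phi> :: "nat \<Rightarrow> int \<Rightarrow> complex" and S :: "nat \<Rightarrow> int set"
  assumes r: "r > 0"
    and S: "\<And>i. i < m \<Longrightarrow> S i \<subseteq> {0..<int n}"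
    and disj: "\<And>i j. i < m \<Longrightarrow> j < m \<Longrightarrow> i \<noteq> j \<Longrightarrow> S i \<inter> S j = {}"
    and supp: "\<And>i k. i < m \<Longrightarrow> \<phi> i k \<noteq> 0 \<Longrightarrow> {k - 1, k, k + 1} \<subseteq> S i"
    and pos: "\<And>i. i < m \<Longrightarrow> (\<Sum>k\<in>S i. (cmod (\<phi> i k))\<^sup>2) > 0"
    and small: "\<And>i. i < m \<Longrightarrow> (\<Sum>k\<in>S i. (cmod (hn_op 0 (\<lambda>k. of_real (w k) - of_real E) (\<phi> i) k))\<^sup>2)
       \<le> r\<^sup>2 / 2 * (\<Sum>k\<in>S i. (cmod (\<phi> i k))\<^sup>2)"
  shows "m \<le> 2 * card {t\<in>jacobi_spectrum w 0 n. \<bar>t - E\<bar> < r}"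
proof (cases "n = 0")
  case True
  have "m = 0"
  proof (rule ccontr)
    assume "m \<noteq> 0"
    then have "S 0 = {}" using S[of 0] True by simp
    then show False using pos[of 0] \<open>m \<noteq> 0\<close> by simp
  qed
  then show ?thesis by simp
next
  case False
  let ?\<sigma> = "jacobi_spectrum w 0 n" and ?I = "{0..<int n}"
  let ?near = "{t\<in>?\<sigma>. \<bar>t - E\<bar> < r}"
  let ?H = "hn_op 0 (\<lambda>k. of_real (w k) - of_real E)"
  define e where "e t k = truncated_solution w n t k / sqrt (\<Sum>k<n. (truncated_solution w n t (int k))\<^sup>2)" for t k
  define c where "c t \<psi> = (\<Sum>k\<in>?I. of_real (e t k) * \<psi> k)" for t and \<psi> :: "int \<Rightarrow> complex"
  obtain rt where rt: "bij_betw rt {..<n} ?\<sigma>"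
    using ex_bij_betw_nat_finite[OF finite_jacobi_spectrum, of w 0 n]
    unfolding card_jacobi_spectrum by (auto simp: atLeast0LessThan)
  have orth: "(\<Sum>k<n. e t (int k) * e s (int k)) = of_bool (t = s)" if ts: "t \<in> ?\<sigma>" "s \<in> ?\<sigma>" for t s
  proof (cases "t = s")
    case True
    have "(\<Sum>k<n. e t (int k) * e s (int k)) = (\<Sum>k<n. (truncated_solution w n t (int k))\<^sup>2) / (\<Sum>k<n. (truncated_solution w n t (int k))\<^sup>2)"
      unfolding sum_divide_distrib True e_def times_divide_times_eq power2_eq_square[symmetric]
      by (rule sum.cong) (simp_all add: sum_nonneg power_divide)
    then show ?thesis using truncated_solution_norm_pos[of n w t] False True by simp
  next
    case F: False
    have "(\<Sum>k<n. e t (int k) * e s (int k))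
        = (\<Sum>k<n. truncated_solution w n t (int k) * truncated_solution w n s (int k)) / (sqrt (\<Sum>k<n. (truncated_solution w n t (int k))\<^sup>2) * sqrt (\<Sum>k<n. (truncated_solution w n s (int k))\<^sup>2))"
      unfolding e_def times_divide_times_eq sum_divide_distrib ..
    then show ?thesis using truncated_solution_orthogonal[OF ts F] F by simp
  qed
  have parseval: "(\<Sum>t\<in>?\<sigma>. (cmod (c t \<psi>))\<^sup>2) = (\<Sum>k\<in>?I. (cmod (\<psi> k))\<^sup>2)" for \<psi>
  proof -
    have "(\<Sum>t\<in>?\<sigma>. (cmod (c t \<psi>))\<^sup>2) = (\<Sum>a<n. (cmod (\<Sum>k<n. of_real (e (rt a) (int k)) * \<psi> (int k)))\<^sup>2)"
      unfolding sum.reindex_bij_betw[OF rt, symmetric] c_def sum_int_nat ..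
    also have "\<dots> = (\<Sum>k<n. (cmod (\<psi> (int k)))\<^sup>2)"
    proof (rule parseval_square)
      fix a b assume "a < n" "b < n"
      then show "(\<Sum>k<n. e (rt a) (int k) * e (rt b) (int k)) = of_bool (a = b)"
        using orth[of "rt a" "rt b"] bij_betwE[OF rt] bij_betw_imp_inj_on[OF rt] by (simp add: inj_on_eq_iff)
    qed
    finally show ?thesis unfolding sum_int_nat .
  qed
  have restrict: "(\<Sum>k\<in>?I. f k) = (\<Sum>k\<in>S i. f k)" if "i < m" "\<And>k. k \<notin> S i \<Longrightarrow> f k = 0" for i and f :: "int \<Rightarrow> real"
    by (rule sum.mono_neutral_right) (use S that in auto)
  have near_i: "(\<Sum>t\<in>?near. (cmod (c t (\<phi> i)))\<^sup>2) \<ge> 1 / 2 * (\<Sum>k\<in>S i. (cmod (\<phi> i k))\<^sup>2)" if i: "i < m" for i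
  proof -
    let ?N = "\<Sum>k\<in>S i. (cmod (\<phi> i k))\<^sup>2"
    have out: "\<phi> i k = 0" "?H (\<phi> i) k = 0" if "k \<notin> S i" for k
      using hn_op_outside[of "\<phi> i" "S i" k] supp[OF i] that by auto
    have coef: "c t (?H (\<phi> i)) = of_real (t - E) * c t (\<phi> i)" if t: "t \<in> ?\<sigma>" for t
    proof -
      let ?v = "\<lambda>k. complex_of_real (truncated_solution w n t k)"
      let ?z = "complex_of_real (sqrt (\<Sum>k<n. (truncated_solution w n t (int k))\<^sup>2))"
      have "(\<Sum>k\<in>?I. ?v k * ?H (\<phi> i) k) = (\<Sum>k\<in>?I. ?H ?v k * \<phi> i k)"
        by (rule hn_op_symmetric) (use S[OF i] in \<open>auto simp: truncated_solution_outside intro!: out(1)\<close>)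
      also have "\<dots> = of_real (t - E) * (\<Sum>k\<in>?I. ?v k * \<phi> i k)"
        unfolding sum_distrib_left by (rule sum.cong) (simp_all add: truncated_solution_eigenvector[OF t] mult.assoc)
      finally have *: "(\<Sum>k\<in>?I. ?v k * ?H (\<phi> i) k) / ?z = of_real (t - E) * ((\<Sum>k\<in>?I. ?v k * \<phi> i k) / ?z)" by simp
      have "c t \<psi> = (\<Sum>k\<in>?I. ?v k * \<psi> k) / ?z" for \<psi>
        unfolding c_def e_def sum_divide_distrib by (simp add: field_simps)
      then show ?thesis using * by simp
    qed
    have "r\<^sup>2 * (\<Sum>t\<in>?\<sigma> - ?near. (cmod (c t (\<phi> i)))\<^sup>2) \<le> (\<Sum>t\<in>?\<sigma> - ?near. (cmod (c t (?H (\<phi> i))))\<^sup>2)"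
      unfolding sum_distrib_left
    proof (rule sum_mono)
      fix t assume t: "t \<in> ?\<sigma> - ?near"
      have "r\<^sup>2 \<le> \<bar>t - E\<bar>\<^sup>2" using t r by (intro power_mono) auto
      then have "r\<^sup>2 * (cmod (c t (\<phi> i)))\<^sup>2 \<le> \<bar>t - E\<bar>\<^sup>2 * (cmod (c t (\<phi> i)))\<^sup>2" by (rule mult_right_mono) simp
      also have "\<dots> = (cmod (c t (?H (\<phi> i))))\<^sup>2"
        using coef[of t] t by (simp only: norm_mult norm_of_real power_mult_distrib DiffD1)
      finally show "r\<^sup>2 * (cmod (c t (\<phi> i)))\<^sup>2 \<le> (cmod (c t (?H (\<phi> i))))\<^sup>2" .
    qed
    also have "\<dots> \<le> (\<Sum>t\<in>?\<sigma>. (cmod (c t (?H (\<phi> i))))\<^sup>2)"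
      by (rule sum_mono2) (auto simp: finite_jacobi_spectrum)
    also have "\<dots> = (\<Sum>k\<in>S i. (cmod (?H (\<phi> i) k))\<^sup>2)"
      unfolding parseval by (rule restrict[OF i]) (simp add: out)
    also have "\<dots> \<le> r\<^sup>2 / 2 * ?N" by (rule small[OF i])
    finally have "r\<^sup>2 * (\<Sum>t\<in>?\<sigma> - ?near. (cmod (c t (\<phi> i)))\<^sup>2) \<le> r\<^sup>2 * (?N / 2)" by simp
    then have far: "(\<Sum>t\<in>?\<sigma> - ?near. (cmod (c t (\<phi> i)))\<^sup>2) \<le> ?N / 2"
      using r by (simp only: mult_le_cancel_left_pos zero_less_power)
    have "(\<Sum>t\<in>?\<sigma>. (cmod (c t (\<phi> i)))\<^sup>2) = ?N"
      unfolding parseval by (rule restrict[OF i]) (simp add: out)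
    moreover have "(\<Sum>t\<in>?\<sigma>. (cmod (c t (\<phi> i)))\<^sup>2) = (\<Sum>t\<in>?\<sigma> - ?near. (cmod (c t (\<phi> i)))\<^sup>2) + (\<Sum>t\<in>?near. (cmod (c t (\<phi> i)))\<^sup>2)"
      by (rule sum.subset_diff) (auto simp: finite_jacobi_spectrum)
    ultimately show ?thesis using far by linarith
  qed
  have bessel: "(\<Sum>i<m. (cmod (c t (\<phi> i)))\<^sup>2 / (\<Sum>k\<in>S i. (cmod (\<phi> i k))\<^sup>2)) \<le> 1" if t: "t \<in> ?\<sigma>" for t
  proof -
    have fin: "finite (S i)" if "i < m" for i using S[OF that] finite_subset by blast
    have "(cmod (c t (\<phi> i)))\<^sup>2 / (\<Sum>k\<in>S i. (cmod (\<phi> i k))\<^sup>2) \<le> (\<Sum>k\<in>S i. (e t k)\<^sup>2)" if i: "i < m" for i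
    proof -
      have out: "\<phi> i k = 0" if "k \<notin> S i" for k using supp[OF i, of k] that by auto
      have "c t (\<phi> i) = (\<Sum>k\<in>S i. of_real (e t k) * \<phi> i k)"
        unfolding c_def by (rule sum.mono_neutral_right) (use S[OF i] out in auto)
      then show ?thesis using cmod_sum_mult_squared_le[of "e t" "\<phi> i" "S i"] pos[OF i]
        by (simp add: pos_divide_le_eq)
    qed
    then have "(\<Sum>i<m. (cmod (c t (\<phi> i)))\<^sup>2 / (\<Sum>k\<in>S i. (cmod (\<phi> i k))\<^sup>2)) \<le> (\<Sum>i<m. \<Sum>k\<in>S i. (e t k)\<^sup>2)"
      by (intro sum_mono) auto
    also have "\<dots> = (\<Sum>k\<in>(\<Union>i<m. S i). (e t k)\<^sup>2)"
      by (rule sum.UNION_disjoint[symmetric]) (use fin disj in auto)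
    also have "\<dots> \<le> (\<Sum>k\<in>?I. (e t k)\<^sup>2)" by (rule sum_mono2) (use S in auto)
    also have "\<dots> = 1" using orth[OF t t] unfolding sum_int_nat by (simp add: power2_eq_square)
    finally show ?thesis .
  qed
  have "real m / 2 = (\<Sum>i<m. 1 / 2)" by simp
  also have "\<dots> \<le> (\<Sum>i<m. \<Sum>t\<in>?near. (cmod (c t (\<phi> i)))\<^sup>2 / (\<Sum>k\<in>S i. (cmod (\<phi> i k))\<^sup>2))"
  proof (rule sum_mono)
    fix i assume "i \<in> {..<m}"
    then show "1 / 2 \<le> (\<Sum>t\<in>?near. (cmod (c t (\<phi> i)))\<^sup>2 / (\<Sum>k\<in>S i. (cmod (\<phi> i k))\<^sup>2))"
      using near_i[of i] pos[of i] unfolding sum_divide_distrib[symmetric] by (simp add: pos_le_divide_eq)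
  qed
  also have "\<dots> = (\<Sum>t\<in>?near. \<Sum>i<m. (cmod (c t (\<phi> i)))\<^sup>2 / (\<Sum>k\<in>S i. (cmod (\<phi> i k))\<^sup>2))" by (rule sum.swap)
  also have "\<dots> \<le> (\<Sum>t\<in>?near. 1)" by (rule sum_mono) (use bessel in auto)
  finally have "real m \<le> real (2 * card ?near)" by simp
  then show ?thesis by (simp only: of_nat_le_iff)
qed

context strictly_ergodic_potential
begin

text \<open>A test sequence violating the bound at \<open>x\<close> violates it on a neighbourhood \<open>W\<close> of \<open>x\<close>. The orbit returns to \<open>W\<close>
  with bounded gaps, so translates of the sequence supply on the order of \<open>n\<close> disjoint bumps in \<open>{0..<n}\<close> and hence as
  many eigenvalues near \<open>E\<close>.\<close>

theorem lower_bound_of_sparse_spectrum: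
  assumes r: "r > 0"
    and sparse: "\<And>\<eta>. \<eta> > 0 \<Longrightarrow>
      \<forall>\<^sub>F n in sequentially. real (card {t\<in>jacobi_spectrum (w x) 0 n. \<bar>t - E\<bar> < r}) \<le> \<eta> * real n"
  shows "lower_bound (r\<^sup>2 / 2) 0 (q x (of_real E))"
proof (rule ccontr)
  assume "\<not> ?thesis"
  then obtain u A where A: "finite A" "\<And>k. u k \<noteq> 0 \<Longrightarrow> {k - 1, k, k + 1} \<subseteq> A"
    and lt: "(\<Sum>k\<in>A. (cmod (hn_op 0 (q x (of_real E)) u k))\<^sup>2) < r\<^sup>2 / 2 * (\<Sum>k\<in>A. (cmod (u k))\<^sup>2)"
    unfolding lower_bound_def not_all not_imp not_le by blast
  define F where "F y = (\<Sum>k\<in>A. (cmod (hn_op 0 (q y (of_real E)) u k))\<^sup>2)" for y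
  let ?N = "\<Sum>k\<in>A. (cmod (u k))\<^sup>2"
  define W where "W = {y. F y < r\<^sup>2 / 2 * ?N}"
  have "continuous_on UNIV F" unfolding F_def hn_op_def by (intro continuous_intros w_cont)
  then have "open W" unfolding W_def by (intro open_Collect_less continuous_on_const)
  moreover have "W \<noteq> {}" using lt unfolding W_def F_def by blast
  ultimately obtain B where B: "\<And>y. \<exists>n\<le>B. (T ^^ n) y \<in> W" by (rule minimal_syndetic_returns[OF comp homeo minimal]) blast
  have Npos: "?N > 0"
  proof -
    have "0 \<le> (\<Sum>k\<in>A. (cmod (hn_op 0 (q x (of_real E)) u k))\<^sup>2)" by (intro sum_nonneg) auto
    then have "0 < r\<^sup>2 / 2 * ?N" using lt by linarith
    then show ?thesis using r by (simp only: zero_less_mult_iff) (auto simp: not_less)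
  qed
  obtain M where M: "A \<subseteq> {- int M..int M}"
  proof -
    have "\<bar>k\<bar> \<le> (\<Sum>j\<in>A. \<bar>j\<bar>)" if "k \<in> A" for k using A(1) that by (intro member_le_sum) auto
    then have "A \<subseteq> {- int (nat (\<Sum>j\<in>A. \<bar>j\<bar>))..int (nat (\<Sum>j\<in>A. \<bar>j\<bar>))}" by force
    then show ?thesis by (rule that)
  qed
  (* a block of length L has room for a return within B steps and for a translate of {- M..M} *)
  define L where "L = B + 2 * M + 1"
  have "\<exists>n'\<le>B. (T ^^ n') ((T ^^ (i * L + M)) x) \<in> W" for i by (rule B)
  then obtain h where h: "\<And>i. h i \<le> B" "\<And>i. (T ^^ h i) ((T ^^ (i * L + M)) x) \<in> W" by metis
  define s where "s i = int (i * L + M + h i)" for i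
  define S where "S i = (\<lambda>k. k + s i) ` A" for i
  have sW: "int_iter T (s i) x \<in> W" for i
  proof -
    have "(T ^^ (h i + (i * L + M))) x \<in> W" using h(2)[of i] by (simp only: funpow_add o_apply)
    then show ?thesis by (simp add: s_def int_iter_of_nat[OF bij] add.commute add.left_commute del: of_nat_add)
  qed
  have range: "k \<in> {int (i * L)..<int (i * L) + int L}" if k: "k \<in> S i" for i k
  proof -
    obtain l where "l \<in> A" "k = l + s i" using k unfolding S_def by blast
    then show ?thesis using M h(1)[of i] unfolding s_def L_def by auto
  qed
  have disj: "S i \<inter> S j = {}" if "i \<noteq> j" for i j
  proof -
    have "False" if ij: "i < j" and k: "k \<in> S i" "k \<in> S j" for i j k
    proof -
      have "Suc i * L \<le> j * L" using ij by (intro mult_right_mono) auto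
      then have "int (i * L) + int L \<le> int (j * L)" by (simp only: mult_Suc of_nat_add[symmetric] of_nat_le_iff add.commute)
      then show False using range[OF k(1)] range[OF k(2)] by simp
    qed
    then show ?thesis using \<open>i \<noteq> j\<close> by (meson disjoint_iff linorder_neqE_nat)
  qed
  have inj: "inj_on (\<lambda>k. k + s i) A" for i by (simp add: inj_on_def)
  have count: "n div L \<le> 2 * card {t\<in>jacobi_spectrum (w x) 0 n. \<bar>t - E\<bar> < r}" for n
  proof (rule disjoint_bumps_force_eigenvalues[where S = S and \<phi> = "\<lambda>i k. u (k - s i)"])
    fix i assume i: "i < n div L"
    show "S i \<subseteq> {0..<int n}"
    proof
      fix k assume "k \<in> S i"
      from range[OF this] have k: "int (i * L) \<le> k" "k < int (i * L) + int L" by auto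
      have "Suc i * L \<le> n div L * L" using i by (intro mult_right_mono) auto
      also have "\<dots> \<le> n" by simp
      finally have "int (i * L) + int L \<le> int n" by (simp only: mult_Suc of_nat_add[symmetric] of_nat_le_iff add.commute)
      moreover have "0 \<le> int (i * L)" by (rule of_nat_0_le_iff)
      ultimately show "k \<in> {0..<int n}" using k unfolding atLeastLessThan_iff by linarith
    qed
    show "{k - 1, k, k + 1} \<subseteq> S i" if "u (k - s i) \<noteq> 0" for k
    proof -
      have "(k - s i) + s i \<in> S i" "(k - s i - 1) + s i \<in> S i" "(k - s i + 1) + s i \<in> S i"
        using A(2)[OF that] unfolding S_def by (blast intro: imageI)+
      then show ?thesis by (simp add: algebra_simps)
    qed
    have norm: "(\<Sum>k\<in>S i. (cmod (u (k - s i)))\<^sup>2) = ?N"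
      unfolding S_def by (subst sum.reindex[OF inj]) simp
    then show "0 < (\<Sum>k\<in>S i. (cmod (u (k - s i)))\<^sup>2)" using Npos by simp
    have "(\<Sum>k\<in>S i. (cmod (hn_op 0 (q x (of_real E)) (\<lambda>k. u (k - s i)) k))\<^sup>2) = F (int_iter T (s i) x)"
      unfolding S_def F_def by (subst sum.reindex[OF inj]) (simp add: hn_op_shift w_shift)
    also have "\<dots> \<le> r\<^sup>2 / 2 * ?N" using sW[of i] unfolding W_def by simp
    finally show "(\<Sum>k\<in>S i. (cmod (hn_op 0 (q x (of_real E)) (\<lambda>k. u (k - s i)) k))\<^sup>2)
        \<le> r\<^sup>2 / 2 * (\<Sum>k\<in>S i. (cmod (u (k - s i)))\<^sup>2)" unfolding norm .
  qed (use r disj in auto)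
  have L: "L > 0" by (simp add: L_def)
  have "\<forall>\<^sub>F n in sequentially. real (card {t\<in>jacobi_spectrum (w x) 0 n. \<bar>t - E\<bar> < r}) \<le> 1 / (8 * real L) * real n"
    by (rule sparse) (use L in simp)
  moreover have "\<forall>\<^sub>F n in sequentially. n > 2 * L" by (rule eventually_gt_at_top)
  ultimately have "\<forall>\<^sub>F n in sequentially. False"
  proof eventually_elim
    case (elim n)
    have "real (n div L) \<le> real (2 * card {t\<in>jacobi_spectrum (w x) 0 n. \<bar>t - E\<bar> < r})"
      using count by (simp only: of_nat_le_iff)
    also have "\<dots> \<le> 2 * (1 / (8 * real L) * real n)" using elim(1) by simp
    also have "\<dots> = real n / real L / 4" by simp
    finally have "real (n div L) \<le> real n / real L / 4" .
    moreover have "real n / real L \<le> real (n div L) + 1"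
      using floor_divide_of_nat_eq[of n L, where ?'a = real] by linarith
    moreover have "real n / real L > 2" using elim(2) L by (simp add: pos_less_divide_eq flip: of_nat_mult)
    moreover have "False" if "a \<le> b / 4" "b \<le> a + 1" "2 < b" for a b :: real using that by argo
    ultimately show False by blast
  qed
  then show False by simp
qed

end

section \<open>Eigenvalue counting and growth\<close>

context strictly_ergodic_potential
begin

lemma growth_cnj: "growth (cnj E) = growth E"
  unfolding growth_def jacobi_det_cnj complex_mod_cnj ..

text \<open>Each eigenvalue within \<open>b\<close> of \<open>a\<close> contributes at least \<open>5 / 4\<close> to the ratio, since
  \<open>25 / 16 (s + b\<^sup>2 / 4) \<le> s + b\<^sup>2\<close> for \<open>0 \<le> s \<le> b\<^sup>2\<close>; every other factor is at least 1.\<close>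

lemma jacobi_count_vertical_ratio:
  assumes b: "b > 0"
  shows "(5 / 4) ^ card {t\<in>jacobi_spectrum u s n. \<bar>t - a\<bar> \<le> b} * cmod (jacobi_det u (Complex a (b / 2)) s n)
    \<le> cmod (jacobi_det u (Complex a b) s n)"
proof -
  let ?\<sigma> = "jacobi_spectrum u s n"
  have fin: "finite ?\<sigma>" by (rule finite_jacobi_spectrum)
  have "(\<Prod>t\<in>?\<sigma>. (if \<bar>t - a\<bar> \<le> b then 5 / 4 else 1) * cmod (of_real t - Complex a (b / 2)))
      \<le> (\<Prod>t\<in>?\<sigma>. cmod (of_real t - Complex a b))"
  proof (intro prod_mono conjI)
    fix t
    show "0 \<le> (if \<bar>t - a\<bar> \<le> b then 5 / 4 else 1) * cmod (of_real t - Complex a (b / 2))" by simp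
    show "(if \<bar>t - a\<bar> \<le> b then 5 / 4 else 1) * cmod (of_real t - Complex a (b / 2)) \<le> cmod (of_real t - Complex a b)"
    proof (rule power2_le_imp_le)
      have sq: "(t - a)\<^sup>2 \<le> b\<^sup>2" if "\<bar>t - a\<bar> \<le> b"
        using power_mono[OF that, of 2] by simp
      have "25 / 16 * ((t - a)\<^sup>2 + b\<^sup>2 / 4) \<le> (t - a)\<^sup>2 + b\<^sup>2" if "(t - a)\<^sup>2 \<le> b\<^sup>2"
        using that zero_le_power2[of b] by argo
      then show "((if \<bar>t - a\<bar> \<le> b then 5 / 4 else 1) * cmod (of_real t - Complex a (b / 2)))\<^sup>2 \<le> (cmod (of_real t - Complex a b))\<^sup>2"
        using sq by (auto simp: power_mult_distrib cmod_power2 power_divide)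
    qed simp
  qed
  moreover have "(\<Prod>t\<in>?\<sigma>. (if \<bar>t - a\<bar> \<le> b then 5 / 4 else 1 :: real)) = (5 / 4) ^ card {t\<in>?\<sigma>. \<bar>t - a\<bar> \<le> b}"
    by (subst prod.inter_filter[OF fin, symmetric]) simp
  ultimately show ?thesis unfolding prod.distrib cmod_jacobi_det by simp
qed

lemma eigenvalue_count_from_growth:
  assumes b: "b > 0" and K: "growth (Complex a b) \<le> growth (Complex a (b / 2)) + K"  and e: "\<epsilon> > 0"
  shows "\<forall>\<^sub>F n in sequentially. real (card {t\<in>jacobi_spectrum (w x) 0 n. \<bar>t - a\<bar> \<le> b}) * ln (5 / 4) \<le> (K + 2 * \<epsilon>) * real n"
proof -
  obtain n1 where n1: "\<forall>n\<ge>n1. \<forall>y. exp ((growth (Complex a b) - \<epsilon>) * real n) \<le> cmod (D y (Complex a b) 0 n) \<and>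
      cmod (D y (Complex a b) 0 n) \<le> exp ((growth (Complex a b) + \<epsilon>) * real n)"
    using growth_eventually[of "Complex a b" \<epsilon>] b e by auto
  obtain n2 where n2: "\<forall>n\<ge>n2. \<forall>y. exp ((growth (Complex a (b / 2)) - \<epsilon>) * real n) \<le> cmod (D y (Complex a (b / 2)) 0 n) \<and>
      cmod (D y (Complex a (b / 2)) 0 n) \<le> exp ((growth (Complex a (b / 2)) + \<epsilon>) * real n)"
    using growth_eventually[of "Complex a (b / 2)" \<epsilon>] b e by auto
  show ?thesis using eventually_ge_at_top[of n1] eventually_ge_at_top[of n2]
  proof eventually_elim
    case (elim n)
    let ?c = "card {t\<in>jacobi_spectrum (w x) 0 n. \<bar>t - a\<bar> \<le> b}"
    have "exp (real ?c * ln (5 / 4)) * exp ((growth (Complex a (b / 2)) - \<epsilon>) * real n)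
        = (5 / 4) ^ ?c * exp ((growth (Complex a (b / 2)) - \<epsilon>) * real n)"
      by (simp add: exp_of_nat_mult)
    also have "\<dots> \<le> (5 / 4) ^ ?c * cmod (D x (Complex a (b / 2)) 0 n)"
      using n2 elim by (intro mult_left_mono) auto
    also have "\<dots> \<le> cmod (D x (Complex a b) 0 n)" by (rule jacobi_count_vertical_ratio[OF b])
    also have "\<dots> \<le> exp ((growth (Complex a b) + \<epsilon>) * real n)" using n1 elim by blast
    finally have "real ?c * ln (5 / 4) + (growth (Complex a (b / 2)) - \<epsilon>) * real n \<le> (growth (Complex a b) + \<epsilon>) * real n"
      unfolding exp_add[symmetric] exp_le_cancel_iff .
    moreover have "(growth (Complex a b) + \<epsilon>) * real n \<le> (growth (Complex a (b / 2)) + K + \<epsilon>) * real n"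
      using K by (intro mult_right_mono) auto
    ultimately show ?case by (simp add: algebra_simps)
  qed
qed

text \<open>Quadratic dependence on \<open>b\<close> is what makes this work: an interval of length \<open>2 b\<close> holds at most a constant times \<open>b\<^sup>2 n\<close>
  eigenvalues, and about \<open>r / b\<close> such intervals cover \<open>{t. |t - E| < r}\<close>, which leaves a total of order \<open>r b n\<close> with
  \<open>b\<close> arbitrarily small.\<close>

lemma sparse_spectrum_near:
  assumes r: "r > 0" and h: "h > 0" and \<eta>: "\<eta> > 0" and K: "K \<ge> 0"
    and diff: "\<And>a b. \<bar>a - E\<bar> \<le> r \<Longrightarrow> 0 < b \<Longrightarrow> b \<le> h \<Longrightarrow> growth (Complex a b) \<le> growth (Complex a (b / 2)) + K * b\<^sup>2"
  shows "\<forall>\<^sub>F n in sequentially. real (card {t\<in>jacobi_spectrum (w x) 0 n. \<bar>t - E\<bar> < r}) \<le> \<eta> * real n"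
proof -
  define l :: real where "l = ln (5 / 4)"
  have l: "l > 0" by (simp add: l_def)
  obtain m :: nat where m: "real m > max (r / h) (2 * ((K + 2) * r\<^sup>2) / (\<eta> * l))" using reals_Archimedean2 by blast
  have "0 < r / h" using r h by simp
  then have m0: "real m > 0" using m by linarith
  then have mpos: "m > 0" by simp
  define b where "b = r / real m"
  have b: "b > 0" using r m0 by (simp add: b_def)
  have bh: "b \<le> h"
  proof -
    have "r / h < real m" using m by simp
    then show ?thesis using h m0 unfolding b_def by (simp add: field_simps)
  qed
  have mb: "real m * b = r" using m0 by (simp add: b_def)
  (* midpoints of intervals of length 2 b that cover the interval of radius r = m b *)
  define c where "c j = E - r + 2 * real j * b" for j :: nat
  have cr: "\<bar>c j - E\<bar> \<le> r" if j: "j \<le> m" for j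
  proof -
    have "real j * b \<le> r" unfolding mb[symmetric] using j b by (intro mult_right_mono) auto
    moreover have "0 \<le> real j * b" using b by simp
    ultimately show ?thesis unfolding c_def by (simp add: abs_le_iff mult.commute)
  qed
  have cover: "{t\<in>\<sigma>. \<bar>t - E\<bar> < r} \<subseteq> (\<Union>j\<le>m. {t\<in>\<sigma>. \<bar>t - c j\<bar> \<le> b})" for \<sigma> :: "real set"
  proof
    fix t assume t: "t \<in> {t\<in>\<sigma>. \<bar>t - E\<bar> < r}"
    define z where "z = (t - (E - r)) / (2 * b)"
    define j where "j = nat \<lfloor>z + 1 / 2\<rfloor>"
    have "0 \<le> t - (E - r)" using t by (auto simp: abs_less_iff)
    then have z0: "0 \<le> z" using b by (simp add: z_def)
    have "z < real m"
    proof -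
      have "t - (E - r) < 2 * (real m * b)" unfolding mb using t by (auto simp: abs_less_iff)
      then show ?thesis using b by (simp add: z_def pos_divide_less_eq mult.left_commute)
    qed
    then have "\<lfloor>z + 1 / 2\<rfloor> \<le> int m" by linarith
    then have "j \<le> m" by (simp add: j_def)
    moreover have jr: "real j = of_int \<lfloor>z + 1 / 2\<rfloor>" using z0 by (simp add: j_def)
    have "\<bar>z - real j\<bar> \<le> 1 / 2" unfolding jr by linarith
    then have "2 * b * \<bar>z - real j\<bar> \<le> 2 * b * (1 / 2)" using b by (intro mult_left_mono) auto
    then have "\<bar>2 * b * (z - real j)\<bar> \<le> b" using b by (simp add: abs_mult)
    moreover have "2 * b * (z - real j) = t - c j" using b by (simp add: z_def c_def field_simps)
    ultimately show "t \<in> (\<Union>j\<le>m. {t\<in>\<sigma>. \<bar>t - c j\<bar> \<le> b})" using t by auto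
  qed
  have "\<forall>\<^sub>F n in sequentially. real (card {t\<in>jacobi_spectrum (w x) 0 n. \<bar>t - c j\<bar> \<le> b}) * l \<le> (K * b\<^sup>2 + 2 * b\<^sup>2) * real n" if "j \<le> m" for j
    unfolding l_def using diff[OF cr[OF that] b bh] b by (intro eigenvalue_count_from_growth) auto
  then have "\<forall>\<^sub>F n in sequentially. \<forall>j\<in>{..m}. real (card {t\<in>jacobi_spectrum (w x) 0 n. \<bar>t - c j\<bar> \<le> b}) * l \<le> (K * b\<^sup>2 + 2 * b\<^sup>2) * real n"
    by (intro eventually_ball_finite) auto
  then show ?thesis
  proof eventually_elim
    case (elim n)
    let ?\<sigma> = "jacobi_spectrum (w x) 0 n"
    have "card {t\<in>?\<sigma>. \<bar>t - E\<bar> < r} \<le> card (\<Union>j\<le>m. {t\<in>?\<sigma>. \<bar>t - c j\<bar> \<le> b})"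
      by (rule card_mono[OF _ cover]) (auto simp: finite_jacobi_spectrum)
    also have "\<dots> \<le> (\<Sum>j\<le>m. card {t\<in>?\<sigma>. \<bar>t - c j\<bar> \<le> b})" by (rule card_UN_le) simp
    finally have "real (card {t\<in>?\<sigma>. \<bar>t - E\<bar> < r}) \<le> real (\<Sum>j\<le>m. card {t\<in>?\<sigma>. \<bar>t - c j\<bar> \<le> b})"
      by (simp only: of_nat_le_iff)
    then have "real (card {t\<in>?\<sigma>. \<bar>t - E\<bar> < r}) * l \<le> (\<Sum>j\<le>m. real (card {t\<in>?\<sigma>. \<bar>t - c j\<bar> \<le> b}) * l)"
      using l unfolding sum_distrib_right[symmetric] of_nat_sum by (intro mult_right_mono) auto
    also have "\<dots> \<le> (\<Sum>j\<le>m. (K * b\<^sup>2 + 2 * b\<^sup>2) * real n)" using elim by (intro sum_mono) auto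
    also have "\<dots> = real (Suc m) * ((K + 2) * b\<^sup>2 * real n)" by (simp add: algebra_simps)
    also have "\<dots> \<le> (2 * real m) * ((K + 2) * b\<^sup>2 * real n)"
      using mpos K by (intro mult_right_mono) auto
    also have "\<dots> = (2 * ((K + 2) * r\<^sup>2) / real m) * real n"
      using m0 unfolding b_def by (simp add: power2_eq_square field_simps)
    also have "\<dots> \<le> (\<eta> * l) * real n"
    proof (rule mult_right_mono)
      have "2 * ((K + 2) * r\<^sup>2) / (\<eta> * l) < real m" using m by simp
      then show "2 * ((K + 2) * r\<^sup>2) / real m \<le> \<eta> * l" using \<eta> l m0 by (simp add: field_simps)
    qed simp
    finally have "real (card {t\<in>?\<sigma>. \<bar>t - E\<bar> < r}) * l \<le> (\<eta> * real n) * l" by (simp only: mult_ac)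
    then show ?case using l by (simp only: mult_le_cancel_right_pos)
  qed
qed

lemma growth_strict_mono:
  assumes b: "\<bar>b\<bar> < \<bar>b'\<bar>" "b \<noteq> 0"
  shows "growth (Complex x b) < growth (Complex x b')"
proof -
  define R where "R = V + 2 + \<bar>x\<bar>"
  have R: "R > 0" using V_nonneg by (simp add: R_def add_nonneg_pos add_pos_nonneg)
  have b'0: "b' \<noteq> 0" using b by auto
  define s where "s = sqrt ((R\<^sup>2 + b\<^sup>2) / (R\<^sup>2 + b'\<^sup>2))"
  have pos: "R\<^sup>2 + b\<^sup>2 > 0" "R\<^sup>2 + b'\<^sup>2 > 0" using R by (auto intro: add_pos_nonneg)
  have "b\<^sup>2 < b'\<^sup>2" using power_strict_mono[OF b(1), of 2] by simp
  then have s: "0 < s" "s < 1" using pos by (auto simp: s_def)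
  define \<epsilon> where "\<epsilon> = - ln s / 4"
  have \<epsilon>: "\<epsilon> > 0" using s by (simp add: \<epsilon>_def)
  obtain n1 where n1: "\<forall>n\<ge>n1. \<forall>y. exp ((growth (Complex x b) - \<epsilon>) * real n) \<le> cmod (D y (Complex x b) 0 n) \<and>
      cmod (D y (Complex x b) 0 n) \<le> exp ((growth (Complex x b) + \<epsilon>) * real n)"
    using growth_eventually[of "Complex x b" \<epsilon>] b \<epsilon> by auto
  obtain n2 where n2: "\<forall>n\<ge>n2. \<forall>y. exp ((growth (Complex x b') - \<epsilon>) * real n) \<le> cmod (D y (Complex x b') 0 n) \<and>
      cmod (D y (Complex x b') 0 n) \<le> exp ((growth (Complex x b') + \<epsilon>) * real n)"
    using growth_eventually[of "Complex x b'" \<epsilon>] b'0 \<epsilon> by auto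
  define n where "n = Suc (max n1 n2)"
  have "exp ((growth (Complex x b) - \<epsilon>) * real n) \<le> cmod (D undefined (Complex x b) 0 n)"
    using n1 by (auto simp: n_def simp del: of_nat_Suc)
  also have "\<dots> \<le> s ^ n * cmod (D undefined (Complex x b') 0 n)"
    unfolding s_def by (rule jacobi_det_vertical_contraction[OF w_bound _ R_def b'0]) (use b in simp)
  also have "\<dots> \<le> s ^ n * exp ((growth (Complex x b') + \<epsilon>) * real n)"
    using n2 s by (intro mult_left_mono) (auto simp: n_def simp del: of_nat_Suc)
  also have "s ^ n = exp (- 4 * \<epsilon> * real n)"
    using s exp_of_nat_mult[of n "ln s"] by (simp add: \<epsilon>_def mult.commute)
  finally have "(growth (Complex x b) - \<epsilon>) * real n \<le> (- 4 * \<epsilon> + (growth (Complex x b') + \<epsilon>)) * real n"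
    unfolding exp_add[symmetric] exp_le_cancel_iff distrib_right .
  then have "growth (Complex x b) - \<epsilon> \<le> - 4 * \<epsilon> + (growth (Complex x b') + \<epsilon>)"
    by (rule mult_right_le_imp_le) (simp add: n_def)
  then show ?thesis using \<epsilon> by linarith
qed

text \<open>By \<open>continuant_casorati\<close>, \<open>D(1, n - 2) / D(0, n) = 1 / (z w) - 1 / D(0, n)\<^sup>2\<close> for a right ratio \<open>z\<close> and a left ratio \<open>w\<close>,
  and \<open>1 - 1 / (z w)\<close> is bounded away from 0.\<close>

lemma trace_lower_upper_half_plane:
  assumes E: "Im E > 0"
  shows "\<bar>Im E\<bar> / (V + cmod E + 1 / \<bar>Im E\<bar>) * cmod (D y E 0 (Suc (Suc n))) - 1 / cmod (D y E 0 (Suc (Suc n)))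
     \<le> cmod (D y E 0 (Suc (Suc n)) - D y E 1 n)"
proof -
  interpret L: lower_half_plane_potential "\<lambda>k. of_real (w y k) - E" "Im E" "V + cmod E" by (rule D_lower_half_plane[OF E])
  let ?D = "D y E 0 (Suc (Suc n))" and ?a = "D y E 0 (Suc n)" and ?b = "D y E 1 (Suc n)"
  have nz: "?D \<noteq> 0" "?a \<noteq> 0" "?b \<noteq> 0" using E D_nonzero[of E] by (simp_all del: continuant.simps)
  have z: "Im (?D / ?a) \<le> - Im E" using L.right_ratio[of 0 "Suc n"] by blast
  have w: "Im (?D / ?b) \<le> - Im E" using L.left_ratio[of 0 "Suc n"] by (simp del: continuant.simps)
  have "cmod (?D / ?a) \<le> V + cmod E + 1 / Im E"
    using L.right_ratio_upper[of 0 "Suc n"] nz by (simp add: norm_divide pos_divide_le_eq del: continuant.simps)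
  from L.one_minus_inverse_product_bound[OF z w this]
  have lo: "Im E / (V + cmod E + 1 / Im E) \<le> cmod (1 - 1 / (?D / ?a * (?D / ?b)))" .
  have cas: "?a * ?b - ?D * D y E 1 n = 1"
    using continuant_casorati[of "\<lambda>k. of_real (w y k) - E" 0 n] by (simp del: continuant.simps)
  have "d - x = d * (1 - 1 / (d / a * (d / b))) + 1 / d" if "a * b - d * x = 1" "d \<noteq> 0" "a \<noteq> 0" "b \<noteq> 0" for a b d x :: complex
  proof -
    have "d * (1 / (d / a * (d / b))) = a * b / d" using that by simp
    moreover have "a * b = 1 + d * x" using that(1) by (simp add: algebra_simps)
    ultimately have "d * (1 / (d / a * (d / b))) = 1 / d + x" using that(2) by (simp add: add_divide_distrib)
    then show ?thesis by (simp add: right_diff_distrib)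
  qed
  from this[OF cas nz] have eq: "?D - D y E 1 n = ?D * (1 - 1 / (?D / ?a * (?D / ?b))) + 1 / ?D" .
  have "Im E / (V + cmod E + 1 / Im E) * cmod ?D \<le> cmod (1 - 1 / (?D / ?a * (?D / ?b))) * cmod ?D"
    by (rule mult_right_mono[OF lo]) simp
  also have "\<dots> = cmod (?D * (1 - 1 / (?D / ?a * (?D / ?b))))" by (simp only: norm_mult mult.commute)
  also have "\<dots> \<le> cmod (?D - D y E 1 n) + cmod (1 / ?D)"
    unfolding eq using norm_triangle_ineq4[of "?D * (1 - 1 / (?D / ?a * (?D / ?b))) + 1 / ?D" "1 / ?D"]
    by (simp only: add_diff_cancel_right')
  finally have "Im E / (V + cmod E + 1 / Im E) * cmod ?D \<le> cmod (?D - D y E 1 n) + 1 / cmod ?D"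
    by (simp only: norm_divide norm_one)
  then show ?thesis unfolding diff_le_eq abs_of_pos[OF E] .
qed

lemma trace_lower:
  assumes E: "Im E \<noteq> 0"
  shows "\<bar>Im E\<bar> / (V + cmod E + 1 / \<bar>Im E\<bar>) * cmod (D y E 0 (Suc (Suc n))) - 1 / cmod (D y E 0 (Suc (Suc n)))
     \<le> cmod (D y E 0 (Suc (Suc n)) - D y E 1 n)"
proof (cases "Im E > 0")
  case False
  then have "Im (cnj E) > 0" using E by simp
  from trace_lower_upper_half_plane[OF this, of y n] show ?thesis
    unfolding jacobi_det_cnj complex_cnj_diff[symmetric] complex_mod_cnj by simp
qed (rule trace_lower_upper_half_plane)

text \<open>The Volterra kernel built from the solution that starts at \<open>j\<close> is a two-sided inverse of the operator with \<open>g = 0\<close>.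
  As a function of \<open>i\<close> it vanishes for \<open>i \<le> j\<close> and grows for \<open>i > j\<close>, where the gauge factor \<open>exp (- g (i - j))\<close>
  beats the growth.\<close>

lemma resolvent_if_growth_below_gauge:
  assumes bound: "\<And>n a. cmod (D y E a n) \<le> C * exp ((g - \<delta>) * real n)" and C: "C > 0" and \<delta>: "\<delta> > 0"
  shows "E \<in> resolvent_set_ell2 (hatano_nelson T v g y)"
proof -
  define K where "K i j = (if j < i then - D y E (j + 1) (nat (i - j - 1)) else 0)" for i j :: int
  have K: "K i j = - D y E (j + 1) m" if "i = j + int m + 1" for i j m using that by (simp add: K_def)
  have K0: "K i j = 0" if "i \<le> j" for i j using that by (simp add: K_def)
  have cases: "i < j \<or> i = j \<or> i = j + 1 \<or> (\<exists>m. i = j + int m + 2)" for i j :: int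
  proof -
    have "i = j + int (nat (i - j - 2)) + 2" if "i > j + 1" using that by simp
    then show ?thesis by (cases "i > j + 1") (blast, linarith)
  qed
  show ?thesis
  proof (rule resolvent_from_gauged_kernel[where K = K and C = "C * exp \<bar>g - \<delta>\<bar>" and \<delta> = \<delta> and V = V])
    fix i j
    show "exp (- g * real_of_int (i - j)) * cmod (K i j) \<le> C * exp \<bar>g - \<delta>\<bar> * exp (- \<delta> * \<bar>real_of_int (i - j)\<bar>)"
    proof (cases "j < i")
      case True
      define m where "m = nat (i - j - 1)"
      have ij: "i = j + int m + 1" using True by (simp add: m_def)
      have d: "real_of_int (i - j) = real m + 1" using ij by simp
      have "exp (- g * real_of_int (i - j)) * cmod (K i j) \<le> exp (- g * (real m + 1)) * (C * exp ((g - \<delta>) * real m))"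
        unfolding d K[OF ij] norm_minus_cancel by (intro mult_left_mono bound) simp
      also have "\<dots> = C * (exp (- (g - \<delta>)) * exp (- \<delta> * (real m + 1)))"
        by (simp add: exp_add[symmetric] algebra_simps)
      also have "\<dots> \<le> C * (exp \<bar>g - \<delta>\<bar> * exp (- \<delta> * (real m + 1)))"
        using C by (intro mult_left_mono mult_right_mono) auto
      finally show ?thesis unfolding d by (simp add: mult.assoc)
    next
      case False
      then show ?thesis using C by (simp add: K0)
    qed
    show "(of_real (v (int_iter T i y)) - E) * K i j - K (i + 1) j - K (i - 1) j = of_bool (i = j)"
    proof -
      have wv: "v (int_iter T k y) = w y k" for k by (simp add: w_def)
      consider "i < j" | "i = j" | "i = j + 1" | m where "i = j + int m + 2" using cases by blast
      then show ?thesis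
      proof cases
        case 2
        have "K (i + 1) j = -1" using K[of "i + 1" j 0] 2 by simp
        then show ?thesis using 2 by (simp add: K0)
      next
        case 3
        have "K (i + 1) j = - D y E (j + 1) 1" "K i j = - 1" using K[of "i + 1" j 1] K[of i j 0] 3 by simp_all
        then show ?thesis using 3 by (simp add: K0 wv)
      next
        case (4 m)
        have "K (i + 1) j = - D y E (j + 1) (Suc (Suc m))" "K i j = - D y E (j + 1) (Suc m)" "K (i - 1) j = - D y E (j + 1) m"
          using K[of "i + 1" j "Suc (Suc m)"] K[of i j "Suc m"] K[of "i - 1" j m] 4 by (simp_all del: continuant.simps)
        moreover have "j + 1 + int m + 1 = i" using 4 by simp
        ultimately show ?thesis using 4 by (simp add: wv algebra_simps)
      qed (simp add: K0)
    qed
    show "K j i * (of_real (v (int_iter T i y)) - E) - K j (i - 1) - K j (i + 1) = of_bool (j = i)"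
    proof -
      have wv: "v (int_iter T k y) = w y k" for k by (simp add: w_def)
      consider "j < i" | "j = i" | "j = i + 1" | m where "j = i + int m + 2" using cases by blast
      then show ?thesis
      proof cases
        case 2
        have "K j (i - 1) = -1" using K[of j "i - 1" 0] 2 by simp
        then show ?thesis using 2 by (simp add: K0)
      next
        case 3
        have "K j (i - 1) = - D y E i 1" "K j i = - 1" using K[of j "i - 1" 1] K[of j i 0] 3 by simp_all
        then show ?thesis using 3 by (simp add: K0 wv)
      next
        case (4 m)
        have "K j (i - 1) = - D y E i (Suc (Suc m))" "K j i = - D y E (i + 1) (Suc m)" "K j (i + 1) = - D y E (i + 2) m"
          using K[of j "i - 1" "Suc (Suc m)"] K[of j i "Suc m"] K[of j "i + 1" m] 4 by (simp_all del: continuant.simps add: algebra_simps)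
        moreover have "D y E i (Suc (Suc m)) = (of_real (w y i) - E) * D y E (i + 1) (Suc m) - D y E (i + 2) m" by (rule continuant_left)
        ultimately show ?thesis using 4 by (simp add: wv algebra_simps del: continuant.simps)
      qed (simp add: K0)
    qed
  qed (use C \<delta> v_bound in auto)
qed

end

section \<open>Energies off the support of the limit measure\<close>

lemma exp_rate_le:
  assumes "\<forall>\<^sub>F n in sequentially. exp (\<kappa> * real n) \<le> C * exp (l * real n)"
  shows "\<kappa> \<le> l"
proof (rule ccontr)
  assume "\<not> \<kappa> \<le> l"
  then have d: "\<kappa> - l > 0" by simp
  have "\<forall>\<^sub>F n in sequentially. real n > C / (\<kappa> - l)"
    using filterlim_real_sequentially by (simp add: filterlim_at_top_dense)
  with assms have "\<forall>\<^sub>F n in sequentially. False"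
  proof eventually_elim
    case (elim n)
    have "exp ((\<kappa> - l) * real n) * exp (l * real n) \<le> C * exp (l * real n)"
      using elim(1) unfolding exp_add[symmetric] by (simp add: algebra_simps)
    then have "exp ((\<kappa> - l) * real n) \<le> C" by (simp only: mult_le_cancel_right_pos exp_gt_zero)
    moreover have "C < (\<kappa> - l) * real n" using elim(2) d by (simp add: pos_divide_less_eq mult.commute)
    ultimately show False using exp_ge_add_one_self[of "(\<kappa> - l) * real n"] by linarith
  qed
  then show False by simp
qed

lemma exp_rate_mono:
  assumes "\<kappa> \<le> l" shows "exp (\<kappa> * real n) \<le> exp (l * real n)"
  using mult_right_mono[OF assms, of "real n"] by simp

text \<open>The polynomials \<open>P n\<close> are now the characteristic polynomials of the periodic truncations at the point \<open>x\<close>.\<close>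

locale zero_free_periodic =
  strictly_ergodic_potential T v \<mu> V + zero_free_disc rt N R E0 r
  for T :: "'a::metric_space \<Rightarrow> 'a" and v \<mu> V rt N R E0 r +
  fixes x :: 'a and g :: real
  assumes g: "g > 0" and P_trace: "\<And>n E. n \<ge> 3 \<Longrightarrow>
    cmod (P n E) = cmod (D x E 0 n - D x E 1 (n - 2) - of_real (exp (g * real n) + exp (- g * real n)))"
begin

text \<open>If both continuants and \<open>exp (g n)\<close> were exponentially smaller than \<open>exp (n U)\<close> at \<open>E\<close>, they would remain so on a small circle
  about \<open>E\<close>, against \<open>potential_lower\<close>.\<close>

lemma U_le_max:
  assumes E: "E \<in> cball E0 r" "Im E \<noteq> 0"
  shows "U E \<le> max (growth E) g"
proof (rule field_le_epsilon)
  fix e :: real assume e: "e > 0"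
  define m where "m = max (growth E) g"
  define \<epsilon> where "\<epsilon> = e / 3"
  have \<epsilon>: "\<epsilon> > 0" using e by (simp add: \<epsilon>_def)
  have m: "m > 0" "growth E < m + \<epsilon>" "g \<le> m" using g \<epsilon> by (auto simp: m_def less_max_iff_disj)
  obtain C where C: "C > 0" "\<And>y a n. cmod (D y E a n) \<le> C * exp ((m + \<epsilon>) * real n)"
    using growth_upper[OF E(2) m(2)] by blast
  define \<rho> where "\<rho> = min r (\<epsilon> * \<bar>Im E\<bar>)"
  have \<rho>: "0 < \<rho>" "\<rho> \<le> r" "\<rho> / \<bar>Im E\<bar> \<le> \<epsilon>"
    using r \<epsilon> E(2) by (auto simp: \<rho>_def pos_divide_le_eq)
  have bnd: "cmod (D x z a k) \<le> C * exp ((m + 2 * \<epsilon>) * real k)" if z: "cmod (z - E) = \<rho>" for z a k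
  proof -
    have "cmod (D x z a k) \<le> (1 + cmod (z - E) / \<bar>Im E\<bar>) ^ k * cmod (D x E a k)" by (rule jacobi_det_perturb[OF E(2)])
    also have "\<dots> \<le> exp \<epsilon> ^ k * (C * exp ((m + \<epsilon>) * real k))"
    proof (intro mult_mono power_mono C)
      show "1 + cmod (z - E) / \<bar>Im E\<bar> \<le> exp \<epsilon>" using \<rho>(3) exp_ge_add_one_self[of \<epsilon>] unfolding z by linarith
    qed auto
    also have "\<dots> = C * exp ((m + 2 * \<epsilon>) * real k)"
      unfolding exp_of_nat_mult[symmetric] by (simp add: exp_add[symmetric] algebra_simps)
    finally show ?thesis .
  qed
  have "\<forall>\<^sub>F n in sequentially. exp ((U E - \<epsilon>) * real n) \<le> (2 * C + 2) * exp ((m + 2 * \<epsilon>) * real n)"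
    using potential_lower[OF E(1) \<epsilon> \<rho>(1,2)] eventually_ge_at_top[of 3]
  proof eventually_elim
    case (elim n)
    let ?X = "exp ((m + 2 * \<epsilon>) * real n)"
    obtain z where z: "cmod (z - E) = \<rho>" "cmod (P n z) \<ge> exp ((U E - \<epsilon>) * real n)" using elim by blast
    have "exp (g * real n) \<le> ?X" "exp (- g * real n) \<le> ?X"
      using m(3) g \<epsilon> by (intro exp_rate_mono; simp)+
    moreover have "cmod (D x z 0 n) \<le> C * ?X" by (rule bnd[OF z(1)])
    moreover have "cmod (D x z 1 (n - 2)) \<le> C * ?X"
    proof -
      have "exp ((m + 2 * \<epsilon>) * real (n - 2)) \<le> ?X" using m \<epsilon> by simp
      then have "C * exp ((m + 2 * \<epsilon>) * real (n - 2)) \<le> C * ?X" using C(1) by (intro mult_left_mono) auto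
      then show ?thesis using bnd[OF z(1), of 1 "n - 2"] by (rule order_trans[rotated])
    qed
    moreover have "cmod (P n z) \<le> cmod (D x z 0 n) + cmod (D x z 1 (n - 2)) + (exp (g * real n) + exp (- g * real n))"
    proof -
      have "cmod (of_real (exp (g * real n) + exp (- g * real n))) = exp (g * real n) + exp (- g * real n)"
        unfolding norm_of_real by (simp add: add_nonneg_nonneg)
      then show ?thesis
        unfolding P_trace[OF elim(2)]
        using norm_triangle_ineq4[of "D x z 0 n - D x z 1 (n - 2)" "of_real (exp (g * real n) + exp (- g * real n))"]
          norm_triangle_ineq4[of "D x z 0 n" "D x z 1 (n - 2)"] by linarith
    qed
    ultimately show ?case using z(2) unfolding distrib_right by linarith
  qed
  from exp_rate_le[OF this] show "U E \<le> max (growth E) g + e" unfolding m_def[symmetric] by (simp add: \<epsilon>_def)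
qed

text \<open>The leading term \<open>D(0, n)\<close> dominates \<open>2 cosh (g n)\<close>, and \<open>trace_lower\<close> excludes that \<open>D(1, n - 2)\<close> cancels it.\<close>

lemma growth_le_U:
  assumes E: "E \<in> cball E0 r" "Im E \<noteq> 0" and gr: "growth E > g"
  shows "growth E \<le> U E"
proof (rule ccontr)
  assume "\<not> ?thesis"
  then have lt: "max (U E) g < growth E" using gr by simp
  define \<kappa> where "\<kappa> = (max (U E) g + growth E) / 2"
  have \<kappa>: "U E < \<kappa>" "g < \<kappa>" "\<kappa> < growth E" using lt unfolding \<kappa>_def by (auto simp: max_def split: if_splits)
  define \<epsilon> where "\<epsilon> = (\<kappa> - U E) / 2"
  have \<epsilon>: "\<epsilon> > 0" "U E + \<epsilon> < \<kappa>" using \<kappa> by (auto simp: \<epsilon>_def field_simps)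
  obtain c where c: "c > 0" "\<And>y a n. c * exp (\<kappa> * real n) \<le> cmod (D y E a n)"
    using growth_lower[OF E(2) \<kappa>(3)] by blast
  define c1 where "c1 = \<bar>Im E\<bar> / (V + cmod E + 1 / \<bar>Im E\<bar>)"
  have c1: "c1 > 0" using E(2) V_nonneg unfolding c1_def by (intro divide_pos_pos add_nonneg_pos add_nonneg_nonneg) auto
  define l where "l = max (U E + \<epsilon>) g"
  have l: "U E + \<epsilon> \<le> l" "g \<le> l" "l < \<kappa>" "0 \<le> l" using \<epsilon> \<kappa> g by (auto simp: l_def)
  have "\<forall>\<^sub>F n in sequentially. exp (\<kappa> * real n) \<le> ((3 + 1 / c) / (c1 * c)) * exp (l * real n)"
    using potential_upper[OF E(1) \<epsilon>(1)] eventually_ge_at_top[of 3]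
  proof eventually_elim
    case (elim n)
    let ?X = "exp (l * real n)" and ?D = "D x E 0 n"
    obtain k where k: "n = Suc (Suc k)" using elim(2) by (metis add_2_eq_Suc le_Suc_ex numeral_3_eq_3 add_Suc add_Suc_shift)
    have X1: "1 \<le> ?X" using l(4) by simp
    have Dc: "c \<le> cmod ?D"
    proof -
      have "c * 1 \<le> c * exp (\<kappa> * real n)" using c(1) \<kappa>(2) g by (intro mult_left_mono) auto
      then show ?thesis using c(2)[of n x 0] by linarith
    qed
    have "c1 * (c * exp (\<kappa> * real n)) \<le> c1 * cmod ?D" using c1 c(2) by (intro mult_left_mono) auto
    moreover have "c1 * cmod ?D - 1 / cmod ?D \<le> cmod (?D - D x E 1 (n - 2))"
      using trace_lower[OF E(2), of x k] unfolding c1_def k by (simp del: continuant.simps)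
    moreover have "1 / cmod ?D \<le> 1 / c * ?X"
    proof -
      have "1 / cmod ?D \<le> 1 / c" using Dc c(1) by (intro divide_left_mono mult_pos_pos) auto
      also have "1 / c * 1 \<le> 1 / c * ?X" using X1 c(1) by (intro mult_left_mono) auto
      finally show ?thesis by simp
    qed
    moreover have "cmod (?D - D x E 1 (n - 2)) \<le> cmod (P n E) + (exp (g * real n) + exp (- g * real n))"
    proof -
      have "cmod (of_real (exp (g * real n) + exp (- g * real n))) = exp (g * real n) + exp (- g * real n)"
        unfolding norm_of_real by (simp add: add_nonneg_nonneg)
      then show ?thesis
        unfolding P_trace[OF elim(2)]
        using norm_triangle_sub[of "?D - D x E 1 (n - 2)" "of_real (exp (g * real n) + exp (- g * real n))"] by linarith
    qed
    moreover have "cmod (P n E) \<le> ?X" using elim(1) exp_rate_mono[OF l(1), of n] by (rule order_trans)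
    moreover have "exp (g * real n) \<le> ?X" by (rule exp_rate_mono[OF l(2)])
    moreover have "exp (- g * real n) \<le> ?X" by (rule exp_rate_mono) (use g l in linarith)
    ultimately have "c1 * (c * exp (\<kappa> * real n)) \<le> (3 + 1 / c) * ?X" unfolding distrib_right by linarith
    then show ?case using c(1) c1 by (simp add: field_simps)
  qed
  from exp_rate_le[OF this] show False using l(3) by linarith
qed

text \<open>Here \<open>2 cosh (g n)\<close> dominates both continuants.\<close>

lemma g_le_U_off_axis:
  assumes E: "E \<in> cball E0 r" "Im E \<noteq> 0" and gr: "growth E < g"
  shows "g \<le> U E"
proof (rule ccontr)
  assume "\<not> ?thesis"
  then have lt: "U E < g" by simp
  define \<kappa> where "\<kappa> = max ((growth E + g) / 2) 0"
  have \<kappa>: "growth E < \<kappa>" "\<kappa> < g" "0 \<le> \<kappa>" using gr g by (auto simp: \<kappa>_def less_max_iff_disj)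
  obtain C where C: "C > 0" "\<And>y a n. cmod (D y E a n) \<le> C * exp (\<kappa> * real n)"
    using growth_upper[OF E(2) \<kappa>(1)] by blast
  define \<epsilon> where "\<epsilon> = (g - U E) / 2"
  have \<epsilon>: "\<epsilon> > 0" "U E + \<epsilon> < g" using lt by (auto simp: \<epsilon>_def field_simps)
  define l where "l = max (U E + \<epsilon>) \<kappa>"
  have l: "U E + \<epsilon> \<le> l" "\<kappa> \<le> l" "l < g" using \<epsilon> \<kappa> by (auto simp: l_def)
  have "\<forall>\<^sub>F n in sequentially. exp (g * real n) \<le> (1 + 2 * C) * exp (l * real n)"
    using potential_upper[OF E(1) \<epsilon>(1)] eventually_ge_at_top[of 3]
  proof eventually_elim
    case (elim n)
    let ?X = "exp (l * real n)"
    have "exp (g * real n) \<le> cmod (of_real (exp (g * real n) + exp (- g * real n)))"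
      unfolding norm_of_real by simp
    also have "\<dots> \<le> cmod (P n E) + cmod (D x E 0 n) + cmod (D x E 1 (n - 2))"
      unfolding P_trace[OF elim(2)]
      using norm_triangle_ineq4[of "D x E 0 n - D x E 1 (n - 2)" "D x E 0 n - D x E 1 (n - 2) - of_real (exp (g * real n) + exp (- g * real n))"]
        norm_triangle_ineq4[of "D x E 0 n" "D x E 1 (n - 2)"] by simp
    also have "cmod (P n E) \<le> ?X" using elim(1) exp_rate_mono[OF l(1), of n] by (rule order_trans)
    also have "cmod (D x E 0 n) \<le> C * ?X"
      using C(2)[of x 0 n] mult_left_mono[OF exp_rate_mono[OF l(2)], of C n] C(1) by linarith
    also have "cmod (D x E 1 (n - 2)) \<le> C * ?X"
    proof -
      have "exp (\<kappa> * real (n - 2)) \<le> exp (\<kappa> * real n)" using \<kappa>(3) by (simp add: mult_left_mono)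
      also have "\<dots> \<le> ?X" by (rule exp_rate_mono[OF l(2)])
      finally have "C * exp (\<kappa> * real (n - 2)) \<le> C * ?X" using C(1) by (intro mult_left_mono) auto
      then show ?thesis using C(2)[of x 1 "n - 2"] by (rule order_trans[rotated])
    qed
    finally show ?case unfolding distrib_right by linarith
  qed
  from exp_rate_le[OF this] show False using l(3) by linarith
qed

text \<open>Only energies with \<open>growth = g\<close> and real energies are not covered by the previous two lemmas. Along a vertical line
  there is at most one of the former on each side of the axis, so every point of the disc is a limit of good points, and \<open>U\<close> is Lipschitz.\<close>

lemma g_le_U:
  assumes E: "E \<in> cball E0 r" shows "g \<le> U E"
proof (rule field_le_epsilon)
  fix e :: real assume e: "e > 0"
  define s where "s = min 1 e"
  have s: "0 < s" "s \<le> 1" "s \<le> e" using e by (auto simp: s_def)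
  define F where "F = E0 + of_real (1 - s) * (E - E0)"
  have FE0: "cmod (F - E0) \<le> (1 - s) * r"
  proof -
    have "cmod (F - E0) = (1 - s) * cmod (E - E0)"
    proof -
      have "cmod (F - E0) = cmod (of_real (1 - s)) * cmod (E - E0)" by (simp add: F_def norm_mult del: of_real_diff)
      then show ?thesis using s unfolding norm_of_real by simp
    qed
    also have "\<dots> \<le> (1 - s) * r" using E s by (intro mult_left_mono) (auto simp: dist_norm norm_minus_commute)
    finally show ?thesis .
  qed
  have FE: "cmod (F - E) \<le> s * r"
  proof -
    have "F - E = of_real s * (E0 - E)" by (simp add: F_def algebra_simps)
    then have "cmod (F - E) = s * cmod (E0 - E)" using s by (simp add: norm_mult)
    also have "\<dots> \<le> s * r" using E s by (intro mult_left_mono) (auto simp: dist_norm)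
    finally show ?thesis .
  qed
  define \<sigma> :: real where "\<sigma> = (if Im F \<ge> 0 then 1 else - 1)"
  define G where "G h = Complex (Re F) (Im F + \<sigma> * h)" for h
  have GF: "cmod (G h - F) = h" if "h > 0" for h
  proof -
    have "G h - F = of_real (\<sigma> * h) * \<i>" by (simp add: G_def complex_eq_iff)
    then show ?thesis using that by (simp add: norm_mult \<sigma>_def)
  qed
  have ImG: "Im (G h) \<noteq> 0" if "h > 0" for h using that by (auto simp: G_def \<sigma>_def)
  have sr: "s * r > 0" using s r by simp
  (* of two heights on the same side of the axis at most one has growth g *)
  have "\<exists>h. 0 < h \<and> h \<le> s * r \<and> growth (G h) \<noteq> g"
  proof (cases "growth (G (s * r)) = g")
    case True
    have "growth (G (s * r / 2)) < growth (G (s * r))"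
      unfolding G_def by (rule growth_strict_mono) (use sr in \<open>auto simp: \<sigma>_def mult.commute\<close>)
    then show ?thesis using True sr by (intro exI[of _ "s * r / 2"]) (auto simp: mult.commute)
  qed (use sr in \<open>auto simp: mult.commute\<close>)
  then obtain h where h: "0 < h" "h \<le> s * r" "growth (G h) \<noteq> g" by blast
  have "cmod (G h - E0) \<le> cmod (G h - F) + cmod (F - E0)" using norm_triangle_ineq[of "G h - F" "F - E0"] by simp
  also have "\<dots> \<le> s * r + (1 - s) * r" using FE0 GF[OF h(1)] h(2) by linarith
  also have "\<dots> = r" by (simp add: algebra_simps)
  finally have Gin: "G h \<in> cball E0 r" by (simp add: dist_norm norm_minus_commute)
  have "g \<le> U (G h)"
  proof (cases "growth (G h) < g")
    case False
    then have "g < growth (G h)" using h(3) by simp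
    then show ?thesis using growth_le_U[OF Gin ImG[OF h(1)]] by linarith
  qed (rule g_le_U_off_axis[OF Gin ImG[OF h(1)]])
  also have "U (G h) \<le> U E + cmod (G h - E) / (3 * r)" using U_lipschitz[OF Gin E] by linarith
  also have "cmod (G h - E) / (3 * r) \<le> e"
  proof -
    have "cmod (G h - E) \<le> cmod (G h - F) + cmod (F - E)" using norm_triangle_ineq[of "G h - F" "F - E"] by simp
    also have "\<dots> \<le> s * r + s * r" using GF[OF h(1)] h(2) FE by linarith
    also have "\<dots> \<le> s * (3 * r)" using sr by linarith
    also have "\<dots> \<le> e * (3 * r)" using s r by (intro mult_right_mono) auto
    finally show ?thesis using r by (simp add: pos_divide_le_eq)
  qed
  finally show "g \<le> U E + e" by simp
qed

text \<open>The vertical direction from \<open>E0\<close> away from the real axis; upwards if \<open>E0\<close> is real.\<close>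

definition outward_sign :: real where "outward_sign = (if Im E0 \<ge> 0 then 1 else - 1)"

definition outward :: "real \<Rightarrow> complex" where "outward h = Complex (Re E0) (Im E0 + outward_sign * h)"

lemma outward_Im: "h > 0 \<Longrightarrow> Im (outward h) \<noteq> 0" by (auto simp: outward_def outward_sign_def)

lemma resolvent_if_growth_small:
  assumes h: "h > 0" and small: "growth (outward h) \<le> g"
  shows "E0 \<in> resolvent_set_ell2 (hatano_nelson T v g y)"
proof -
  have "growth (outward (h / 2)) < growth (outward h)"
    unfolding outward_def by (rule growth_strict_mono) (use h in \<open>auto simp: outward_sign_def\<close>)
  then have lt: "growth (outward (h / 2)) < g" using small by linarith
  define \<delta> where "\<delta> = (g - growth (outward (h / 2))) / 2"
  have \<delta>: "\<delta> > 0" "growth (outward (h / 2)) < g - \<delta>" using lt by (auto simp: \<delta>_def field_simps)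
  have "Im (outward (h / 2)) \<noteq> 0" using h by (intro outward_Im) simp
  then obtain C where C: "C > 0" "\<And>y a n. cmod (D y (outward (h / 2)) a n) \<le> C * exp ((g - \<delta>) * real n)"
    using growth_upper[OF _ \<delta>(2)] by blast
  show ?thesis
  proof (rule resolvent_if_growth_below_gauge[OF _ C(1) \<delta>(1)])
    fix n a
    have "cmod (D y (Complex (Re E0) (Im E0)) a n) \<le> cmod (D y (outward (h / 2)) a n)"
      unfolding outward_def by (rule jacobi_det_vertical_mono) (use h in \<open>auto simp: outward_sign_def\<close>)
    then show "cmod (D y E0 a n) \<le> C * exp ((g - \<delta>) * real n)"
      unfolding complex_surj using C(2) by (rule order_trans)
  qed
qed

text \<open>At a nearby outward point \<open>U \<ge> growth > g\<close>, so the minimum principle excludes \<open>U E0 \<le> g\<close>. Where \<open>U > g\<close>, the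
  comparison estimates collapse to \<open>growth = U\<close>.\<close>

lemma growth_near:
  assumes large: "\<And>h. 0 < h \<Longrightarrow> h < r \<Longrightarrow> g < growth (outward h)"
  shows "\<exists>\<rho> \<delta>. 0 < \<rho> \<and> \<rho> \<le> r \<and> 0 < \<delta> \<and> (\<forall>E\<in>cball E0 \<rho>. Im E \<noteq> 0 \<longrightarrow> g + \<delta> < growth E \<and> growth E = U E)"
proof -
  have "U E0 > g"
  proof (rule ccontr)
    assume "\<not> U E0 > g"
    then have le: "U E0 \<le> g" by simp
    define z where "z = outward (r / 2) - E0"
    have "z = of_real (outward_sign * (r / 2)) * \<i>" by (simp add: z_def outward_def complex_eq_iff)
    then have "cmod z = \<bar>outward_sign * (r / 2)\<bar>" by (simp only: norm_mult norm_of_real norm_ii mult_1_right)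
    then have "cmod z = r / 2" using r by (simp add: outward_sign_def)
    then have zr: "cmod z \<le> r" using r by simp
    have in_disc: "outward (r / 2) \<in> cball E0 r" using zr by (simp add: z_def dist_norm norm_minus_commute)
    have "U (E0 + z) \<le> g" by (rule U_minimum_principle[OF g_le_U le zr])
    moreover have gr: "g < growth (outward (r / 2))" using r by (intro large) auto
    moreover have "growth (outward (r / 2)) \<le> U (outward (r / 2))"
      using r by (intro growth_le_U[OF in_disc outward_Im gr]) auto
    ultimately show False by (simp add: z_def)
  qed
  then have pos: "U E0 - g > 0" by simp
  define \<delta> where "\<delta> = (U E0 - g) / 3"
  have \<delta>: "\<delta> > 0" using pos by (simp add: \<delta>_def)
  define \<rho> where "\<rho> = min r (3 * r * \<delta>)"
  have \<rho>: "0 < \<rho>" "\<rho> \<le> r" "\<rho> \<le> 3 * r * \<delta>" using r \<delta> by (auto simp: \<rho>_def)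
  have "g + \<delta> < growth E \<and> growth E = U E" if E: "E \<in> cball E0 \<rho>" "Im E \<noteq> 0" for E
  proof -
    have Er: "E \<in> cball E0 r" using E(1) \<rho>(2) by auto
    have "cmod (E0 - E) \<le> 3 * r * \<delta>" using E(1) \<rho>(3) by (simp add: dist_norm)
    then have "cmod (E0 - E) / (3 * r) \<le> \<delta>" using r by (simp add: pos_divide_le_eq mult_ac)
    then have "U E0 - U E \<le> \<delta>" using U_lipschitz[of E0 E] Er r by simp
    moreover have "3 * \<delta> = U E0 - g" by (simp add: \<delta>_def)
    ultimately have UE: "g + \<delta> < U E" using \<delta> by linarith
    have "U E \<le> max (growth E) g" by (rule U_le_max[OF Er E(2)])
    then have "U E \<le> growth E" using UE \<delta> by (simp add: le_max_iff_disj)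
    moreover have "growth E \<le> U E" by (rule growth_le_U[OF Er E(2)]) (use calculation UE \<delta> in linarith)
    ultimately show ?thesis using UE by linarith
  qed
  then show ?thesis using \<rho> \<delta> by blast
qed

text \<open>Near \<open>E0\<close> the growth equals \<open>U\<close> off the axis and is symmetric under conjugation. The second difference of \<open>U\<close>
  thus bounds \<open>growth (a + i b) - growth (a + i b / 2)\<close> by a multiple of \<open>b\<^sup>2\<close>, which is the input for counting eigenvalues.\<close>

lemma green_kernel_real_energy:
  assumes im: "Im E0 = 0" and \<rho>: "0 < \<rho>" "\<rho> \<le> r" and \<delta>: "0 < \<delta>"
    and near: "\<And>E. E \<in> cball E0 \<rho> \<Longrightarrow> Im E \<noteq> 0 \<Longrightarrow> g + \<delta> < growth E \<and> growth E = U E"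
  shows "\<exists>C>0. \<forall>y. \<exists>K. green_kernel (q y E0) C (g + \<delta> / 2) K"
proof -
  define e where "e = Re E0"
  have e: "E0 = of_real e" using im by (simp add: e_def complex_eq_iff)
  define s where "s = \<rho> / 2"
  have s: "s > 0" using \<rho> by (simp add: s_def)
  have inb: "Complex a b \<in> cball E0 \<rho>" if "\<bar>a - e\<bar> \<le> s" "\<bar>b\<bar> \<le> s" for a b
  proof -
    have "cmod (Complex a b - E0) \<le> \<bar>a - e\<bar> + \<bar>b\<bar>"
      using cmod_le[of "Complex a b - E0"] by (simp add: e)
    then show ?thesis using that unfolding s_def mem_cball dist_norm by (simp add: norm_minus_commute)
  qed
  have diff: "growth (Complex a b) \<le> growth (Complex a (b / 2)) + 1 / r\<^sup>2 * b\<^sup>2" if ab: "\<bar>a - e\<bar> \<le> s" "0 < b" "b \<le> s" for a b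
  proof -
    have ins: "Complex a b \<in> cball E0 \<rho>" "Complex a (- b) \<in> cball E0 \<rho>" "Complex a (b / 2) \<in> cball E0 \<rho>" "Complex a (- b / 2) \<in> cball E0 \<rho>"
      using ab by (intro inb; simp)+
    have "U (Complex a b) + U (Complex a (- b)) - U (Complex a (b / 2)) - U (Complex a (- b / 2)) \<le> b\<^sup>2 / r\<^sup>2"
      using ins(1,2) \<rho>(2) by (intro U_vertical_second_difference) auto
    moreover have "growth (Complex a (- b)) = growth (Complex a b)" "growth (Complex a (- b / 2)) = growth (Complex a (b / 2))"
      using growth_cnj[of "Complex a b"] growth_cnj[of "Complex a (b / 2)"] by (simp_all add: complex_cnj)
    moreover have "growth (Complex a b) = U (Complex a b)" "growth (Complex a (- b)) = U (Complex a (- b))"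
      "growth (Complex a (b / 2)) = U (Complex a (b / 2))" "growth (Complex a (- b / 2)) = U (Complex a (- b / 2))"
      using near[OF ins(1)] near[OF ins(2)] near[OF ins(3)] near[OF ins(4)] ab(2) by simp_all
    ultimately have "2 * (growth (Complex a b) - growth (Complex a (b / 2))) \<le> b\<^sup>2 / r\<^sup>2" by argo
    moreover have "0 \<le> b\<^sup>2 / r\<^sup>2" by simp
    ultimately have "growth (Complex a b) \<le> growth (Complex a (b / 2)) + b\<^sup>2 / r\<^sup>2" by argo
    then show ?thesis by simp
  qed
  have "lower_bound (s\<^sup>2 / 2) 0 (q x (of_real e))"
    by (rule lower_bound_of_sparse_spectrum[OF s]) (rule sparse_spectrum_near[OF s s _ _ diff], auto)
  then have lb0: "lower_bound (s\<^sup>2 / 2) 0 (q y (of_real e))" for y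
    unfolding w_def by (rule lower_bound_all_points[OF homeo minimal v_cont])
  have lb: "lower_bound (s\<^sup>2 / 2 / 4) 0 (q y E)" if E: "E \<in> ball E0 (s / 4)" for y E
  proof (rule lower_bound_perturb[OF lb0[of y]])
    show "cmod (q y E k - q y (of_real e) k) \<le> s / 4" for k
      using E unfolding e by (simp add: dist_norm)
    show "4 * (s / 4)\<^sup>2 \<le> s\<^sup>2 / 2" by (simp add: power2_eq_square)
  qed
  show ?thesis
  proof (rule green_kernel_at_real_energy[OF im _ _ lb])
    show "g + \<delta> < growth E" if "E \<in> ball E0 (s / 4)" "Im E \<noteq> 0" for E
    proof -
      have "E \<in> cball E0 \<rho>" using that(1) s unfolding s_def by auto
      then show ?thesis using near that(2) by blast
    qed
  qed (use s g \<delta> in auto)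
qed

theorem resolvent_off_support: "E0 \<in> resolvent_set_ell2 (hatano_nelson T v g y)"
proof (cases "\<exists>h>0. growth (outward h) \<le> g")
  case True
  then show ?thesis using resolvent_if_growth_small by blast
next
  case False
  then have "\<And>h. 0 < h \<Longrightarrow> h < r \<Longrightarrow> g < growth (outward h)" by (meson not_le)
  from growth_near[OF this] obtain \<rho> \<delta> where \<rho>: "0 < \<rho>" "\<rho> \<le> r" and \<delta>: "0 < \<delta>"
    and near: "\<And>E. E \<in> cball E0 \<rho> \<Longrightarrow> Im E \<noteq> 0 \<Longrightarrow> g + \<delta> < growth E \<and> growth E = U E" by blast
  have "\<exists>C>0. \<forall>y. \<exists>K. green_kernel (q y E0) C (g + \<delta> / 2) K"
  proof (cases "Im E0 = 0")
    case True
    then show ?thesis by (rule green_kernel_real_energy[OF _ \<rho> \<delta> near])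
  next
    case False
    have "g + \<delta> / 2 < growth E0" using near[of E0] \<rho> \<delta> False by simp
    then show ?thesis using off_axis_green_kernel_uniform[of "{E0}" "\<bar>Im E0\<bar>" "g + \<delta> / 2"] False g \<delta> by auto
  qed
  then obtain C K where "C > 0" "green_kernel (q y E0) C (g + \<delta> / 2) K" by blast
  then show ?thesis
    using resolvent_of_green_kernel[where g = g and V = V and T = T and v = v and x = y and z = E0 and C = C and K = K and \<kappa> = "g + \<delta> / 2"]
      v_bound g \<delta> unfolding w_def by simp
qed

end

section \<open>The density of states and the spectrum\<close>

text \<open>Used with \<open>xs\<close> a list of eigenvalues, to turn an average over a multiset into an average over indices.\<close>

lemma sum_count_mset:
  fixes f :: "'b \<Rightarrow> real"
  assumes "finite S" "set xs \<subseteq> S"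
  shows "(\<Sum>a\<in>S. f a * real (count (mset xs) a)) = sum_list (map f xs)"
  using assms(2)
proof (induction xs)
  case (Cons x xs)
  have "(\<Sum>a\<in>S. f a * real (count (mset (x # xs)) a)) = (\<Sum>a\<in>S. f a * real (count (mset xs) a)) + (\<Sum>a\<in>S. if a = x then f a else 0)"
    unfolding sum.distrib[symmetric] by (rule sum.cong) (auto simp: algebra_simps)
  also have "(\<Sum>a\<in>S. if a = x then f a else 0) = f x"
    using assms(1) Cons.prems by simp
  finally show ?case using Cons by simp
qed simp

lemma eigenvalue_list:
  assumes A: "A \<in> carrier_mat n n" and n: "n > 0"
  shows "\<exists>rt :: nat \<Rightarrow> complex. (\<forall>E. poly (char_poly A) E = (\<Prod>i<n. E - rt i)) \<and>
    (\<forall>f :: complex \<Rightarrow> real. continuous_on UNIV f \<longrightarrow>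
      (\<integral>z. f z \<partial>eigenvalue_counting_measure A) = (\<Sum>i<n. f (rt i)) / real n)"
proof -
  obtain as where as: "char_poly A = (\<Prod>a\<leftarrow>as. [:- a, 1:])" "length as = n"
    using char_poly_factorized[OF A] by blast
  have roots: "proots (char_poly A) = mset as"
  proof -
    have "proots (\<Prod>a\<leftarrow>as. [:- a, 1:]) = mset as"
    proof (induction as)
      case (Cons a as)
      have "(\<Prod>a\<leftarrow>as. [:- a, 1:]) \<noteq> 0" by (auto simp: prod_list_zero_iff)
      then show ?case using Cons by (simp add: proots_mult del: mult_pCons_left)
    qed simp
    then show ?thesis unfolding as(1) .
  qed
  have ne: "mset as \<noteq> {#}" using as(2) n by auto
  show ?thesis
  proof (intro exI[of _ "\<lambda>i. as ! i"] conjI allI impI)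
    fix E
    have "poly (\<Prod>a\<leftarrow>as. [:- a, 1:]) E = (\<Prod>a\<leftarrow>as. E - a)" by (induction as) (auto simp: algebra_simps)
    also have "\<dots> = (\<Prod>i<n. E - as ! i)"
      using prod.list_conv_set_nth[of "map (\<lambda>a. E - a) as"] as(2) by (simp add: atLeast0LessThan)
    finally show "poly (char_poly A) E = (\<Prod>i<n. E - as ! i)" unfolding as(1) .
  next
    fix f :: "complex \<Rightarrow> real" assume f: "continuous_on UNIV f"
    have fm: "f \<in> borel_measurable borel" by (rule borel_measurable_continuous_onI[OF f])
    have "(\<integral>z. f z \<partial>eigenvalue_counting_measure A) = (\<integral>z. f z \<partial>measure_pmf (pmf_of_multiset (mset as)))"
      unfolding eigenvalue_counting_measure_def roots by (rule integral_distr) (use fm in auto)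
    also have "\<dots> = (\<Sum>a\<in>set as. f a * pmf (pmf_of_multiset (mset as)) a)"
      by (rule integral_measure_pmf_real) (auto simp: set_pmf_of_multiset[OF ne])
    also have "\<dots> = (\<Sum>a\<in>set as. f a * real (count (mset as) a)) / real n"
      unfolding pmf_of_multiset[OF ne] sum_divide_distrib by (simp add: as(2))
    also have "(\<Sum>a\<in>set as. f a * real (count (mset as) a)) = sum_list (map f as)"
      by (rule sum_count_mset) auto
    also have "\<dots> = (\<Sum>i<n. f (as ! i))"
      by (simp add: sum_list_sum_nth as(2) atLeast0LessThan)
    finally show "(\<integral>z. f z \<partial>eigenvalue_counting_measure A) = (\<Sum>i<n. f (as ! i)) / real n" .
  qed
qed

lemma periodic_int_mod:
  fixes u :: "int \<Rightarrow> complex"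
  assumes per: "\<And>k. u (k + int n) = u k"
  shows "u (k mod int n) = u k"
proof -
  have up: "u (k + int j * int n) = u k" for k j
  proof (induction j)
    case (Suc j)
    have "k + int (Suc j) * int n = (k + int j * int n) + int n" by (simp add: algebra_simps)
    then show ?case using per[of "k + int j * int n"] Suc by (simp only:)
  qed simp
  show ?thesis
  proof (cases "k div int n \<ge> 0")
    case True
    have "u k = u (k mod int n + int (nat (k div int n)) * int n)" using True by simp
    then show ?thesis unfolding up by simp
  next
    case False
    have "k mod int n = k + int (nat (- (k div int n))) * int n"
      using False by (simp add: minus_div_mult_eq_mod[symmetric])
    then show ?thesis by (simp only: up)
  qed
qed

text \<open>Evaluate the eigenvalue equation at a site where the periodic eigenvector has maximal modulus.\<close>

lemma periodic_eigenvalue_bounded: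
  assumes n: "n \<ge> 3" and root: "poly (char_poly (periodic_hn_matrix T v g x n)) E = 0" and v: "\<And>y. \<bar>v y\<bar> \<le> V"
  shows "cmod E \<le> V + exp g + exp (- g)"
proof -
  obtain u :: "int \<Rightarrow> complex" where per: "\<And>k. u (k + int n) = u k" and nz: "\<exists>k. u k \<noteq> 0"
    and eq: "\<And>k. 0 \<le> k \<Longrightarrow> k < int n \<Longrightarrow> (of_real (v (int_iter T k x)) - E) * u k
       - of_real (exp g) * u (k + 1) - of_real (exp (- g)) * u (k - 1) = 0"
    by (rule periodic_hn_eigenvector[OF n root]) blast
  have n0: "int n > 0" using n by simp
  have "\<exists>k\<in>{0..<int n}. \<forall>j\<in>{0..<int n}. cmod (u j) \<le> cmod (u k)"
  proof -
    have "Max ((\<lambda>k. cmod (u k)) ` {0..<int n}) \<in> (\<lambda>k. cmod (u k)) ` {0..<int n}" using n0 by (intro Max_in) auto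
    then obtain k where "k \<in> {0..<int n}" "cmod (u k) = Max ((\<lambda>k. cmod (u k)) ` {0..<int n})" by force
    then show ?thesis by (intro bexI[of _ k]) auto
  qed
  then obtain k where k: "0 \<le> k" "k < int n" "\<And>j. j \<in> {0..<int n} \<Longrightarrow> cmod (u j) \<le> cmod (u k)" by auto
  have le: "cmod (u j) \<le> cmod (u k)" for j
    using k(3)[of "j mod int n"] n0 periodic_int_mod[of u n j, OF per] by simp
  have pos: "cmod (u k) > 0"
  proof -
    obtain j where "u j \<noteq> 0" using nz by blast
    then have "0 < cmod (u j)" by simp
    then show ?thesis using le[of j] by linarith
  qed
  have "E * u k = of_real (v (int_iter T k x)) * u k - of_real (exp g) * u (k + 1) - of_real (exp (- g)) * u (k - 1)"
    using eq[OF k(1,2)] by (simp add: algebra_simps)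
  then have "cmod E * cmod (u k) = cmod (of_real (v (int_iter T k x)) * u k - of_real (exp g) * u (k + 1) - of_real (exp (- g)) * u (k - 1))"
    by (simp only: norm_mult[symmetric])
  also have "\<dots> \<le> cmod (of_real (v (int_iter T k x)) * u k) + cmod (of_real (exp g) * u (k + 1)) + cmod (of_real (exp (- g)) * u (k - 1))"
    by (rule order_trans[OF norm_triangle_ineq4 add_right_mono[OF norm_triangle_ineq4]])
  also have "\<dots> \<le> V * cmod (u k) + exp g * cmod (u k) + exp (- g) * cmod (u k)"
    unfolding norm_mult norm_of_real using v le order_trans[OF abs_ge_zero v] by (intro add_mono mult_mono) auto
  finally have "cmod E * cmod (u k) \<le> (V + exp g + exp (- g)) * cmod (u k)" by (simp only: distrib_right)
  then show ?thesis using pos by (simp only: mult_le_cancel_right_pos)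
qed

lemma LIMSEQ_recurrent_value:
  fixes a :: "nat \<Rightarrow> real"
  assumes "a \<longlonglongrightarrow> l" "\<And>m. \<exists>n\<ge>m. a n = c" shows "l = c"
proof (rule ccontr)
  assume "l \<noteq> c"
  from tendsto_imp_eventually_ne[OF assms(1) this] obtain m where "\<And>n. n \<ge> m \<Longrightarrow> a n \<noteq> c"
    unfolding eventually_sequentially by blast
  then show False using assms(2)[of m] by blast
qed

theorem theorem1p3:
  fixes T :: "'a::metric_space \<Rightarrow> 'a"
    and v :: "'a \<Rightarrow> real"
    and g :: real
    and \<mu> :: "'a measure"
    and N :: "complex measure"
    and x :: 'a
  assumes "compact (UNIV :: 'a set)"
    and "connected (UNIV :: 'a set)"
    and "homeomorphism UNIV UNIV T (inv_into UNIV T)"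
    and "strictly_ergodic T"
    and "invariant_prob T \<mu>"
    and "continuous_on UNIV v"
    and "g > 0"
    and "continuous_on UNIV (lyapunov_exponent \<mu> T v)"
    and "density_of_states \<mu> T v g N"
  shows "measure_support N = spectrum_ell2 (hatano_nelson T v g x)"
proof -
  note comp = assms(1) and homeo = assms(3) and v_cont = assms(6)
  have minimal: "minimal_system T" using assms(4) by (simp add: strictly_ergodic_def)
  have uniq: "\<nu> = \<mu>" if "invariant_prob T \<nu>" for \<nu>
    using assms(4,5) that unfolding strictly_ergodic_def uniquely_ergodic_def by blast
  obtain V where V: "\<And>y. \<bar>v y\<bar> \<le> V"
  proof -
    have "compact (v ` UNIV)" by (rule compact_continuous_image[OF v_cont comp])
    then obtain b where "\<forall>z\<in>v ` UNIV. norm z \<le> b" using compact_imp_bounded bounded_iff by blast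
    then show ?thesis by (intro that[of b]) auto
  qed
  have sets_N: "sets N = sets borel" and fin_N: "finite_measure N"
    and AE: "AE y in \<mu>. converges_weakly (\<lambda>n. eigenvalue_counting_measure (periodic_hn_matrix T v g y n)) N"
    using assms(9) by (auto simp: density_of_states_def)
  interpret \<mu>: prob_space \<mu> using assms(5) by (simp add: invariant_prob_def)
  obtain y where y: "converges_weakly (\<lambda>n. eigenvalue_counting_measure (periodic_hn_matrix T v g y n)) N"
  proof -
    have "\<exists>y. converges_weakly (\<lambda>n. eigenvalue_counting_measure (periodic_hn_matrix T v g y n)) N"
    proof (rule ccontr)
      assume "\<not> ?thesis"
      then have "AE y in \<mu>. False" using AE by simp
      then show False by (simp add: \<mu>.AE_False)
    qed
    then show ?thesis using that by blast
  qed
  define lists_eigenvalues where "lists_eigenvalues n rt \<longleftrightarrow>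
      (\<forall>E. poly (char_poly (periodic_hn_matrix T v g y n)) E = (\<Prod>i<n. E - rt i)) \<and>
      (\<forall>f :: complex \<Rightarrow> real. continuous_on UNIV f \<longrightarrow>
        (\<integral>z. f z \<partial>eigenvalue_counting_measure (periodic_hn_matrix T v g y n)) = (\<Sum>i<n. f (rt i)) / real n)"
    for n and rt :: "nat \<Rightarrow> complex"
  have "\<exists>rt. lists_eigenvalues n rt" if "n > 0" for n
    unfolding lists_eigenvalues_def by (rule eigenvalue_list[OF periodic_hn_matrix_carrier that])
  then have "\<forall>n. \<exists>rt. n > 0 \<longrightarrow> lists_eigenvalues n rt" by blast
  from choice[OF this] obtain rt where "\<forall>n. n > 0 \<longrightarrow> lists_eigenvalues n (rt n)" by (rule exE)
  then have ev: "lists_eigenvalues n (rt n)" if "n > 0" for n using that by simp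
  have rt: "poly (char_poly (periodic_hn_matrix T v g y n)) E = (\<Prod>i<n. E - rt n i)"
      "continuous_on UNIV f \<Longrightarrow>
        (\<integral>z. f z \<partial>eigenvalue_counting_measure (periodic_hn_matrix T v g y n)) = (\<Sum>i<n. f (rt n i)) / real n"
    if "n > 0" for n E and f :: "complex \<Rightarrow> real"
    using ev[OF that] unfolding lists_eigenvalues_def by simp_all
  define R where "R = V + exp g + exp (- g)"
  have root: "poly (char_poly (periodic_hn_matrix T v g y n)) (rt n i) = 0" if "n > 0" "i < n" for n i
    unfolding rt(1)[OF that(1)] using that(2) by (intro prod_zero) auto
  have weak: "(\<lambda>n. (\<Sum>i<n. f (rt n i)) / real n) \<longlonglongrightarrow> (\<integral>z. f z \<partial>N)"
    if f: "continuous_on UNIV f" "bounded (range f)" for f :: "complex \<Rightarrow> real"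
  proof -
    have "(\<lambda>n. \<integral>z. f z \<partial>eigenvalue_counting_measure (periodic_hn_matrix T v g y n)) \<longlonglongrightarrow> (\<integral>z. f z \<partial>N)"
      using y f unfolding converges_weakly_def by blast
    then show ?thesis
    proof (rule Lim_transform_eventually)
      show "\<forall>\<^sub>F n in sequentially. (\<integral>z. f z \<partial>eigenvalue_counting_measure (periodic_hn_matrix T v g y n)) = (\<Sum>i<n. f (rt n i)) / real n"
        using eventually_gt_at_top[of 0] by eventually_elim (rule rt(2)[OF _ f(1)])
    qed
  qed
  interpret W: weak_root_limit rt N R
  proof (rule weak_root_limit.intro)
    show "cmod (rt n i) \<le> R" if "n \<ge> 3" "i < n" for n i
      unfolding R_def by (rule periodic_eigenvalue_bounded[OF that(1) root V]) (use that in auto)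
  qed (fact weak sets_N fin_N)+
  interpret S: strictly_ergodic_potential T v \<mu> V
    by unfold_locales (fact comp homeo minimal uniq v_cont V)+
  have "E0 \<notin> measure_support N \<longleftrightarrow> E0 \<in> resolvent_set_ell2 (hatano_nelson T v g x)" for E0
  proof
    assume "E0 \<notin> measure_support N"
    then obtain G where G: "open G" "E0 \<in> G" "emeasure N G = 0" by (auto simp: measure_support_def)
    obtain s where s: "s > 0" "ball E0 s \<subseteq> G" using G(1,2) openE by blast
    have "emeasure N (ball E0 s) \<le> emeasure N G" by (rule emeasure_mono[OF s(2)]) (use G(1) in \<open>simp add: sets_N\<close>)
    then have null: "emeasure N (ball E0 (4 * (s / 4))) = 0" using G(3) by simp
    (* the point y at which weak convergence holds may differ from x; the conclusion holds at every point *)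
    interpret zero_free_periodic T v \<mu> V rt N R E0 "s / 4" y g
    proof unfold_locales
      fix n :: nat and E assume n: "n \<ge> 3"
      have "W.P n E = poly (char_poly (periodic_hn_matrix T v g y n)) E"
        unfolding W.P_def using rt(1)[of n E] n by simp
      also have "\<dots> = (-1) ^ n * (S.D y E 0 n - S.D y E 1 (n - 2) - of_real (exp (g * real n) + exp (- g * real n)))"
        by (rule char_poly_periodic_hn_matrix[OF n]) (rule ext, simp add: S.w_def)
      finally show "cmod (W.P n E) = cmod (S.D y E 0 n - S.D y E 1 (n - 2) - of_real (exp (g * real n) + exp (- g * real n)))"
        by (simp only: norm_mult norm_power norm_minus_cancel norm_one power_one mult_1_left)
    qed (use s null assms(7) in auto)
    show "E0 \<in> resolvent_set_ell2 (hatano_nelson T v g x)" by (rule resolvent_off_support)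
  next
    assume "E0 \<in> resolvent_set_ell2 (hatano_nelson T v g x)"
    then obtain r where r: "r > 0" "\<And>y m. \<exists>n\<ge>m. \<forall>E. dist E0 E < r \<longrightarrow> poly (char_poly (periodic_hn_matrix T v g y n)) E \<noteq> 0"
      by (rule periodic_spectrum_avoids_resolvent_set[OF comp homeo minimal v_cont]) blast
    (* a bump supported in the disc that infinitely many truncations avoid *)
    define f where "f z = max 0 (1 - dist E0 z / r)" for z
    have f_cont: "continuous_on UNIV f" unfolding f_def using r(1) by (intro continuous_intros) auto
    have f01: "0 \<le> f z" "f z \<le> 1" for z using r(1) by (auto simp: f_def)
    have f_bdd: "bounded (range f)" using f01 by (intro boundedI[of _ 1]) auto
    have "\<exists>n\<ge>m. (\<Sum>i<n. f (rt n i)) / real n = 0" for m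
    proof -
      obtain n where n: "n \<ge> max m 1" "\<forall>E. dist E0 E < r \<longrightarrow> poly (char_poly (periodic_hn_matrix T v g y n)) E \<noteq> 0"
        using r(2) by blast
      have "f (rt n i) = 0" if "i < n" for i
      proof -
        have "\<not> dist E0 (rt n i) < r" using n root[of n i] that by auto
        then show ?thesis using r(1) by (simp add: f_def)
      qed
      then show ?thesis using n(1) by (intro exI[of _ n]) auto
    qed
    then have int0: "(\<integral>z. f z \<partial>N) = 0" by (rule LIMSEQ_recurrent_value[OF weak[OF f_cont f_bdd]])
    have "integrable N f"
      by (rule W.N.integrable_const_bound[of _ 1])
        (use f01 borel_measurable_continuous_onI[OF f_cont] in \<open>auto simp: measurable_cong_sets[OF sets_N refl]\<close>)
    then have "AE z in N. f z = 0"
      using int0 integral_nonneg_eq_0_iff_AE[of N f] f01 by simp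
    then have "AE z in N. z \<notin> ball E0 r"
    proof eventually_elim
      case (elim z)
      have "f z > 0" if "dist E0 z < r" using that r(1) by (simp add: f_def)
      then show ?case using elim by auto
    qed
    then have "emeasure N (ball E0 r) = 0"
      by (subst (asm) AE_iff_measurable[OF _ refl]) (auto simp: sets_N W.space_N ball_def)
    then show "E0 \<notin> measure_support N"
      unfolding measure_support_def using r(1) by (auto intro!: exI[of _ "ball E0 r"])
  qed
  then show ?thesis unfolding spectrum_ell2_def by blast
qed

end
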